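(* Let $C\subset\mathbb P^2$ be a reduced projective plane curve over $\mathbb C$ of degree $d$, let $C_1,\dots,C_k$ be its irreducible components, and assume $\deg C_i=d_i\geq 2$ for all $i=1,\dots,k$. Let $f:Z\to\hat{\mathbb P}^2$ be the dualizing covering for $C$. Then the Galois group $G$ of $f$ is $G\simeq \Sigma_{d_1}\times\dots\times\Sigma_{d_k}$.
   Context: $\hat{\mathbb P}^2$ is the dual projective plane (its points are the lines $l\subset\mathbb P^2$), and $I=\{(P,l)\in\mathbb P^2\times\hat{\mathbb P}^2\mid P\in l\}$ is the incidence variety, with projections $\mathrm{pr}_1,\mathrm{pr}_2$ of $\mathbb P^2\times\hat{\mathbb P}^2$ to its factors. Put $X=\mathrm{pr}_1^{-1}(C)\cap I=\{(P,l)\mid P\in C\cap l\}$, let $f':X\to\hat{\mathbb P}^2$ be the restriction of $\mathrm{pr}_2$ to $X$, let $\nu':Z\to X$ be the normalization of $X$, and $f=f'\circ\nu':Z\to\hat{\mathbb P}^2$. The map $f$ has degree $d=d_1+\dots+d_k$ and is called the dualizing covering for $C$. Let $\overline B\subset\hat{\mathbb P}^2$ be the branch locus of $f$ and choose $l_0\in\hat{\mathbb P}^2\setminus\overline B$. After numbering the $d$ points of $f^{-1}(l_0)$, the unramified covering $Z\setminus f^{-1}(\overline B)\to\hat{\mathbb P}^2\setminus\overline B$ induces a monodromy homomorphism $f_*:\pi_1(\hat{\mathbb P}^2\setminus\overline B,l_0)\to\Sigma_d$, where $\Sigma_d$ is the symmetric group acting on the fibre $f^{-1}(l_0)$. The Galois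 group of $f$ is the image $G=\operatorname{Im} f_*\subset\Sigma_d$. *)

theory Defs
  imports
    "HOL-Analysis.Analysis"
    "HOL-Library.Poly_Mapping"
    "HOL-Computational_Algebra.Squarefree"
    "HOL-Algebra.Ring"
    "HOL-Algebra.Bij"
    "HOL-Algebra.Sym_Groups"
    "HOL-Algebra.Product_Groups"
begin

section \<open>Polynomials over the complex numbers\<close>

text \<open>A monomial is a finitely supported exponent function, a polynomial a finitely
  supported family of coefficients indexed by monomials; the ring structure is the one of
  \<^theory>\<open>HOL-Library.Poly_Mapping\<close>.\<close>

type_synonym 'v cpoly = "('v \<Rightarrow>\<^sub>0 nat) \<Rightarrow>\<^sub>0 complex"

definition poly_eval :: "'v cpoly \<Rightarrow> ('v \<Rightarrow> complex) \<Rightarrow> complex" where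
  "poly_eval p x =
     (\<Sum>m\<in>Poly_Mapping.keys p.
        Poly_Mapping.lookup p m * (\<Prod>i\<in>Poly_Mapping.keys m. x i ^ Poly_Mapping.lookup m i))"

definition homogeneous :: "'v cpoly \<Rightarrow> nat \<Rightarrow> bool" where
  "homogeneous p d \<longleftrightarrow>
     (\<forall>m\<in>Poly_Mapping.keys p. (\<Sum>i\<in>Poly_Mapping.keys m. Poly_Mapping.lookup m i) = d)"

definition bihomogeneous :: "(3 + 3) cpoly \<Rightarrow> nat \<Rightarrow> nat \<Rightarrow> bool" where
  "bihomogeneous p a b \<longleftrightarrow>
     (\<forall>m\<in>Poly_Mapping.keys p.
        (\<Sum>i\<in>UNIV. Poly_Mapping.lookup m (Inl i)) = a \<and>
        (\<Sum>i\<in>UNIV. Poly_Mapping.lookup m (Inr i)) = b)"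


section \<open>The projective plane\<close>

typedef proj_plane = "{L :: (complex^3) set. \<exists>v. v \<noteq> 0 \<and> L = vec.span {v}}"
  using zero_neq_one by blast

text \<open>The dual plane is coordinatized by the coefficients of linear forms: the point
  \<open>[a\<^sub>1 : a\<^sub>2 : a\<^sub>3]\<close> is the line \<open>a\<^sub>1 x\<^sub>1 + a\<^sub>2 x\<^sub>2 + a\<^sub>3 x\<^sub>3 = 0\<close>.\<close>

type_synonym dual_proj_plane = proj_plane

text \<open>The value of \<open>proj_pt\<close> at \<open>0\<close> is irrelevant.\<close>

definition proj_pt :: "complex^3 \<Rightarrow> proj_plane" where
  "proj_pt v = Abs_proj_plane (vec.span {v})"

text \<open>A choice of homogeneous coordinates; it is only used in expressions that do not depend
  on the choice.\<close>

definition hcoord :: "proj_plane \<Rightarrow> complex^3" where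
  "hcoord P = (SOME v. v \<noteq> 0 \<and> proj_pt v = P)"

definition incident :: "proj_plane \<Rightarrow> dual_proj_plane \<Rightarrow> bool" where
  "incident P l \<longleftrightarrow> (\<Sum>i\<in>UNIV. hcoord P $ i * hcoord l $ i) = 0"

text \<open>The complex topology, as the quotient topology of \<open>\<complex>\<^sup>3 - {0}\<close>.\<close>

instantiation proj_plane :: topological_space
begin

definition open_proj_plane :: "proj_plane set \<Rightarrow> bool" where
  "open_proj_plane U \<longleftrightarrow> open {v. v \<noteq> 0 \<and> proj_pt v \<in> U}"

instance
proof
  have "{v::complex^3. v \<noteq> 0 \<and> proj_pt v \<in> UNIV} = - {0}" by auto
  then show "open (UNIV :: proj_plane set)"
    by (simp add: open_proj_plane_def open_Compl)
next
  fix S T :: "proj_plane set"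
  assume "open S" "open T"
  moreover have "{v. v \<noteq> 0 \<and> proj_pt v \<in> S \<inter> T} =
      {v. v \<noteq> 0 \<and> proj_pt v \<in> S} \<inter> {v. v \<noteq> 0 \<and> proj_pt v \<in> T}" by auto
  ultimately show "open (S \<inter> T)" by (simp add: open_proj_plane_def open_Int)
next
  fix K :: "proj_plane set set"
  assume "\<forall>S\<in>K. open S"
  moreover have "{v. v \<noteq> 0 \<and> proj_pt v \<in> \<Union>K} = (\<Union>S\<in>K. {v. v \<noteq> 0 \<and> proj_pt v \<in> S})" by auto
  ultimately show "open (\<Union>K)" by (auto simp: open_proj_plane_def)
qed

end

text \<open>A function on an open set \<open>W\<close> of the plane is holomorphic iff its pullback to the cone
  over \<open>W\<close> is complex differentiable, since \<open>\<complex>\<^sup>3 - {0}\<close> is a holomorphic principal bundle over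
  the plane.\<close>

definition holomorphic_on_plane :: "(proj_plane \<Rightarrow> complex) \<Rightarrow> proj_plane set \<Rightarrow> bool" where
  "holomorphic_on_plane h W \<longleftrightarrow>
     (\<forall>v. v \<noteq> 0 \<and> proj_pt v \<in> W \<longrightarrow>
        (\<exists>D. ((\<lambda>u. h (proj_pt u)) has_derivative D) (at v) \<and> (\<forall>c u. D (c *s u) = c * D u)))"


section \<open>Complex varieties as spaces with functions\<close>

text \<open>A variety is a set with a Zariski topology and, for every Zariski open \<open>U\<close>, a set of
  regular functions on \<open>U\<close>. Functions are total; values outside \<open>U\<close> are immaterial, and the
  second component is only meaningful on open sets.\<close>

record 'a fun_space =
  zariski :: "'a topology"
  regular :: "'a set \<Rightarrow> ('a \<Rightarrow> complex) set"

definition space_with_functions :: "'a fun_space \<Rightarrow> bool" where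
  "space_with_functions X \<longleftrightarrow>
     (\<forall>U. openin (zariski X) U \<longrightarrow>
        (\<forall>c. (\<lambda>_. c) \<in> regular X U) \<and>
        (\<forall>f\<in>regular X U. \<forall>g\<in>regular X U.
           (\<lambda>x. f x + g x) \<in> regular X U \<and> (\<lambda>x. f x * g x) \<in> regular X U) \<and>
        (\<forall>f\<in>regular X U. \<forall>g. (\<forall>x\<in>U. g x = f x) \<longrightarrow> g \<in> regular X U) \<and>
        (\<forall>f\<in>regular X U.
           openin (zariski X) {x \<in> U. f x \<noteq> 0} \<and>
           (\<lambda>x. inverse (f x)) \<in> regular X {x \<in> U. f x \<noteq> 0})) \<and>
     (\<forall>\<U> f. (\<forall>U\<in>\<U>. openin (zariski X) U) \<longrightarrow>
        (f \<in> regular X (\<Union>\<U>) \<longleftrightarrow> (\<forall>U\<in>\<U>. f \<in> regular X U)))"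

definition open_subspace :: "'a fun_space \<Rightarrow> 'a set \<Rightarrow> 'a fun_space" where
  "open_subspace X U = \<lparr>zariski = subtopology (zariski X) U, regular = regular X\<rparr>"

definition preimage_in :: "'a fun_space \<Rightarrow> ('a \<Rightarrow> 'b) \<Rightarrow> 'b set \<Rightarrow> 'a set" where
  "preimage_in X \<phi> V = {x \<in> topspace (zariski X). \<phi> x \<in> V}"

definition morphism :: "'a fun_space \<Rightarrow> 'b fun_space \<Rightarrow> ('a \<Rightarrow> 'b) \<Rightarrow> bool" where
  "morphism X Y \<phi> \<longleftrightarrow>
     continuous_map (zariski X) (zariski Y) \<phi> \<and>
     (\<forall>V g. openin (zariski Y) V \<and> g \<in> regular Y V \<longrightarrow> g \<circ> \<phi> \<in> regular X (preimage_in X \<phi> V))"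

definition isomorphism :: "'a fun_space \<Rightarrow> 'b fun_space \<Rightarrow> ('a \<Rightarrow> 'b) \<Rightarrow> bool" where
  "isomorphism X Y \<phi> \<longleftrightarrow>
     morphism X Y \<phi> \<and>
     (\<exists>\<psi>. morphism Y X \<psi> \<and>
        (\<forall>x\<in>topspace (zariski X). \<psi> (\<phi> x) = x) \<and> (\<forall>y\<in>topspace (zariski Y). \<phi> (\<psi> y) = y))"

text \<open>Affine \<open>n\<close>-space is the set of sequences vanishing from index \<open>n\<close> on; polynomials in
  countably many variables restrict on it to polynomials in \<open>n\<close> variables.\<close>

definition affine_algebraic_set :: "nat \<Rightarrow> (nat \<Rightarrow> complex) set \<Rightarrow> bool" where
  "affine_algebraic_set n A \<longleftrightarrow>
     (\<exists>S. A = {x. (\<forall>i\<ge>n. x i = 0) \<and> (\<forall>p\<in>S. poly_eval p x = 0)})"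

definition affine_space_of :: "(nat \<Rightarrow> complex) set \<Rightarrow> (nat \<Rightarrow> complex) fun_space" where
  "affine_space_of A =
     (let T = topology_generated_by {{x \<in> A. poly_eval p x \<noteq> 0} | p. True}
      in \<lparr>zariski = T,
          regular = (\<lambda>U. {f. \<forall>x\<in>U. \<exists>W p q. openin T W \<and> x \<in> W \<and> W \<subseteq> U \<and>
             (\<forall>y\<in>W. poly_eval q y \<noteq> 0 \<and> f y = poly_eval p y / poly_eval q y)})\<rparr>)"

definition affine_variety :: "'a fun_space \<Rightarrow> bool" where
  "affine_variety X \<longleftrightarrow>
     (\<exists>n A \<phi>. affine_algebraic_set n A \<and> isomorphism X (affine_space_of A) \<phi>)"

text \<open>Separatedness is not part of this notion. It is automatic for the source of a finite
  morphism to a separated variety, which is the only place where prevarieties are used.\<close>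

definition prevariety :: "'a fun_space \<Rightarrow> bool" where
  "prevariety X \<longleftrightarrow>
     space_with_functions X \<and>
     (\<exists>\<U>. finite \<U> \<and> \<Union>\<U> = topspace (zariski X) \<and>
        (\<forall>U\<in>\<U>. openin (zariski X) U \<and> affine_variety (open_subspace X U)))"

text \<open>The subvariety of the product of the plane and the dual plane with underlying
  (Zariski closed) set \<open>A\<close>: regular functions are locally quotients of bihomogeneous polynomials
  of equal bidegree.\<close>

definition bihom_eval :: "(3 + 3) cpoly \<Rightarrow> proj_plane \<times> dual_proj_plane \<Rightarrow> complex" where
  "bihom_eval p x = poly_eval p (case_sum (($) (hcoord (fst x))) (($) (hcoord (snd x))))"

definition biprojective_space_of ::
    "(proj_plane \<times> dual_proj_plane) set \<Rightarrow> (proj_plane \<times> dual_proj_plane) fun_space" where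
  "biprojective_space_of A =
     (let T = topology_generated_by
                {{x \<in> A. bihom_eval p x \<noteq> 0} | p. \<exists>a b. bihomogeneous p a b}
      in \<lparr>zariski = T,
          regular = (\<lambda>U. {f. \<forall>x\<in>U. \<exists>W p q a b. openin T W \<and> x \<in> W \<and> W \<subseteq> U \<and>
             bihomogeneous p a b \<and> bihomogeneous q a b \<and>
             (\<forall>y\<in>W. bihom_eval q y \<noteq> 0 \<and> f y = bihom_eval p y / bihom_eval q y)})\<rparr>)"


section \<open>Normalization\<close>

definition regular_at :: "'a fun_space \<Rightarrow> 'a \<Rightarrow> ('a \<Rightarrow> complex) \<Rightarrow> bool" where
  "regular_at X x f \<longleftrightarrow> (\<exists>U. openin (zariski X) U \<and> x \<in> U \<and> f \<in> regular X U)"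

definition germ :: "'a fun_space \<Rightarrow> 'a \<Rightarrow> ('a \<Rightarrow> complex) \<Rightarrow> ('a \<Rightarrow> complex) set" where
  "germ X x f =
     {g. regular_at X x g \<and> (\<exists>U. openin (zariski X) U \<and> x \<in> U \<and> (\<forall>y\<in>U. g y = f y))}"

definition local_ring :: "'a fun_space \<Rightarrow> 'a \<Rightarrow> ('a \<Rightarrow> complex) set ring" where
  "local_ring X x =
     \<lparr>carrier = {germ X x f | f. regular_at X x f},
      monoid.mult = (\<lambda>A B. \<Union>f\<in>A. \<Union>g\<in>B. germ X x (\<lambda>y. f y * g y)),
      one = germ X x (\<lambda>_. 1),
      zero = germ X x (\<lambda>_. 0),
      add = (\<lambda>A B. \<Union>f\<in>A. \<Union>g\<in>B. germ X x (\<lambda>y. f y + g y))\<rparr>"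

text \<open>A domain is integrally closed if every fraction \<open>a / b\<close> that is a root of a monic polynomial
  over the domain lies in the domain; here the monic equation is multiplied by \<open>b\<^sup>n\<close>.\<close>

definition integrally_closed_domain :: "('r, 'm) ring_scheme \<Rightarrow> bool" where
  "integrally_closed_domain R \<longleftrightarrow>
     domain R \<and>
     (\<forall>a\<in>carrier R. \<forall>b\<in>carrier R - {\<zero>\<^bsub>R\<^esub>}.
        (\<exists>n>0. \<exists>c\<in>{..<n} \<rightarrow> carrier R.
           (a [^]\<^bsub>R\<^esub> (n::nat)) \<oplus>\<^bsub>R\<^esub>
             (\<Oplus>\<^bsub>R\<^esub>i\<in>{..<n}. c i \<otimes>\<^bsub>R\<^esub> ((a [^]\<^bsub>R\<^esub> i) \<otimes>\<^bsub>R\<^esub> (b [^]\<^bsub>R\<^esub> (n - i)))) = \<zero>\<^bsub>R\<^esub>)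
        \<longrightarrow> (\<exists>q\<in>carrier R. a = q \<otimes>\<^bsub>R\<^esub> b))"

text \<open>Varieties may be reducible or disconnected; normality only forces the irreducible components
  to be disjoint.\<close>

definition normal_variety :: "'a fun_space \<Rightarrow> bool" where
  "normal_variety X \<longleftrightarrow>
     prevariety X \<and> (\<forall>x\<in>topspace (zariski X). integrally_closed_domain (local_ring X x))"

definition finite_morphism :: "'a fun_space \<Rightarrow> 'b fun_space \<Rightarrow> ('a \<Rightarrow> 'b) \<Rightarrow> bool" where
  "finite_morphism Y X \<phi> \<longleftrightarrow>
     morphism Y X \<phi> \<and>
     (\<forall>V. openin (zariski X) V \<and> affine_variety (open_subspace X V) \<longrightarrow>
        affine_variety (open_subspace Y (preimage_in Y \<phi> V)) \<and>
        (\<exists>B. finite B \<and> B \<subseteq> regular Y (preimage_in Y \<phi> V) \<and>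
           (\<forall>g\<in>regular Y (preimage_in Y \<phi> V). \<exists>a. (\<forall>b\<in>B. a b \<in> regular X V) \<and>
              (\<forall>y\<in>preimage_in Y \<phi> V. g y = (\<Sum>b\<in>B. a b (\<phi> y) * b y)))))"

definition birational_morphism :: "'a fun_space \<Rightarrow> 'b fun_space \<Rightarrow> ('a \<Rightarrow> 'b) \<Rightarrow> bool" where
  "birational_morphism Y X \<phi> \<longleftrightarrow>
     morphism Y X \<phi> \<and>
     (\<exists>U. openin (zariski X) U \<and>
        zariski X closure_of U = topspace (zariski X) \<and>
        zariski Y closure_of (preimage_in Y \<phi> U) = topspace (zariski Y) \<and>
        isomorphism (open_subspace Y (preimage_in Y \<phi> U)) (open_subspace X U) \<phi>)"

definition normalization :: "'a fun_space \<Rightarrow> 'b fun_space \<Rightarrow> ('a \<Rightarrow> 'b) \<Rightarrow> bool" where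
  "normalization Z X \<nu> \<longleftrightarrow>
     normal_variety Z \<and> finite_morphism Z X \<nu> \<and> birational_morphism Z X \<nu>"


section \<open>Branch locus\<close>

text \<open>The complex topology: the coarsest topology finer than the Zariski topology for which all
  regular functions on Zariski open sets are continuous.\<close>

definition complex_topology :: "'a fun_space \<Rightarrow> 'a topology" where
  "complex_topology X =
     topology_generated_by
       {{x \<in> U. g x \<in> V} | U g V. openin (zariski X) U \<and> g \<in> regular X U \<and> open V}"

text \<open>Only holomorphy of the inverse, tested on regular functions, has to be required; the map
  itself is holomorphic because it will be a morphism.\<close>

definition locally_biholomorphic_at :: "'a fun_space \<Rightarrow> ('a \<Rightarrow> dual_proj_plane) \<Rightarrow> 'a \<Rightarrow> bool" where
  "locally_biholomorphic_at Z f z \<longleftrightarrow>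
     (\<exists>U. openin (complex_topology Z) U \<and> z \<in> U \<and> open (f ` U) \<and>
        homeomorphic_map (subtopology (complex_topology Z) U) (top_of_set (f ` U)) f \<and>
        (\<forall>W g. openin (zariski Z) W \<and> g \<in> regular Z W \<longrightarrow>
           holomorphic_on_plane (g \<circ> inv_into U f) (f ` (U \<inter> W))))"

definition branch_locus :: "'a fun_space \<Rightarrow> ('a \<Rightarrow> dual_proj_plane) \<Rightarrow> dual_proj_plane set" where
  "branch_locus Z f = f ` {z \<in> topspace (zariski Z). \<not> locally_biholomorphic_at Z f z}"


section \<open>Monodromy\<close>

definition path_class :: "'a::topological_space set \<Rightarrow> (real \<Rightarrow> 'a) \<Rightarrow> (real \<Rightarrow> 'a) set" where
  "path_class S p = {q. homotopic_paths S p q}"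

definition fundamental_group :: "'a::topological_space set \<Rightarrow> 'a \<Rightarrow> (real \<Rightarrow> 'a) set monoid" where
  "fundamental_group S x =
     \<lparr>carrier = {path_class S p | p.
        path p \<and> path_image p \<subseteq> S \<and> pathstart p = x \<and> pathfinish p = x},
      monoid.mult = (\<lambda>A B. \<Union>p\<in>A. \<Union>q\<in>B. path_class S (p +++ q)),
      one = path_class S (\<lambda>_. x)\<rparr>"

definition lift_of ::
    "'a fun_space \<Rightarrow> ('a \<Rightarrow> dual_proj_plane) \<Rightarrow> (real \<Rightarrow> dual_proj_plane) \<Rightarrow> (real \<Rightarrow> 'a) \<Rightarrow> bool" where
  "lift_of Z f p g \<longleftrightarrow> pathin (complex_topology Z) g \<and> (\<forall>t\<in>{0..1}. f (g t) = p t)"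

text \<open>The class of a loop sends \<open>z\<close> to the initial point of the lift that ends at \<open>z\<close>. With this
  choice (rather than its inverse) the monodromy is a homomorphism, not an antihomomorphism,
  from the fundamental group, where \<open>p +++ q\<close> runs through \<open>p\<close> first, to the group of
  permutations of the fibre under composition.\<close>

definition monodromy ::
    "'a fun_space \<Rightarrow> ('a \<Rightarrow> dual_proj_plane) \<Rightarrow> dual_proj_plane \<Rightarrow> (real \<Rightarrow> dual_proj_plane) set \<Rightarrow> 'a \<Rightarrow> 'a"
  where
  "monodromy Z f l c =
     (\<lambda>z\<in>preimage_in Z f {l}. THE w. \<exists>p\<in>c. \<exists>g. lift_of Z f p g \<and> g 0 = w \<and> g 1 = z)"

definition galois_group ::
    "'a fun_space \<Rightarrow> ('a \<Rightarrow> dual_proj_plane) \<Rightarrow> dual_proj_plane \<Rightarrow> ('a \<Rightarrow> 'a) monoid" where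
  "galois_group Z f l =
     BijGroup (preimage_in Z f {l})
       \<lparr>carrier := monodromy Z f l ` carrier (fundamental_group (- branch_locus Z f) l)\<rparr>"


section \<open>Plane curves and the dualizing covering\<close>

text \<open>A reduced plane curve of degree \<open>d\<close> is given by a squarefree form of degree \<open>d\<close>; its
  irreducible components are given by the irreducible factors of that form.\<close>

definition reduced_plane_curve :: "3 cpoly \<Rightarrow> nat \<Rightarrow> bool" where
  "reduced_plane_curve F d \<longleftrightarrow> d \<ge> 1 \<and> homogeneous F d \<and> squarefree F"

definition irreducible_plane_curve :: "3 cpoly \<Rightarrow> nat \<Rightarrow> bool" where
  "irreducible_plane_curve F d \<longleftrightarrow> d \<ge> 1 \<and> homogeneous F d \<and> Factorial_Ring.irreducible F"

definition curve_points :: "3 cpoly \<Rightarrow> proj_plane set" where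
  "curve_points F = {P. poly_eval F (($) (hcoord P)) = 0}"

definition curve_incidence :: "3 cpoly \<Rightarrow> (proj_plane \<times> dual_proj_plane) fun_space" where
  "curve_incidence F = biprojective_space_of {(P, l). P \<in> curve_points F \<and> incident P l}"

text \<open>The normalization is determined only up to isomorphism over the incidence surface, so this is
  a predicate satisfied by every model of it.\<close>

definition dualizing_covering :: "3 cpoly \<Rightarrow> 'a fun_space \<Rightarrow> ('a \<Rightarrow> dual_proj_plane) \<Rightarrow> bool" where
  "dualizing_covering F Z f \<longleftrightarrow>
     (\<exists>\<nu>. normalization Z (curve_incidence F) \<nu> \<and> f = snd \<circ> \<nu>)"

end

theory Submission
  imports
    Defs
    "HOL-Complex_Analysis.Complex_Analysis"
    "HOL-Computational_Algebra.Computational_Algebra"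
    "HOL-Computational_Algebra.Field_as_Ring"
begin

text \<open>Call a line good if it meets each component \<open>C\<^sub>i\<close> in \<open>d\<^sub>i\<close> points, no two components in a common point, and avoids
 a curve outside of which \<open>Z \<rightarrow> X\<close> is an isomorphism. Over good lines \<open>f\<close> is unramified with fibre \<open>C \<inter> l\<close>, and a pencil
 that contains a good line contains only finitely many bad ones. Finiteness of \<open>Z \<rightarrow> X\<close> makes \<open>f\<close> proper, so that
 paths outside the branch locus lift. A point of the normal surface \<open>Z\<close> has a neighbourhood that lies over a single
 component of \<open>C\<close>; hence monodromy preserves the blocks \<open>C\<^sub>i \<inter> l\<close> of the fibre.

 The points of \<open>C\<^sub>i\<close> on the lines of a pencil are the roots of an irreducible polynomial in two variables, and these form
 a connected covering of the pencil. For the pencil through a point outside \<open>C\<^sub>i\<close>, respectively through a point of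
 \<open>C\<^sub>i \<inter> l\<close>, this shows that monodromy acts transitively, respectively doubly transitively, on \<open>C\<^sub>i \<inter> l\<close>. Since \<open>d\<^sub>i \<ge> 2\<close>,
 the curve \<open>C\<^sub>i\<close> has a tangent that is simple and otherwise transversal to \<open>C\<close>, and a small loop around it acts as a
 transposition of two points of \<open>C\<^sub>i \<inter> l\<close>. Its conjugates are all transpositions inside the \<open>i\<close>-th block.\<close>

section \<open>Polynomial functions\<close>

text \<open>The incidence surface is singular over the singular points of \<open>C\<close>, and its
  normalization is known through its defining properties alone, so \<open>Z\<close> is never
  described there. Everything concrete happens over good lines, where the inverse
  \<open>\<psi>\<close> of the birational map identifies points of \<open>Z\<close> with pairs of a
  point and a line. The base point may be bad, and is joined to a good line inside a pencil.
  Normality enters through the absence of zero divisors in local rings, which keeps the components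
  apart. Restricting to a pencil turns both transitivity and the transposition into statements about
  polynomials in two variables \<open>s\<close>, \<open>y\<close>, with \<open>s\<close> naming the
  line and \<open>y\<close> the point on it. Double transitivity is wanted because conjugation then
  carries one transposition to every pair of a block. The hard point is a tangent without further
  contact. It is found by a local computation instead of duality of curves: when the point of
  contact moves, the tangent turns about it, so it cannot keep touching the curve elsewhere. For a
  line the tangent would not move, which is why degree one is excluded.\<close>

abbreviation "keys \<equiv> Poly_Mapping.keys"
abbreviation "lookup \<equiv> Poly_Mapping.lookup"
abbreviation "irred \<equiv> Factorial_Ring.irreducible"
abbreviation "swap \<equiv> Transposition.transpose"

definition monomial_eval :: "('v \<Rightarrow>\<^sub>0 nat) => ('v => complex) => complex" where
 "monomial_eval m x = (\<Prod>i\<in>keys m. x i ^ lookup m i)"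

lemma monomial_eval_superset:
 assumes "finite S" "keys m \<subseteq> S"
 shows "monomial_eval m x = (\<Prod>i\<in>S. x i ^ lookup m i)"
 unfolding monomial_eval_def
 by (rule prod.mono_neutral_left) (use assms in \<open>auto simp: in_keys_iff\<close>)

lemma monomial_eval_add: "monomial_eval (m + n) x = monomial_eval m x * monomial_eval n x"
proof -
 let ?S = "keys m \<union> keys n"
 have "keys (m + n) \<subseteq> ?S" by (rule Poly_Mapping.keys_add)
 then show ?thesis
  by (subst (1 2 3) monomial_eval_superset[of ?S])
   (auto simp: lookup_add power_add prod.distrib)
qed

lemma poly_eval_superset:
 assumes "finite S" "keys p \<subseteq> S"
 shows "poly_eval p x = (\<Sum>m\<in>S. lookup p m * monomial_eval m x)"
 unfolding poly_eval_def monomial_eval_def[symmetric]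
 by (rule sum.mono_neutral_left) (use assms in \<open>auto simp: in_keys_iff\<close>)

lemma poly_eval_add [simp]: "poly_eval (p + q) x = poly_eval p x + poly_eval q x"
proof -
 let ?S = "keys p \<union> keys q"
 have "keys (p + q) \<subseteq> ?S" by (rule Poly_Mapping.keys_add)
 then show ?thesis
  by (subst (1 2 3) poly_eval_superset[of ?S])
   (auto simp: lookup_add distrib_right sum.distrib)
qed

lemma poly_eval_0 [simp]: "poly_eval 0 x = 0"
 by (simp add: poly_eval_def)

lemma poly_eval_sum [simp]: "poly_eval (\<Sum>i\<in>I. p i) x = (\<Sum>i\<in>I. poly_eval (p i) x)"
 by (induction I rule: infinite_finite_induct) auto

lemma poly_eval_single: "poly_eval (Poly_Mapping.single m c) x = c * monomial_eval m x"
 by (subst poly_eval_superset[of "{m}"]) (auto simp: lookup_single)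

lemma poly_mapping_eq_sum:
 "p = (\<Sum>m\<in>keys p. Poly_Mapping.single m (lookup p m))"
 by (rule poly_mapping_eqI) (auto simp: lookup_sum lookup_single when_def in_keys_iff)

lemma poly_eval_mult [simp]: "poly_eval (p * q) x = poly_eval p x * poly_eval q x"
proof -
 have "p * q = (\<Sum>m\<in>keys p. \<Sum>n\<in>keys q.
   Poly_Mapping.single (m + n) (lookup p m * lookup q n))"
  by (subst poly_mapping_eq_sum[of p], subst poly_mapping_eq_sum[of q])
   (simp add: sum_product mult_single)
 then show ?thesis
  by (simp add: poly_eval_single monomial_eval_add poly_eval_def[of p] poly_eval_def[of q]
    monomial_eval_def[symmetric] sum_product ac_simps)
qed

definition cvar :: "'v => 'v cpoly" where
 "cvar i = Poly_Mapping.single (Poly_Mapping.single i 1) 1"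

definition cconst :: "complex => 'v cpoly" where
 "cconst c = Poly_Mapping.single 0 c"

lemma poly_eval_cvar [simp]: "poly_eval (cvar i) x = x i"
 by (simp add: cvar_def poly_eval_single monomial_eval_def)

lemma poly_eval_cconst [simp]: "poly_eval (cconst c) x = c"
 by (simp add: cconst_def poly_eval_single monomial_eval_def)

lemma cconst_1: "cconst 1 = 1"
 by (simp add: cconst_def)

lemma poly_eval_1 [simp]: "poly_eval 1 x = 1"
 using poly_eval_cconst[of 1 x] by (simp add: cconst_1)

lemma poly_eval_power [simp]: "poly_eval (p ^ n) x = poly_eval p x ^ n"
 by (induction n) auto

lemma poly_eval_prod [simp]: "poly_eval (\<Prod>i\<in>I. p i) x = (\<Prod>i\<in>I. poly_eval (p i) x)"
 by (induction I rule: infinite_finite_induct) auto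

text \<open>Monomials are products of powers of variables, so sums and products of constants and
  variables exhaust all polynomials. This is how substitutions are shown to yield polynomials again
  without handling exponents.\<close>

lemma cpoly_induct [case_names const var add mult]:
 assumes "!!c. P (cconst c)" "!!i. P (cvar i)"
  and add: "!!p q. P p ==> P q ==> P (p + q)" and mult: "!!p q. P p ==> P q ==> P (p * q)"
 shows "P p"
proof -
 have P0: "P 0" using assms(1)[of 0] by (simp add: cconst_def)
 have pow: "P (cvar i ^ n)" for i n
  by (induction n) (use assms(1)[of 1] assms(2) mult in \<open>auto simp: cconst_1\<close>)
 have powe: "cvar i ^ n = Poly_Mapping.single (Poly_Mapping.single i n) 1" for i and n :: nat
  by (induction n) (auto simp: cvar_def mult_single simp flip: single_add)
 have "P (Poly_Mapping.single (\<Sum>i\<in>S. Poly_Mapping.single i (lookup m i)) 1)" for S m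
 proof (induction S rule: infinite_finite_induct)
  case (insert i S)
  then show ?case
   using mult[OF pow[of i "lookup m i"] insert.IH] by (simp add: powe mult_single)
 qed (use assms(1)[of 1] in \<open>auto simp: cconst_def\<close>)
 from this[of _ "keys _"] have mon: "P (Poly_Mapping.single m 1)" for m
  by (subst poly_mapping_eq_sum)
 have "P (Poly_Mapping.single m c)" for m c
  using mult[OF assms(1)[of c] mon[of m]] by (simp add: cconst_def mult_single)
 then have "P (\<Sum>m\<in>S. Poly_Mapping.single m (lookup p m))" for S
  by (induction S rule: infinite_finite_induct) (auto intro: P0 add)
 then show ?thesis by (subst poly_mapping_eq_sum)
qed

subsection \<open>Weighted homogeneity\<close>

text \<open>One grading for both purposes: constant weight 1 gives \<open>homogeneous\<close>, and
  weights that are 1 on one summand of \<open>3 + 3\<close> and 0 on the other give the two degrees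
  of \<open>bihomogeneous\<close>.\<close>

definition weighted :: "('v => nat) => 'v cpoly => nat => bool" where
 "weighted w p d \<longleftrightarrow>
   (\<forall>m\<in>keys p. (\<Sum>i\<in>keys m. w i * lookup m i) = d)"

lemma homogeneous_weighted: "homogeneous p d \<longleftrightarrow> weighted (%_. 1) p d"
 by (simp add: homogeneous_def weighted_def)

lemma bihomogeneous_weighted:
 "bihomogeneous p a b \<longleftrightarrow>
   weighted (case_sum (%_. 1) (%_. 0)) p a & weighted (case_sum (%_. 0) (%_. 1)) p b"
proof -
 have *: "(\<Sum>i\<in>keys m. w i * lookup m i) =
  (\<Sum>i\<in>UNIV. w (Inl i) * lookup m (Inl i)) +
  (\<Sum>i\<in>UNIV. w (Inr i) * lookup m (Inr i))" for w and m :: "(3 + 3) \<Rightarrow>\<^sub>0 nat"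
 proof -
  have "(\<Sum>i\<in>keys m. w i * lookup m i) =
    (\<Sum>i\<in>UNIV <+> UNIV. w i * lookup m i)"
   by (rule sum.mono_neutral_left) (auto simp: in_keys_iff)
  then show ?thesis by (subst (asm) sum.Plus) auto
 qed
 show ?thesis by (auto simp: bihomogeneous_def weighted_def *)
qed

lemma weight_superset:
 assumes "finite S" "keys m \<subseteq> S"
 shows "(\<Sum>i\<in>keys m. w i * lookup m i) =
  (\<Sum>i\<in>S. w i * (lookup m i :: nat))"
 by (rule sum.mono_neutral_left) (use assms in \<open>auto simp: in_keys_iff\<close>)

lemma weight_add:
 "(\<Sum>i\<in>keys (m + n). w i * lookup (m + n) i) =
  (\<Sum>i\<in>keys m. w i * lookup m i) +
  (\<Sum>i\<in>keys n. w i * (lookup n i :: nat))"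
proof -
 let ?S = "keys m \<union> keys n"
 have "keys (m + n) \<subseteq> ?S" by (rule Poly_Mapping.keys_add)
 then show ?thesis
  by (subst (1 2 3) weight_superset[of ?S])
   (auto simp: lookup_add distrib_left sum.distrib)
qed

lemma weighted_mult:
 assumes "weighted w p a" "weighted w q b"
 shows "weighted w (p * q) (a + b)"
 unfolding weighted_def
proof
 fix m assume "m \<in> keys (p * q)"
 then obtain m1 m2 where "m = m1 + m2" "m1 \<in> keys p" "m2 \<in> keys q"
  using keys_mult[of p q] by auto
 then show "(\<Sum>i\<in>keys m. w i * lookup m i) = a + b"
  using assms by (simp add: weight_add weighted_def)
qed

lemma weighted_add: "weighted w p a ==> weighted w q a ==> weighted w (p + q) a"
 using Poly_Mapping.keys_add[of p q] by (fastforce simp: weighted_def)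

lemma weighted_0 [simp]: "weighted w 0 a"
 by (simp add: weighted_def)

lemma weighted_sum: "(!!i. i \<in> I ==> weighted w (p i) a) ==> weighted w (\<Sum>i\<in>I. p i) a"
 by (induction I rule: infinite_finite_induct) (auto intro: weighted_add)

lemma weighted_cconst [simp]: "weighted w (cconst c) 0"
 by (simp add: weighted_def cconst_def)

lemma weighted_1 [simp]: "weighted w 1 0"
 using weighted_cconst[of w 1] by (simp add: cconst_1)

lemma weighted_cvar: "weighted w (cvar i) (w i)"
 by (simp add: weighted_def cvar_def)

lemma weighted_power: "weighted w p a ==> weighted w (p ^ n) (n * a)"
 by (induction n) (auto dest: weighted_mult)

lemma weighted_prod:
 "finite I ==> (!!i. i \<in> I ==> weighted w (p i) (a i)) ==> weighted w (\<Prod>i\<in>I. p i) (\<Sum>i\<in>I. a i)"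
 by (induction I rule: finite_induct) (auto intro: weighted_mult)

lemma weighted_scale:
 assumes "weighted w p d"
 shows "poly_eval p (%i. c ^ w i * x i) = c ^ d * poly_eval p x"
proof -
 have "monomial_eval m (%i. c ^ w i * x i) = c ^ d * monomial_eval m x"
  if "m \<in> keys p" for m
 proof -
  have "monomial_eval m (%i. c ^ w i * x i) =
    (\<Prod>i\<in>keys m. c ^ (w i * lookup m i)) * monomial_eval m x"
   by (simp add: monomial_eval_def power_mult_distrib prod.distrib power_mult)
  also have "(\<Prod>i\<in>keys m. c ^ (w i * lookup m i)) = c ^ d"
   using assms that by (simp add: weighted_def flip: power_sum)
  finally show ?thesis .
 qed
 then show ?thesis
  by (simp add: poly_eval_def monomial_eval_def[symmetric] sum_distrib_left mult.left_commute)
qed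

lemma homogeneous_scale: "homogeneous p d ==> poly_eval p (%i. c * x i) = c ^ d * poly_eval p x"
 using weighted_scale[of "%_. 1" p d c x] by (simp add: homogeneous_weighted)

lemma bihomogeneous_scale:
 assumes "bihomogeneous p a b"
 shows "poly_eval p (case_sum (%i. s * x i) (%i. t * y i)) =
  s ^ a * t ^ b * poly_eval p (case_sum x y)"
proof -
 have 1: "case_sum (%i. s * x i) (%i. t * y i) =
   (%i. s ^ case_sum (%_. 1) (%_. 0) i * (t ^ case_sum (%_. 0) (%_. 1) i * case_sum x y i))"
  by (auto split: sum.split)
 show ?thesis
  using assms unfolding 1 bihomogeneous_weighted
  by (subst weighted_scale, blast, subst weighted_scale) auto
qed

lemma bihomogeneous_mult:
 "bihomogeneous p a b ==> bihomogeneous q a' b' ==> bihomogeneous (p * q) (a + a') (b + b')"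
 by (simp add: bihomogeneous_weighted weighted_mult)

lemma bihomogeneous_add:
 "bihomogeneous p a b ==> bihomogeneous q a b ==> bihomogeneous (p + q) a b"
 by (simp add: bihomogeneous_weighted weighted_add)

lemma bihomogeneous_const: "bihomogeneous (cconst c) 0 0"
 by (simp add: bihomogeneous_weighted)

lemma bihomogeneous_1: "bihomogeneous 1 0 0"
 by (simp add: bihomogeneous_weighted)

lemma bihomogeneous_0: "bihomogeneous 0 a b"
 by (simp add: bihomogeneous_weighted)

lemma bihomogeneous_Inl: "bihomogeneous (cvar (Inl i)) 1 0"
 using weighted_cvar[of "case_sum (%_. 1) (%_. 0)" "Inl i"]
  weighted_cvar[of "case_sum (%_. 0) (%_. 1)" "Inl i"]
 by (simp add: bihomogeneous_weighted)

lemma bihomogeneous_Inr: "bihomogeneous (cvar (Inr i)) 0 1"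
 using weighted_cvar[of "case_sum (%_. 1) (%_. 0)" "Inr i"]
  weighted_cvar[of "case_sum (%_. 0) (%_. 1)" "Inr i"]
 by (simp add: bihomogeneous_weighted)

lemma bihomogeneous_power: "bihomogeneous p a b ==> bihomogeneous (p ^ n) (n * a) (n * b)"
 by (simp add: bihomogeneous_weighted weighted_power)

subsection \<open>A polynomial is determined by its values\<close>

text \<open>The substitution \<open>x\<^sub>i = t ^ z\<^bsup>j(i)\<^esup>\<close> separates the finitely many monomials of a polynomial
 for all but finitely many \<open>z\<close>.\<close>

lemma poly_eval_eq_0_imp:
 assumes "!!x. poly_eval p x = 0"
 shows "p = 0"
proof (rule ccontr)
 assume "p ~= 0"
 define K where "K = keys p"
 have finK: "finite K" and K: "K ~= {}" using \<open>p ~= 0\<close> by (auto simp: K_def)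
 define V where "V = (\<Union>m\<in>K. keys m)"
 have finV: "finite V" using finK by (auto simp: V_def)
 obtain j :: "_ => nat" where j: "inj_on j V" using finite_imp_inj_to_nat_seg[OF finV] by metis
 \<comment> \<open>The exponents of \<open>m\<close> become coefficients of \<open>q m\<close>, so
   its value at \<open>z\<close> is the exponent of \<open>t\<close> after the substitution.\<close>
 define q :: "_ => int poly" where "q m = (\<Sum>i\<in>V. monom (int (lookup m i)) (j i))" for m
 have coeffq: "coeff (q m) (j i) = int (lookup m i)" if "i \<in> V" for m i
 proof -
  have "coeff (q m) (j i) = (\<Sum>i'\<in>V. if i' = i then int (lookup m i') else 0)"
   unfolding q_def coeff_sum using j that
   by (intro sum.cong) (auto dest: inj_onD)
  then show ?thesis using that finV by simp
 qed
 have qinj: "m = n" if "m \<in> K" "n \<in> K" "q m = q n" for m n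
 proof (rule poly_mapping_eqI)
  fix i
  show "lookup m i = lookup n i"
  proof (cases "i \<in> V")
   case True
   then show ?thesis using coeffq[of i m] coeffq[of i n] that by simp
  next
   case False
   then have "i \<notin> keys m" "i \<notin> keys n" using that by (auto simp: V_def)
   then show ?thesis by (simp add: in_keys_iff)
  qed
 qed
 \<comment> \<open>Integers at which two different monomials of \<open>p\<close> would receive the
   same exponent.\<close>
 define R where "R = (\<Union>(m,n)\<in>{(m,n)\<in>K\<times>K. m ~= n}. {z. poly (q m - q n) z = 0})"
 have "finite {(m,n)\<in>K\<times>K. m ~= n}"
  by (rule finite_subset[of _ "K \<times> K"]) (use finK in auto)
 moreover have "finite {z. poly (q m - q n) z = 0}" if "m \<in> K" "n \<in> K" "m ~= n" for m n
  using qinj[of m n] that by (intro poly_roots_finite) auto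
 ultimately have "finite R" unfolding R_def by (intro finite_UN_I) auto
 have "infinite (range int)" by (simp add: finite_image_iff)
 then have "\<not> range int \<subseteq> R" using \<open>finite R\<close> finite_subset by blast
 then obtain z where z: "int z \<notin> R" by blast
 define e where "e m = (\<Sum>i\<in>V. z ^ j i * lookup m i)" for m
 have qe: "poly (q m) (int z) = int (e m)" for m
  by (simp add: q_def e_def poly_sum poly_monom mult.commute)
 have einj: "inj_on e K"
 proof (rule inj_onI)
  fix m n assume mn: "m \<in> K" "n \<in> K" "e m = e n"
  then have "poly (q m - q n) (int z) = 0" by (simp add: qe)
  with mn z show "m = n" by (auto simp: R_def)
 qed
 define r where "r = (\<Sum>m\<in>K. monom (lookup p m) (e m))"
 have "poly r t = 0" for t
 proof -
  have "monomial_eval m (%i. t ^ (z ^ j i)) = t ^ e m" if "m \<in> K" for m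
   using that finV
   by (subst monomial_eval_superset[of V]) (auto simp: V_def e_def power_sum power_mult)
  then have "poly r t = poly_eval p (%i. t ^ (z ^ j i))"
   by (simp add: r_def poly_sum poly_monom poly_eval_def monomial_eval_def[symmetric] K_def)
  then show ?thesis using assms by simp
 qed
 then have "r = 0" using poly_all_0_iff_0 by blast
 obtain m where m: "m \<in> K" using K by blast
 have "coeff r (e m) = (\<Sum>n\<in>K. if n = m then lookup p n else 0)"
  unfolding r_def coeff_sum using einj m by (intro sum.cong) (auto dest: inj_onD)
 then have "coeff r (e m) = lookup p m" using m finK by simp
 then show False using \<open>r = 0\<close> m by (simp add: K_def in_keys_iff)
qed

lemma poly_eval_inject:
 assumes "!!x. poly_eval p x = poly_eval q x"
 shows "p = q"
proof -
 have "poly_eval (p + cconst (-1) * q) x = 0" for x using assms by simp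
 then have *: "p + cconst (-1) * q = 0" by (rule poly_eval_eq_0_imp)
 have **: "cconst (-1) * q + q = (0 :: 'a cpoly)"
  by (rule poly_eval_eq_0_imp) simp
 have "p = p + (cconst (-1) * q + q)" unfolding ** by simp
 also have "\<dots> = (p + cconst (-1) * q) + q" by (simp only: add.assoc)
 finally show ?thesis unfolding * by simp
qed

section \<open>Polynomials in two variables\<close>

text \<open>An element of \<^typ>\<open>complex poly poly\<close> is a polynomial in \<open>y\<close> whose coefficients are
 polynomials in \<open>s\<close>.\<close>

definition poly2 :: "complex poly poly => complex => complex => complex" where
 "poly2 G s y = poly (poly G [:y:]) s"

definition at_s :: "complex poly poly => complex => complex poly" where
 "at_s G s = map_poly (%c. poly c s) G"

lemma poly2_simps [simp]:
 "poly2 (G + H) s y = poly2 G s y + poly2 H s y"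
 "poly2 (G - H) s y = poly2 G s y - poly2 H s y"
 "poly2 (- G) s y = - poly2 G s y"
 "poly2 (G * H) s y = poly2 G s y * poly2 H s y"
 "poly2 0 s y = 0" "poly2 1 s y = 1" "poly2 [:c:] s y = poly c s"
 "poly2 (pCons c G) s y = poly c s + y * poly2 G s y"
 "poly2 (smult c G) s y = poly c s * poly2 G s y"
 "poly2 (G ^ n) s y = poly2 G s y ^ n"
 by (auto simp: poly2_def)

lemma poly2_sum [simp]: "poly2 (\<Sum>i\<in>I. G i) s y = (\<Sum>i\<in>I. poly2 (G i) s y)"
 by (simp add: poly2_def poly_sum)

lemma coeff_at_s [simp]: "coeff (at_s G s) j = poly (coeff G j) s"
 by (simp add: at_s_def coeff_map_poly)

lemma degree_at_s_le: "degree (at_s G s) \<le> degree G"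
 by (rule degree_le) (auto simp: coeff_eq_0)

lemma poly_at_s [simp]: "poly (at_s G s) y = poly2 G s y"
 by (induction G) (auto simp: at_s_def map_poly_pCons)

lemma poly2_altdef: "poly2 G s y = (\<Sum>j\<le>degree G. poly (coeff G j) s * y ^ j)"
proof -
 have "poly2 G s y = (\<Sum>j\<le>degree G. coeff (at_s G s) j * y ^ j)"
  unfolding poly_at_s[symmetric] poly_altdef
  by (rule sum.mono_neutral_cong_left) (use degree_at_s_le[of G s] in \<open>auto simp: coeff_eq_0 simp flip: coeff_at_s\<close>)
 then show ?thesis by simp
qed

lemma at_s_pderiv: "at_s (pderiv G) s = pderiv (at_s G s)"
 by (rule poly_eqI) (simp add: coeff_pderiv)

lemma poly2_eq_0_imp: assumes "!!s y. poly2 G s y = 0" shows "G = 0"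
proof (rule poly_eqI)
 fix j
 have "poly (coeff G j) s = 0" for s
 proof -
  have "at_s G s = 0" using assms by (metis poly_all_0_iff_0 poly_at_s)
  then show ?thesis by (metis coeff_0 coeff_at_s)
 qed
 then show "coeff G j = coeff 0 j" using poly_all_0_iff_0 by auto
qed

lemma poly2_inject: assumes "!!s y. poly2 G s y = poly2 H s y" shows "G = H"
 using poly2_eq_0_imp[of "G - H"] assms by simp

lemma complex_poly_poly_prime_iff: "irred (G :: complex poly poly) \<longleftrightarrow> prime_elem G"
 by (simp add: prime_elem_iff_irreducible)

text \<open>The element of least degree in the ideal generated by \<open>G\<close> and \<open>A\<close> divides both, up to
 factors in \<open>\<complex>[s]\<close>.\<close>

lemma bezout_of_irreducible:
 fixes G A :: "complex poly poly"
 assumes G: "irred G" and A: "\<not> G dvd A"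
 obtains U V r where "U * G + V * A = [:r:]" "r ~= 0"
proof (cases "degree G = 0")
 case True
 then obtain g where g: "G = [:g:]" by (meson degree_eq_zeroE)
 moreover have "g ~= 0" using G g by (auto simp: Factorial_Ring.irreducible_def)
 ultimately show ?thesis using that[of 1 0 g] by simp
next
 case False
 define I where "I D \<longleftrightarrow> D ~= 0 & (\<exists>U V. D = U * G + V * A)" for D
 have "I G" using G unfolding I_def Factorial_Ring.irreducible_def
  by (metis add.right_neutral mult_1 mult_zero_left)
 then obtain D where D: "I D" and min: "!!D'. I D' ==> degree D \<le> degree D'"
  by (metis arg_min_nat_lemma)
 obtain U V where UV: "D = U * G + V * A" using D I_def by blast
 have D0: "D ~= 0" using D I_def by blast
 \<comment> \<open>Pseudo-division by \<open>D\<close> leaves a remainder in the same ideal of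
   smaller degree, which vanishes by minimality. The factor \<open>c\<close> pays for not inverting
   the leading coefficient.\<close>
 have *: "\<exists>c q. c ~= 0 & smult c X = D * q" if X: "\<exists>U V. X = U * G + V * A" for X
 proof -
  obtain q r where qr: "pseudo_divmod X D = (q, r)" by (meson surj_pair)
  define c where "c = coeff D (degree D) ^ (Suc (degree X) - degree D)"
  from pseudo_divmod[OF D0 qr] have eq: "smult c X = D * q + r" and r: "r = 0 \<or> degree r < degree D"
   by (auto simp: c_def)
  obtain U' V' where UV': "X = U' * G + V' * A" using X by blast
  have "r = smult c X - D * q" using eq by simp
  also have "\<dots> = ([:c:] * U' - q * U) * G + ([:c:] * V' - q * V) * A"
   unfolding UV' UV by (simp add: algebra_simps smult_add_right)
  finally have "r = 0" using r min[of r] unfolding I_def by force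
  moreover have "c ~= 0" using D0 by (simp add: c_def)
  ultimately show ?thesis using eq by auto
 qed
 \<comment> \<open>Suppose \<open>D\<close> has positive degree. As \<open>G\<close> is prime,
   either it divides \<open>D\<close> and then a nonzero polynomial in \<open>s\<close> alone, or it
   cancels from \<open>smult c G = D * q\<close> and leaves \<open>D\<close> dividing such a
   polynomial; both contradict degrees.\<close>
 have "degree D = 0"
 proof (rule ccontr)
  assume dD: "degree D ~= 0"
  have prime: "prime_elem G" using G by (simp add: complex_poly_poly_prime_iff)
  obtain c q where cq: "c ~= 0" "smult c G = D * q"
   using *[of G] by (metis add.right_neutral mult_1 mult_zero_left)
  have "G dvd D * q" using cq(2) by (metis dvd_refl dvd_smult)
  then consider "G dvd D" | "G dvd q" using prime prime_elem_dvd_mult_iff by blast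
  then show False
  proof cases
   case 1
   obtain c' q' where cq': "c' ~= 0" "smult c' A = D * q'"
    using *[of A] by (metis add.left_neutral mult_1 mult_zero_left)
   have "G dvd [:c':] * A" using 1 cq'(2) by (simp add: dvd_mult2)
   then have "G dvd [:c':]" using prime A prime_elem_dvd_mult_iff by blast
   then have "degree G \<le> degree [:c':]" using cq'(1) by (intro dvd_imp_degree_le) auto
   then show False using False by simp
  next
   case 2
   then obtain q' where "q = G * q'" by blast
   with cq(2) have "G * [:c:] = G * (D * q')" by (simp add: mult.left_commute)
   then have "[:c:] = D * q'" using False by (metis degree_0 mult_left_cancel)
   then have "degree D \<le> degree [:c:]" using cq(1) by (intro dvd_imp_degree_le) auto
   then show False using dD by simp
  qed
 qed
 then obtain r where "D = [:r:]" by (meson degree_eq_zeroE)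
 then show ?thesis using that[of U V r] UV D0 by auto
qed

text \<open>At a common zero the Bezout combination vanishes, so \<open>s\<close> is a root of the
  nonzero \<open>r\<close>.\<close>

lemma finite_common_roots:
 assumes "irred G" "\<not> G dvd A"
 shows "finite {s. \<exists>y. poly2 G s y = 0 & poly2 A s y = 0}"
proof -
 obtain U V r where r: "U * G + V * A = [:r:]" "r ~= 0" using bezout_of_irreducible assms by blast
 have "poly r s = 0" if "poly2 G s y = 0" "poly2 A s y = 0" for s y
 proof -
  have "poly2 (U * G + V * A) s y = 0" using that by simp
  then show ?thesis unfolding r(1) by simp
 qed
 then show ?thesis using poly_roots_finite[OF r(2)] by (auto intro: finite_subset[rotated])
qed

lemma not_dvd_pderiv:
 fixes G :: "complex poly poly"
 assumes "degree G > 0"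
 shows "\<not> G dvd pderiv G"
proof
 assume "G dvd pderiv G"
 moreover have "pderiv G ~= 0" using assms by (simp add: pderiv_eq_0_iff)
 ultimately have "degree G \<le> degree (pderiv G)" by (rule dvd_imp_degree_le)
 then show False using assms by (simp add: degree_pderiv)
qed

text \<open>A simple root is no root of the cofactor, so splitting off a linear factor lowers the
  degree and the number of roots by one each.\<close>

lemma card_roots_eq_degree:
 fixes p :: "complex poly"
 assumes "p ~= 0" "!!y. poly p y = 0 ==> poly (pderiv p) y ~= 0"
 shows "card {y. poly p y = 0} = degree p"
 using assms
proof (induction "degree p" arbitrary: p)
 case 0
 then obtain c where "p = [:c:]" "c ~= 0" by (metis degree_eq_zeroE pCons_0_0)
 then show ?case by simp
next
 case (Suc n)
 obtain a where a: "poly p a = 0"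
  using Suc.hyps(2) alg_closed_imp_poly_has_root[of p] by auto
 then obtain q where q: "p = [:-a, 1:] * q" by (metis dvdE poly_eq_0_iff_dvd)
 have "q ~= 0" using Suc.prems(1) q by auto
 have dq: "degree q = n" using Suc.hyps(2) \<open>q ~= 0\<close> unfolding q by (subst (asm) degree_mult_eq) auto
 have der: "poly (pderiv p) y = poly q y + (y - a) * poly (pderiv q) y" for y
  unfolding q pderiv_mult by (simp add: pderiv_pCons algebra_simps del: mult_pCons_left)
 have qa: "poly q a ~= 0" using Suc.prems(2)[OF a] der[of a] by simp
 have "card {y. poly q y = 0} = degree q"
 proof (rule Suc.hyps(1))
  show "poly (pderiv q) y ~= 0" if "poly q y = 0" for y
   using Suc.prems(2)[of y] der[of y] that by (auto simp: q)
 qed (use dq \<open>q ~= 0\<close> in auto)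
 moreover have "{y. poly p y = 0} = insert a {y. poly q y = 0}" by (auto simp: q)
 ultimately show ?case using qa dq Suc.hyps(2) poly_roots_finite[OF \<open>q ~= 0\<close>] by simp
qed

text \<open>A double root survives in the cofactor, which has the same roots as \<open>p\<close> but
  smaller degree.\<close>

lemma card_roots_le_of_double:
 fixes p :: "complex poly"
 assumes "p ~= 0" "poly p a = 0" "poly (pderiv p) a = 0"
 shows "card {y. poly p y = 0} < degree p"
proof -
 obtain q where q: "p = [:-a, 1:] * q" using assms(2) by (metis dvdE poly_eq_0_iff_dvd)
 then have "poly (pderiv p) a = poly q a"
  unfolding q by (simp add: pderiv_mult pderiv_pCons del: mult_pCons_left)
 with assms have "poly q a = 0" by simp
 have "q ~= 0" using assms(1) q by auto
 have "{y. poly p y = 0} = {y. poly q y = 0}" using \<open>poly q a = 0\<close> by (auto simp: q)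
 then have "card {y. poly p y = 0} \<le> degree q" using card_poly_roots_bound[OF \<open>q ~= 0\<close>] by simp
 also have "degree q < degree p" unfolding q using \<open>q ~= 0\<close> by (subst degree_mult_eq) auto
 finally show ?thesis .
qed

section \<open>Pencils of lines\<close>

text \<open>Bilinear, without conjugation, because it pairs a point with a line and its vanishing
  means incidence.\<close>

definition dot :: "complex^3 => complex^3 => complex" where
 "dot x v = (\<Sum>i\<in>UNIV. x $ i * v $ i)"

lemma dot_simps [simp]:
 "dot (x + y) v = dot x v + dot y v" "dot (x - y) v = dot x v - dot y v"
 "dot (c *s x) v = c * dot x v" "dot x (v + w) = dot x v + dot x w"
 "dot x (v - w) = dot x v - dot x w" "dot x (c *s v) = c * dot x v" "dot 0 v = 0" "dot x 0 = 0"
 "dot (- x) v = - dot x v" "dot x (- v) = - dot x v"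
 by (auto simp: dot_def algebra_simps sum.distrib sum_subtractf sum_negf sum_distrib_left)

lemma dot_3: "dot x v = x$1 * v$1 + x$2 * v$2 + x$3 * v$3"
 by (simp add: dot_def sum_3)

text \<open>Free of conjugation like \<open>dot\<close>; for two distinct lines it is their common
  point.\<close>

definition ccross :: "complex^3 => complex^3 => complex^3" where
 "ccross a b = vector [a$2 * b$3 - a$3 * b$2, a$3 * b$1 - a$1 * b$3, a$1 * b$2 - a$2 * b$1]"

lemma ccross_nth [simp]:
 "ccross a b $ 1 = a$2 * b$3 - a$3 * b$2" "ccross a b $ 2 = a$3 * b$1 - a$1 * b$3"
 "ccross a b $ 3 = a$1 * b$2 - a$2 * b$1"
 by (simp_all add: ccross_def)

abbreviation peval :: "3 cpoly => complex^3 => complex" where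
 "peval F v \<equiv> poly_eval F (($) v)"

lemma peval_scale: "homogeneous F d ==> peval F (c *s v) = c ^ d * peval F v"
proof -
 have "($) (c *s v) = (%i. c * v $ i)" by auto
 then show "homogeneous F d ==> peval F (c *s v) = c ^ d * peval F v"
  by (simp only: homogeneous_scale)
qed

lemma peval_0: "homogeneous F d ==> d > 0 ==> peval F 0 = 0"
 using peval_scale[of F d 0 0] by (simp add: zero_power)

lemma peval_inject: assumes "!!v. peval p v = peval q v" shows "p = q"
proof (rule poly_eval_inject)
 fix x :: "3 => complex"
 have "x = (($) (\<chi> i. x i))" by auto
 then show "poly_eval p x = poly_eval q x" using assms by metis
qed

definition lin_form :: "complex^3 => 3 cpoly" where
 "lin_form m = (\<Sum>i\<in>UNIV. cconst (m $ i) * cvar i)"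

lemma peval_lin_form [simp]: "peval (lin_form m) v = dot v m"
 by (simp add: lin_form_def dot_def mult.commute)

lemma homogeneous_lin_form: "homogeneous (lin_form m) 1"
 unfolding lin_form_def homogeneous_weighted
 by (intro weighted_sum) (metis weighted_mult weighted_cconst weighted_cvar add_0)

lemma homogeneous_mult: "homogeneous p a ==> homogeneous q b ==> homogeneous (p * q) (a + b)"
 by (simp add: homogeneous_weighted weighted_mult)

lemma homogeneous_power: "homogeneous p a ==> homogeneous (p ^ n) (n * a)"
 by (simp add: homogeneous_weighted weighted_power)

lemma homogeneous_unit:
 assumes "homogeneous (P :: 3 cpoly) N" "P dvd 1"
 shows "N = 0"
proof (rule ccontr)
 assume "N ~= 0"
 obtain Q where "1 = P * Q" using assms(2) by blast
 then have "1 = peval P 0 * peval Q 0" by (metis poly_eval_1 poly_eval_mult)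
 then show False using peval_0[OF assms(1)] \<open>N ~= 0\<close> by simp
qed

lemma poly_along_line: "\<exists>P. \<forall>t. poly P t = peval F (v + t *s w)"
proof (induction F rule: cpoly_induct)
 case (const c) show ?case by (rule exI[of _ "[:c:]"]) simp
next
 case (var i) show ?case by (rule exI[of _ "[:v $ i, w $ i:]"]) simp
next
 case (add p q)
 then obtain P Q where "\<forall>t. poly P t = peval p (v + t *s w)" "\<forall>t. poly Q t = peval q (v + t *s w)" by blast
 then show ?case by (metis poly_add poly_eval_add)
next
 case (mult p q)
 then obtain P Q where "\<forall>t. poly P t = peval p (v + t *s w)" "\<forall>t. poly Q t = peval q (v + t *s w)" by blast
 then show ?case by (metis poly_mult poly_eval_mult)
qed

text \<open>Each line in direction \<open>w\<close> meets the plane \<open>m = 0\<close> once, and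
  polynomials in one variable that agree at all other parameters are equal. This permits cancelling
  powers of \<open>lin_form m\<close>.\<close>

lemma peval_inject_off_plane:
 assumes m: "dot w m ~= 0" and eq: "!!v. dot v m ~= 0 ==> peval p v = peval q v"
 shows "p = q"
proof (rule peval_inject)
 fix v
 obtain P where P: "!!t. poly P t = peval p (v + t *s w)" using poly_along_line by metis
 obtain Q where Q: "!!t. poly Q t = peval q (v + t *s w)" using poly_along_line by metis
 have "poly (P - Q) t = 0" if "t ~= - dot v m / dot w m" for t
 proof -
  have "dot (v + t *s w) m ~= 0" using that m by (auto simp: field_simps add_eq_0_iff2)
  then show ?thesis by (simp add: P Q eq)
 qed
 then have "UNIV - {- dot v m / dot w m} \<subseteq> {t. poly (P - Q) t = 0}" by blast
 moreover have "infinite (UNIV - {- dot v m / dot w m})"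
  by (rule Diff_infinite_finite) (auto simp: infinite_UNIV_char_0)
 ultimately have "P - Q = 0" using poly_roots_finite finite_subset by blast
 then have "poly P 0 = poly Q 0" by simp
 then show "peval p v = peval q v" by (simp add: P Q)
qed

text \<open>The basis \<open>b0, b1, b2\<close> is dual to \<open>m0, m1, m2\<close>; the lines of the pencil spanned by \<open>m0\<close> and
 \<open>m1\<close> pass through the point \<open>b2\<close>.\<close>

locale pencil =
 fixes m0 m1 m2 :: "complex^3"
 assumes det1: "dot (ccross m0 m1) m2 = 1"
begin

definition "b0 = ccross m1 m2"
definition "b1 = ccross m2 m0"
definition "b2 = ccross m0 m1"

definition pline :: "complex => complex^3" where
 "pline s = m0 + s *s m1"

text \<open>The points of \<open>pline s\<close> other than the common point \<open>b2\<close>,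
  scaled so that the pairing with \<open>m1\<close> is 1; then \<open>y\<close> is the pairing with
  \<open>m2\<close>.\<close>

definition ppoint :: "complex => complex => complex^3" where
 "ppoint s y = b1 - s *s b0 + y *s b2"

lemma dual_basis [simp]:
 "dot b0 m0 = 1" "dot b0 m1 = 0" "dot b0 m2 = 0"
 "dot b1 m0 = 0" "dot b1 m1 = 1" "dot b1 m2 = 0"
 "dot b2 m0 = 0" "dot b2 m1 = 0" "dot b2 m2 = 1"
 using det1 unfolding b0_def b1_def b2_def by (simp_all add: dot_3 algebra_simps)

text \<open>Cramer's rule, with determinant 1.\<close>

lemma expand: "x = dot x m0 *s b0 + dot x m1 *s b1 + dot x m2 *s b2"
proof -
 have "dot (ccross m0 m1) m2 *s x = dot x m0 *s b0 + dot x m1 *s b1 + dot x m2 *s b2"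
  unfolding b0_def b1_def b2_def vec_eq_iff forall_3
  by (simp add: dot_3 algebra_simps)
 then show ?thesis by (simp add: det1)
qed

lemma dot_ppoint_pline [simp]: "dot (ppoint s y) (pline s) = 0"
 by (simp add: ppoint_def pline_def)

lemma dot_b2_pline [simp]: "dot b2 (pline s) = 0"
 by (simp add: pline_def)

lemma pline_nonzero: "pline s ~= 0"
 by (metis dot_simps(4,6,8) dual_basis(1,2) pline_def mult_zero_right add_0_right zero_neq_one)

lemma ppoint_nonzero: "ppoint s y ~= 0"
proof
 assume "ppoint s y = 0"
 then have "dot (ppoint s y) m1 = 0" by simp
 then show False by (simp add: ppoint_def)
qed

lemma b2_nonzero: "b2 ~= 0"
 using dual_basis(9) by (metis dot_simps(7) zero_neq_one)

lemma on_pline_cases: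
 assumes "x ~= 0" "dot x (pline s) = 0"
 shows "\<exists>c. c ~= 0 & (x = c *s b2 \<or> (\<exists>y. x = c *s ppoint s y))"
proof -
 have 0: "dot x m0 = - (s * dot x m1)" using assms(2) by (simp add: pline_def add_eq_0_iff2)
 show ?thesis
 proof (cases "dot x m1 = 0")
  case True
  then have "x = dot x m2 *s b2" using expand[of x] 0 by simp
  moreover from this have "dot x m2 ~= 0" using assms(1) by (metis vector_smult_lzero)
  ultimately show ?thesis by blast
 next
  case False
  have "x = (- (s * dot x m1)) *s b0 + dot x m1 *s b1 + dot x m2 *s b2"
   using expand[of x] 0 by simp
  also have "\<dots> = dot x m1 *s ppoint s (dot x m2 / dot x m1)"
   using False by (simp add: ppoint_def vec_eq_iff algebra_simps)
  finally show ?thesis using False by blast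
 qed
qed

text \<open>The equation of the curve in the chart \<open>m1 = 1\<close>. Fixing \<open>s\<close>
  cuts the curve with one line of the pencil.\<close>

definition dehom :: "3 cpoly => complex poly poly" where
 "dehom F = (SOME G. \<forall>s y. poly2 G s y = peval F (ppoint s y))"

lemma poly2_dehom [simp]: "poly2 (dehom F) s y = peval F (ppoint s y)"
proof -
 have "\<exists>G. \<forall>s y. poly2 G s y = peval F (ppoint s y)"
 proof (induction F rule: cpoly_induct)
  case (const c) show ?case by (rule exI[of _ "[:[:c:]:]"]) simp
 next
  case (var i) show ?case
   by (rule exI[of _ "[:[:b1 $ i, - b0 $ i:], [:b2 $ i:]:]"]) (simp add: ppoint_def)
 next
  case (add p q)
  then obtain P Q where "\<forall>s y. poly2 P s y = peval p (ppoint s y)"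
   "\<forall>s y. poly2 Q s y = peval q (ppoint s y)" by blast
  then show ?case by (intro exI[of _ "P + Q"]) simp
 next
  case (mult p q)
  then obtain P Q where "\<forall>s y. poly2 P s y = peval p (ppoint s y)"
   "\<forall>s y. poly2 Q s y = peval q (ppoint s y)" by blast
  then show ?case by (intro exI[of _ "P * Q"]) simp
 qed
 then show ?thesis unfolding dehom_def by (rule someI2_ex) blast
qed

lemma peval_eq_dehom:
 assumes "homogeneous F d" "dot x m1 ~= 0"
 shows "peval F x = dot x m1 ^ d * poly2 (dehom F) (- dot x m0 / dot x m1) (dot x m2 / dot x m1)"
proof -
 have "x = dot x m1 *s ppoint (- dot x m0 / dot x m1) (dot x m2 / dot x m1)"
  by (subst expand[of x]) (use assms(2) in \<open>simp add: ppoint_def vec_eq_iff algebra_simps\<close>)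
 then show ?thesis using peval_scale[OF assms(1)] by (metis poly2_dehom)
qed

subsection \<open>Homogenization\<close>

text \<open>The polynomial \<open>h\<close> is the form of highest degree of \<open>A\<close>, on the line at infinity \<open>m1 = 0\<close>.\<close>

definition homogenizes :: "complex poly poly => nat => 3 cpoly => complex poly => bool" where
 "homogenizes A N P h \<longleftrightarrow> homogeneous P N & h ~= 0 & (N = 0 --> (\<exists>c. A = [:[:c:]:])) &
   (\<forall>x. dot x m1 ~= 0 -->
    peval P x = dot x m1 ^ N * poly2 A (- dot x m0 / dot x m1) (dot x m2 / dot x m1)) &
   (\<forall>x. dot x m1 = 0 & dot x m2 = 1 --> peval P x = poly h (- dot x m0))"

lemma ex_homogenizes:
 assumes "A ~= 0"
 shows "\<exists>N P h. homogenizes A N P h"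
proof -
 \<comment> \<open>The exponent \<open>j\<close> of \<open>y\<close> comes first, the exponent
   \<open>i\<close> of \<open>s\<close> second.\<close>
 define a where "a = (%(j, i). coeff (coeff A j) i)"
 define I where "I = {ji. a ji ~= 0}"
 define S where "S = (SIGMA j:{..degree A}. {..degree (coeff A j)})"
 have IS: "I \<subseteq> S"
  by (auto simp: I_def S_def a_def intro!: le_degree)
 have finI: "finite I" by (rule finite_subset[OF IS]) (simp add: S_def)
 have "I ~= {}"
 proof -
  have "coeff (coeff A (degree A)) (degree (coeff A (degree A))) ~= 0"
   using assms by simp
  then have "(degree A, degree (coeff A (degree A))) \<in> I" by (auto simp: I_def a_def)
  then show ?thesis by blast
 qed
 have evalA: "poly2 A s y = (\<Sum>(j,i)\<in>I. a (j,i) * s ^ i * y ^ j)" for s y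
 proof -
  have "poly2 A s y = (\<Sum>(j,i)\<in>S. a (j,i) * s ^ i * y ^ j)"
   unfolding poly2_altdef S_def a_def
   by (subst sum.Sigma[symmetric]) (auto simp: poly_altdef sum_distrib_right)
  also have "\<dots> = (\<Sum>(j,i)\<in>I. a (j,i) * s ^ i * y ^ j)"
   by (rule sum.mono_neutral_right) (use IS in \<open>auto simp: I_def S_def\<close>)
  finally show ?thesis .
 qed
 \<comment> \<open>The total degree of \<open>A\<close>, the least degree in which no negative power
   of \<open>m1\<close> is needed.\<close>
 define N where "N = Max ((%(j,i). i + j) ` I)"
 have N: "i + j \<le> N" if "(j,i) \<in> I" for i j
  unfolding N_def using finI that by (intro Max_ge) force+
 have "N \<in> (%(j,i). i + j) ` I" unfolding N_def using finI \<open>I ~= {}\<close> by (intro Max_in) auto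
 then obtain j0 i0 where 0: "(j0, i0) \<in> I" "N = i0 + j0" by auto
 define P where "P = (\<Sum>(j,i)\<in>I. cconst (a (j,i)) * lin_form (- m0) ^ i * lin_form m2 ^ j *
   lin_form m1 ^ (N - i - j))"
 define h where "h = (\<Sum>(j,i)\<in>{(j,i)\<in>I. i + j = N}. monom (a (j,i)) i)"
 have P: "peval P x = (\<Sum>(j,i)\<in>I. a (j,i) * (- dot x m0) ^ i * dot x m2 ^ j * dot x m1 ^ (N - i - j))" for x
  by (auto simp: P_def case_prod_beta intro!: sum.cong)
 have "homogeneous P N"
  unfolding P_def homogeneous_weighted
 proof (intro weighted_sum, clarify)
  fix j i assume ji: "(j, i) \<in> I"
  have "homogeneous (cconst (a (j,i)) * lin_form (- m0) ^ i * lin_form m2 ^ j * lin_form m1 ^ (N - i - j))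
    (0 + i * 1 + j * 1 + (N - i - j) * 1)"
   by (intro homogeneous_mult homogeneous_power homogeneous_lin_form) (simp add: homogeneous_weighted)
  then show "weighted (%_. 1) (cconst (a (j,i)) * lin_form (- m0) ^ i * lin_form m2 ^ j * lin_form m1 ^ (N - i - j)) N"
   using N[OF ji] by (simp add: homogeneous_weighted)
 qed
 moreover have "h ~= 0"
 proof -
  have "coeff h i0 = (\<Sum>ji\<in>{(j,i)\<in>I. i + j = N}. if ji = (j0, i0) then a ji else 0)"
   unfolding h_def coeff_sum using 0 by (intro sum.cong) (auto simp: case_prod_beta)
  also have "\<dots> = a (j0, i0)" using 0 finI
   by (subst sum.delta) (auto intro: finite_subset[OF _ finI])
  finally show ?thesis using 0 by (auto simp: I_def)
 qed
 moreover have "\<exists>c. A = [:[:c:]:]" if "N = 0"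
 proof -
  have "I \<subseteq> {(0,0)}" using N that by fastforce
  then have "poly2 A s y = poly2 [:[:a (0,0):]:] s y" for s y
   using evalA[of s y] \<open>I ~= {}\<close> by (auto simp: subset_singleton_iff)
  then show ?thesis using poly2_inject by blast
 qed
 moreover have "peval P x = dot x m1 ^ N * poly2 A (- dot x m0 / dot x m1) (dot x m2 / dot x m1)"
  if "dot x m1 ~= 0" for x
  unfolding P evalA sum_distrib_left
 proof (rule sum.cong, simp, clarify)
  fix j i assume "(j, i) \<in> I"
  then have "dot x m1 ^ N = dot x m1 ^ i * dot x m1 ^ j * dot x m1 ^ (N - i - j)"
   using N[of j i] by (simp flip: power_add)
  then show "a (j, i) * (- dot x m0) ^ i * dot x m2 ^ j * dot x m1 ^ (N - i - j) =
    dot x m1 ^ N * (a (j, i) * (- dot x m0 / dot x m1) ^ i * (dot x m2 / dot x m1) ^ j)"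
   using that power_divide[of "- dot x m0" "dot x m1" i] power_divide[of "dot x m2" "dot x m1" j]
   by (simp del: divide_minus_left)
 qed
 moreover have "peval P x = poly h (- dot x m0)" if x: "dot x m1 = 0 & dot x m2 = 1" for x
 proof -
  have "peval P x = (\<Sum>(j,i)\<in>{(j,i)\<in>I. i + j = N}. a (j,i) * (- dot x m0) ^ i)"
   unfolding P
  proof (rule sum.mono_neutral_cong_right)
   show "\<forall>ji\<in>I - {(j, i). (j, i) \<in> I & i + j = N}. (case ji of (j, i) =>
     a (j, i) * (- dot x m0) ^ i * dot x m2 ^ j * dot x m1 ^ (N - i - j)) = 0"
    using N x by (force simp: zero_power)
  qed (use finI x in auto)
  then show ?thesis by (simp add: h_def poly_sum poly_monom case_prod_beta)
 qed
 ultimately show ?thesis unfolding homogenizes_def by blast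
qed

text \<open>Away from \<open>m1 = 0\<close> both sides agree up to a power of the form
  \<open>m1\<close>. If this power stood on the wrong side, \<open>P * Q\<close> would vanish on the
  line at infinity, and with it the product of the nonzero leading forms \<open>g\<close> and
  \<open>h\<close>.\<close>

lemma homogenizes_factorization:
 assumes F: "homogeneous F d" and AB: "dehom F = A * B"
  and A: "homogenizes A M P g" and B: "homogenizes B N Q h"
 shows "\<exists>e. F = P * Q * lin_form m1 ^ e & M + N + e = d"
proof -
 have off: "peval (P * Q * lin_form m1 ^ d) x = peval (lin_form m1 ^ (M + N) * F) x" if "dot x m1 ~= 0" for x
  using that A B by (simp add: peval_eq_dehom[OF F that] AB homogenizes_def power_add)
 then have all: "P * Q * lin_form m1 ^ d = lin_form m1 ^ (M + N) * F"
  using peval_inject_off_plane[of b1 m1] by simp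
 have "M + N \<le> d"
 proof (rule ccontr)
  assume "\<not> M + N \<le> d"
  then have "P * Q = lin_form m1 ^ (M + N - d) * F"
   using off
   by (intro peval_inject_off_plane[of b1 m1])
    (auto simp: power_diff field_simps)
  then have *: "peval (P * Q) x = 0" if "dot x m1 = 0" for x
   using that \<open>\<not> M + N \<le> d\<close> by (simp add: zero_power)
  \<comment> \<open>The point \<open>b2 - s *s b0\<close> of the line at infinity is the one at
    which the leading forms take their values at \<open>s\<close>.\<close>
  have "poly (g * h) s = 0" for s
   using *[of "b2 - s *s b0"] A B by (simp add: homogenizes_def)
  then have "g * h = 0" using poly_all_0_iff_0 by blast
  then show False using A B by (simp add: homogenizes_def)
 qed
 moreover from this have "F = P * Q * lin_form m1 ^ (d - (M + N))"
  using off by (intro peval_inject_off_plane[of b1 m1]) (auto simp: power_diff field_simps)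
 ultimately show ?thesis by (intro exI[of _ "d - (M + N)"]) auto
qed

lemma homogenizes_1: "homogenizes 1 0 1 1"
 by (auto simp: homogenizes_def homogeneous_weighted one_pCons)

lemma not_unit_lin_form: "n > 0 ==> \<not> lin_form m ^ n dvd 1"
 using homogeneous_unit[of "lin_form m ^ n" n] homogeneous_power[OF homogeneous_lin_form, of m n] by auto

lemma dehom_nonzero: assumes "homogeneous F d" "F ~= 0" shows "dehom F ~= 0"
proof
 assume "dehom F = 0"
 then have "F = 0"
  using peval_eq_dehom[OF assms(1)] by (intro peval_inject_off_plane[of b1 m1]) auto
 then show False using assms(2) by simp
qed

text \<open>A surplus power of \<open>m1\<close> would split \<open>F\<close>, unless the cofactor
  is a unit. Then \<open>F\<close> is a unit times a power of a linear form, which for an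
  irreducible form contradicts \<open>d \<ge> 2\<close>.\<close>

lemma homogenizes_dehom_irreducible:
 assumes F: "homogeneous F d" "irred F" "d \<ge> 2"
 shows "\<exists>h. homogenizes (dehom F) d F h"
proof -
 have F0: "F ~= 0" using F(2) by (auto simp: Factorial_Ring.irreducible_def)
 obtain N P h where P: "homogenizes (dehom F) N P h"
  using ex_homogenizes[OF dehom_nonzero[OF F(1) F0]] by blast
 obtain e where e: "F = P * lin_form m1 ^ e" "N + e = d"
  using homogenizes_factorization[OF F(1) _ P homogenizes_1] by auto
 have "e = 0"
 proof (rule ccontr)
  assume "e ~= 0"
  have "P dvd 1 \<or> lin_form m1 ^ e dvd 1" using F(2) e(1) by (auto simp: Factorial_Ring.irreducible_def)
  then have "P dvd 1" using not_unit_lin_form \<open>e ~= 0\<close> by auto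
  then have "N = 0" using homogeneous_unit P by (auto simp: homogenizes_def)
  then have "F = (P * lin_form m1) * lin_form m1 ^ (d - 1)"
   using e F(3) by (simp add: mult.assoc flip: power_Suc)
  then have "P * lin_form m1 dvd 1 \<or> lin_form m1 ^ (d - 1) dvd 1"
   using F(2) by (auto simp: Factorial_Ring.irreducible_def)
  then have "lin_form m1 ^ 1 dvd 1 \<or> lin_form m1 ^ (d - 1) dvd 1" by (auto dest: dvd_mult_right)
  then show False using not_unit_lin_form[of 1 m1] not_unit_lin_form[of "d - 1" m1] F(3) by auto
 qed
 then show ?thesis using e P by auto
qed

lemma const_poly2_unit: "c ~= 0 ==> [:[:c::complex:]:] dvd 1"
 by (simp add: is_unit_const_poly_iff dvd_field_iff)

text \<open>A factorization in the chart homogenizes to one of \<open>F\<close>, and a factor whose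
  homogenization is a unit was constant. The degree bound excludes \<open>F\<close> proportional to
  \<open>m1\<close>, which the chart would turn into a unit.\<close>

lemma irreducible_dehom:
 assumes F: "homogeneous F d" "irred F" "d \<ge> 2"
 shows "irred (dehom F)"
 unfolding Factorial_Ring.irreducible_def
proof (intro conjI allI impI notI)
 have F0: "F ~= 0" using F(2) by (auto simp: Factorial_Ring.irreducible_def)
 show "dehom F = 0 ==> False" using dehom_nonzero[OF F(1) F0] by simp
 obtain h where h: "homogenizes (dehom F) d F h" using homogenizes_dehom_irreducible[OF F] by blast
 show False if "dehom F dvd 1"
 proof -
  from that obtain c where c: "dehom F = [:c:]" "c dvd 1" by (auto simp: is_unit_poly_iff)
  then obtain c' where "c = [:c':]" by (auto simp: is_unit_poly_iff)
  then have "homogenizes (dehom F) 0 (cconst c') [:c':]"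
   using c by (auto simp: homogenizes_def homogeneous_weighted)
  from homogenizes_factorization[OF F(1) _ this homogenizes_1]
  obtain e where "F = cconst c' * lin_form m1 ^ e" "e = d" by auto
  then have "F = (cconst c' * lin_form m1) * lin_form m1 ^ (d - 1)"
   using F(3) by (simp add: mult.assoc flip: power_Suc)
  then have "cconst c' * lin_form m1 dvd 1 \<or> lin_form m1 ^ (d - 1) dvd 1"
   using F(2) by (auto simp: Factorial_Ring.irreducible_def)
  then have "lin_form m1 ^ 1 dvd 1 \<or> lin_form m1 ^ (d - 1) dvd 1" by (auto dest: dvd_mult_right)
  then show False using not_unit_lin_form[of 1 m1] not_unit_lin_form[of "d - 1" m1] F(3) by auto
 qed
 fix A B assume AB: "dehom F = A * B"
 then have "A ~= 0" "B ~= 0" using dehom_nonzero[OF F(1) F0] by auto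
 obtain M P g where A: "homogenizes A M P g" using ex_homogenizes[OF \<open>A ~= 0\<close>] by blast
 obtain N Q h where B: "homogenizes B N Q h" using ex_homogenizes[OF \<open>B ~= 0\<close>] by blast
 obtain e where e: "F = P * (Q * lin_form m1 ^ e)"
  using homogenizes_factorization[OF F(1) AB A B] by (auto simp: mult.assoc)
 then have "P dvd 1 \<or> Q * lin_form m1 ^ e dvd 1" using F(2) by (auto simp: Factorial_Ring.irreducible_def)
 then have "P dvd 1 \<or> Q dvd 1" by (auto dest: dvd_mult_left)
 then have "M = 0 \<or> N = 0" using homogeneous_unit A B by (auto simp: homogenizes_def)
 then show "A dvd 1 \<or> B dvd 1"
  using A B \<open>A ~= 0\<close> \<open>B ~= 0\<close> const_poly2_unit unfolding homogenizes_def by fastforce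
qed

lemma dehom_dvd_imp:
 assumes F: "homogeneous F d" "irred F" "d \<ge> 2"
  and F': "homogeneous F' d'" "F' ~= 0" and dvd: "dehom F dvd dehom F'"
 shows "F dvd F'"
proof -
 obtain h where h: "homogenizes (dehom F) d F h" using homogenizes_dehom_irreducible[OF F] by blast
 obtain B where B: "dehom F' = dehom F * B" using dvd by blast
 then have "B ~= 0" using dehom_nonzero[OF F'] by auto
 then obtain N Q h' where "homogenizes B N Q h'" using ex_homogenizes by blast
 from homogenizes_factorization[OF F'(1) B h this] show ?thesis by (auto simp: mult.assoc)
qed

end

section \<open>Simple roots depend differentiably on parameters\<close>

text \<open>Since \<open>p'/p = \<Sum> 1 / (x - r)\<close> over the roots \<open>r\<close>, some root is close to \<open>x\<close>
 if \<open>p x\<close> is small compared with \<open>p' x\<close>.\<close>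

lemma nearby_root:
 fixes p :: "complex poly"
 assumes "poly (pderiv p) x ~= 0" "degree p \<le> n"
 shows "\<exists>r. poly p r = 0 & norm (x - r) * norm (poly (pderiv p) x) \<le> n * norm (poly p x)"
proof -
 \<comment> \<open>The estimate behind the logarithmic derivative, stated without division: if all
   roots have distance at least \<open>\<delta>\<close> from \<open>x\<close>, each of the
   \<open>degree p\<close> summands is at most the reciprocal of \<open>\<delta>\<close>.\<close>
 have *: "norm (poly (pderiv p) x) * \<delta> \<le> degree p * norm (poly p x)"
  if "p ~= 0" "!!r. poly p r = 0 ==> \<delta> \<le> norm (x - r)" "\<delta> \<ge> 0" for p \<delta>
  using that
 proof (induction "degree p" arbitrary: p)
  case 0
  then obtain c where "p = [:c:]" by (metis degree_eq_zeroE)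
  then show ?case by simp
 next
  case (Suc n)
  obtain a where a: "poly p a = 0"
   using Suc.hyps(2) alg_closed_imp_poly_has_root[of p] by auto
  then obtain q where q: "p = [:-a, 1:] * q" by (metis dvdE poly_eq_0_iff_dvd)
  have "q ~= 0" using Suc.prems(1) q by auto
  have dq: "degree q = n" using Suc.hyps(2) \<open>q ~= 0\<close> unfolding q by (subst (asm) degree_mult_eq) auto
  have der: "poly (pderiv p) x = poly q x + (x - a) * poly (pderiv q) x"
   unfolding q pderiv_mult by (simp add: pderiv_pCons algebra_simps del: mult_pCons_left)
  have px: "poly p x = (x - a) * poly q x" unfolding q poly_mult by simp
  have IH: "norm (poly (pderiv q) x) * \<delta> \<le> degree q * norm (poly q x)"
   by (rule Suc.hyps(1)) (use dq \<open>q ~= 0\<close> Suc.prems in \<open>auto simp: q\<close>)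
  have "norm (poly (pderiv p) x) * \<delta> \<le>
    (norm (poly q x) + norm (x - a) * norm (poly (pderiv q) x)) * \<delta>"
   unfolding der using Suc.prems(3)
   by (intro mult_right_mono) (auto intro: norm_triangle_le simp: norm_mult)
  also have "\<dots> = norm (poly q x) * \<delta> + norm (x - a) * (norm (poly (pderiv q) x) * \<delta>)"
   by (simp add: algebra_simps)
  also have "\<dots> \<le> norm (poly q x) * norm (x - a) + norm (x - a) * (degree q * norm (poly q x))"
   by (intro add_mono mult_left_mono IH Suc.prems(2) a) auto
  also have "\<dots> = degree p * norm (poly p x)"
   using dq Suc.hyps(2)[symmetric] unfolding px norm_mult by (simp add: algebra_simps)
  finally show ?case .
 qed
 have p0: "p ~= 0" using assms(1) by auto
 let ?\<delta> = "degree p * norm (poly p x) / norm (poly (pderiv p) x)"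
 show ?thesis
 proof (cases "\<exists>r. poly p r = 0 & norm (x - r) \<le> ?\<delta>")
  case True
  then obtain r where "poly p r = 0" "norm (x - r) * norm (poly (pderiv p) x) \<le> degree p * norm (poly p x)"
   using assms(1) by (auto simp: field_simps)
  moreover have "degree p * norm (poly p x) \<le> n * norm (poly p x)"
   using assms(2) by (intro mult_right_mono) auto
  ultimately show ?thesis by force
 next
  case False
  define R where "R = {r. poly p r = 0}"
  have finR: "finite R" unfolding R_def using p0 by (rule poly_roots_finite)
  have "degree p > 0" using assms(1) by (metis degree_eq_zeroE neq0_conv pderiv_0 pderiv_pCons poly_0 add_0 degree_0 pderiv_eq_0_iff)
  then have "R ~= {}" using alg_closed_imp_poly_has_root[of p] by (auto simp: R_def)
  define \<delta> where "\<delta> = Min ((%r. norm (x - r)) ` R)"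
  have "\<delta> \<in> (%r. norm (x - r)) ` R" unfolding \<delta>_def using finR \<open>R ~= {}\<close> by (intro Min_in) auto
  then have big: "\<delta> > ?\<delta>" using False by (auto simp: R_def not_le)
  have "norm (poly (pderiv p) x) * \<delta> \<le> degree p * norm (poly p x)"
  proof (rule *[OF p0])
   show "\<delta> \<le> norm (x - r)" if "poly p r = 0" for r
    unfolding \<delta>_def using finR that by (intro Min_le) (auto simp: R_def)
   have "0 \<le> ?\<delta>" by simp
   then show "0 \<le> \<delta>" using big by linarith
  qed
  then show ?thesis using big assms(1) by (simp add: field_simps)
 qed
qed

text \<open>The quotient of \<open>p x - p y\<close> by \<open>x - y\<close> as a polynomial, so
  that it makes sense for \<open>x = y\<close> and varies continuously with the coefficients. The
  fixed bound \<open>N\<close> keeps the formula the same when the degree drops.\<close>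

definition diff_quot :: "nat => complex poly => complex => complex => complex" where
 "diff_quot N p x y = (\<Sum>j\<le>N. coeff p j * (\<Sum>i<j. x ^ i * y ^ (j - Suc i)))"

lemma poly_bounded_degree:
 fixes p :: "complex poly"
 shows "degree p \<le> N ==> poly p x = (\<Sum>j\<le>N. coeff p j * x ^ j)"
 unfolding poly_altdef by (rule sum.mono_neutral_left) (auto simp: coeff_eq_0)

lemma diff_quot:
 assumes "degree p \<le> N"
 shows "poly p x - poly p y = (x - y) * diff_quot N p x y"
proof -
 have "x ^ j - y ^ j = (x - y) * (\<Sum>i<j. x ^ i * y ^ (j - Suc i))" for j
  using power_diff_sumr2[of x j y] by (simp add: mult.commute)
 then show ?thesis
  by (simp add: poly_bounded_degree[OF assms] diff_quot_def sum_distrib_left mult.left_commute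
    flip: sum_subtractf right_diff_distrib)
qed

lemma diff_quot_diagonal:
 assumes "degree p \<le> N"
 shows "diff_quot N p x x = poly (pderiv p) x"
proof -
 have lim: "((%y. diff_quot N p y x) \<longlongrightarrow> diff_quot N p x x) (at x)"
  unfolding diff_quot_def by (intro tendsto_intros)
 have lim': "((%y. (poly p y - poly p x) / (y - x)) \<longlongrightarrow> poly (pderiv p) x) (at x)"
  using poly_DERIV[of p x] by (simp add: has_field_derivative_iff)
 have "\<forall>\<^sub>F y in at x. diff_quot N p y x = (poly p y - poly p x) / (y - x)"
  by (auto simp: eventually_at_filter diff_quot[OF assms])
 from tendsto_cong[OF this] lim lim' show ?thesis by (blast intro: LIM_unique)
qed

lemma tendsto_diff_quot:
 assumes "!!j. ((%a. coeff (p a) j) \<longlongrightarrow> coeff q j) F" "(x \<longlongrightarrow> x') F" "(y \<longlongrightarrow> y') F"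
 shows "((%a. diff_quot N (p a) (x a) (y a)) \<longlongrightarrow> diff_quot N q x' y') F"
 unfolding diff_quot_def by (intro tendsto_intros assms)

lemma tendsto_poly_coeffs:
 fixes p :: "'b => complex poly"
 assumes "!!j. ((%a. coeff (p a) j) \<longlongrightarrow> coeff q j) F" "(x \<longlongrightarrow> x') F"
  "!!a. degree (p a) \<le> N" "degree q \<le> N"
 shows "((%a. poly (p a) (x a)) \<longlongrightarrow> poly q x') F"
 unfolding poly_bounded_degree[OF assms(3)] poly_bounded_degree[OF assms(4)]
 by (intro tendsto_intros assms)

text \<open>The degree is merely bounded, since leading coefficients may vanish at some
  parameters.\<close>

locale poly_family =
 fixes S :: "'a::metric_space set" and p :: "'a => complex poly" and N :: nat
 assumes open_S: "open S" and degree_le: "!!a. degree (p a) \<le> N"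
  and cont: "!!j. continuous_on S (%a. coeff (p a) j)"
begin

lemma tendsto_coeff: "a \<in> S ==> ((%b. coeff (p b) j) \<longlongrightarrow> coeff (p a) j) (nhds a)"
 using cont[of j] open_S tendsto_at_iff_tendsto_nhds[of "%b. coeff (p b) j" a]
 by (auto simp: continuous_on_eq_continuous_at isCont_def)

text \<open>An implicit function theorem from continuity of the coefficients:
  \<open>nearby_root\<close> produces a root close to \<open>x0\<close>, and the nonvanishing
  difference quotient forbids a second one.\<close>

lemma root_function:
 assumes a0: "a0 \<in> S" and root: "poly (p a0) x0 = 0" and simple: "poly (pderiv (p a0)) x0 ~= 0"
  and "\<epsilon> > 0"
 shows "\<exists>\<delta> r \<xi>. \<delta> > 0 & ball a0 \<delta> \<subseteq> S & 0 < r & r \<le> \<epsilon> & \<xi> a0 = x0 & continuous_on (ball a0 \<delta>) \<xi> &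
  (\<forall>a\<in>ball a0 \<delta>. \<xi> a \<in> ball x0 r & poly (p a) (\<xi> a) = 0 & poly (pderiv (p a)) (\<xi> a) ~= 0 &
   (\<forall>x\<in>ball x0 r. poly (p a) x = 0 --> x = \<xi> a))"
proof -
 have K0: "diff_quot N (p a0) x0 x0 ~= 0" using simple by (simp add: diff_quot_diagonal degree_le)
 have "((%z. diff_quot N (p (fst z)) (fst (snd z)) (snd (snd z))) \<longlongrightarrow>
   diff_quot N (p a0) x0 x0) (nhds (a0, x0, x0))"
 proof (rule tendsto_diff_quot)
  show "((%z. coeff (p (fst z)) j) \<longlongrightarrow> coeff (p a0) j) (nhds (a0, x0, x0))" for j
   by (rule filterlim_compose[OF tendsto_coeff[OF a0]])
    (use tendsto_fst[OF filterlim_ident[of "nhds (a0, x0, x0)"]] in simp)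
  have "((%z. snd z) \<longlongrightarrow> (x0, x0)) (nhds (a0, x0, x0))"
   using tendsto_snd[OF filterlim_ident[of "nhds (a0, x0, x0)"]] by simp
  from tendsto_fst[OF this] tendsto_snd[OF this]
  show "((%z. fst (snd z)) \<longlongrightarrow> x0) (nhds (a0, x0, x0))"
   "((%z. snd (snd z)) \<longlongrightarrow> x0) (nhds (a0, x0, x0))" by simp_all
 qed
 then have "\<forall>\<^sub>F z in nhds (a0, x0, x0). diff_quot N (p (fst z)) (fst (snd z)) (snd (snd z)) ~= 0"
  using K0 by (rule tendsto_imp_eventually_ne)
 then obtain e where e: "e > 0"
  "!!z. dist z (a0, x0, x0) < e ==> diff_quot N (p (fst z)) (fst (snd z)) (snd (snd z)) ~= 0"
  unfolding eventually_nhds_metric by blast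
 \<comment> \<open>A third of \<open>e\<close> for the parameter and for each argument of the
   difference quotient, since the distance in the product is at most the sum of the three.\<close>
 define r where "r = min (e / 3) \<epsilon>"
 have r: "0 < r" "r \<le> \<epsilon>" using e \<open>\<epsilon> > 0\<close> by (auto simp: r_def)
 have K: "diff_quot N (p a) x y ~= 0" if "dist a a0 < e / 3" "dist x x0 < r" "dist y x0 < r" for a x y
 proof -
  have "dist (a, x, y) (a0, x0, x0) \<le> dist a a0 + dist (x, y) (x0, x0)"
   unfolding dist_Pair_Pair by (rule sqrt_sum_squares_le_sum) auto
  also have "dist (x, y) (x0, x0) \<le> dist x x0 + dist y x0"
   unfolding dist_Pair_Pair by (rule sqrt_sum_squares_le_sum) auto
  finally show ?thesis using e(2)[of "(a, x, y)"] that by (auto simp: r_def)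
 qed
 \<comment> \<open>Negative at \<open>a0\<close>, hence nearby; this is the condition under which
   \<open>nearby_root\<close> finds a root within \<open>r\<close> of \<open>x0\<close>.\<close>
 have small: "((%a. N * norm (poly (p a) x0) - r * norm (poly (pderiv (p a)) x0)) \<longlongrightarrow>
   N * norm (poly (p a0) x0) - r * norm (poly (pderiv (p a0)) x0)) (nhds a0)"
  by (intro tendsto_intros tendsto_poly_coeffs[where N = N])
   (auto simp: degree_le coeff_pderiv degree_pderiv intro!: tendsto_intros tendsto_coeff a0
    intro: le_trans[OF degree_le] order_trans[OF diff_le_self])
 have ev1: "\<forall>\<^sub>F a in nhds a0. N * norm (poly (p a) x0) - r * norm (poly (pderiv (p a)) x0) < 0"
  by (rule order_tendstoD(2)[OF small]) (use root simple r in auto)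
 have ev2: "\<forall>\<^sub>F a in nhds a0. a \<in> S" using open_S a0 by (auto simp: eventually_nhds)
 obtain \<delta>' where \<delta>': "\<delta>' > 0" "!!a. dist a a0 < \<delta>' ==>
   N * norm (poly (p a) x0) < r * norm (poly (pderiv (p a)) x0) & a \<in> S"
  using eventually_conj[OF ev1 ev2] unfolding eventually_nhds_metric by auto
 define \<delta> where "\<delta> = min \<delta>' (e / 3)"
 have \<delta>: "\<delta> > 0" using \<delta>' e by (auto simp: \<delta>_def)
 have ex: "\<exists>x. x \<in> ball x0 r & poly (p a) x = 0" if "a \<in> ball a0 \<delta>" for a
 proof -
  have a: "N * norm (poly (p a) x0) < r * norm (poly (pderiv (p a)) x0)"
   using \<delta>'(2)[of a] that by (auto simp: \<delta>_def dist_commute)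
  then have ne: "poly (pderiv (p a)) x0 ~= 0"
   by (metis linorder_not_less mult_zero_right norm_ge_zero norm_zero mult_nonneg_nonneg of_nat_0_le_iff)
  obtain x where x: "poly (p a) x = 0"
   "norm (x0 - x) * norm (poly (pderiv (p a)) x0) \<le> N * norm (poly (p a) x0)"
   using nearby_root[OF ne degree_le] by blast
  then have "norm (x0 - x) * norm (poly (pderiv (p a)) x0) < r * norm (poly (pderiv (p a)) x0)"
   using a by linarith
  then have "norm (x0 - x) < r" using ne by (simp add: mult_less_cancel_right)
  then show ?thesis using x(1) by (auto simp: dist_norm)
 qed
 have uniq: "x = y" if "a \<in> ball a0 \<delta>" "x \<in> ball x0 r" "y \<in> ball x0 r"
  "poly (p a) x = 0" "poly (p a) y = 0" for a x y
  using diff_quot[OF degree_le, of a x y] K[of a x y] that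
  by (auto simp: \<delta>_def dist_commute)
 define \<xi> where "\<xi> a = (SOME x. x \<in> ball x0 r & poly (p a) x = 0)" for a
 have \<xi>: "\<xi> a \<in> ball x0 r & poly (p a) (\<xi> a) = 0" if "a \<in> ball a0 \<delta>" for a
  unfolding \<xi>_def by (rule someI_ex) (rule ex[OF that])
 have \<xi>': "poly (pderiv (p a)) (\<xi> a) ~= 0" if "a \<in> ball a0 \<delta>" for a
  using K[of a "\<xi> a" "\<xi> a"] \<xi>[OF that] that diff_quot_diagonal[OF degree_le]
  by (auto simp: \<delta>_def dist_commute)
 have "continuous_on (ball a0 \<delta>) \<xi>"
  unfolding continuous_on_eq_continuous_at[OF open_ball]
 proof
  fix a assume a: "a \<in> ball a0 \<delta>"
  then have aS: "a \<in> S" using \<delta>' by (auto simp: \<delta>_def dist_commute)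
  \<comment> \<open>The bound of \<open>nearby_root\<close> at the old root \<open>\<xi> a\<close>
    for the polynomial at \<open>b\<close>. It tends to 0 as \<open>b\<close> tends to
    \<open>a\<close>, and uniqueness identifies the root found with \<open>\<xi> b\<close>.\<close>
  have 1: "((%b. N * norm (poly (p b) (\<xi> a)) / norm (poly (pderiv (p b)) (\<xi> a))) \<longlongrightarrow>
    N * norm (poly (p a) (\<xi> a)) / norm (poly (pderiv (p a)) (\<xi> a))) (nhds a)"
   using \<xi>'[OF a]
   by (intro tendsto_intros tendsto_poly_coeffs[where N = N])
   (auto simp: degree_le coeff_pderiv degree_pderiv intro!: tendsto_intros tendsto_coeff aS
    intro: le_trans[OF degree_le] order_trans[OF diff_le_self])
  have 2: "((%b. poly (pderiv (p b)) (\<xi> a)) \<longlongrightarrow> poly (pderiv (p a)) (\<xi> a)) (nhds a)"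
   by (intro tendsto_poly_coeffs[where N = N])
   (auto simp: degree_le coeff_pderiv degree_pderiv intro!: tendsto_intros tendsto_coeff aS
    intro: le_trans[OF degree_le] order_trans[OF diff_le_self])
  show "isCont \<xi> a"
   unfolding isCont_def tendsto_at_iff_tendsto_nhds
  proof (rule tendstoI)
   fix \<eta> :: real assume "\<eta> > 0"
   obtain \<rho> where \<rho>: "\<rho> > 0" "ball (\<xi> a) \<rho> \<subseteq> ball x0 r" using \<xi>[OF a] open_ball open_contains_ball by blast
   have "\<forall>\<^sub>F b in nhds a. N * norm (poly (p b) (\<xi> a)) / norm (poly (pderiv (p b)) (\<xi> a)) < min \<eta> \<rho>"
    by (rule order_tendstoD(2)[OF 1]) (use \<xi>[OF a] \<open>\<eta> > 0\<close> \<rho> in auto)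
   moreover have "\<forall>\<^sub>F b in nhds a. poly (pderiv (p b)) (\<xi> a) ~= 0"
    using 2 \<xi>'[OF a] by (rule tendsto_imp_eventually_ne)
   moreover have "\<forall>\<^sub>F b in nhds a. b \<in> ball a0 \<delta>"
    using a by (metis eventually_nhds open_ball)
   ultimately show "\<forall>\<^sub>F b in nhds a. dist (\<xi> b) (\<xi> a) < \<eta>"
   proof eventually_elim
    case (elim b)
    obtain x where x: "poly (p b) x = 0"
     "norm (\<xi> a - x) * norm (poly (pderiv (p b)) (\<xi> a)) \<le> N * norm (poly (p b) (\<xi> a))"
     using nearby_root[OF elim(2) degree_le] by blast
    then have "norm (\<xi> a - x) \<le> N * norm (poly (p b) (\<xi> a)) / norm (poly (pderiv (p b)) (\<xi> a))"
     using elim(2) by (simp add: field_simps)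
    then have lt: "norm (\<xi> a - x) < min \<eta> \<rho>" using elim(1) by linarith
    then have "x \<in> ball x0 r" using \<rho>(2) by (auto simp: dist_norm)
    then have "x = \<xi> b" using uniq[OF elim(3) _ _ x(1)] \<xi>[OF elim(3)] by blast
    then show ?case using lt by (simp add: dist_norm norm_minus_commute)
   qed
  qed
 qed
 moreover have "ball a0 \<delta> \<subseteq> S" using \<delta>' by (auto simp: \<delta>_def dist_commute)
 moreover have "\<xi> a0 = x0" using uniq[of a0 "\<xi> a0" x0] \<xi>[of a0] \<delta> root r by auto
 moreover have "\<forall>a\<in>ball a0 \<delta>. \<xi> a \<in> ball x0 r & poly (p a) (\<xi> a) = 0 & poly (pderiv (p a)) (\<xi> a) ~= 0 &
   (\<forall>x\<in>ball x0 r. poly (p a) x = 0 --> x = \<xi> a)"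
  using \<xi> \<xi>' uniq by blast
 ultimately show ?thesis using \<delta> r by blast
qed

end

text \<open>Since \<open>f\<close> vanishes at \<open>a\<close>, the increment of \<open>k\<close>
  is multiplied by something of first order, so continuity of \<open>k\<close> suffices.\<close>

lemma has_derivative_mult_zero:
 fixes f k :: "'a::real_normed_vector => complex"
 assumes f: "(f has_derivative D) (at a)" and f0: "f a = 0" and k: "isCont k a"
 shows "((%b. f b * k b) has_derivative (%h. D h * k a)) (at a)"
proof -
 have D: "bounded_linear D" using f by (rule has_derivative_bounded_linear)
 have lim: "((%h. norm (f (a + h) - f a - D h) / norm h) \<longlongrightarrow> 0) (at 0)"
  using f by (simp add: has_derivative_at)
 have kc: "((%h. k (a + h)) \<longlongrightarrow> k a) (at 0)" using k by (simp add: isCont_iff)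
 obtain B where B: "!!h. norm (D h) \<le> norm h * B" using D bounded_linear.bounded by blast
 have "((%h. norm (f (a + h) * k (a + h) - f a * k a - D h * k a) / norm h) \<longlongrightarrow> 0) (at 0)"
 proof (rule tendsto_sandwich[OF _ _ tendsto_const])
  show "((%h. norm (f (a + h) - f a - D h) / norm h * norm (k (a + h)) + B * norm (k (a + h) - k a)) \<longlongrightarrow> 0) (at 0)"
   using tendsto_add[OF tendsto_mult[OF lim tendsto_norm[OF kc]]
    tendsto_mult[OF tendsto_const[of B] tendsto_norm[OF tendsto_diff[OF kc tendsto_const[of "k a"]]]]]
   by simp
  show "\<forall>\<^sub>F h in at 0. norm (f (a + h) * k (a + h) - f a * k a - D h * k a) / norm h \<le>
   norm (f (a + h) - f a - D h) / norm h * norm (k (a + h)) + B * norm (k (a + h) - k a)"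
   unfolding eventually_at_filter
  proof (intro always_eventually allI impI)
   fix h :: 'a assume h: "h ~= 0"
   have "f (a + h) * k (a + h) - f a * k a - D h * k a =
    (f (a + h) - f a - D h) * k (a + h) + D h * (k (a + h) - k a)"
    by (simp add: f0 algebra_simps)
   then have "norm (f (a + h) * k (a + h) - f a * k a - D h * k a) \<le>
    norm (f (a + h) - f a - D h) * norm (k (a + h)) + norm (D h) * norm (k (a + h) - k a)"
    by (metis norm_mult norm_triangle_ineq)
   also have "\<dots> \<le> norm (f (a + h) - f a - D h) * norm (k (a + h)) + (norm h * B) * norm (k (a + h) - k a)"
    by (intro add_left_mono mult_right_mono B) auto
   finally show "norm (f (a + h) * k (a + h) - f a * k a - D h * k a) / norm h \<le>
   norm (f (a + h) - f a - D h) / norm h * norm (k (a + h)) + B * norm (k (a + h) - k a)"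
    using h by (simp add: field_simps)
  qed
 qed (auto intro: always_eventually)
 moreover have "bounded_linear (%h. D h * k a)"
  using bounded_linear_compose[OF bounded_linear_mult_left D] by simp
 ultimately show ?thesis by (simp add: has_derivative_at)
qed

text \<open>\<open>\<xi> b - \<xi> a\<close> is the quotient of \<open>- p\<^sub>b (\<xi> a)\<close> by a continuous nonvanishing difference
 quotient.\<close>

lemma root_has_derivative:
 fixes p :: "'a::real_normed_vector => complex poly"
 assumes "open S" "a \<in> S" and deg: "!!a. degree (p a) \<le> N"
  and cont: "isCont \<xi> a" and root: "!!b. b \<in> S ==> poly (p b) (\<xi> b) = 0"
  and simple: "poly (pderiv (p a)) (\<xi> a) ~= 0"
  and cc: "!!j. isCont (%b. coeff (p b) j) a"
  and D: "((%b. poly (p b) (\<xi> a)) has_derivative D) (at a)"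
 shows "(\<xi> has_derivative (%h. - D h / poly (pderiv (p a)) (\<xi> a))) (at a)"
proof -
 define K where "K b = diff_quot N (p b) (\<xi> b) (\<xi> a)" for b
 have Ka: "K a = poly (pderiv (p a)) (\<xi> a)" by (simp add: K_def diff_quot_diagonal deg)
 have contK: "isCont K a"
  unfolding K_def isCont_def
  by (rule tendsto_diff_quot) (use cc cont in \<open>auto simp: isCont_def\<close>)
 have "isCont (%b. - inverse (K b)) a"
  using contK Ka simple by (intro continuous_intros) auto
 from has_derivative_mult_zero[OF D _ this]
 have "((%b. poly (p b) (\<xi> a) * - inverse (K b)) has_derivative (%h. D h * - inverse (K a))) (at a)"
  using root assms(2) by simp
 then have D': "((%b. poly (p b) (\<xi> a) * - inverse (K b) + \<xi> a) has_derivative (%h. D h * - inverse (K a))) (at a)"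
  using has_derivative_add[OF _ has_derivative_const] by fastforce
 have ev: "\<forall>\<^sub>F b in nhds a. poly (p b) (\<xi> a) * - inverse (K b) + \<xi> a = \<xi> b"
 proof -
  have "\<forall>\<^sub>F b in nhds a. b \<in> S" using assms(1,2) by (auto simp: eventually_nhds)
  moreover have "\<forall>\<^sub>F b in nhds a. K b ~= 0"
  proof -
   have "(K \<longlongrightarrow> K a) (nhds a)"
    using contK by (simp add: isCont_def tendsto_at_iff_tendsto_nhds)
   then show ?thesis by (rule tendsto_imp_eventually_ne) (use Ka simple in simp)
  qed
  ultimately show ?thesis
  proof eventually_elim
   case (elim b)
   then show ?case
    using diff_quot[OF deg, of b "\<xi> b" "\<xi> a"] root[of b] by (simp add: K_def field_simps)
  qed
 qed
 have "(\<xi> has_derivative (%h. D h * - inverse (K a))) (at a)"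
  by (rule has_derivative_transform_eventually[OF D'])
   (use ev in \<open>simp_all add: eventually_nhds_conv_at\<close>)
 then show ?thesis by (simp add: Ka divide_inverse)
qed

context poly_family begin

text \<open>\<open>R\<close> may be a proper subset of the roots at \<open>c\<close>: near a tangent
  the simple roots are continued this way, the double one is not.\<close>

definition root_sheets :: "'a => complex set => real => real => (complex => 'a => complex) => bool" where
 "root_sheets c R \<epsilon> \<delta> Y \<longleftrightarrow> \<delta> > 0 & ball c \<delta> \<subseteq> S &
  (\<forall>y\<in>R. Y y c = y & continuous_on (ball c \<delta>) (Y y) &
   (\<forall>s\<in>ball c \<delta>. poly (p s) (Y y s) = 0 & poly (pderiv (p s)) (Y y s) ~= 0 & dist (Y y s) y < \<epsilon>)) &
  (\<forall>s\<in>ball c \<delta>. inj_on (%y. Y y s) R)"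

lemma ex_root_sheets:
 assumes c: "c \<in> S" and R: "finite R" "!!y. y \<in> R ==> poly (p c) y = 0 & poly (pderiv (p c)) y ~= 0"
  and "\<epsilon> > 0"
 shows "\<exists>\<delta> Y. root_sheets c R \<epsilon> \<delta> Y"
proof -
 have "\<forall>y\<in>R. \<exists>e>0. \<forall>y'\<in>R. y' ~= y --> e \<le> dist y y'"
  using finite_set_avoid[OF R(1)] by (metis dist_commute)
 then obtain e where e: "!!y. y \<in> R ==> e y > 0" "!!y y'. y \<in> R ==> y' \<in> R ==> y' ~= y ==> e y \<le> dist y y'"
  by metis
 \<comment> \<open>Half the distance to the nearest other point of \<open>R\<close> keeps the sheets
   apart.\<close>
 have "\<exists>\<delta> \<xi>. \<delta> > 0 & ball c \<delta> \<subseteq> S & \<xi> c = y & continuous_on (ball c \<delta>) \<xi> &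
   (\<forall>s\<in>ball c \<delta>. poly (p s) (\<xi> s) = 0 & poly (pderiv (p s)) (\<xi> s) ~= 0 & dist (\<xi> s) y < min \<epsilon> (e y / 2))"
  if "y \<in> R" for y
 proof -
  note R' = R(2)[OF that]
  have "min \<epsilon> (e y / 2) > 0" using e(1)[OF that] \<open>\<epsilon> > 0\<close> by simp
  from root_function[OF c conjunct1[OF R'] conjunct2[OF R'] this]
  obtain \<delta> r \<xi> where *: "\<delta> > 0" "ball c \<delta> \<subseteq> S" "r \<le> min \<epsilon> (e y / 2)" "\<xi> c = y"
   "\<forall>a\<in>ball c \<delta>. \<xi> a \<in> ball y r & poly (p a) (\<xi> a) = 0 & poly (pderiv (p a)) (\<xi> a) ~= 0"
   "continuous_on (ball c \<delta>) \<xi>" by metis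
  have "dist (\<xi> s) y < min \<epsilon> (e y / 2)" if "s \<in> ball c \<delta>" for s
   using *(5) that *(3) by (force simp: dist_commute)
  with * show ?thesis by blast
 qed
 then obtain \<delta>' Y where Y: "!!y. y \<in> R ==> \<delta>' y > 0 & ball c (\<delta>' y) \<subseteq> S & Y y c = y & continuous_on (ball c (\<delta>' y)) (Y y) &
   (\<forall>s\<in>ball c (\<delta>' y). poly (p s) (Y y s) = 0 & poly (pderiv (p s)) (Y y s) ~= 0 &
    dist (Y y s) y < min \<epsilon> (e y / 2))"
  by metis
 obtain \<delta>0 where \<delta>0: "\<delta>0 > 0" "ball c \<delta>0 \<subseteq> S" using open_S c open_contains_ball by blast
 define \<delta> where "\<delta> = Min (insert \<delta>0 (\<delta>' ` R))"
 have "\<delta> > 0" unfolding \<delta>_def using R(1) \<delta>0 Y by (subst Min_gr_iff) auto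
 have le: "\<delta> \<le> \<delta>' y" if "y \<in> R" for y unfolding \<delta>_def using R(1) that by (intro Min_le) auto
 have "\<delta> \<le> \<delta>0" unfolding \<delta>_def using R(1) by (intro Min_le) auto
 show ?thesis
  unfolding root_sheets_def
 proof (intro exI[of _ \<delta>] exI[of _ Y] conjI ballI)
  show "\<delta> > 0" by fact
  show "ball c \<delta> \<subseteq> S" using \<open>\<delta> \<le> \<delta>0\<close> \<delta>0(2) by (meson subset_ball order_trans)
  show "Y y c = y" if "y \<in> R" for y using Y that by blast
  show "continuous_on (ball c \<delta>) (Y y)" if "y \<in> R" for y
   using Y[OF that] le[OF that] continuous_on_subset subset_ball by meson
  show "poly (p s) (Y y s) = 0" "poly (pderiv (p s)) (Y y s) ~= 0" "dist (Y y s) y < \<epsilon>"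
   if "y \<in> R" "s \<in> ball c \<delta>" for y s
   using Y[OF that(1)] le[OF that(1)] that(2) by auto
  show "inj_on (%y. Y y s) R" if s: "s \<in> ball c \<delta>" for s
  proof (rule inj_onI, rule ccontr)
   fix y y' assume y: "y \<in> R" "y' \<in> R" "Y y s = Y y' s" "y ~= y'"
   have "dist (Y y s) y < e y / 2" "dist (Y y' s) y' < e y' / 2"
    using Y[OF y(1)] Y[OF y(2)] le[OF y(1)] le[OF y(2)] s by auto
   moreover have "e y \<le> dist y y'" "e y' \<le> dist y y'"
    using e(2)[of y y'] e(2)[of y' y] y by (auto simp: dist_commute)
   ultimately show False using dist_triangle2[of y y' "Y y s"] y(3) by (simp add: dist_commute)
  qed
 qed
qed

end

lemma poly_family_at_s: "poly_family UNIV (at_s G) (degree G)"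
 by standard (auto simp: degree_at_s_le intro!: continuous_intros)

text \<open>The roles of the variables are exchanged for vertical tangents, where \<open>s\<close>
  is a function of \<open>y\<close> but not conversely.\<close>

lemma poly_family_at_y: "\<exists>N. poly_family UNIV (%y. poly G [:y:]) N"
proof (intro exI)
 have *: "degree (poly G [:y:]) \<le> (\<Sum>j\<le>degree G. degree (coeff G j))" for y
  unfolding poly_altdef
 proof (rule degree_sum_le)
  fix j assume "j \<in> {..degree G}"
  have "degree (coeff G j * [:y:] ^ j) \<le> degree (coeff G j) + 0"
   by (rule order_trans[OF degree_mult_le add_left_mono]) (use degree_power_le[of "[:y:]" j] in simp)
  also have "\<dots> \<le> (\<Sum>j\<le>degree G. degree (coeff G j))"
   using \<open>j \<in> _\<close> by (intro order_trans[OF _ member_le_sum]) auto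
  finally show "degree (coeff G j * [:y:] ^ j) \<le> (\<Sum>j\<le>degree G. degree (coeff G j))" .
 qed simp
 have pw: "[:y:] ^ j = [:y ^ j:]" for y :: complex and j by (induction j) auto
 show "poly_family UNIV (%y. poly G [:y:]) (\<Sum>j\<le>degree G. degree (coeff G j))"
 proof
  show "degree (poly G [:y:]) \<le> (\<Sum>j\<le>degree G. degree (coeff G j))" for y by (rule *)
  show "continuous_on UNIV (%y. coeff (poly G [:y:]) i)" for i
   by (auto simp: poly_altdef coeff_sum pw mult.commute[of _ "[:_:]"] intro!: continuous_intros)
 qed simp
qed

text \<open>The partial derivative by \<open>s\<close>; \<open>pderiv\<close> applied to the outer
  polynomial is the one by \<open>y\<close>.\<close>

definition sderiv :: "complex poly poly => complex poly poly" where
 "sderiv G = map_poly pderiv G"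

lemma poly_sderiv: "poly (sderiv G) [:y:] = pderiv (poly G [:y:])"
 by (induction G) (auto simp: sderiv_def map_poly_pCons pderiv_add pderiv_smult)

lemma poly2_DERIV_s: "((%s. poly2 G s y) has_field_derivative poly2 (sderiv G) s y) (at s)"
 unfolding poly2_def poly_sderiv by (rule poly_DERIV)

lemma poly2_DERIV_y: "(poly2 G s has_field_derivative poly2 (pderiv G) s y) (at y)"
 using poly_DERIV[of "at_s G s" y] by (simp add: poly_at_s[abs_def] flip: at_s_pderiv)

lemma root_holomorphic:
 assumes S: "open S" "continuous_on S \<xi>"
  and root: "!!s. s \<in> S ==> poly2 G s (\<xi> s) = 0" "!!s. s \<in> S ==> poly2 (pderiv G) s (\<xi> s) ~= 0"
  and s: "s \<in> S"
 shows "(\<xi> has_field_derivative - poly2 (sderiv G) s (\<xi> s) / poly2 (pderiv G) s (\<xi> s)) (at s)"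
proof -
 have "(\<xi> has_derivative (%h. - (poly2 (sderiv G) s (\<xi> s) * h) / poly (pderiv (at_s G s)) (\<xi> s))) (at s)"
 proof (rule root_has_derivative[where p = "at_s G" and N = "degree G"])
  show "((%b. poly (at_s G b) (\<xi> s)) has_derivative (*) (poly2 (sderiv G) s (\<xi> s))) (at s)"
   using poly2_DERIV_s[of G "\<xi> s" s] by (simp add: has_field_derivative_def)
  show "isCont \<xi> s" using S s by (simp add: continuous_on_eq_continuous_at)
 qed (use assms degree_at_s_le in \<open>auto simp flip: at_s_pderiv\<close>)
 moreover have "(%h. - (poly2 (sderiv G) s (\<xi> s) * h) / poly (pderiv (at_s G s)) (\<xi> s)) =
   (*) (- poly2 (sderiv G) s (\<xi> s) / poly2 (pderiv G) s (\<xi> s))"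
  by (simp add: fun_eq_iff flip: at_s_pderiv)
 ultimately show ?thesis by (simp add: has_field_derivative_def)
qed

subsection \<open>The roots of an irreducible polynomial form a connected covering\<close>

lemma holomorphic_coeff_prod:
 assumes "finite A" "!!y. y \<in> A ==> b y holomorphic_on S" "a holomorphic_on S"
 shows "(%s. coeff (\<Prod>y\<in>A. [:- b y s, a s:]) k) holomorphic_on S"
 using assms(1,2)
proof (induction A arbitrary: k rule: finite_induct)
 case empty
 then show ?case by (cases k) (auto simp: coeff_pCons)
next
 case (insert y A)
 have "coeff (\<Prod>y\<in>insert y A. [:- b y s, a s:]) k =
  - b y s * coeff (\<Prod>y\<in>A. [:- b y s, a s:]) k +
  (case k of 0 => 0 | Suc k' => a s * coeff (\<Prod>y\<in>A. [:- b y s, a s:]) k')" for s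
  using insert.hyps by (simp add: coeff_pCons split: nat.split)
 moreover have "(%s. - b y s * coeff (\<Prod>y\<in>A. [:- b y s, a s:]) k +
  (case k of 0 => 0 | Suc k' => a s * coeff (\<Prod>y\<in>A. [:- b y s, a s:]) k')) holomorphic_on S"
  using insert.IH insert.prems assms(3) by (cases k) (auto intro!: holomorphic_intros)
 ultimately show ?case by simp
qed

lemma coeff_prod_bound:
 fixes a K and b :: "complex => complex"
 assumes "finite A" "!!y. y \<in> A ==> norm (b y) \<le> K" "norm a \<le> K"
 shows "norm (coeff (\<Prod>y\<in>A. [:- b y, a:]) k) \<le> (2 * K) ^ card A"
 using assms(1,2)
proof (induction A arbitrary: k rule: finite_induct)
 case empty
 then show ?case by (cases k) (auto simp: coeff_pCons)
next
 case (insert y A)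
 have K: "0 \<le> K" using assms(3) norm_ge_zero order_trans by blast
 have eq: "coeff (\<Prod>y\<in>insert y A. [:- b y, a:]) k =
  - b y * coeff (\<Prod>y\<in>A. [:- b y, a:]) k +
  (case k of 0 => 0 | Suc k' => a * coeff (\<Prod>y\<in>A. [:- b y, a:]) k')"
  using insert.hyps by (simp add: coeff_pCons split: nat.split)
 have "norm (- b y * coeff (\<Prod>y\<in>A. [:- b y, a:]) k) \<le> K * (2 * K) ^ card A"
  unfolding norm_mult using insert by (intro mult_mono) (auto simp: K)
 moreover have "norm (case k of 0 => 0 | Suc k' => a * coeff (\<Prod>y\<in>A. [:- b y, a:]) k') \<le> K * (2 * K) ^ card A"
  using insert assms(3) K by (cases k) (auto simp: norm_mult intro!: mult_mono)
 ultimately have "norm (coeff (\<Prod>y\<in>insert y A. [:- b y, a:]) k) \<le> K * (2 * K) ^ card A + K * (2 * K) ^ card A"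
  unfolding eq by (intro norm_triangle_le add_mono)
 also have "\<dots> = (2 * K) ^ card (insert y A)" using insert.hyps by simp
 finally show ?case .
qed

text \<open>Cauchy's bound for roots, multiplied by the leading coefficient so that it stays finite
  where this coefficient tends to 0.\<close>

lemma root_bound:
 fixes p :: "complex poly"
 assumes "poly p y = 0" "degree p = n" "n > 0"
 shows "norm (lead_coeff p * y) \<le> (\<Sum>j\<le>n. norm (coeff p j))"
proof (cases "norm y \<le> 1")
 case True
 have "norm (lead_coeff p * y) \<le> norm (coeff p n)"
  using True assms(2) by (simp add: norm_mult mult_left_le)
 also have "\<dots> \<le> (\<Sum>j\<le>n. norm (coeff p j))" by (intro member_le_sum) auto
 finally show ?thesis .
next
 case False
 then have y: "norm y \<ge> 1" by simp
 have "0 = (\<Sum>j<n. coeff p j * y ^ j) + coeff p n * y ^ n"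
  using assms by (simp add: poly_altdef flip: lessThan_Suc_atMost)
 then have "norm (coeff p n * y ^ n) = norm (\<Sum>j<n. coeff p j * y ^ j)"
  by (metis add_eq_0_iff norm_minus_cancel)
 also have "\<dots> \<le> (\<Sum>j<n. norm (coeff p j) * norm y ^ (n - 1))"
  by (rule sum_norm_le) (use y in \<open>auto simp: norm_mult norm_power intro!: mult_left_mono power_increasing\<close>)
 also have "\<dots> \<le> (\<Sum>j\<le>n. norm (coeff p j)) * norm y ^ (n - 1)"
  unfolding sum_distrib_right[symmetric] by (intro mult_right_mono sum_mono2) auto
 finally have "norm (lead_coeff p * y) * norm y ^ (n - 1) \<le> (\<Sum>j\<le>n. norm (coeff p j)) * norm y ^ (n - 1)"
  using assms(2,3) by (cases n) (auto simp: norm_mult norm_power mult_ac)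
 moreover have "0 < norm y ^ (n - 1)" using y by (intro zero_less_power) linarith
 ultimately show ?thesis by (rule mult_right_le_imp_le)
qed

lemma poly_growth: "\<exists>B n. \<forall>s. 1 \<le> norm s --> norm (poly p s) \<le> B * norm (s::complex) ^ n"
proof (intro exI allI impI)
 fix s :: complex assume s: "1 \<le> norm s"
 have "norm (poly p s) \<le> (\<Sum>i\<le>degree p. norm (coeff p i) * norm s ^ degree p)"
  unfolding poly_altdef
  by (rule sum_norm_le) (use s in \<open>auto simp: norm_mult norm_power intro!: mult_left_mono power_increasing\<close>)
 then show "norm (poly p s) \<le> (\<Sum>i\<le>degree p. norm (coeff p i)) * norm s ^ degree p"
  by (simp add: sum_distrib_right)
qed

text \<open>The continuous majorant \<open>K\<close> makes the points of \<open>S0\<close> removable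
  singularities, and an entire function of polynomial growth is a polynomial by Liouville.\<close>

lemma poly_of_growth:
 assumes "finite S0" "f holomorphic_on - S0"
  and K: "continuous_on UNIV K" "!!s. s \<notin> S0 ==> norm (f s) \<le> K s"
  and growth: "!!s. 1 \<le> norm s ==> K s \<le> B * norm s ^ n"
 shows "\<exists>P. \<forall>s. s \<notin> S0 --> poly P s = (f s :: complex)"
proof -
 have "\<exists>g. g holomorphic_on UNIV & (\<forall>z\<in>UNIV - S0. g z = f z)"
 proof (rule removable_singularities)
  fix z assume "z \<in> S0"
  have "\<forall>\<^sub>F s in at z. s \<notin> S0"
   using assms(1) by (simp add: eventually_at_filter eventually_nhds islimpt_finite)
    (metis (no_types, lifting) Compl_iff Diff_iff finite_imp_closed finite_Diff open_Compl singletonI insertI1 empty_iff insert_iff)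
  moreover have "\<forall>\<^sub>F s in at z. K s < K z + 1"
   using K(1) by (intro order_tendstoD(2)[of K "K z"]) (auto simp: continuous_on_def)
  ultimately have "\<forall>\<^sub>F s in at z. norm (f s) \<le> (K z + 1) * norm (1::real)"
   by eventually_elim (use K(2) in fastforce)
  then show "f \<in> O[at z](%_. 1)" by (intro landau_o.bigI[of "max 1 (K z + 1)"]) (auto elim: eventually_mono)
 qed (use assms in \<open>auto simp: Compl_eq_Diff_UNIV\<close>)
 then obtain g where g: "g holomorphic_on UNIV" "!!z. z \<notin> S0 ==> g z = f z" by auto
 obtain A where A: "!!s. s \<in> S0 ==> norm s < A"
  using finite_imp_bounded[OF assms(1)] by (metis bounded_pos le_less_trans less_add_one)
 have "norm (g s) \<le> B * norm s ^ n" if "max A 1 \<le> norm s" for s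
  using g(2)[of s] K(2)[of s] growth[of s] A[of s] that by fastforce
 from Liouville_polynomial[OF g(1) this]
 have L: "g s = (\<Sum>k\<le>n. (deriv ^^ k) g 0 / fact k * s ^ k)" for s by blast
 show ?thesis
  by (rule exI[of _ "\<Sum>k\<le>n. monom ((deriv ^^ k) g 0 / fact k) k"])
   (simp add: poly_sum poly_monom L flip: g(2))
qed

text \<open>A full number of distinct roots off \<open>S0\<close> says at once that the leading
  coefficient does not vanish there and that all roots are simple.\<close>

locale irreducible_covering =
 fixes G :: "complex poly poly" and S0 :: "complex set"
 assumes irr: "irred G" and fin: "finite S0" and deg: "degree G > 0"
  and card_roots: "!!s. s \<notin> S0 ==> card {y. poly2 G s y = 0} = degree G"
begin

definition "roots s = {y. poly2 G s y = 0}"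
definition "W = {(s, y). s \<notin> S0 & poly2 G s y = 0}"

sublocale poly_family UNIV "at_s G" "degree G" by (rule poly_family_at_s)

lemma at_s_nonzero: "s \<notin> S0 ==> at_s G s ~= 0"
 using card_roots[of s] deg infinite_UNIV_char_0[where 'a = complex] by (auto simp flip: poly_at_s)

lemma degree_at_s: "s \<notin> S0 ==> degree (at_s G s) = degree G"
 using card_poly_roots_bound[OF at_s_nonzero, of s] card_roots[of s] degree_at_s_le[of G s]
 by simp

lemma simple_root: "s \<notin> S0 ==> poly2 G s y = 0 ==> poly2 (pderiv G) s y ~= 0"
 using card_roots_le_of_double[OF at_s_nonzero, of s y] card_roots[of s] degree_at_s[of s]
 by (auto simp flip: at_s_pderiv poly_at_s)

lemma finite_roots: "s \<notin> S0 ==> finite (roots s)"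
 using poly_roots_finite[OF at_s_nonzero, of s] by (simp add: roots_def)

text \<open>A trivialization of the covering by roots over a disc.\<close>

definition sheet_system :: "complex => real => (complex => complex => complex) => bool" where
 "sheet_system c \<delta> Y \<longleftrightarrow> \<delta> > 0 & ball c \<delta> \<subseteq> - S0 &
  (\<forall>y\<in>roots c. Y y c = y & Y y holomorphic_on ball c \<delta>) &
  (\<forall>s\<in>ball c \<delta>. (\<forall>y\<in>roots c. poly2 G s (Y y s) = 0) & inj_on (%y. Y y s) (roots c) &
   roots s = (%y. Y y s) ` roots c)"

lemma ex_sheet_system:
 assumes c: "c \<notin> S0"
 shows "\<exists>\<delta> Y. sheet_system c \<delta> Y"
proof -
 have R: "!!y. y \<in> roots c ==> poly (at_s G c) y = 0 & poly (pderiv (at_s G c)) y ~= 0"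
  using simple_root[OF c] by (auto simp: roots_def simp flip: at_s_pderiv)
 obtain \<delta>1 where \<delta>1: "\<delta>1 > 0" "ball c \<delta>1 \<subseteq> - S0"
  using c fin by (metis ComplI finite_imp_closed open_Compl open_contains_ball)
 obtain \<delta>2 Y where Y0: "root_sheets c (roots c) 1 \<delta>2 Y"
  using ex_root_sheets[OF UNIV_I finite_roots[OF c] R zero_less_one] by blast
 then have Y: "\<delta>2 > 0" "!!y. y \<in> roots c ==> Y y c = y"
  "!!y. y \<in> roots c ==> continuous_on (ball c \<delta>2) (Y y)"
  "!!y s. y \<in> roots c ==> s \<in> ball c \<delta>2 ==> poly2 G s (Y y s) = 0 & poly2 (pderiv G) s (Y y s) ~= 0"
  "!!s. s \<in> ball c \<delta>2 ==> inj_on (%y. Y y s) (roots c)"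
  unfolding root_sheets_def at_s_pderiv[symmetric] poly_at_s by metis+
 define \<delta> where "\<delta> = min \<delta>1 \<delta>2"
 show ?thesis
  unfolding sheet_system_def
 proof (intro exI[of _ \<delta>] exI[of _ Y] conjI ballI)
  show "\<delta> > 0" using \<delta>1 Y by (simp add: \<delta>_def)
  show sub: "ball c \<delta> \<subseteq> - S0" using \<delta>1 by (auto simp: \<delta>_def)
  have sub2: "ball c \<delta> \<subseteq> ball c \<delta>2" by (auto simp: \<delta>_def)
  show "Y y holomorphic_on ball c \<delta>" if "y \<in> roots c" for y
   unfolding holomorphic_on_open[OF open_ball]
   using root_holomorphic[OF open_ball Y(3)[OF that], of G] Y(4)[OF that] sub2 by blast
  show "poly2 G s (Y y s) = 0" if "y \<in> roots c" "s \<in> ball c \<delta>" for y s using Y(4) that sub2 by blast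
  show inj: "inj_on (%y. Y y s) (roots c)" if "s \<in> ball c \<delta>" for s using Y(5) that sub2 by blast
  show "roots s = (%y. Y y s) ` roots c" if s: "s \<in> ball c \<delta>" for s
  proof (rule sym, rule card_subset_eq)
   have "s \<notin> S0" using s sub by blast
   then show "finite (roots s)" by (rule finite_roots)
   show "(%y. Y y s) ` roots c \<subseteq> roots s" using Y(4) s sub2 by (auto simp: roots_def)
   show "card ((%y. Y y s) ` roots c) = card (roots s)"
    using card_image[OF inj[OF s]] card_roots[OF c] card_roots[OF \<open>s \<notin> S0\<close>] by (simp add: roots_def)
  qed
 qed (use Y in auto)
qed

lemma connected_compl: "path_connected (- S0)"
 by (rule path_connected_complement_countable) (auto simp: countable_finite fin)

text \<open>The product of the \<open>y - \<eta>\<close> over the roots \<open>\<eta>\<close> above \<open>s\<close> in one path component is, up to a power of the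
 leading coefficient, a polynomial in \<open>s\<close> by Liouville's theorem; it shares roots with \<open>G\<close> and is hence divisible by \<open>G\<close>.\<close>

theorem path_component_roots:
 assumes w1: "(s1, y1) \<in> W" and w2: "(s2, y2) \<in> W"
 shows "path_component W (s1, y1) (s2, y2)"
proof -
 \<comment> \<open>The roots over \<open>s\<close> that can be reached from the first point; they
   will turn out to be all roots.\<close>
 define A where "A s = {y. path_component W (s1, y1) (s, y)}" for s
 have A_sub: "A s \<subseteq> roots s" for s
  by (auto simp: A_def roots_def dest!: path_component_mem(2)) (auto simp: W_def)
 \<comment> \<open>A sheet over a disc is path connected, so belonging to the path component is
   constant along it.\<close>
 have sheet: "A s = (%y. Y y s) ` A c"
  if c: "c \<notin> S0" and s: "s \<in> ball c \<delta>" and ball: "ball c \<delta> \<subseteq> - S0"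
   and Y: "!!y. y \<in> roots c ==> Y y c = y" "!!y. y \<in> roots c ==> Y y holomorphic_on ball c \<delta>"
   "!!y s. y \<in> roots c ==> s \<in> ball c \<delta> ==> poly2 G s (Y y s) = 0"
   "roots s = (%y. Y y s) ` roots c" for c \<delta> s Y
 proof -
  have *: "path_component W (c, y) (s, Y y s)" if y: "y \<in> roots c" for y
  proof -
   have "path_connected ((%s. (s, Y y s)) ` ball c \<delta>)"
    by (intro path_connected_continuous_image convex_imp_path_connected convex_ball continuous_intros
      holomorphic_on_imp_continuous_on Y(2)[OF y])
   moreover have "(%s. (s, Y y s)) ` ball c \<delta> \<subseteq> W" using Y(3)[OF y] ball by (auto simp: W_def)
   moreover have "(c, y) \<in> (%s. (s, Y y s)) ` ball c \<delta>"
    using Y(1)[OF y] s by (intro image_eqI[of _ _ c]) (auto intro: le_less_trans[OF zero_le_dist])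
   ultimately show ?thesis
    using s by (meson imageI path_component_of_subset path_connected_component)
  qed
  show ?thesis
  proof (intro equalityI subsetI)
   fix z assume z: "z \<in> A s"
   then obtain y where y: "y \<in> roots c" "z = Y y s" using A_sub Y(4) by blast
   then have "y \<in> A c"
    using z *[OF y(1)] unfolding A_def by (metis mem_Collect_eq path_component_sym path_component_trans)
   then show "z \<in> (%y. Y y s) ` A c" using y by blast
  next
   fix z assume "z \<in> (%y. Y y s) ` A c"
   then obtain y where "y \<in> A c" "z = Y y s" by blast
   then show "z \<in> A s"
    using *[of y] A_sub[of c] unfolding A_def by (auto intro: path_component_trans)
  qed
 qed
 have finA: "finite (A s)" if "s \<notin> S0" for s using A_sub finite_roots[OF that] finite_subset by blast
 have "(%s. card (A s)) constant_on (- S0)"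
 proof (rule locally_constant_imp_constant)
  show "connected (- S0)" using connected_compl by (rule path_connected_imp_connected)
  fix c assume "c \<in> - S0"
  then have c: "c \<notin> S0" by simp
  obtain \<delta> Y where "sheet_system c \<delta> Y" using ex_sheet_system[OF c] by blast
  then have Y: "\<delta> > 0" "ball c \<delta> \<subseteq> - S0" "!!y. y \<in> roots c ==> Y y c = y"
   "!!y. y \<in> roots c ==> Y y holomorphic_on ball c \<delta>"
   "!!y s. y \<in> roots c ==> s \<in> ball c \<delta> ==> poly2 G s (Y y s) = 0"
   "!!s. s \<in> ball c \<delta> ==> inj_on (%y. Y y s) (roots c)"
   "!!s. s \<in> ball c \<delta> ==> roots s = (%y. Y y s) ` roots c"
   unfolding sheet_system_def by blast+
  have "card (A s) = card (A c)" if s: "s \<in> ball c \<delta>" for s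
  proof -
   have "A s = (%y. Y y s) ` A c" by (rule sheet[OF c s Y(2-5) Y(7)[OF s]])
   then show ?thesis using card_image[OF inj_on_subset[OF Y(6)[OF s] A_sub]] by simp
  qed
  moreover have "openin (top_of_set (- S0)) (ball c \<delta>)"
   using Y(2) by (simp add: open_subset)
  ultimately show "\<exists>T. openin (top_of_set (- S0)) T & c \<in> T & (\<forall>x\<in>T. card (A x) = card (A c))"
   using Y(1) by (metis centre_in_ball)
 qed
 then obtain m where m: "!!s. s \<notin> S0 ==> card (A s) = m" unfolding constant_on_def by auto
 have s1: "s1 \<notin> S0" and s2: "s2 \<notin> S0" using w1 w2 by (auto simp: W_def)
 have "y1 \<in> A s1" using w1 by (simp add: A_def path_component_refl)
 then have "m > 0" using m[OF s1] finA[OF s1] by (auto simp: card_gt_0_iff)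
 define a where "a = lead_coeff G"
 define K where "K s = (\<Sum>j\<le>degree G. norm (poly (coeff G j) s))" for s
 \<comment> \<open>Each linear factor is multiplied by the leading coefficient \<open>a\<close>,
   which keeps the coefficients bounded near \<open>S0\<close>, where roots may escape to
   infinity.\<close>
 define Q where "Q s = (\<Prod>y\<in>A s. [:- (poly a s * y), poly a s:])" for s
 have "\<exists>P. \<forall>s. s \<notin> S0 --> poly P s = coeff (Q s) k" for k
 proof -
  have hol: "(%s. coeff (Q s) k) holomorphic_on - S0"
  proof (rule holomorphic_onI)
   fix c assume "c \<in> - S0"
   then have c: "c \<notin> S0" by simp
   obtain \<delta> Y where "sheet_system c \<delta> Y" using ex_sheet_system[OF c] by blast
   then have Y: "\<delta> > 0" "ball c \<delta> \<subseteq> - S0" "!!y. y \<in> roots c ==> Y y c = y"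
    "!!y. y \<in> roots c ==> Y y holomorphic_on ball c \<delta>"
    "!!y s. y \<in> roots c ==> s \<in> ball c \<delta> ==> poly2 G s (Y y s) = 0"
    "!!s. s \<in> ball c \<delta> ==> inj_on (%y. Y y s) (roots c)"
    "!!s. s \<in> ball c \<delta> ==> roots s = (%y. Y y s) ` roots c"
    unfolding sheet_system_def by blast+
   have Qs: "Q s = (\<Prod>y\<in>A c. [:- (poly a s * Y y s), poly a s:])" if s: "s \<in> ball c \<delta>" for s
   proof -
    have "A s = (%y. Y y s) ` A c" by (rule sheet[OF c s Y(2-5) Y(7)[OF s]])
    then show ?thesis
     unfolding Q_def by (simp add: prod.reindex inj_on_subset[OF Y(6)[OF s] A_sub])
   qed
   have "(%s. coeff (\<Prod>y\<in>A c. [:- (poly a s * Y y s), poly a s:]) k) holomorphic_on ball c \<delta>"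
    by (rule holomorphic_coeff_prod[OF finA[OF c]]) (use Y(4) A_sub in \<open>auto intro!: holomorphic_intros\<close>)
   then have "(%s. coeff (Q s) k) holomorphic_on ball c \<delta>"
    by (rule holomorphic_transform) (simp add: Qs)
   then show "(%s. coeff (Q s) k) field_differentiable at c within - S0"
    using Y(1) by (metis centre_in_ball field_differentiable_at_within holomorphic_on_imp_differentiable_at open_ball)
  qed
  have bound: "norm (coeff (Q s) k) \<le> (2 * K s) ^ m" if s: "s \<notin> S0" for s
  proof -
   have "norm (coeff (Q s) k) \<le> (2 * K s) ^ card (A s)"
    unfolding Q_def
   proof (rule coeff_prod_bound[OF finA[OF s]])
    fix y assume "y \<in> A s"
    then have "poly2 G s y = 0" using A_sub by (auto simp: roots_def)
    then show "norm (poly a s * y) \<le> K s"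
     using root_bound[of "at_s G s" y, OF _ degree_at_s[OF s] deg] by (simp add: a_def K_def degree_at_s[OF s])
   next
    show "norm (poly a s) \<le> K s" unfolding K_def a_def by (rule member_le_sum) auto
   qed
   then show ?thesis using m[OF s] by simp
  qed
  have "\<exists>B n. \<forall>s. 1 \<le> norm s --> (2 * K s) ^ m \<le> B * norm s ^ n"
  proof -
   have "\<forall>j. \<exists>B n. \<forall>s. 1 \<le> norm s --> norm (poly (coeff G j) s) \<le> B * norm s ^ n"
    using poly_growth by blast
   then obtain B n where Bn: "!!j s. 1 \<le> norm s ==> norm (poly (coeff G j) s) \<le> B j * norm s ^ n j"
    by metis
   define M where "M = (\<Sum>j\<le>degree G. n j)"
   have "K s \<le> (\<Sum>j\<le>degree G. \<bar>B j\<bar>) * norm s ^ M" if s: "1 \<le> norm s" for s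
    unfolding K_def sum_distrib_right
   proof (rule sum_mono)
    fix j assume j: "j \<in> {..degree G}"
    have "norm (poly (coeff G j) s) \<le> B j * norm s ^ n j" by (rule Bn[OF s])
    also have "\<dots> \<le> \<bar>B j\<bar> * norm s ^ M"
     using s j by (intro mult_mono power_increasing) (auto simp: M_def intro!: member_le_sum)
    finally show "norm (poly (coeff G j) s) \<le> \<bar>B j\<bar> * norm s ^ M" .
   qed
   moreover have "0 \<le> K s" for s by (auto simp: K_def intro: sum_nonneg)
   ultimately have "(2 * K s) ^ m \<le> (2 * ((\<Sum>j\<le>degree G. \<bar>B j\<bar>) * norm s ^ M)) ^ m" if "1 \<le> norm s" for s
    using that by (intro power_mono) auto
   then show ?thesis
    by (intro exI[of _ "(2 * (\<Sum>j\<le>degree G. \<bar>B j\<bar>)) ^ m"] exI[of _ "M * m"])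
     (auto simp: power_mult_distrib power_mult mult.assoc)
  qed
  then obtain B n where "!!s. 1 \<le> norm s ==> (2 * K s) ^ m \<le> B * norm s ^ n" by blast
  moreover have "continuous_on UNIV (%s. (2 * K s) ^ m)" unfolding K_def by (intro continuous_intros)
  ultimately show ?thesis using poly_of_growth[OF fin hol _ bound] by blast
 qed
 then obtain P where P: "!!k s. s \<notin> S0 ==> poly (P k) s = coeff (Q s) k" by metis
 \<comment> \<open>The polynomial in both variables whose roots over each \<open>s\<close> off
   \<open>S0\<close> are exactly \<open>A s\<close>.\<close>
 define H where "H = (\<Sum>k\<le>m. monom (P k) k)"
 have degQ: "degree (Q s) \<le> m" if "s \<notin> S0" for s
 proof -
  have "degree (Q s) \<le> (\<Sum>y\<in>A s. degree [:- (poly a s * y), poly a s:])"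
   unfolding Q_def by (rule degree_prod_sum_le[OF finA[OF that], unfolded o_def])
  also have "\<dots> \<le> (\<Sum>y\<in>A s. 1)" by (rule sum_mono) simp
  finally show ?thesis using m[OF that] by simp
 qed
 have H: "poly2 H s y = poly (Q s) y" if "s \<notin> S0" for s y
 proof -
  have "poly2 H s y = (\<Sum>k\<le>m. poly2 (monom (P k) k) s y)" by (simp add: H_def)
  also have "\<dots> = (\<Sum>k\<le>m. coeff (Q s) k * y ^ k)"
   by (rule sum.cong) (auto simp: poly2_def poly_monom P[OF that] poly_power)
  also have "\<dots> = poly (Q s) y" by (rule poly_bounded_degree[OF degQ[OF that], symmetric])
  finally show ?thesis .
 qed
 have lead: "poly a s ~= 0" if "s \<notin> S0" for s
  using degree_at_s[OF that] at_s_nonzero[OF that] by (metis a_def coeff_at_s leading_coeff_0_iff)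
 have Hroot: "poly2 H s y = 0 \<longleftrightarrow> y \<in> A s" if "s \<notin> S0" for s y
  using lead[OF that] finA[OF that] unfolding H[OF that] Q_def
  by (auto simp: poly_prod prod_zero_iff)
 \<comment> \<open>Otherwise the irreducible \<open>G\<close> shares roots with \<open>H\<close>
   over finitely many \<open>s\<close>, whereas \<open>A s\<close> is nonempty for every
   \<open>s\<close> off \<open>S0\<close>.\<close>
 have "G dvd H"
 proof (rule ccontr)
  assume "\<not> G dvd H"
  then have "finite {s. \<exists>y. poly2 G s y = 0 & poly2 H s y = 0}" by (rule finite_common_roots[OF irr])
  moreover have "- S0 \<subseteq> {s. \<exists>y. poly2 G s y = 0 & poly2 H s y = 0}"
  proof
   fix s assume "s \<in> - S0"
   then have s: "s \<notin> S0" by simp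
   then obtain y where "y \<in> A s" using m[OF s] \<open>m > 0\<close> by fastforce
   then show "s \<in> {s. \<exists>y. poly2 G s y = 0 & poly2 H s y = 0}"
    using Hroot[OF s] A_sub by (auto simp: roots_def)
  qed
  moreover have "infinite (- S0)" using fin by (simp add: Compl_eq_Diff_UNIV infinite_UNIV_char_0)
  ultimately show False using finite_subset by blast
 qed
 then obtain J where "H = G * J" by blast
 then have "y2 \<in> A s2" using w2 Hroot[OF s2, of y2] by (auto simp: W_def)
 then show ?thesis by (simp add: A_def)
qed

end

subsection \<open>Monodromy around a simple tangent\<close>

lemma holomorphic_coeff_at_y: "(%y. coeff (poly G [:y:]) j) holomorphic_on S"
proof -
 have pw: "[:y:] ^ i = [:y ^ i:]" for y :: complex and i by (induction i) auto
 show ?thesis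
  by (auto simp: poly_altdef coeff_sum pw mult.commute[of _ "[:_:]"] intro!: holomorphic_intros)
qed

lemma swapped_root_holomorphic:
 assumes S: "open S" "continuous_on S h"
  and root: "!!y. y \<in> S ==> poly2 G (h y) y = 0" "!!y. y \<in> S ==> poly2 (sderiv G) (h y) y ~= 0"
 shows "h holomorphic_on S"
 unfolding holomorphic_on_open[OF S(1)]
proof
 fix y assume y: "y \<in> S"
 obtain N where N: "poly_family UNIV (%y. poly G [:y:]) N" using poly_family_at_y by blast
 interpret poly_family UNIV "%y. poly G [:y:]" N by fact
 have "(h has_derivative (%k. - (poly2 (pderiv G) (h y) y * k) / poly (pderiv (poly G [:y:])) (h y))) (at y)"
 proof (rule root_has_derivative[where p = "%y. poly G [:y:]" and N = N])
  show "((%b. poly (poly G [:b:]) (h y)) has_derivative (*) (poly2 (pderiv G) (h y) y)) (at y)"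
   using poly2_DERIV_y[of G "h y" y] by (simp add: has_field_derivative_def flip: poly2_def)
  show "isCont h y" using S y by (simp add: continuous_on_eq_continuous_at)
  show "isCont (%b. coeff (poly G [:b:]) j) y" for j
   using cont by (simp add: continuous_on_eq_continuous_at)
 qed (use assms y degree_le in \<open>auto simp: poly2_def poly_sderiv\<close>)
 moreover have "(%k. - (poly2 (pderiv G) (h y) y * k) / poly (pderiv (poly G [:y:])) (h y)) =
   (*) (- poly2 (pderiv G) (h y) y / poly2 (sderiv G) (h y) y)"
  by (simp add: fun_eq_iff poly2_def poly_sderiv)
 ultimately show "\<exists>f'. (h has_field_derivative f') (at y)" by (auto simp: has_field_derivative_def)
qed

text \<open>One root fewer than the degree leaves room for a single coincidence, which the known
  multiple root uses up.\<close>

lemma double_root_factorization: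
 fixes p :: "complex poly"
 assumes p: "p ~= 0" "card {y. poly p y = 0} = degree p - 1" and
  y0: "poly p y0 = 0" "poly (pderiv p) y0 = 0"
 shows "\<exists>q. p = [:- y0, 1:] ^ 2 * q & poly q y0 ~= 0 & degree p = degree q + 2 &
  (\<forall>y. y ~= y0 --> poly p y = 0 --> poly (pderiv p) y ~= 0)"
proof -
 obtain r where r: "p = [:- y0, 1:] * r" using y0(1) by (metis dvdE poly_eq_0_iff_dvd)
 then have "poly (pderiv p) y0 = poly r y0"
  unfolding r pderiv_mult by (simp add: pderiv_pCons del: mult_pCons_left)
 then have "poly r y0 = 0" using y0(2) by simp
 then obtain q where q: "r = [:- y0, 1:] * q" by (metis dvdE poly_eq_0_iff_dvd)
 have pq: "p = [:- y0, 1:] ^ 2 * q" unfolding r q by (simp only: power2_eq_square mult.assoc)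
 have q0: "q ~= 0" using p(1) pq by auto
 have d: "degree p = degree q + 2" unfolding pq using q0 by (subst degree_mult_eq) (auto simp: degree_power_eq)
 have "{y. poly p y = 0} = insert y0 ({y. poly q y = 0} - {y0})" unfolding pq by auto
 then have "card {y. poly p y = 0} = Suc (card ({y. poly q y = 0} - {y0}))"
  using poly_roots_finite[OF q0] by (simp only: card_insert_disjoint finite_Diff Diff_iff singletonI simp_thms)
 then have c: "card ({y. poly q y = 0} - {y0}) = degree q" using p(2) d by simp
 have le: "card {y. poly q y = 0} \<le> degree q" by (rule card_poly_roots_bound[OF q0])
 have qy0: "poly q y0 ~= 0"
 proof
  assume "poly q y0 = 0"
  then have "card ({y. poly q y = 0} - {y0}) < card {y. poly q y = 0}"
   using poly_roots_finite[OF q0] by (intro psubset_card_mono) auto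
  then show False using c le by simp
 qed
 have simple: "poly (pderiv p) y ~= 0" if y: "y ~= y0" "poly p y = 0" for y
 proof
  assume *: "poly (pderiv p) y = 0"
  have qy: "poly q y = 0" using y unfolding pq by simp
  have "poly (pderiv p) y = (y - y0)^2 * poly (pderiv q) y"
   unfolding pq pderiv_mult using qy by (simp add: algebra_simps del: mult_pCons_left)
  then have "poly (pderiv q) y = 0" using * y(1) by simp
  then have "card {y. poly q y = 0} < degree q" using card_roots_le_of_double[OF q0 qy] by simp
  moreover have "card ({y. poly q y = 0} - {y0}) \<le> card {y. poly q y = 0}"
   using poly_roots_finite[OF q0] by (intro card_mono) auto
  ultimately show False using c by simp
 qed
 show ?thesis using pq qy0 d simple by blast
qed

text \<open>Near a simple tangency the roots are \<open>\<eta> (\<plusminus> sqrt s)\<close> for a local coordinate \<open>\<eta>\<close>, because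
 \<open>s\<close> is the square of a local coordinate on the curve.\<close>

lemma simple_tangent_coordinate:
 assumes p: "at_s G 0 ~= 0" "card {y. poly2 G 0 y = 0} = degree (at_s G 0) - 1" and
  y0: "poly2 G 0 y0 = 0" "poly2 (pderiv G) 0 y0 = 0" "poly2 (sderiv G) 0 y0 ~= 0" and "e > 0"
 shows "\<exists>\<rho> \<eta>. \<rho> > 0 & continuous_on (ball 0 \<rho>) \<eta> & inj_on \<eta> (ball 0 \<rho>) &
  (\<forall>x\<in>ball 0 \<rho>. poly2 G (x\<^sup>2) (\<eta> x) = 0 & dist (\<eta> x) y0 < e)"
proof -
 obtain q where q: "at_s G 0 = [:- y0, 1:] ^ 2 * q" "poly q y0 ~= 0"
  using double_root_factorization[of "at_s G 0" y0] p y0 by (auto simp: simp flip: at_s_pderiv)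
 have G0: "poly2 G 0 y = (y - y0)^2 * poly q y" for y
  using poly_at_s[of G 0 y] unfolding q(1) by simp
 obtain N where N: "poly_family UNIV (%y. poly G [:y:]) N" using poly_family_at_y by blast
 interpret poly_family UNIV "%y. poly G [:y:]" N by fact
 \<comment> \<open>Near the tangency the curve is a graph \<open>s = h y\<close>, because the
   derivative by \<open>s\<close> does not vanish.\<close>
 have "poly (poly G [:y0:]) 0 = 0" "poly (pderiv (poly G [:y0:])) 0 ~= 0"
  using y0 by (simp_all add: poly2_def poly_sderiv)
 from root_function[OF UNIV_I this zero_less_one]
 obtain \<delta> h where h: "\<delta> > 0" "h y0 = 0" "continuous_on (ball y0 \<delta>) h"
  "\<forall>y\<in>ball y0 \<delta>. poly (poly G [:y:]) (h y) = 0 & poly (pderiv (poly G [:y:])) (h y) ~= 0"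
  by metis
 have holh: "h holomorphic_on ball y0 \<delta>"
  by (rule swapped_root_holomorphic[OF open_ball h(3)]) (use h(4) in \<open>auto simp: poly2_def poly_sderiv\<close>)
 \<comment> \<open>Comparing \<open>G\<close> at \<open>s = h y\<close> and at \<open>s = 0\<close>
   yields \<open>h y = (y - y0)^2 * k y\<close> with \<open>k y0\<close> nonzero, a zero of order
   exactly two.\<close>
 define K where "K y = diff_quot N (poly G [:y:]) (h y) 0" for y
 have Kh: "- ((y - y0)^2 * poly q y) = h y * K y" if "y \<in> ball y0 \<delta>" for y
  using diff_quot[OF degree_le, of y "h y" 0] h(4) that G0[of y] by (simp add: K_def poly2_def)
 have Ky0: "K y0 ~= 0" using y0(3) h(2) by (simp add: K_def diff_quot_diagonal degree_le poly2_def poly_sderiv)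
 have holK: "K holomorphic_on ball y0 \<delta>"
  unfolding K_def diff_quot_def by (intro holomorphic_intros holomorphic_coeff_at_y holh)
 define k where "k y = - poly q y / K y" for y
 have contK: "isCont K y0" using holK h(1) by (meson centre_in_ball holomorphic_on_imp_continuous_on continuous_on_eq_continuous_at open_ball)
 have ky0: "k y0 ~= 0" using Ky0 q(2) by (simp add: k_def)
 have "isCont k y0"
  unfolding k_def using contK Ky0 by (intro continuous_intros)
 then have "isCont (%y. Re (k y / k y0)) y0"
  unfolding isCont_def using ky0 by (intro tendsto_intros)
 then have ev: "\<forall>\<^sub>F y in at y0. 0 < Re (k y / k y0)" 
  unfolding isCont_def by (rule order_tendstoD(1)) (use ky0 in simp)
 have "\<forall>\<^sub>F y in at y0. K y ~= 0"
  using contK Ky0 unfolding isCont_def by (rule tendsto_imp_eventually_ne)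
 with ev have "\<forall>\<^sub>F y in at y0. 0 < Re (k y / k y0) & K y ~= 0" by eventually_elim simp
 then obtain \<delta>2 where \<delta>2: "\<delta>2 > 0" "!!y. y ~= y0 ==> dist y y0 < \<delta>2 ==> 0 < Re (k y / k y0) & K y ~= 0"
  unfolding eventually_at by auto
 define r where "r = Min {\<delta>, \<delta>2, e}"
 have r: "r > 0" "r \<le> \<delta>" "r \<le> \<delta>2" "r \<le> e" using h(1) \<delta>2 \<open>e > 0\<close> by (auto simp: r_def)
 have rk: "0 < Re (k y / k y0) & K y ~= 0" if "y \<in> ball y0 r" for y
  using \<delta>2(2)[of y] that r Ky0 ky0 by (cases "y = y0") (auto simp: dist_commute)
 have holk: "k holomorphic_on ball y0 r"
  unfolding k_def using rk r
  by (intro holomorphic_intros holomorphic_on_subset[OF holK]) auto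
 \<comment> \<open>A holomorphic square root of \<open>h\<close>. Dividing by \<open>k y0\<close>
   first keeps the argument of the varying root in the right half plane, away from the cut of
   \<open>csqrt\<close>.\<close>
 define v where "v y = (y - y0) * (csqrt (k y0) * csqrt (k y / k y0))" for y
 have holg: "(%y. csqrt (k y0) * csqrt (k y / k y0)) holomorphic_on ball y0 r"
  using rk ky0 by (intro holomorphic_intros holk) (fastforce simp: complex_nonpos_Reals_iff simp flip: not_less)+
 have holv: "v holomorphic_on ball y0 r"
  unfolding v_def by (intro holomorphic_intros holg)
 have v2: "(v y)\<^sup>2 = h y" if y: "y \<in> ball y0 r" for y
 proof -
  have "(v y)\<^sup>2 = (y - y0)\<^sup>2 * k y" using ky0 by (simp add: v_def power_mult_distrib)
  also have "\<dots> = h y"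
   using Kh[of y] rk[OF y] y r by (simp add: k_def field_simps)
  finally show ?thesis .
 qed
 have "(v has_field_derivative csqrt (k y0)) (at y0)"
 proof -
  obtain g' where "((%y. csqrt (k y0) * csqrt (k y / k y0)) has_field_derivative g') (at y0)"
   using holg r(1) by (meson centre_in_ball holomorphic_on_open open_ball)
  from DERIV_mult[OF DERIV_diff[OF DERIV_ident DERIV_const[of y0]] this] show ?thesis
   using ky0 by (simp add: v_def[abs_def])
 qed
 then have "deriv v y0 ~= 0" using ky0 by (simp add: DERIV_imp_deriv)
 then obtain r' where r': "r' > 0" "ball y0 r' \<subseteq> ball y0 r" "open (v ` ball y0 r')" "inj_on v (ball y0 r')"
  using has_complex_derivative_locally_invertible[OF holv _ open_ball, of y0] r(1) centre_in_ball by metis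
 have "v holomorphic_on ball y0 r'" using holv r'(2) holomorphic_on_subset by blast
 then obtain \<eta> where \<eta>: "\<eta> holomorphic_on v ` ball y0 r'" "!!y. y \<in> ball y0 r' ==> \<eta> (v y) = y"
  using holomorphic_has_inverse[OF _ open_ball r'(4)] by metis
 have "0 \<in> v ` ball y0 r'" using r'(1) by (intro image_eqI[of _ _ y0]) (auto simp: v_def)
 then obtain \<rho> where \<rho>: "\<rho> > 0" "ball 0 \<rho> \<subseteq> v ` ball y0 r'" using r'(3) open_contains_ball by blast
 have inv: "\<eta> x \<in> ball y0 r' & v (\<eta> x) = x" if x: "x \<in> ball 0 \<rho>" for x
 proof -
  obtain y where "y \<in> ball y0 r'" "x = v y" using \<rho>(2) x by blast
  then show ?thesis using \<eta>(2) by simp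
 qed
 have "poly2 G (x\<^sup>2) (\<eta> x) = 0 & dist (\<eta> x) y0 < e" if x: "x \<in> ball 0 \<rho>" for x
 proof -
  have y: "\<eta> x \<in> ball y0 r" using inv[OF x] r'(2) by blast
  then have "h (\<eta> x) = x\<^sup>2" using v2 inv[OF x] by metis
  then have "poly2 G (x\<^sup>2) (\<eta> x) = 0" using bspec[OF h(4), of "\<eta> x"] y r by (auto simp: poly2_def)
  then show ?thesis using y r by (auto simp: dist_commute)
 qed
 moreover have "inj_on \<eta> (ball 0 \<rho>)" using inv by (metis inj_onI)
 moreover have "continuous_on (ball 0 \<rho>) \<eta>"
  using \<eta>(1) \<rho>(2) by (meson continuous_on_subset holomorphic_on_imp_continuous_on)
 ultimately show ?thesis using \<rho>(1) by blast
qed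

text \<open>Going once around \<open>s = 0\<close> is a half turn of the square root
  \<open>x\<close> of \<open>s\<close>, which exchanges \<open>\<eta> x\<close> and
  \<open>\<eta> (- x)\<close>. The other roots are functions of \<open>s\<close> on a whole disc and
  come back.\<close>

lemma simple_tangent_monodromy:
 assumes d: "at_s G 0 ~= 0" "degree (at_s G 0) = degree G"
  and card: "card {y. poly2 G 0 y = 0} = degree G - 1" and
  y0: "poly2 G 0 y0 = 0" "poly2 (pderiv G) 0 y0 = 0" "poly2 (sderiv G) 0 y0 ~= 0" and e: "e > 0"
 shows "\<exists>\<epsilon>0>0. \<forall>\<epsilon>. 0 < \<epsilon> & \<epsilon> < \<epsilon>0 & at_s G (of_real \<epsilon>) ~= 0 --> (\<exists>u v. u ~= v & dist u y0 < e & dist v y0 < e &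
   poly2 G \<epsilon> u = 0 & poly2 G \<epsilon> v = 0 &
   (\<forall>w. poly2 G \<epsilon> w = 0 --> (\<exists>p. path p & p 0 = w & p 1 = swap u v w &
    (\<forall>t\<in>{0..1}. poly2 G (\<epsilon> * exp (2 * pi * \<i> * of_real t)) (p t) = 0))))"
proof -
 define R where "R = {y. poly2 G 0 y = 0} - {y0}"
 have finR0: "finite {y. poly2 G 0 y = 0}" using poly_roots_finite[OF d(1)] by simp
 have finR: "finite R" unfolding R_def using finR0 by simp
 have "card {y. poly (at_s G 0) y = 0} = degree (at_s G 0) - 1" "poly (at_s G 0) y0 = 0"
  "poly (pderiv (at_s G 0)) y0 = 0"
  using d card y0 by (simp_all flip: at_s_pderiv)
 from double_root_factorization[OF d(1) this]
 obtain q :: "complex poly" where q: "degree (at_s G 0) = degree q + 2"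
  "\<forall>y. y ~= y0 --> poly (at_s G 0) y = 0 --> poly (pderiv (at_s G 0)) y ~= 0"
  by blast
 have cardR: "card R + 2 = degree G" using card q(1) d(2) y0(1) finR0 by (simp add: R_def)
 obtain e0 where e0: "e0 > 0" "!!y. y \<in> R ==> e0 \<le> dist y0 y"
  using finite_set_avoid[OF finR, of y0] by (auto simp: R_def)
 \<comment> \<open>Half of the lower bound \<open>e0\<close> for the distance from \<open>y0\<close>
   to the other roots separates the two merging roots from the remaining sheets.\<close>
 define e1 where "e1 = min e (e0 / 2)"
 have "e1 > 0" using e e0 by (simp add: e1_def)
 obtain \<rho> \<eta> where \<eta>: "\<rho> > 0" "continuous_on (ball 0 \<rho>) \<eta>" "inj_on \<eta> (ball 0 \<rho>)"
  "!!x. x \<in> ball 0 \<rho> ==> poly2 G (x\<^sup>2) (\<eta> x) = 0 & dist (\<eta> x) y0 < e1"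
  using simple_tangent_coordinate[OF d(1) _ y0 \<open>e1 > 0\<close>] d card by auto
 interpret poly_family UNIV "at_s G" "degree G" by (rule poly_family_at_s)
 have "poly (at_s G 0) y = 0 & poly (pderiv (at_s G 0)) y ~= 0" if "y \<in> R" for y
  using q(2) that by (auto simp: R_def)
 then obtain \<delta> Y where "root_sheets 0 R (e0 / 2) \<delta> Y"
  using ex_root_sheets[OF UNIV_I finR, of 0 "e0 / 2"] e0(1) by auto
 then have Y: "\<delta> > 0" "!!y. y \<in> R ==> continuous_on (ball 0 \<delta>) (Y y)"
  "!!y s. y \<in> R ==> s \<in> ball 0 \<delta> ==> poly2 G s (Y y s) = 0 & dist (Y y s) y < e0 / 2"
  "!!s. s \<in> ball 0 \<delta> ==> inj_on (%y. Y y s) R"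
  unfolding root_sheets_def poly_at_s by blast+
 \<comment> \<open>The circle of radius \<open>\<epsilon>\<close> has to lie in the disc of the
   sheets, and the one of radius \<open>sqrt \<epsilon>\<close> in the disc of
   \<open>\<eta>\<close>.\<close>
 define \<epsilon>0 where "\<epsilon>0 = min \<delta> (\<rho>\<^sup>2)"
 show ?thesis
 proof (intro exI[of _ \<epsilon>0] conjI allI impI)
  show "\<epsilon>0 > 0" using Y \<eta> by (simp add: \<epsilon>0_def)
  fix \<epsilon> :: real assume \<epsilon>: "0 < \<epsilon> & \<epsilon> < \<epsilon>0 & at_s G (of_real \<epsilon>) ~= 0"
  define s where "s t = \<epsilon> * exp (2 * pi * \<i> * of_real t)" for t
  define x where "x t = sqrt \<epsilon> * exp (pi * \<i> * of_real t)" for t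
  have ns: "norm (s t) = \<epsilon>" for t using \<epsilon> by (simp add: s_def norm_mult)
  have nx: "norm (x t) = sqrt \<epsilon>" for t using \<epsilon> by (simp add: x_def norm_mult)
  have sb: "s t \<in> ball 0 \<delta>" for t using \<epsilon> ns by (simp add: \<epsilon>0_def)
  have "sqrt \<epsilon> < \<rho>" using \<epsilon> \<eta>(1) real_sqrt_less_mono[of \<epsilon> "\<rho>\<^sup>2"] by (simp add: \<epsilon>0_def)
  then have xb: "x t \<in> ball 0 \<rho>" "- x t \<in> ball 0 \<rho>" for t using nx by auto
  have x2: "(x t)\<^sup>2 = s t" for t
  proof -
   have "complex_of_real (sqrt \<epsilon>) * complex_of_real (sqrt \<epsilon>) = \<epsilon>"
    using \<epsilon> by (simp flip: of_real_mult)
   then show ?thesis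
    by (simp add: x_def s_def power2_eq_square mult_exp_exp algebra_simps flip: exp_add)
  qed
  have s01: "s 0 = \<epsilon>" "s 1 = \<epsilon>" by (simp_all add: s_def)
  have x01: "x 1 = - x 0" by (simp add: x_def)
  have x0: "x 0 ~= - x 0"
  proof
   assume "x 0 = - x 0"
   then have "norm (x 0) = 0" by (metis add.right_inverse add_eq_0_iff mult_2 mult_eq_0_iff norm_zero zero_neq_numeral)
   then show False using \<epsilon> nx by simp
  qed
  have contx: "continuous_on UNIV x" and conts: "continuous_on UNIV s"
   unfolding x_def s_def by (intro continuous_intros)+
  define u v where "u = \<eta> (x 0)" and "v = \<eta> (- x 0)"
  have uv: "u ~= v" using \<eta>(3) xb x0 unfolding u_def v_def by (meson inj_onD)
  have du: "dist u y0 < e1" "dist v y0 < e1" using \<eta>(4) xb by (auto simp: u_def v_def)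
  have root: "poly2 G \<epsilon> u = 0" "poly2 G \<epsilon> v = 0"
   using \<eta>(4)[OF xb(1), of 0] \<eta>(4)[OF xb(2), of 0] x2[of 0] s01 by (auto simp: u_def v_def)
  define R' where "R' = (%y. Y y \<epsilon>) ` R"
  have R': "w ~= u & w ~= v & poly2 G \<epsilon> w = 0" if "w \<in> R'" for w
  proof -
   obtain y where y: "y \<in> R" "w = Y y \<epsilon>" using \<open>w \<in> R'\<close> by (auto simp: R'_def)
   have a: "dist w y < e0 / 2" "poly2 G \<epsilon> w = 0" using Y(3)[OF y(1) sb, of 0] y s01 by auto
   have "dist w y0 \<ge> e0 / 2" using e0(2)[OF y(1)] a(1) dist_triangle2[of y0 y w] by (simp add: dist_commute)
   then show ?thesis using du a by (auto simp: e1_def)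
  qed
  \<comment> \<open>These are two plus \<open>degree G - 2\<close> distinct roots, as many as the
    degree permits.\<close>
  have "{u, v} \<union> R' = {y. poly2 G \<epsilon> y = 0}"
  proof (rule card_subset_eq)
   show fin: "finite {y. poly2 G \<epsilon> y = 0}" using \<epsilon> poly_roots_finite[of "at_s G (of_real \<epsilon>)"] by simp
   show sub: "{u, v} \<union> R' \<subseteq> {y. poly2 G \<epsilon> y = 0}" using root R' by auto
   have "card R' = card R" unfolding R'_def using Y(4)[OF sb, of 0] s01 by (intro card_image) simp
   moreover have "card ({u, v} \<union> R') = card {u, v} + card R'"
    using R' finR by (intro card_Un_disjoint) (auto simp: R'_def)
   ultimately have "card ({u, v} \<union> R') = degree G" using cardR uv by simp
   moreover have "card {y. poly2 G \<epsilon> y = 0} \<le> degree G"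
    using card_poly_roots_bound[of "at_s G (of_real \<epsilon>)"] degree_at_s_le[of G "of_real \<epsilon>"] \<epsilon> by simp
   moreover have "card ({u, v} \<union> R') \<le> card {y. poly2 G \<epsilon> y = 0}" by (rule card_mono[OF fin sub])
   ultimately show "card ({u, v} \<union> R') = card {y. poly2 G \<epsilon> y = 0}" by simp
  qed
  moreover have "\<exists>p. path p & p 0 = w & p 1 = swap u v w &
    (\<forall>t\<in>{0..1}. poly2 G (s t) (p t) = 0)" if "w \<in> {u, v} \<union> R'" for w
   using that
  proof (elim UnE insertE emptyE)
   assume w: "w = u"
   have "path (%t. \<eta> (x t))"
    unfolding path_def by (rule continuous_on_compose2[OF \<eta>(2)])
     (use xb contx in \<open>auto intro: continuous_on_subset\<close>)
   moreover have "poly2 G (s t) (\<eta> (x t)) = 0" for t using \<eta>(4)[OF xb(1), of t] x2 by simp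
   ultimately show ?thesis using w x01 by (intro exI[of _ "%t. \<eta> (x t)"]) (auto simp: u_def v_def)
  next
   assume w: "w = v"
   have "path (%t. \<eta> (- x t))"
    unfolding path_def by (rule continuous_on_compose2[OF \<eta>(2)])
     (use xb contx in \<open>auto intro!: continuous_intros intro: continuous_on_subset\<close>)
   moreover have "poly2 G (s t) (\<eta> (- x t)) = 0" for t using \<eta>(4)[OF xb(2), of t] x2 by simp
   ultimately show ?thesis using w x01 by (intro exI[of _ "%t. \<eta> (- x t)"]) (auto simp: u_def v_def)
  next
   assume w: "w \<in> R'"
   then obtain y where y: "y \<in> R" "w = Y y \<epsilon>" by (auto simp: R'_def)
   have "path (%t. Y y (s t))"
    unfolding path_def by (rule continuous_on_compose2[OF Y(2)[OF y(1)]])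
     (use sb conts in \<open>auto intro: continuous_on_subset\<close>)
   moreover have "poly2 G (s t) (Y y (s t)) = 0" for t using Y(3)[OF y(1) sb] by simp
   moreover have "swap u v w = w" using R'[OF w] by (simp add: transpose_apply_other)
   ultimately show ?thesis using s01 y by (intro exI[of _ "%t. Y y (s t)"]) auto
  qed
  ultimately show "\<exists>u v. u ~= v & dist u y0 < e & dist v y0 < e &
   poly2 G \<epsilon> u = 0 & poly2 G \<epsilon> v = 0 &
   (\<forall>w. poly2 G \<epsilon> w = 0 --> (\<exists>p. path p & p 0 = w & p 1 = swap u v w &
    (\<forall>t\<in>{0..1}. poly2 G (\<epsilon> * exp (2 * pi * \<i> * of_real t)) (p t) = 0)))"
   using uv du root unfolding s_def by (intro exI[of _ u] exI[of _ v]) (auto simp: e1_def)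
 qed
qed

subsection \<open>Existence of simple tangents\<close>

text \<open>Otherwise each point of \<open>L\<close> would be isolated by a basis set of its own,
  and a basis can be chosen countable.\<close>

lemma uncountable_imp_limit_point:
 fixes L :: "'a::second_countable_topology set"
 assumes "uncountable L"
 shows "\<exists>x\<in>L. x islimpt L"
proof (rule ccontr)
 assume "\<not> ?thesis"
 then have no: "!!x. x \<in> L ==> \<exists>T. x \<in> T & open T & (\<forall>y\<in>L. y \<in> T --> y = x)"
  unfolding islimpt_def by metis
 obtain \<B> :: "'a set set" where \<B>: "countable \<B>" "topological_basis \<B>" using ex_countable_basis by blast
 have "\<exists>B\<in>\<B>. x \<in> B & (\<forall>y\<in>L. y \<in> B --> y = x)" if "x \<in> L" for x
  using no[OF that] topological_basisE[OF \<B>(2)] by (metis subsetD)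
 then obtain F where F: "!!x. x \<in> L ==> F x \<in> \<B> & x \<in> F x & (\<forall>y\<in>L. y \<in> F x --> y = x)" by metis
 have "inj_on F L" by (rule inj_onI) (metis F)
 moreover have "F ` L \<subseteq> \<B>" using F by blast
 ultimately show False using assms \<B>(1) by (meson countable_image_inj_on countable_subset)
qed

lemma sderiv_pCons: "sderiv (pCons c G) = pCons (pderiv c) (sderiv G)"
 by (simp add: sderiv_def map_poly_pCons)

lemma poly2_chain:
 assumes "(a has_field_derivative a') (at z)" "(b has_field_derivative b') (at z)"
 shows "((%z. poly2 G (a z) (b z)) has_field_derivative
  poly2 (sderiv G) (a z) (b z) * a' + poly2 (pderiv G) (a z) (b z) * b') (at z)"
proof (induction G)
 case 0
 then show ?case by (simp add: sderiv_def)
next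
 case (pCons c G)
 have "((%z. poly c (a z)) has_field_derivative poly (pderiv c) (a z) * a') (at z)"
  using DERIV_chain[OF poly_DERIV assms(1)] by (simp add: o_def)
 from DERIV_add[OF this DERIV_mult[OF assms(2) pCons.IH]]
 show ?case
  unfolding poly2_simps sderiv_pCons pderiv_pCons by (rule DERIV_cong) (simp add: algebra_simps)
qed

text \<open>Substituting a linear polynomial for \<open>y\<close> restricts \<open>G\<close> to a
  line that is not vertical; tangency becomes a multiple root in one variable.\<close>

lemma poly2_on_line: "poly (poly G [:\<beta>, \<alpha>:]) s = poly2 G s (\<alpha> * s + \<beta>)"
 by (induction G) (auto simp: algebra_simps)

lemma pderiv_on_line:
 "pderiv (poly G [:\<beta>, \<alpha>:]) = poly (sderiv G + smult [:\<alpha>:] (pderiv G)) [:\<beta>, \<alpha>:]"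
proof -
 have "poly (pderiv (poly G [:\<beta>, \<alpha>:])) s = poly (poly (sderiv G + smult [:\<alpha>:] (pderiv G)) [:\<beta>, \<alpha>:]) s" for s
 proof (rule DERIV_unique[OF poly_DERIV])
  have "((%s. poly2 G s (\<alpha> * s + \<beta>)) has_field_derivative
    poly2 (sderiv G) s (\<alpha> * s + \<beta>) * 1 + poly2 (pderiv G) s (\<alpha> * s + \<beta>) * \<alpha>) (at s)"
   by (rule poly2_chain) (auto intro!: derivative_eq_intros)
  then show "(poly (poly G [:\<beta>, \<alpha>:]) has_field_derivative
    poly (poly (sderiv G + smult [:\<alpha>:] (pderiv G)) [:\<beta>, \<alpha>:]) s) (at s)"
   by (simp add: poly2_on_line mult.commute flip: poly2_on_line[of _ _ _, abs_def])
    (simp add: poly2_on_line[abs_def] poly2_def mult.commute)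
 qed
 then show ?thesis by (simp add: poly_eq_poly_eq_iff[symmetric] fun_eq_iff)
qed

text \<open>The second derivative makes \<open>a\<close> a double root and no more, so it costs
  exactly one root.\<close>

lemma triple_root_or_simple:
 fixes p :: "complex poly"
 assumes p: "p ~= 0" "poly p a = 0" "poly (pderiv p) a = 0" "poly (pderiv (pderiv p)) a ~= 0"
  and simple: "!!x. x ~= a ==> poly p x = 0 ==> poly (pderiv p) x ~= 0"
 shows "card {x. poly p x = 0} = degree p - 1"
proof -
 obtain r where r: "p = [:- a, 1:] * r" using p(2) by (metis dvdE poly_eq_0_iff_dvd)
 have dp: "poly (pderiv p) x = poly r x + (x - a) * poly (pderiv r) x" for x
  unfolding r pderiv_mult by (simp add: pderiv_pCons algebra_simps del: mult_pCons_left)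
 have dr: "pderiv p = r + [:- a, 1:] * pderiv r"
  unfolding r pderiv_mult by (simp add: pderiv_pCons)
 have "poly (pderiv (pderiv p)) a = 2 * poly (pderiv r) a"
  unfolding dr pderiv_add pderiv_mult by (simp add: pderiv_pCons del: mult_pCons_left)
 then have ra: "poly r a = 0" "poly (pderiv r) a ~= 0" using p(3,4) dp[of a] by auto
 have "r ~= 0" using p(1) r by auto
 have "card {x. poly r x = 0} = degree r"
 proof (rule card_roots_eq_degree[OF \<open>r ~= 0\<close>])
  fix x assume x: "poly r x = 0"
  show "poly (pderiv r) x ~= 0"
   using ra simple[of x] x dp[of x] by (cases "x = a") (auto simp: r)
 qed
 moreover have "{x. poly p x = 0} = {x. poly r x = 0}" using ra by (auto simp: r)
 moreover have "degree p = Suc (degree r)" unfolding r using \<open>r ~= 0\<close> by (subst degree_mult_eq) auto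
 ultimately show ?thesis by simp
qed

section \<open>Polynomials in one variable with holomorphic coefficients\<close>

definition holomorphic_family :: "complex set => (complex => complex poly) => bool" where
 "holomorphic_family D p \<longleftrightarrow> (\<exists>N. \<forall>c. degree (p c) \<le> N) & (\<forall>j. (%c. coeff (p c) j) holomorphic_on D)"

lemma holomorphic_family_const: "holomorphic_family D (%_. q)"
 by (auto simp: holomorphic_family_def)

lemma holomorphic_family_linear:
 "b holomorphic_on D ==> a holomorphic_on D ==> holomorphic_family D (%c. [:b c, a c:])"
 unfolding holomorphic_family_def
proof (intro conjI allI)
 show "b holomorphic_on D ==> a holomorphic_on D ==> (%c. coeff [:b c, a c:] j) holomorphic_on D" for j
  by (cases j; cases "j - 1") (auto simp: coeff_pCons)
qed (auto intro!: exI[of _ 1])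

lemma holomorphic_family_add:
 "holomorphic_family D p ==> holomorphic_family D q ==> holomorphic_family D (%c. p c + q c)"
 unfolding holomorphic_family_def by (auto intro!: holomorphic_intros) (meson degree_add_le max.coboundedI1 max.coboundedI2)

lemma holomorphic_family_mult:
 assumes "holomorphic_family D p" "holomorphic_family D q"
 shows "holomorphic_family D (%c. p c * q c)"
proof -
 obtain M N where "!!c. degree (p c) \<le> M" "!!c. degree (q c) \<le> N"
  using assms by (auto simp: holomorphic_family_def)
 then have "degree (p c * q c) \<le> M + N" for c
  by (meson add_mono degree_mult_le order_trans)
 then show ?thesis
  using assms unfolding holomorphic_family_def coeff_mult by (auto intro!: holomorphic_intros)
qed

lemma holomorphic_family_pderiv: "holomorphic_family D p ==> holomorphic_family D (%c. (pderiv ^^ k) (p c))"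
proof (induction k)
 case (Suc k)
 then obtain N where N: "!!c. degree ((pderiv ^^ k) (p c)) \<le> N" by (auto simp: holomorphic_family_def)
 have "degree ((pderiv ^^ Suc k) (p c)) \<le> N" for c
  using N[of c] degree_pderiv[of "(pderiv ^^ k) (p c)"] by simp
 then show ?case
  using Suc unfolding holomorphic_family_def by (auto simp: coeff_pderiv intro!: holomorphic_intros)
qed simp

lemma holomorphic_family_poly:
 "holomorphic_family D q ==> holomorphic_family D (%c. poly G (q c))"
proof (induction G)
 case (pCons a G)
 then show ?case
  using holomorphic_family_add[OF holomorphic_family_const holomorphic_family_mult] by simp
qed (simp add: holomorphic_family_const)

lemma holomorphic_family_eval:
 assumes "holomorphic_family D p"
 shows "(%c. poly (p c) x) holomorphic_on D"
proof -
 obtain N where N: "!!c. degree (p c) \<le> N" using assms by (auto simp: holomorphic_family_def)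
 show ?thesis
  unfolding poly_bounded_degree[OF N]
  using assms by (auto simp: holomorphic_family_def intro!: holomorphic_intros)
qed

lemma family_root_derivative:
 assumes D: "open D" "holomorphic_family D p" and c: "c \<in> D"
  and root: "poly (p c) x = 0" "poly (pderiv (p c)) x ~= 0"
 shows "\<exists>\<delta> r \<xi> \<xi>'. \<delta> > 0 & ball c \<delta> \<subseteq> D & 0 < r & \<xi> c = x & (\<xi> has_field_derivative \<xi>') (at c) &
   (\<forall>a\<in>ball c \<delta>. \<forall>y\<in>ball x r. poly (p a) y = 0 --> y = \<xi> a)"
proof -
 obtain N where N: "!!c. degree (p c) \<le> N" using D by (auto simp: holomorphic_family_def)
 have cc: "continuous_on D (%c. coeff (p c) j)" for j
  using D by (auto simp: holomorphic_family_def intro: holomorphic_on_imp_continuous_on)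
 interpret poly_family D p N by standard (use D N cc in auto)
 from root_function[OF c root zero_less_one]
 obtain \<delta> r \<xi> where \<xi>: "\<delta> > 0" "ball c \<delta> \<subseteq> D" "0 < r" "\<xi> c = x" "continuous_on (ball c \<delta>) \<xi>"
  "\<forall>a\<in>ball c \<delta>. poly (p a) (\<xi> a) = 0 & (\<forall>y\<in>ball x r. poly (p a) y = 0 --> y = \<xi> a)"
  by metis
 obtain d where d: "((%b. poly (p b) x) has_field_derivative d) (at c)"
  using holomorphic_family_eval[OF D(2), of x] D(1) c by (meson holomorphic_on_open)
 have "(\<xi> has_derivative (%h. - (d * h) / poly (pderiv (p c)) (\<xi> c))) (at c)"
 proof (rule root_has_derivative[where p = p and N = N and S = "ball c \<delta>"])
  show "((%b. poly (p b) (\<xi> c)) has_derivative (*) d) (at c)"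
   using d \<xi>(4) by (simp add: has_field_derivative_def)
  show "isCont (%b. coeff (p b) j) c" for j using cc D(1) c by (simp add: continuous_on_eq_continuous_at)
  show "isCont \<xi> c" using \<xi>(1,5) by (simp add: continuous_on_eq_continuous_at)
 qed (use \<xi> N root in auto)
 moreover have "(%h. - (d * h) / poly (pderiv (p c)) (\<xi> c)) = (*) (- d / poly (pderiv (p c)) (\<xi> c))"
  by (simp add: fun_eq_iff)
 ultimately have "(\<xi> has_field_derivative (- d / poly (pderiv (p c)) (\<xi> c))) (at c)"
  by (simp add: has_field_derivative_def)
 with \<xi> show ?thesis by blast
qed

text \<open>The derivative is the limit of difference quotients, which are 0 at these zeros.\<close>

lemma deriv_zero_at_limit_of_zeros:
 fixes e :: "complex => complex"
 assumes "(e has_field_derivative e') (at c)" "e c = 0" "c islimpt {a. e a = 0}"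
 shows "e' = 0"
proof (rule ccontr)
 assume "e' ~= 0"
 have "((%a. (e a - e c) / (a - c)) \<longlongrightarrow> e') (at c)" using assms(1) by (simp add: has_field_derivative_iff)
 then have "\<forall>\<^sub>F a in at c. (e a - e c) / (a - c) ~= 0" using \<open>e' ~= 0\<close> by (rule tendsto_imp_eventually_ne)
 then obtain d where "d > 0" "!!a. a ~= c ==> dist a c < d ==> e a ~= 0"
  unfolding eventually_at using assms(2) by auto
 then show False using assms(3) unfolding islimpt_approachable by blast
qed

text \<open>The multiplicity minus one is such an \<open>m\<close>. A multiple root cannot be
  followed by the implicit function theorem, but as a simple root of the \<open>m\<close>-th
  derivative it can.\<close>

lemma poly_order_exists:
 fixes p :: "complex poly"
 assumes "p ~= 0" "poly p x = 0" "poly (pderiv p) x = 0"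
 shows "\<exists>m. poly ((pderiv ^^ m) p) x = 0 & poly (pderiv ((pderiv ^^ m) p)) x ~= 0"
proof (rule ccontr)
 assume no: "\<not> ?thesis"
 have z: "poly ((pderiv ^^ m) p) x = 0" for m
  by (induction m) (use no assms in auto)
 have "degree ((pderiv ^^ m) p) = degree p - m & ((pderiv ^^ m) p ~= 0)" if "m \<le> degree p" for m
  using that
 proof (induction m)
  case (Suc m)
  then have "degree ((pderiv ^^ m) p) > 0" by simp
  then show ?case using Suc by (simp add: degree_pderiv pderiv_eq_0_iff)
 qed (use assms in simp)
 from this[of "degree p"] have "degree ((pderiv ^^ degree p) p) = 0" "(pderiv ^^ degree p) p ~= 0" by auto
 then obtain c where "(pderiv ^^ degree p) p = [:c:]" "c ~= 0" by (metis degree_eq_zeroE pCons_0_0)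
 then show False using z[of "degree p"] by simp
qed

text \<open>If the tangents at uncountably many points of a branch touch the curve at a second point, differentiating the
 equation of the curve along these second points at a limit point shows that one of them is exceptional.\<close>

lemma ex_simple_tangent:
 fixes G G1 G' :: "complex poly poly" and lc :: "complex poly"
 assumes fac: "G = G1 * G'" and irr: "irred G1" and deg1: "degree G1 \<ge> 2"
  and fin: "finite S0" and card_roots: "!!s. s \<notin> S0 ==> card {y. poly2 G s y = 0} = degree G"
  and nz: "!!s. at_s G s ~= 0" and lc: "lc ~= 0"
  and degT: "!!\<alpha> \<beta>. degree (poly G [:\<beta>, \<alpha>:]) \<le> d"
  and lcT: "!!\<alpha> \<beta>. coeff (poly G [:\<beta>, \<alpha>:]) d = poly lc \<alpha>"
 shows "\<exists>s \<alpha> \<beta>. poly2 G1 s (\<alpha> * s + \<beta>) = 0 & poly2 (pderiv G) s (\<alpha> * s + \<beta>) ~= 0 &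
  poly (pderiv (poly G [:\<beta>, \<alpha>:])) s = 0 & poly lc \<alpha> ~= 0 &
  card {x. poly (poly G [:\<beta>, \<alpha>:]) x = 0} = d - 1"
proof (rule ccontr)
 assume contr: "\<not> ?thesis"
 have G0: "G ~= 0" using nz[of 0] by (auto simp: at_s_def)
 have "degree G1 \<le> degree G" using G0 unfolding fac by (intro dvd_imp_degree_le) auto
 have simple: "poly2 (pderiv G) s y ~= 0" if s: "s \<notin> S0" "poly2 G s y = 0" for s y
 proof
  assume "poly2 (pderiv G) s y = 0"
  then have "card {y. poly (at_s G s) y = 0} < degree (at_s G s)"
   using s by (intro card_roots_le_of_double[OF nz, of s y]) (auto simp flip: at_s_pderiv)
  then show False using card_roots[OF s(1)] degree_at_s_le[of G s] by simp
 qed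
 obtain s1 where s1: "s1 \<notin> S0" using fin infinite_UNIV_char_0[where 'a = complex] by (metis ex_new_if_finite)
 have "degree (at_s G s1) = degree G"
  using card_poly_roots_bound[OF nz, of s1] card_roots[OF s1] degree_at_s_le[of G s1] by simp
 then have "poly (lead_coeff G) s1 ~= 0" using nz[of s1] by (metis coeff_at_s leading_coeff_0_iff)
 then have "coeff (at_s G1 s1) (degree G1) ~= 0" by (simp add: fac lead_coeff_mult)
 then have "degree (at_s G1 s1) > 0" using deg1 le_degree[of "at_s G1 s1" "degree G1"] by simp
 then obtain y1 where y1: "poly2 G1 s1 y1 = 0" using alg_closed_imp_poly_has_root[of "at_s G1 s1"] by auto
 have G1simple: "poly2 (pderiv G1) s y ~= 0" if "s \<notin> S0" "poly2 G1 s y = 0" for s y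
  using simple[of s y] that by (auto simp: fac pderiv_mult)
 interpret poly_family "- S0" "at_s G1" "degree G1"
  by standard (use fin in \<open>auto simp: degree_at_s_le finite_imp_closed intro!: continuous_intros\<close>)
 have "poly (at_s G1 s1) y1 = 0" "poly (pderiv (at_s G1 s1)) y1 ~= 0"
  using y1 G1simple[OF s1] by (auto simp flip: at_s_pderiv)
 \<comment> \<open>A local branch \<open>y = g s\<close> of the component; the tangents considered
   below touch it.\<close>
 from root_function[OF _ this zero_less_one] s1
 obtain \<delta> g where g: "\<delta> > 0" "ball s1 \<delta> \<subseteq> - S0" "continuous_on (ball s1 \<delta>) g"
  "\<forall>s\<in>ball s1 \<delta>. poly (at_s G1 s) (g s) = 0 & poly (pderiv (at_s G1 s)) (g s) ~= 0"
  by (metis ComplI)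
 define D0 where "D0 = ball s1 \<delta>"
 have gG: "poly2 G1 s (g s) = 0" "poly2 G s (g s) = 0" "poly2 (pderiv G) s (g s) ~= 0" if "s \<in> D0" for s
  using g(4) g(2) simple[of s "g s"] that by (auto simp: D0_def fac simp flip: at_s_pderiv)
 have holg: "g holomorphic_on D0"
  unfolding D0_def holomorphic_on_open[OF open_ball]
 proof
  fix s assume "s \<in> ball s1 \<delta>"
  then show "\<exists>f'. (g has_field_derivative f') (at s)"
   using root_holomorphic[OF open_ball g(3), of G1 s] g(4) unfolding at_s_pderiv[symmetric] poly_at_s by blast
 qed
 define g' where "g' = deriv g"
 define g'' where "g'' = deriv g'"
 have oD0: "open D0" by (simp add: D0_def)
 have holg': "g' holomorphic_on D0" unfolding g'_def by (rule holomorphic_deriv[OF holg oD0])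
 have holg'': "g'' holomorphic_on D0" unfolding g''_def by (rule holomorphic_deriv[OF holg' oD0])
 have dg: "(g has_field_derivative g' s) (at s)" if "s \<in> D0" for s
  unfolding g'_def using holg oD0 that by (rule holomorphic_derivI)
 have dg': "(g' has_field_derivative g'' s) (at s)" if "s \<in> D0" for s
  unfolding g''_def using holg' oD0 that by (rule holomorphic_derivI)
 \<comment> \<open>Otherwise the branch is a piece of a line, and the irreducible \<open>G1\<close>
   would be its linear equation, against \<open>degree G1 \<ge> 2\<close>.\<close>
 have "\<exists>c\<in>D0. g'' c ~= 0"
 proof (rule ccontr)
  assume "\<not> ?thesis"
  then have "!!s. s \<in> D0 ==> (g' has_field_derivative 0) (at s within D0)"
   using dg' has_field_derivative_at_within by fastforce
  then have "\<exists>\<alpha>. \<forall>s\<in>D0. g' s = \<alpha>"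
   using has_field_derivative_zero_constant[of D0 g'] by (simp add: D0_def)
  then obtain \<alpha> where \<alpha>: "!!s. s \<in> D0 ==> g' s = \<alpha>" by blast
  have "((%s. g s - \<alpha> * s) has_field_derivative 0) (at s within D0)" if "s \<in> D0" for s
   by (rule has_field_derivative_at_within) (use dg[OF that] \<alpha>[OF that] in \<open>auto intro!: derivative_eq_intros\<close>)
  then have "\<exists>\<beta>. \<forall>s\<in>D0. g s - \<alpha> * s = \<beta>"
   using has_field_derivative_zero_constant[of D0 "%s. g s - \<alpha> * s"] by (simp add: D0_def)
  then obtain \<beta> where \<beta>: "!!s. s \<in> D0 ==> g s = \<alpha> * s + \<beta>" by (metis add.commute diff_add_cancel)
  have "D0 \<subseteq> {s. poly (poly G1 [:\<beta>, \<alpha>:]) s = 0}"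
   using gG(1) \<beta> by (auto simp: poly2_on_line)
  moreover have "infinite D0"
   using g(1) by (metis D0_def finite_imp_not_open centre_in_ball empty_iff open_ball)
  ultimately have "poly G1 [:\<beta>, \<alpha>:] = 0" using poly_roots_finite finite_subset by blast
  then obtain H where H: "G1 = [:- [:\<beta>, \<alpha>:], 1:] * H" by (metis dvdE poly_eq_0_iff_dvd)
  then have "[:- [:\<beta>, \<alpha>:], 1:] dvd 1 \<or> H dvd 1" using irr by (simp add: Factorial_Ring.irreducible_def)
  moreover have "\<not> [:- [:\<beta>, \<alpha>:], 1:] dvd 1" by (auto simp: is_unit_poly_iff)
  ultimately obtain h where "H = [:h:]" by (auto simp: is_unit_poly_iff)
  then have "degree G1 \<le> 1" unfolding H by (auto intro: order_trans[OF degree_mult_le])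
  then show False using deg1 by simp
 qed
 then obtain c0 where c0: "c0 \<in> D0" "g'' c0 ~= 0" by blast
 have "\<forall>\<^sub>F s in nhds c0. g'' s ~= 0 & s \<in> D0"
 proof (rule eventually_conj)
  have "isCont g'' c0" using holg'' oD0 c0(1)
   by (metis continuous_on_eq_continuous_at holomorphic_on_imp_continuous_on)
  then show "\<forall>\<^sub>F s in nhds c0. g'' s ~= 0"
   using c0(2) by (intro tendsto_imp_eventually_ne[of g'' "g'' c0"]) (auto simp: isCont_def tendsto_at_iff_tendsto_nhds[of g''])
  show "\<forall>\<^sub>F s in nhds c0. s \<in> D0" using oD0 c0(1) by (auto simp: eventually_nhds)
 qed
 then obtain \<rho> where \<rho>: "\<rho> > 0" "!!s. dist s c0 < \<rho> ==> g'' s ~= 0 & s \<in> D0"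
  unfolding eventually_nhds_metric by blast
 \<comment> \<open>\<open>D\<close> is a disc without zeros of \<open>g''\<close>. Inside it, the
   compact \<open>K\<close> makes sets of zeros finite and is still uncountable.\<close>
 define D where "D = ball c0 (\<rho> / 2)"
 define K where "K = cball c0 (\<rho> / 4)"
 have D: "open D" "connected D" "compact K" "K \<subseteq> D" using \<rho>(1) by (auto simp: D_def K_def)
 have DD: "g'' s ~= 0" "s \<in> D0" if "s \<in> D" for s using \<rho> that by (auto simp: D_def dist_commute)
 have finite_zeros: "finite {z\<in>K. e z = 0}"
  if "!!z. z \<in> D ==> (e has_field_derivative e' z) (at z)" "!!z. z \<in> D ==> e' z ~= 0" for e e'
 proof (rule holomorphic_compact_finite_zeros[OF _ D])
  show "e holomorphic_on D" using that(1) D(1) holomorphic_on_open by blast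
  show "\<not> e constant_on D"
  proof
   assume "e constant_on D"
   then obtain k where k: "!!z. z \<in> D ==> e z = k" by (auto simp: constant_on_def)
   have c: "c0 \<in> D" using \<rho>(1) by (simp add: D_def)
   have "(e has_field_derivative 0) (at c0)"
    by (rule has_field_derivative_transform_within_open[OF DERIV_const D(1) c]) (simp add: k)
   then show False using that[OF c] DERIV_unique by blast
  qed
 qed
 \<comment> \<open>\<open>T c\<close> is the restriction of \<open>G\<close> to the tangent at the
   point over \<open>c\<close>, and \<open>\<tau> c x\<close> is the height of that tangent over
   \<open>x\<close>.\<close>
 define T where "T c = poly G [:g c - g' c * c, g' c:]" for c
 define \<tau> where "\<tau> c x = g c + g' c * (x - c)" for c x
 have Teval: "poly (T c) x = poly2 G x (\<tau> c x)" for c x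
  by (simp add: T_def \<tau>_def poly2_on_line algebra_simps)
 have Tderiv: "poly (pderiv (T c)) x = poly2 (sderiv G) x (\<tau> c x) + g' c * poly2 (pderiv G) x (\<tau> c x)" for c x
  by (simp add: T_def pderiv_on_line \<tau>_def poly2_on_line algebra_simps)
 have tang: "poly2 (sderiv G) c (g c) + poly2 (pderiv G) c (g c) * g' c = 0" if c: "c \<in> D0" for c
 proof (rule DERIV_unique)
  show "((%z. poly2 G z (g z)) has_field_derivative poly2 (sderiv G) c (g c) + poly2 (pderiv G) c (g c) * g' c) (at c)"
   using poly2_chain[OF DERIV_ident dg[OF c], of G] by simp
  show "((%z. poly2 G z (g z)) has_field_derivative 0) (at c)"
   by (rule has_field_derivative_transform_within_open[OF DERIV_const oD0 c]) (simp add: gG)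
 qed
 have Tc: "poly (T c) c = 0" "poly (pderiv (T c)) c = 0" if "c \<in> D0" for c
  using gG(2)[OF that] tang[OF that] by (auto simp: Teval Tderiv \<tau>_def mult.commute)
 \<comment> \<open>Differentiating the tangency relation along the branch shows that this is
   \<open>- g'' c\<close> times the derivative of \<open>G\<close> by \<open>y\<close>: the contact
   has order exactly two.\<close>
 have T2: "poly (pderiv (pderiv (T c))) c ~= 0" if c: "c \<in> D" for c
 proof -
  have c': "c \<in> D0" using DD c by blast
  have "poly2 (sderiv (sderiv G)) c (g c) + poly2 (pderiv (sderiv G)) c (g c) * g' c +
   ((poly2 (sderiv (pderiv G)) c (g c) + poly2 (pderiv (pderiv G)) c (g c) * g' c) * g' c +
    g'' c * poly2 (pderiv G) c (g c)) = 0"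
  proof (rule DERIV_unique)
   show "((%z. poly2 (sderiv G) z (g z) + poly2 (pderiv G) z (g z) * g' z) has_field_derivative
    (poly2 (sderiv (sderiv G)) c (g c) + poly2 (pderiv (sderiv G)) c (g c) * g' c +
   ((poly2 (sderiv (pderiv G)) c (g c) + poly2 (pderiv (pderiv G)) c (g c) * g' c) * g' c +
    g'' c * poly2 (pderiv G) c (g c)))) (at c)"
    using DERIV_add[OF poly2_chain[OF DERIV_ident dg[OF c'], of "sderiv G"]
      DERIV_mult[OF poly2_chain[OF DERIV_ident dg[OF c'], of "pderiv G"] dg'[OF c']]]
    by simp
   show "((%z. poly2 (sderiv G) z (g z) + poly2 (pderiv G) z (g z) * g' z) has_field_derivative 0) (at c)"
    by (rule has_field_derivative_transform_within_open[OF DERIV_const oD0 c']) (simp add: tang)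
  qed
  moreover have "poly (pderiv (pderiv (T c))) c =
    poly2 (sderiv (sderiv G)) c (g c) + g' c * poly2 (pderiv (sderiv G)) c (g c) +
    g' c * (poly2 (sderiv (pderiv G)) c (g c) + g' c * poly2 (pderiv (pderiv G)) c (g c))"
  proof -
   have s_add: "sderiv (A + smult [:\<alpha>:] B) = sderiv A + smult [:\<alpha>:] (sderiv B)" for A B \<alpha>
    unfolding sderiv_def by (rule poly_eqI) (simp add: coeff_map_poly pderiv_add pderiv_smult)
   show ?thesis
    by (simp add: T_def pderiv_on_line poly2_on_line s_add pderiv_add pderiv_smult algebra_simps)
  qed
  ultimately have "poly (pderiv (pderiv (T c))) c = - (g'' c * poly2 (pderiv G) c (g c))"
   by (simp add: algebra_simps add_eq_0_iff2)
  then show ?thesis using DD[OF c] gG(3)[OF c'] by simp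
 qed
 \<comment> \<open>All points of the curve at which the derivative by \<open>y\<close> vanishes are
   among these.\<close>
 define Sing where "Sing = {(x, y). x \<in> S0 & poly2 G x y = 0}"
 have finSing: "finite Sing"
 proof -
  have "finite (SIGMA x:S0. {y. poly (at_s G x) y = 0})"
   using fin poly_roots_finite[OF nz] by (intro finite_SigmaI) auto
  then show ?thesis by (rule finite_subset[rotated]) (auto simp: Sing_def)
 qed
 \<comment> \<open>Parameters at which the degree of \<open>T c\<close> drops (\<open>bad1\<close>)
   or whose tangent passes through a point of \<open>Sing\<close> (\<open>bad2\<close>).\<close>
 define bad1 where "bad1 = (\<Union>\<alpha>\<in>{\<alpha>. poly lc \<alpha> = 0}. {c\<in>K. g' c - \<alpha> = 0})"
 define bad2 where "bad2 = (\<Union>(x,y)\<in>Sing. {c\<in>K. \<tau> c x - y = 0})"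
 \<comment> \<open>The tangent turns about its point of contact: for \<open>c\<close> in
   \<open>D\<close> its height over any \<open>x\<close> different from \<open>c\<close> changes at
   a nonzero rate.\<close>
 have dtau: "((%c. \<tau> c x - y) has_field_derivative g'' c * (x - c)) (at c)" if "c \<in> D0" for c x y
  unfolding \<tau>_def using dg[OF that] dg'[OF that] by (auto intro!: derivative_eq_intros simp: algebra_simps)
 have "finite bad1"
  unfolding bad1_def
 proof (intro finite_UN_I)
  show "finite {\<alpha>. poly lc \<alpha> = 0}" using lc by (rule poly_roots_finite)
  show "finite {c\<in>K. g' c - \<alpha> = 0}" for \<alpha>
   by (rule finite_zeros[of "%c. g' c - \<alpha>" g'']) (use dg' DD in \<open>auto intro!: derivative_eq_intros\<close>)
 qed
 have "finite bad2"
  unfolding bad2_def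
 proof (intro finite_UN_I finSing, clarify)
  fix x y assume "(x, y) \<in> Sing"
  then have "x \<in> S0" by (simp add: Sing_def)
  then have "x \<notin> D0" using g(2) by (auto simp: D0_def)
  then have "x ~= c" if "c \<in> D" for c using DD(2) that by blast
  then show "finite {c\<in>K. \<tau> c x - y = 0}"
   by (intro finite_zeros[of "%c. \<tau> c x - y" "%c. g'' c * (x - c)"]) (use dtau DD in auto)
 qed
 \<comment> \<open>As the conclusion is assumed to fail for this tangent, it has a second multiple
   intersection \<open>x\<close>, which is a simple root of some derivative.\<close>
 have bitangent: "\<exists>x m. x ~= c & poly (T c) x = 0 & poly (pderiv (T c)) x = 0 &
   poly ((pderiv ^^ m) (T c)) x = 0 & poly (pderiv ((pderiv ^^ m) (T c))) x ~= 0"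
  if c: "c \<in> K - bad1 - bad2" for c
 proof -
  have cD: "c \<in> D" "c \<in> D0" using c D(4) DD by auto
  have lcc: "poly lc (g' c) ~= 0" using c by (auto simp: bad1_def)
  then have T0: "T c ~= 0" "degree (T c) = d"
   using lcT[of "g c - g' c * c" "g' c"] degT[of "g c - g' c * c" "g' c"] le_degree[of "T c" d]
   by (auto simp: T_def)
  have "card {x. poly (T c) x = 0} ~= d - 1"
  proof
   assume "card {x. poly (T c) x = 0} = d - 1"
   moreover have "g' c * c + (g c - g' c * c) = g c" by simp
   ultimately show False
    using contr gG[OF cD(2)] Tc(2)[OF cD(2)] lcc unfolding T_def by metis
  qed
  then obtain x where x: "x ~= c" "poly (T c) x = 0" "poly (pderiv (T c)) x = 0"
   using triple_root_or_simple[OF T0(1) Tc[OF cD(2)] T2[OF cD(1)]] T0(2) by metis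
  obtain m where "poly ((pderiv ^^ m) (T c)) x = 0 & poly (pderiv ((pderiv ^^ m) (T c))) x ~= 0"
   using poly_order_exists[OF T0(1) x(2,3)] by blast
  with x show ?thesis by blast
 qed
 \<comment> \<open>Sorting by \<open>m\<close> gives countably many classes, so one of them is
   uncountable and contains a limit point of itself.\<close>
 define L where "L m = {(c, x). c \<in> K - bad1 - bad2 & x ~= c & poly (T c) x = 0 & poly (pderiv (T c)) x = 0 &
   poly ((pderiv ^^ m) (T c)) x = 0 & poly (pderiv ((pderiv ^^ m) (T c))) x ~= 0}" for m
 have "uncountable K" unfolding K_def by (rule uncountable_cball) (use \<rho>(1) in simp)
 then have unc: "uncountable (K - bad1 - bad2)"
  using \<open>finite bad1\<close> \<open>finite bad2\<close> by (simp add: uncountable_minus_countable countable_finite)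
 have "K - bad1 - bad2 \<subseteq> (\<Union>m. fst ` L m)"
 proof
  fix c assume c: "c \<in> K - bad1 - bad2"
  obtain x m where "(c, x) \<in> L m" using bitangent[OF c] c unfolding L_def by blast
  then show "c \<in> (\<Union>m. fst ` L m)" by force
 qed
 then have "\<exists>m. uncountable (L m)"
  using unc countable_subset[of "K - bad1 - bad2" "\<Union>m. fst ` L m"] by auto
 then obtain m where "uncountable (L m)" by blast
 then obtain c x where cx: "(c, x) \<in> L m" and lim: "(c, x) islimpt L m"
  using uncountable_imp_limit_point by (metis surj_pair)
 have c: "c \<in> K" "c \<in> D" "c \<in> D0" "c \<notin> bad2" and x: "x ~= c" "poly (T c) x = 0" "poly (pderiv (T c)) x = 0"
  "poly ((pderiv ^^ m) (T c)) x = 0" "poly (pderiv ((pderiv ^^ m) (T c))) x ~= 0"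
  using cx D(4) DD by (auto simp: L_def)
 have fam: "holomorphic_family D0 (%c. (pderiv ^^ m) (T c))"
  unfolding T_def
  by (intro holomorphic_family_pderiv holomorphic_family_poly holomorphic_family_linear holomorphic_intros holg holg')
 obtain \<delta>' r \<xi> \<xi>' where \<xi>: "\<delta>' > 0" "ball c \<delta>' \<subseteq> D0" "0 < r" "\<xi> c = x" "(\<xi> has_field_derivative \<xi>') (at c)"
   "!!a y. a \<in> ball c \<delta>' ==> y \<in> ball x r ==> poly ((pderiv ^^ m) (T a)) y = 0 ==> y = \<xi> a"
  using family_root_derivative[OF oD0 fam c(3) x(4,5)] by blast
 \<comment> \<open>The equation of the curve along the second contact point, continued as the root
   \<open>\<xi>\<close> of the \<open>m\<close>-th derivative. It vanishes at parameters
   accumulating at \<open>c\<close>, so its derivative at \<open>c\<close> is 0.\<close>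
 define e where "e a = poly2 G (\<xi> a) (\<tau> a (\<xi> a))" for a
 have "((%a. \<tau> a (\<xi> a)) has_field_derivative (g'' c * (x - c) + g' c * \<xi>')) (at c)"
  unfolding \<tau>_def using dg[OF c(3)] dg'[OF c(3)] \<xi>(4,5) by (auto intro!: derivative_eq_intros simp: algebra_simps)
 from poly2_chain[OF \<xi>(5) this, of G]
 have de: "(e has_field_derivative (poly2 (sderiv G) x (\<tau> c x) * \<xi>' + poly2 (pderiv G) x (\<tau> c x) *
   (g'' c * (x - c) + g' c * \<xi>'))) (at c)"
  by (simp add: e_def[abs_def] \<xi>(4))
 have "c islimpt {a. e a = 0}"
  unfolding islimpt_approachable
 proof (intro allI impI)
  fix \<epsilon> :: real assume "\<epsilon> > 0"
  have Tne: "T c ~= 0" using x(5) by (induction m) auto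
  obtain r1 where r1: "r1 > 0" "!!y. poly (T c) y = 0 ==> y ~= x ==> r1 \<le> dist x y"
   using finite_set_avoid[OF poly_roots_finite[OF Tne], of x] by auto
  have "0 < Min {\<epsilon>, \<delta>', r, r1}" using \<open>\<epsilon> > 0\<close> \<xi>(1,3) r1(1) by simp
  then have "\<exists>z\<in>L m. z ~= (c, x) & dist z (c, x) < Min {\<epsilon>, \<delta>', r, r1}"
   using lim unfolding islimpt_approachable by blast
  then obtain a y where ay: "(a, y) \<in> L m" "(a, y) ~= (c, x)" "dist (a, y) (c, x) < Min {\<epsilon>, \<delta>', r, r1}"
   by (metis surj_pair)
  then have d: "dist a c < \<epsilon>" "dist a c < \<delta>'" "dist y x < r" "dist y x < r1"
   using dist_fst_le[of "(a,y)" "(c,x)"] dist_snd_le[of "(a,y)" "(c,x)"] by auto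
  have "a ~= c"
  proof
   assume "a = c"
   then have "y ~= x" "poly (T c) y = 0" using ay by (auto simp: L_def)
   then show False using r1(2) d(4) by (force simp: dist_commute)
  qed
  moreover have "y = \<xi> a" using \<xi>(6)[of a y] ay(1) d by (auto simp: L_def dist_commute)
  then have "e a = 0" using ay(1) by (auto simp: e_def L_def Teval)
  ultimately show "\<exists>x'\<in>{a. e a = 0}. x' ~= c & dist x' c < \<epsilon>" using d by blast
 qed
 moreover have "e c = 0" using x(2) by (simp add: e_def \<xi>(4) Teval)
 ultimately have "poly2 (sderiv G) x (\<tau> c x) * \<xi>' + poly2 (pderiv G) x (\<tau> c x) * (g'' c * (x - c) + g' c * \<xi>') = 0"
  using deriv_zero_at_limit_of_zeros[OF de] by blast
 \<comment> \<open>The unknown speed \<open>\<xi>'\<close> is multiplied by the derivative of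
   \<open>T c\<close> at a multiple root and drops out.\<close>
 then have "poly (pderiv (T c)) x * \<xi>' + poly2 (pderiv G) x (\<tau> c x) * (g'' c * (x - c)) = 0"
  by (simp add: Tderiv algebra_simps)
 then have "poly2 (pderiv G) x (\<tau> c x) = 0" using x(1,3) DD(1)[OF c(2)] by simp
 then have "x \<in> S0" using simple[of x "\<tau> c x"] x(2) Teval by auto
 then have "(x, \<tau> c x) \<in> Sing" using x(2) Teval by (simp add: Sing_def)
 then have "c \<in> bad2" using c(1) unfolding bad2_def by force
 then show False using c(4) by blast
qed

section \<open>The projective plane\<close>

lemma proj_pt_eq_iff:
 assumes "v ~= 0" "w ~= 0"
 shows "proj_pt v = proj_pt w \<longleftrightarrow> (\<exists>c. c ~= 0 & w = c *s v)"
proof -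
 have "proj_pt v = proj_pt w \<longleftrightarrow> vec.span {v} = vec.span {w}"
  unfolding proj_pt_def using assms by (subst Abs_proj_plane_inject) auto
 also have "\<dots> \<longleftrightarrow> (\<exists>c. c ~= 0 & w = c *s v)"
 proof
  assume "vec.span {v} = vec.span {w}"
  then have "w \<in> vec.span {v}" by (metis insertI1 vec.span_base)
  then show "\<exists>c. c ~= 0 & w = c *s v" using assms by (auto simp: vec.span_singleton)
 next
  assume "\<exists>c. c ~= 0 & w = c *s v"
  then obtain c where "c ~= 0" "w = c *s v" by blast
  then have "k *s v = (k / c) *s w" for k by simp
  then have "range (%k. k *s v) \<subseteq> range (%k. k *s w)" by blast
  moreover have "range (%k. k *s w) \<subseteq> range (%k. k *s v)" using \<open>w = c *s v\<close> by auto
  ultimately show "vec.span {v} = vec.span {w}" by (auto simp: vec.span_singleton)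
 qed
 finally show ?thesis .
qed

lemma proj_pt_scale [simp]: "c ~= 0 ==> proj_pt (c *s v) = proj_pt v"
 by (cases "v = 0") (auto simp: proj_pt_eq_iff[of "c *s v" v] intro!: exI[of _ "inverse c"])

lemma hcoord: "hcoord P ~= 0" "proj_pt (hcoord P) = P"
proof -
 obtain v where "v ~= 0" "Rep_proj_plane P = vec.span {v}" using Rep_proj_plane[of P] by blast
 then have "v ~= 0 & proj_pt v = P" by (metis Rep_proj_plane_inverse proj_pt_def)
 then have "hcoord P ~= 0 & proj_pt (hcoord P) = P" unfolding hcoord_def by (rule someI)
 then show "hcoord P ~= 0" "proj_pt (hcoord P) = P" by auto
qed

lemma hcoord_proj_pt: "v ~= 0 ==> \<exists>c. c ~= 0 & hcoord (proj_pt v) = c *s v"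
 using proj_pt_eq_iff[of v "hcoord (proj_pt v)"] hcoord[of "proj_pt v"] by metis

lemma incident_proj_pt:
 assumes "x ~= 0" "v ~= 0"
 shows "incident (proj_pt x) (proj_pt v) \<longleftrightarrow> dot x v = 0"
proof -
 obtain a b where "a ~= 0" "hcoord (proj_pt x) = a *s x" "b ~= 0" "hcoord (proj_pt v) = b *s v"
  using hcoord_proj_pt assms by metis
 then show ?thesis unfolding incident_def dot_def[symmetric] by simp
qed

lemma curve_points_proj_pt:
 assumes "homogeneous F d" "x ~= 0"
 shows "proj_pt x \<in> curve_points F \<longleftrightarrow> peval F x = 0"
proof -
 obtain a where "a ~= 0" "hcoord (proj_pt x) = a *s x" using hcoord_proj_pt assms by metis
 then show ?thesis using peval_scale[OF assms(1)] by (simp add: curve_points_def)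
qed

text \<open>Evaluation at arbitrary homogeneous coordinates, in contrast to
  \<open>bihom_eval\<close>, whose chosen coordinates need not vary continuously.\<close>

definition beval :: "(3 + 3) cpoly => complex^3 => complex^3 => complex" where
 "beval p x v = poly_eval p (case_sum (($) x) (($) v))"

lemma beval_simps [simp]:
 "beval (p + q) x v = beval p x v + beval q x v" "beval (p * q) x v = beval p x v * beval q x v"
 "beval (p ^ n) x v = beval p x v ^ n" "beval (cconst c) x v = c" "beval 0 x v = 0" "beval 1 x v = 1"
 "beval (cvar (Inl i)) x v = x $ i" "beval (cvar (Inr i)) x v = v $ i"
 by (simp_all add: beval_def)

lemma beval_scale:
 assumes "bihomogeneous p a b"
 shows "beval p (s *s x) (t *s v) = s ^ a * t ^ b * beval p x v"
proof -
 have "case_sum (($) (s *s x)) (($) (t *s v)) = case_sum (%i. s * x $ i) (%i. t * v $ i)"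
  by (auto split: sum.split)
 then show ?thesis using bihomogeneous_scale[OF assms, of s "($) x" t "($) v"] by (simp add: beval_def)
qed

text \<open>The same scalars serve all \<open>p\<close>, so quotients of forms of equal bidegree can
  be computed in any coordinates.\<close>

lemma bihom_eval_proj_pt:
 assumes "x ~= 0" "v ~= 0"
 shows "\<exists>s t. s ~= 0 & t ~= 0 & (\<forall>p a b. bihomogeneous p a b -->
  bihom_eval p (proj_pt x, proj_pt v) = s ^ a * t ^ b * beval p x v)"
proof -
 obtain s t where "s ~= 0" "hcoord (proj_pt x) = s *s x" "t ~= 0" "hcoord (proj_pt v) = t *s v"
  using hcoord_proj_pt assms by metis
 then have "s ~= 0 & t ~= 0 & (\<forall>p a b. bihomogeneous p a b -->
  bihom_eval p (proj_pt x, proj_pt v) = s ^ a * t ^ b * beval p x v)"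
  using beval_scale by (simp add: bihom_eval_def flip: beval_def)
 then show ?thesis by blast
qed

subsection \<open>Topology\<close>

lemma open_proj_plane_iff: "open U \<longleftrightarrow> open {v. v ~= 0 & proj_pt v \<in> U}"
 by (rule open_proj_plane_def)

lemma continuous_on_proj_pt: "continuous_on (- {0}) proj_pt"
proof -
 have "open (proj_pt -` B \<inter> - {0})" if "open B" for B
 proof -
  have "proj_pt -` B \<inter> - {0} = {v. v ~= 0 & proj_pt v \<in> B}" by auto
  then show ?thesis using that by (simp add: open_proj_plane_iff)
 qed
 then show ?thesis by (subst continuous_on_open_vimage) (auto simp: open_Compl)
qed

lemma continuous_on_proj_pt_compose:
 "continuous_on S f ==> (!!x. x \<in> S ==> f x ~= 0) ==> continuous_on S (%x. proj_pt (f x))"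
 by (rule continuous_on_compose2[OF continuous_on_proj_pt]) auto

lemma tendsto_proj_pt: "(f \<longlongrightarrow> v) F ==> v ~= 0 ==> ((%n. proj_pt (f n)) \<longlongrightarrow> proj_pt v) F"
 using continuous_on_proj_pt
 by (auto simp: continuous_on_eq_continuous_at open_Compl intro: isCont_tendsto_compose)

lemma continuous_on_plane:
 assumes "open U" "continuous_on {v. v ~= 0 & proj_pt v \<in> U} (%v. h (proj_pt v))"
 shows "continuous_on U h"
proof -
 have o: "open {v. v ~= 0 & proj_pt v \<in> U}" using assms(1) by (simp add: open_proj_plane_iff)
 have "open (h -` B \<inter> U)" if "open B" for B
 proof -
  have "{v. v ~= 0 & proj_pt v \<in> h -` B \<inter> U} = (%v. h (proj_pt v)) -` B \<inter> {v. v ~= 0 & proj_pt v \<in> U}"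
   by auto
  then show ?thesis
   using assms(2) o that by (simp add: open_proj_plane_iff[of "h -` B \<inter> U"] continuous_on_open_vimage)
 qed
 then show ?thesis using assms(1) by (simp add: continuous_on_open_vimage)
qed

text \<open>The representative with \<open>i\<close>-th coordinate 1; on the chart it depends
  continuously on the point.\<close>

definition chart_coord :: "3 => proj_plane => complex^3" where
 "chart_coord i P = inverse (hcoord P $ i) *s hcoord P"

definition chart :: "3 => proj_plane set" where
 "chart i = {P. hcoord P $ i ~= 0}"

lemma chart_proj_pt: "v ~= 0 ==> proj_pt v \<in> chart i \<longleftrightarrow> v $ i ~= 0"
 using hcoord_proj_pt[of v] by (auto simp: chart_def)

lemma chart_coord_proj_pt: "v ~= 0 ==> v $ i ~= 0 ==> chart_coord i (proj_pt v) = inverse (v $ i) *s v"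
 using hcoord_proj_pt[of v] by (auto simp: chart_coord_def)

lemma chart_coord_nth: "P \<in> chart i ==> chart_coord i P $ i = 1"
 by (simp add: chart_def chart_coord_def)

lemma chart_coord_nonzero: "P \<in> chart i ==> chart_coord i P ~= 0"
 using chart_coord_nth by force

lemma proj_pt_chart_coord: "P \<in> chart i ==> proj_pt (chart_coord i P) = P"
 by (simp add: chart_def chart_coord_def hcoord)

lemma ex_chart: "\<exists>i. P \<in> chart i"
 using hcoord(1)[of P] by (auto simp: chart_def vec_eq_iff)

lemma open_chart: "open (chart i)"
proof -
 have "v ~= 0" if "v $ i ~= 0" for v :: "complex^3" using that by auto
 then have "{v. v ~= 0 & proj_pt v \<in> chart i} = {v. v $ i ~= 0}"
  using chart_proj_pt by blast
 then show ?thesis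
  by (simp add: open_proj_plane_iff) (intro open_Collect_neq continuous_intros)
qed

lemma continuous_chart_coord: "continuous_on (chart i) (chart_coord i)"
proof (rule continuous_on_plane[OF open_chart])
 have eq: "chart_coord i (proj_pt v) = (\<chi> j. v $ j / v $ i)" if "v \<in> {v. v ~= 0 & proj_pt v \<in> chart i}" for v
  using that chart_proj_pt[of v i] by (simp add: chart_coord_proj_pt vec_eq_iff divide_inverse mult.commute)
 have "continuous_on {v. v ~= 0 & proj_pt v \<in> chart i} (%v. \<chi> j. v $ j / v $ i)"
  by (intro continuous_intros) (use chart_proj_pt in auto)
 then show "continuous_on {v. v ~= 0 & proj_pt v \<in> chart i} (%v. chart_coord i (proj_pt v))"
  by (rule continuous_on_eq) (simp only: eq)
qed

lemma open_chart_vimage: "open B ==> open (chart_coord i -` B \<inter> chart i)"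
 using continuous_chart_coord[of i] by (simp add: continuous_on_open_vimage open_chart)

instance proj_plane :: t2_space
proof
 fix P Q :: proj_plane assume "P ~= Q"
 obtain i where i: "P \<in> chart i" using ex_chart by blast
 show "\<exists>U V. open U & open V & P \<in> U & Q \<in> V & U \<inter> V = {}"
 proof (cases "Q \<in> chart i")
  case True
  then have "chart_coord i P ~= chart_coord i Q" using i \<open>P ~= Q\<close> proj_pt_chart_coord by metis
  then obtain A B where AB: "open A" "open B" "chart_coord i P \<in> A" "chart_coord i Q \<in> B" "A \<inter> B = {}"
   using hausdorff[of "chart_coord i P" "chart_coord i Q"] by blast
  have "open (chart_coord i -` A \<inter> chart i)" "open (chart_coord i -` B \<inter> chart i)"
   using AB(1,2) by (simp_all add: open_chart_vimage)
  then show ?thesis using AB i True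
   by (intro exI[of _ "chart_coord i -` A \<inter> chart i"] exI[of _ "chart_coord i -` B \<inter> chart i"]) auto
 next
  case False
  obtain j where j: "Q \<in> chart j" using ex_chart by blast
  have Qi: "chart_coord j Q $ i = 0" using False by (simp add: chart_def chart_coord_def)
  \<comment> \<open>The ratio of the \<open>i\<close>-th to the \<open>j\<close>-th coordinate is 0
    at \<open>Q\<close>, while its inverse is bounded by \<open>r\<close> near \<open>P\<close>; the
    two bounds exclude each other.\<close>
  define r where "r = norm (chart_coord i P $ j) + 1"
  define A where "A = chart_coord i -` {v. norm (v $ j) < r} \<inter> chart i"
  define B where "B = chart_coord j -` {v. norm (v $ i) * r < 1} \<inter> chart j"
  have "open {v::complex^3. norm (v $ j) < r}" "open {v::complex^3. norm (v $ i) * r < 1}"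
   by (intro open_Collect_less continuous_intros)+
  then have "open A" "open B"
   unfolding A_def B_def by (simp_all only: open_chart_vimage)
  moreover have "P \<in> A" "Q \<in> B" using i j Qi by (auto simp: A_def B_def r_def)
  moreover have "A \<inter> B = {}"
  proof (rule ccontr)
   assume "A \<inter> B ~= {}"
   then obtain R where R: "R \<in> chart i" "norm (hcoord R $ j / hcoord R $ i) < r"
    "R \<in> chart j" "norm (hcoord R $ i / hcoord R $ j) * r < 1"
    by (auto simp: A_def B_def chart_coord_def divide_inverse mult.commute)
   have "0 < r" using R(2) norm_ge_zero le_less_trans by blast
   have "1 = norm (hcoord R $ i / hcoord R $ j) * norm (hcoord R $ j / hcoord R $ i)"
    using R(1,3) by (simp add: chart_def norm_divide)
   also have "\<dots> \<le> norm (hcoord R $ i / hcoord R $ j) * r"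
    using R(2) by (intro mult_left_mono) auto
   finally show False using R(4) by simp
  qed
  ultimately show ?thesis by blast
 qed
qed

lemma tendsto_chart_coord:
 "(f \<longlongrightarrow> P) F ==> P \<in> chart i ==> ((%n. chart_coord i (f n)) \<longlongrightarrow> chart_coord i P) F"
 using continuous_chart_coord[of i] open_chart[of i] isCont_tendsto_compose[of P "chart_coord i" f F]
 by (simp add: continuous_on_eq_continuous_at)

text \<open>Homogeneous coordinates can be scaled into the compact unit sphere.\<close>

lemma proj_plane_convergent_subsequence:
 fixes P :: "nat => proj_plane"
 shows "\<exists>r Q. strict_mono r & (P \<circ> r) \<longlonglongrightarrow> Q"
proof -
 define u where "u n = (inverse (norm (hcoord (P n)))) *\<^sub>R hcoord (P n)" for n
 have u: "u n \<in> sphere 0 1" "proj_pt (u n) = P n" for n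
 proof -
  have n: "norm (hcoord (P n)) > 0" using hcoord(1) by simp
  show "u n \<in> sphere 0 1" using n by (simp add: u_def)
  have "u n = complex_of_real (inverse (norm (hcoord (P n)))) *s hcoord (P n)"
  proof -
   have "u n $ j = complex_of_real (inverse (norm (hcoord (P n)))) * hcoord (P n) $ j" for j
    unfolding u_def vector_scaleR_component by (simp only: scaleR_conv_of_real)
   then show ?thesis by (simp add: vec_eq_iff)
  qed
  then show "proj_pt (u n) = P n" using n hcoord(2) by simp
 qed
 have "compact (sphere (0::complex^3) 1)" by simp
 then have "seq_compact (sphere (0::complex^3) 1)" by (simp add: compact_eq_seq_compact_metric)
 then obtain l r where l: "l \<in> sphere 0 1" "strict_mono (r :: nat => nat)" "(u \<circ> r) \<longlonglongrightarrow> l"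
  using u(1) unfolding seq_compact_def by metis
 then have "(%n. proj_pt ((u \<circ> r) n)) \<longlonglongrightarrow> proj_pt l" by (intro tendsto_proj_pt) (auto simp: o_def)
 then show ?thesis using l(2) by (auto simp: u(2) o_def)
qed

lemma tendsto_poly_eval:
 assumes "!!i. ((%n. f n i) \<longlongrightarrow> x i) F"
 shows "((%n. poly_eval p (f n)) \<longlongrightarrow> poly_eval p x) F"
 unfolding poly_eval_def by (intro tendsto_intros assms)

lemma tendsto_beval:
 "(x \<longlongrightarrow> x') F ==> (v \<longlongrightarrow> v') F ==> ((%n. beval p (x n) (v n)) \<longlongrightarrow> beval p x' v') F"
 unfolding beval_def by (rule tendsto_poly_eval) (auto split: sum.split intro: tendsto_vec_nth)

subsection \<open>Points of a curve on a line\<close>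

definition line_points :: "3 cpoly => complex^3 => proj_plane set" where
 "line_points F v = {P. P \<in> curve_points F & incident P (proj_pt v)}"

lemma line_points_eq:
 assumes "homogeneous F d" "v ~= 0"
 shows "line_points F v = proj_pt ` {x. x ~= 0 & peval F x = 0 & dot x v = 0}"
proof -
 have "P \<in> line_points F v \<longleftrightarrow> P \<in> proj_pt ` {x. x ~= 0 & peval F x = 0 & dot x v = 0}" for P
 proof
  assume "P \<in> line_points F v"
  then show "P \<in> proj_pt ` {x. x ~= 0 & peval F x = 0 & dot x v = 0}"
   using hcoord[of P] curve_points_proj_pt[OF assms(1) hcoord(1)[of P]] incident_proj_pt[OF hcoord(1)[of P] assms(2)]
   by (intro image_eqI[of _ _ "hcoord P"]) (auto simp: line_points_def)
 next
  assume "P \<in> proj_pt ` {x. x ~= 0 & peval F x = 0 & dot x v = 0}"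
  then show "P \<in> line_points F v"
   using curve_points_proj_pt[OF assms(1)] incident_proj_pt[OF _ assms(2)] by (auto simp: line_points_def)
 qed
 then show ?thesis by blast
qed

lemma line_points_scale: "c ~= 0 ==> line_points F (c *s v) = line_points F v"
 by (simp add: line_points_def)

text \<open>Exchanging the two points that span the line reverses the list of coefficients, so the
  coefficient of degree \<open>d\<close> is the value at the point \<open>w\<close> reached for
  infinite \<open>y\<close>.\<close>

lemma degree_along_line:
 assumes F: "homogeneous F d" and p: "!!y. poly p y = peval F (v + y *s w)"
 shows "degree p \<le> d" "coeff p d = peval F w"
proof -
 obtain q where q: "!!t. poly q t = peval F (w + t *s v)" using poly_along_line by metis
 have eq: "monom 1 (degree q) * p = monom 1 d * reflect_poly q"
 proof (rule ccontr)
  assume "monom 1 (degree q) * p ~= monom 1 d * reflect_poly q"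
  then have fin: "finite {y. poly (monom 1 (degree q) * p - monom 1 d * reflect_poly q) y = 0}"
   by (intro poly_roots_finite) simp
  have "poly (monom 1 (degree q) * p) y = poly (monom 1 d * reflect_poly q) y" if "y ~= 0" for y
  proof -
   have "v + y *s w = y *s (w + inverse y *s v)" using that by (simp add: vec_eq_iff algebra_simps)
   then have "poly p y = y ^ d * poly q (inverse y)" by (simp only: p q peval_scale[OF F])
   then show ?thesis using that by (simp add: poly_monom poly_reflect_poly_nz)
  qed
  then have "UNIV - {0} \<subseteq> {y. poly (monom 1 (degree q) * p - monom 1 d * reflect_poly q) y = 0}" by auto
  moreover have "infinite (UNIV - {0::complex})" by (simp add: infinite_UNIV_char_0)
  ultimately show False using fin finite_subset by blast
 qed
 have c: "coeff p j = (if d \<le> j + degree q then coeff (reflect_poly q) (j + degree q - d) else 0)" for j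
  using arg_cong[OF eq, of "%p. coeff p (j + degree q)"] by (simp add: coeff_monom_mult)
 have "coeff p j = 0" if "j > d" for j
  using that c[of j] degree_reflect_poly_le[of q] by (auto intro!: coeff_eq_0)
 then show "degree p \<le> d" by (meson degree_le)
 show "coeff p d = peval F w" using c[of d] q[of 0] by (simp add: poly_0_coeff_0 coeff_reflect_poly)
qed

context pencil begin

lemma ppoint_inj: "proj_pt (ppoint s y) = proj_pt (ppoint s y') \<longleftrightarrow> y = y'"
proof
 assume "proj_pt (ppoint s y) = proj_pt (ppoint s y')"
 then obtain c where c: "ppoint s y' = c *s ppoint s y" using proj_pt_eq_iff ppoint_nonzero by metis
 have "dot (ppoint s y') m1 = c * dot (ppoint s y) m1" "dot (ppoint s y') m2 = c * dot (ppoint s y) m2"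
  unfolding c by simp_all
 then show "y = y'" by (simp add: ppoint_def)
qed simp

lemma ppoint_ne_b2: "proj_pt (ppoint s y) ~= proj_pt b2"
proof
 assume "proj_pt (ppoint s y) = proj_pt b2"
 then obtain c where c: "c ~= 0" "b2 = c *s ppoint s y" using proj_pt_eq_iff ppoint_nonzero b2_nonzero by metis
 have "dot b2 m1 = c * dot (ppoint s y) m1" unfolding c by simp
 then show False using c(1) by (simp add: ppoint_def)
qed

lemma line_points_pline:
 assumes "homogeneous F d"
 shows "line_points F (pline s) = (%y. proj_pt (ppoint s y)) ` {y. poly2 (dehom F) s y = 0} \<union>
  (if peval F b2 = 0 then {proj_pt b2} else {})" (is "?L = ?R")
proof
 show "?L \<subseteq> ?R"
 proof
  fix P assume "P \<in> ?L"
  then obtain x where x: "x ~= 0" "peval F x = 0" "dot x (pline s) = 0" "P = proj_pt x"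
   unfolding line_points_eq[OF assms pline_nonzero] by blast
  then obtain c where "c ~= 0" "x = c *s b2 \<or> (\<exists>y. x = c *s ppoint s y)" using on_pline_cases by metis
  then show "P \<in> ?R" using x(2,4) peval_scale[OF assms] by auto
 qed
 show "?R \<subseteq> ?L"
  unfolding line_points_eq[OF assms pline_nonzero] using ppoint_nonzero b2_nonzero
  by (auto split: if_splits)
qed

text \<open>All lines of the pencil reach \<open>b2\<close> for infinite \<open>y\<close>, so the
  top coefficient does not depend on \<open>s\<close>.\<close>

lemma degree_at_s_dehom:
 assumes "homogeneous F d"
 shows "degree (at_s (dehom F) s) \<le> d" "coeff (at_s (dehom F) s) d = peval F b2"
 by (rule degree_along_line[OF assms, of _ "b1 - s *s b0"], simp add: ppoint_def)+

lemma degree_dehom_le: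
 assumes "homogeneous F d"
 shows "degree (dehom F) \<le> d"
proof (rule degree_le, intro allI impI)
 fix j assume "j > d"
 then have "coeff (at_s (dehom F) s) j = 0" for s
  using degree_at_s_dehom(1)[OF assms, of s] by (intro coeff_eq_0) simp
 then show "coeff (dehom F) j = 0" using poly_all_0_iff_0[of "coeff (dehom F) j"] by simp
qed

lemma degree_dehom_eq:
 assumes "homogeneous F d" "peval F b2 ~= 0"
 shows "degree (dehom F) = d"
proof (rule antisym[OF degree_dehom_le[OF assms(1)]])
 have "coeff (dehom F) d ~= 0"
  using degree_at_s_dehom(2)[OF assms(1), of 0] assms(2) by auto
 then show "d \<le> degree (dehom F)" by (rule le_degree)
qed

lemma card_line_points_pline:
 assumes "homogeneous F d" "finite {y. poly2 (dehom F) s y = 0}"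
 shows "card (line_points F (pline s)) = card {y. poly2 (dehom F) s y = 0} + (if peval F b2 = 0 then 1 else 0)"
proof -
 have "inj_on (%y. proj_pt (ppoint s y)) A" for A using ppoint_inj by (auto intro: inj_onI)
 moreover have "proj_pt b2 \<notin> (%y. proj_pt (ppoint s y)) ` A" for A using ppoint_ne_b2 by (metis imageE)
 ultimately show ?thesis
  unfolding line_points_pline[OF assms(1)] using assms(2) by (simp add: card_image)
qed

end

section \<open>Path lifting\<close>

text \<open>A local homeomorphism over \<open>S\<close> that separates the points of a fibre and is
  proper in the sequential sense. Paths are lifted from these properties directly, without evenly
  covered neighbourhoods.\<close>

locale lifting =
 fixes T :: "'z topology" and f :: "'z => 'b::t2_space" and S :: "'b set"
 assumes local_homeo: "!!z. z \<in> topspace T ==> f z \<in> S ==>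
   \<exists>U. openin T U & z \<in> U & open (f ` U) & homeomorphic_map (subtopology T U) (top_of_set (f ` U)) f"
  and separated: "!!z z'. z \<in> topspace T ==> z' \<in> topspace T ==> z ~= z' ==> f z = f z' ==>
   \<exists>U V. openin T U & openin T V & z \<in> U & z' \<in> V & U \<inter> V = {}"
  and proper: "!!zs l. (!!n::nat. zs n \<in> topspace T) ==> (%n. f (zs n)) \<longlonglongrightarrow> l ==>
   \<exists>r z. strict_mono r & z \<in> topspace T & f z = l & limitin T (zs \<circ> r) z sequentially"
begin

definition lift :: "'c::topological_space set => ('c => 'b) => ('c => 'z) => bool" where
 "lift J p g \<longleftrightarrow> continuous_map (top_of_set J) T g & (\<forall>t\<in>J. f (g t) = p t)"

lemma lift_subset: "lift J p g ==> J' \<subseteq> J ==> lift J' p g"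
 unfolding lift_def by (meson continuous_map_from_subtopology_mono subsetD)

lemma lift_topspace: "lift J p g ==> t \<in> J ==> g t \<in> topspace T"
 unfolding lift_def using continuous_map_image_subset_topspace[of "top_of_set J" T g] by auto

lemma lift_preimage_open:
 assumes "lift J p g" "openin T U"
 shows "openin (top_of_set J) {t \<in> J. g t \<in> U}"
 using openin_continuous_map_preimage[of "top_of_set J" T g U] assms by (simp add: lift_def)

lemma local_section:
 assumes "z \<in> topspace T" "f z \<in> S"
 shows "\<exists>U \<sigma>. openin T U & z \<in> U & open (f ` U) & continuous_map (top_of_set (f ` U)) T \<sigma> &
  (\<forall>w\<in>U. \<sigma> (f w) = w)"
proof -
 obtain U where U: "openin T U" "z \<in> U" "open (f ` U)"
  "homeomorphic_map (subtopology T U) (top_of_set (f ` U)) f"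
  using local_homeo[OF assms] by blast
 then obtain \<sigma> where "homeomorphic_maps (subtopology T U) (top_of_set (f ` U)) f \<sigma>"
  using homeomorphic_map_maps by blast
 moreover have "topspace (subtopology T U) = U" using openin_subset[OF U(1)] by auto
 ultimately have "continuous_map (top_of_set (f ` U)) T \<sigma>" "\<forall>w\<in>U. \<sigma> (f w) = w"
  by (auto simp: homeomorphic_maps_def continuous_map_in_subtopology)
 with U show ?thesis by blast
qed

text \<open>The set of agreement is open by local injectivity and closed by separation of
  fibres.\<close>

lemma lift_unique:
 assumes J: "connected J" and g: "lift J p g" and h: "lift J p h" and p: "!!t. t \<in> J ==> p t \<in> S"
  and t0: "t0 \<in> J" "g t0 = h t0" and t: "t \<in> J"
 shows "g t = h t"
proof -
 define A where "A = {t \<in> J. g t = h t}"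
 have "openin (top_of_set J) A"
 proof (subst openin_subopen, intro ballI)
  fix t assume "t \<in> A"
  then have t: "t \<in> J" "g t = h t" by (auto simp: A_def)
  obtain U \<sigma> where U: "openin T U" "g t \<in> U" "\<forall>w\<in>U. \<sigma> (f w) = w"
   using local_section[of "g t"] lift_topspace[OF g t(1)] p[OF t(1)] g t(1) by (auto simp: lift_def)
  let ?N = "{t \<in> J. g t \<in> U} \<inter> {t \<in> J. h t \<in> U}"
  have "openin (top_of_set J) ?N" using lift_preimage_open g h U(1) by (intro openin_Int)
  moreover have "t \<in> ?N" using t U by auto
  moreover have "?N \<subseteq> A" using U(3) g h unfolding A_def lift_def by (auto, metis)
  ultimately show "\<exists>N. openin (top_of_set J) N & t \<in> N & N \<subseteq> A" by blast
 qed
 moreover have "openin (top_of_set J) (J - A)"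
 proof (subst openin_subopen, intro ballI)
  fix t assume "t \<in> J - A"
  then have t: "t \<in> J" "g t ~= h t" by (auto simp: A_def)
  obtain U V where UV: "openin T U" "openin T V" "g t \<in> U" "h t \<in> V" "U \<inter> V = {}"
   using separated[of "g t" "h t"] lift_topspace g h t by (metis lift_def)
  let ?N = "{t \<in> J. g t \<in> U} \<inter> {t \<in> J. h t \<in> V}"
  have "openin (top_of_set J) ?N" using lift_preimage_open g h UV(1,2) by (intro openin_Int)
  moreover have "t \<in> ?N" "?N \<subseteq> J - A" using t UV unfolding A_def by auto
  ultimately show "\<exists>N. openin (top_of_set J) N & t \<in> N & N \<subseteq> J - A" by blast
 qed
 then have "closedin (top_of_set J) A" by (auto simp: closedin_def A_def)
 ultimately have "A = {} \<or> A = J" using J unfolding connected_clopen by blast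
 then show ?thesis using t0 t by (auto simp: A_def)
qed

lemma lift_extend:
 assumes "lift {0..a} p g" "lift {a..b} p h" "g a = h a" "0 \<le> a" "a \<le> (b::real)"
 shows "lift {0..b} p (%t. if t \<le> a then g t else h t)"
proof -
 have "continuous_map (top_of_set {0..b}) T (%t. if t \<le> a then g t else h t)"
 proof (rule continuous_map_cases_le)
  have "{0..b} \<inter> {x \<in> topspace (top_of_set {0..b}). x \<le> a} = {0..a}"
   "{0..b} \<inter> {x \<in> topspace (top_of_set {0..b}). a \<le> x} = {a..b}" using assms by auto
  then show "continuous_map (subtopology (top_of_set {0..b}) {x \<in> topspace (top_of_set {0..b}). x \<le> a}) T g"
   "continuous_map (subtopology (top_of_set {0..b}) {x \<in> topspace (top_of_set {0..b}). a \<le> x}) T h"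
   using assms(1,2) by (simp_all add: subtopology_subtopology lift_def)
 qed (use assms(3) in \<open>auto intro: continuous_map_id[unfolded id_def] continuous_map_from_subtopology\<close>)
 then show ?thesis using assms by (auto simp: lift_def)
qed

text \<open>Lifts up to times approaching the supremum \<open>b\<close> have, by properness, end
  points that accumulate at a point over \<open>p b\<close>; a local section there carries the lift
  beyond \<open>b\<close>.\<close>

lemma lift_exists:
 assumes p: "path p" "path_image p \<subseteq> S" and z: "z \<in> topspace T" "f z = p 0"
 shows "\<exists>g. lift {0..1} p g & g 0 = z"
proof -
 have pS: "p t \<in> S" if "t \<in> {0..1}" for t using p(2) that by (auto simp: path_image_def)
 define A where "A = {t \<in> {0..1}. \<exists>g. lift {0..t} p g & g 0 = z}"
 have "lift {0..0} p (%_. z)" using z by (auto simp: lift_def)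
 then have "0 \<in> A" by (auto simp: A_def)
 define b where "b = Sup A"
 have bdd: "bdd_above A" by (rule bdd_aboveI[of _ 1]) (auto simp: A_def)
 have le1: "t \<le> 1" if "t \<in> A" for t using that by (simp add: A_def)
 have b: "0 \<le> b" "b \<le> 1"
  unfolding b_def
  by (rule cSup_upper[OF \<open>0 \<in> A\<close> bdd], rule cSup_least[OF _ le1]) (use \<open>0 \<in> A\<close> in auto)
 have le_b: "t \<le> b" if "t \<in> A" for t unfolding b_def using that bdd by (rule cSup_upper)
 have "\<exists>t\<in>A. b - inverse (real (Suc n)) < t" for n
  using less_cSup_iff[of A "b - inverse (real (Suc n))"] bdd \<open>0 \<in> A\<close> by (auto simp: b_def)
 then obtain ts where ts: "!!n. ts n \<in> A" "!!n. b - inverse (real (Suc n)) < ts n" by metis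
 have "\<forall>t\<in>A. \<exists>g. lift {0..t} p g & g 0 = z" by (simp add: A_def)
 then obtain G where G: "!!t. t \<in> A ==> lift {0..t} p (G t) & G t 0 = z" by metis
 define zs where "zs n = G (ts n) (ts n)" for n
 have ts01: "ts n \<in> {0..1}" for n using ts(1) by (auto simp: A_def)
 have zs: "zs n \<in> topspace T" "f (zs n) = p (ts n)" for n
  using G[OF ts(1)[of n]] ts01[of n] lift_topspace[of "{0..ts n}" p "G (ts n)" "ts n"] by (auto simp: zs_def lift_def)
 have tsb: "ts \<longlonglongrightarrow> b"
 proof (rule tendsto_sandwich)
  show "(%n. b - inverse (real (Suc n))) \<longlonglongrightarrow> b"
   using tendsto_diff[OF tendsto_const LIMSEQ_inverse_real_of_nat] by simp
  show "\<forall>\<^sub>F n in sequentially. b - inverse (real (Suc n)) \<le> ts n"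
   using ts(2) less_imp_le by (blast intro: always_eventually)
  show "\<forall>\<^sub>F n in sequentially. ts n \<le> b" using le_b[OF ts(1)] by (simp add: always_eventually)
 qed simp
 have pcont: "continuous_on {0..1} p" using p(1) by (simp add: path_def)
 have "(%n. p (ts n)) \<longlonglongrightarrow> p b"
  by (rule continuous_on_tendsto_compose[OF pcont tsb]) (use ts01 b in auto)
 then have "(%n. f (zs n)) \<longlonglongrightarrow> p b" by (simp add: zs)
 then obtain r w where w: "strict_mono r" "w \<in> topspace T" "f w = p b" "limitin T (zs \<circ> r) w sequentially"
  using proper[of zs "p b"] zs by blast
 obtain U \<sigma> where U: "openin T U" "w \<in> U" "open (f ` U)" "continuous_map (top_of_set (f ` U)) T \<sigma>"
  "\<forall>w\<in>U. \<sigma> (f w) = w"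
  using local_section[OF w(2)] w(3) pS b by force
 have "p b \<in> f ` U" using U(2) w(3) by force
 then obtain \<delta> where \<delta>: "\<delta> > 0" "!!t. t \<in> {0..1} ==> dist t b < \<delta> ==> p t \<in> f ` U"
 proof -
  have "b \<in> {0..1}" using b by simp
  then have "\<forall>\<^sub>F t in at b within {0..1}. p t \<in> f ` U"
   using pcont U(3) \<open>p b \<in> f ` U\<close> topological_tendstoD[of p "p b" "at b within {0..1}" "f ` U"]
   unfolding continuous_on_def by blast
  then show ?thesis using that \<open>p b \<in> f ` U\<close> unfolding eventually_at by metis
 qed
 have "\<forall>\<^sub>F n in sequentially. (zs \<circ> r) n \<in> U" using w(4) U(1,2) by (auto simp: limitin_def)
 moreover have "(ts \<circ> r) \<longlonglongrightarrow> b" by (rule LIMSEQ_subseq_LIMSEQ[OF tsb w(1)])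
 then have "\<forall>\<^sub>F n in sequentially. dist ((ts \<circ> r) n) b < \<delta>" using \<delta>(1) by (rule tendstoD)
 ultimately have "\<forall>\<^sub>F n in sequentially. (zs \<circ> r) n \<in> U & dist ((ts \<circ> r) n) b < \<delta>" by eventually_elim simp
 then obtain n where n: "zs (r n) \<in> U" "dist (ts (r n)) b < \<delta>"
  using eventually_happens'[OF sequentially_bot] by (auto simp: o_def)
 define t where "t = ts (r n)"
 \<comment> \<open>A time beyond \<open>b\<close>, cut off at 1. Since \<open>e\<close> will lie in
   \<open>A\<close>, which \<open>b\<close> bounds, it must be 1.\<close>
 define e where "e = min 1 (b + \<delta> / 2)"
 have te: "0 \<le> t" "t \<le> e" "e \<le> 1" "t \<le> b" using ts01[of "r n"] le_b[OF ts(1), of "r n"] \<delta>(1) b by (auto simp: t_def e_def)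
 have pU: "p u \<in> f ` U" if "u \<in> {t..e}" for u
  using \<delta>(2)[of u] that te n(2) \<delta>(1) by (auto simp: t_def e_def dist_real_def)
 have "lift {t..e} p (%u. \<sigma> (p u))"
  unfolding lift_def
 proof (intro conjI ballI)
  have "continuous_map (top_of_set {t..e}) (top_of_set (f ` U)) p"
   using pU te by (auto intro: continuous_on_subset[OF pcont])
  from continuous_map_compose[OF this U(4)]
  show "continuous_map (top_of_set {t..e}) T (%u. \<sigma> (p u))" by (simp add: o_def)
  show "f (\<sigma> (p u)) = p u" if "u \<in> {t..e}" for u using pU[OF that] U(5) by auto
 qed
 moreover have "G t t = \<sigma> (p t)" using n(1) U(5) zs(2)[of "r n"] by (simp add: zs_def t_def) (metis)
 ultimately have "lift {0..e} p (%u. if u \<le> t then G t u else \<sigma> (p u))"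
  using G[OF ts(1), of "r n"] te by (intro lift_extend) (auto simp: t_def)
 then have "e \<in> A" using te G[OF ts(1), of "r n"] unfolding A_def by (auto simp: t_def intro!: exI)
 then have "e = 1" using le_b[of e] \<delta>(1) by (auto simp: e_def min_def split: if_splits)
 then show ?thesis using \<open>e \<in> A\<close> by (auto simp: A_def)
qed

definition fibre :: "'b => 'z set" where
 "fibre l = {z \<in> topspace T. f z = l}"

definition connects :: "(real => 'b) => 'z => 'z => bool" where
 "connects p w z \<longleftrightarrow> (\<exists>g. lift {0..1} p g & g 0 = w & g 1 = z)"

lemma connects_fibre: "connects p w z ==> w \<in> fibre (p 0) & z \<in> fibre (p 1)"
 unfolding connects_def fibre_def using lift_topspace by (fastforce simp: lift_def)

lemma connects_ex: "path p ==> path_image p \<subseteq> S ==> w \<in> fibre (p 0) ==> \<exists>z. connects p w z"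
 unfolding connects_def fibre_def using lift_exists by blast

lemma connects_unique:
 assumes "path_image p \<subseteq> S" "connects p w z" "connects p w z'"
 shows "z = z'"
proof -
 obtain g h where "lift {0..1} p g" "g 0 = w" "g 1 = z" "lift {0..1} p h" "h 0 = w" "h 1 = z'"
  using assms(2,3) unfolding connects_def by blast
 then show ?thesis
  using lift_unique[of "{0..1}" p g h 0 1] assms(1) by (auto simp: path_image_def image_subset_iff)
qed

lemma connects_reversepath:
 assumes "connects p w z"
 shows "connects (reversepath p) z w"
proof -
 obtain g where g: "lift {0..1} p g" "g 0 = w" "g 1 = z" using assms unfolding connects_def by blast
 have "continuous_map (top_of_set {0..1}) (top_of_set {0..1}) (%t::real. 1 - t)"
  by (auto intro!: continuous_intros)
 from continuous_map_compose[OF this] have "lift {0..1} (reversepath p) (%t. g (1 - t))"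
  using g(1) by (auto simp: lift_def reversepath_def o_def)
 then show ?thesis using g unfolding connects_def by (intro exI[of _ "%t. g (1 - t)"]) auto
qed

lemma connects_unique_start:
 "path_image p \<subseteq> S ==> connects p w z ==> connects p w' z ==> w = w'"
 using connects_unique[of "reversepath p" z] connects_reversepath by (metis path_image_reversepath)

lemma connects_ex_start:
 assumes "path p" "path_image p \<subseteq> S" "z \<in> fibre (p 1)"
 shows "\<exists>w. connects p w z"
proof -
 have "reversepath p 0 = p 1" by (simp add: reversepath_def)
 then obtain w where "connects (reversepath p) z w" using connects_ex[of "reversepath p" z] assms by auto
 then show ?thesis using connects_reversepath[of "reversepath p" z w] by auto
qed

lemma connects_join:
 assumes "connects p w y" "connects q y z" "path p" "path q" "p 1 = q 0"
  and S: "path_image p \<subseteq> S" "path_image q \<subseteq> S"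
 shows "connects (p +++ q) w z"
proof -
 obtain g where g: "lift {0..1} p g" "g 0 = w" "g 1 = y" using assms unfolding connects_def by blast
 obtain h where h: "lift {0..1} q h" "h 0 = y" "h 1 = z" using assms unfolding connects_def by blast
 have "continuous_map (top_of_set {0..1/2}) (top_of_set {0..1}) (%t::real. 2 * t)"
  by (auto intro!: continuous_intros)
 from continuous_map_compose[OF this] have "lift {0..1/2} (p +++ q) (%t. g (2 * t))"
  using g(1) by (auto simp: lift_def joinpaths_def o_def)
 then have L1: "lift {0..1/2} (p +++ q) (%t. g (2 * t))" .
 have "continuous_map (top_of_set {1/2..1}) (top_of_set {0..1}) (%t::real. 2 * t - 1)"
  by (auto intro!: continuous_intros)
 from continuous_map_compose[OF this, of T h]
 have "continuous_map (top_of_set {1/2..1}) T (%t. h (2 * t - 1))"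
  using h(1) by (simp add: lift_def o_def)
 moreover have "f (h (2 * t - 1)) = (p +++ q) t" if "t \<in> {1/2..1}" for t
 proof (cases "t = 1/2")
  case True
  show ?thesis unfolding True using h(1) assms(5) by (simp add: lift_def joinpaths_def)
 next
  case False
  then show ?thesis using h(1) that by (simp add: lift_def joinpaths_def)
 qed
 ultimately have "lift {1/2..1} (p +++ q) (%t. h (2 * t - 1))" by (simp add: lift_def)
 with L1 have "lift {0..1} (p +++ q) (%t. if t \<le> 1/2 then g (2 * t) else h (2 * t - 1))"
  using g h by (intro lift_extend) auto
 then show ?thesis using g h unfolding connects_def
  by (intro exI[of _ "%t. if t \<le> 1/2 then g (2 * t) else h (2 * t - 1)"]) auto
qed

lemma connects_const: "z \<in> fibre l ==> connects (%_. l) z z"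
 unfolding connects_def fibre_def lift_def by (intro exI[of _ "%_. z"]) auto

text \<open>The property \<open>Q t\<close> says that the value at \<open>t\<close> of the lifts depends continuously on the
 parameter; the set of such \<open>t\<close> is open and closed.\<close>

lemma homotopy_lift_end:
 assumes K: "continuous_on ({0..1} \<times> {0..1}) K" "K ` ({0..1} \<times> {0..1}) \<subseteq> S"
  and ends: "!!s. s \<in> {0..1} ==> K (s, 1) = l"
  and g: "!!s. s \<in> {0..1::real} ==> lift {0..1} (%t::real. K (s, t)) (g s) & g s 0 = z"
  and s: "s \<in> {0..1}"
 shows "g s 1 = g 0 1"
proof -
 have cont1: "\<exists>\<delta>>0. \<forall>s\<in>{0..1}. dist s s0 < \<delta> --> g s 1 \<in> N"
  if s0: "s0 \<in> {0..1}" and N: "openin T N" "g s0 1 \<in> N" for s0 N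
 proof -
  define Q where "Q t \<longleftrightarrow> (\<forall>N. openin T N & g s0 t \<in> N --> (\<exists>\<delta>>0. \<forall>s\<in>{0..1}. dist s s0 < \<delta> --> g s t \<in> N))" for t
  \<comment> \<open>Near \<open>(s0, t1)\<close> the lifts that meet \<open>U\<close> are given by
    one local section, so continuity in \<open>s\<close> passes from one time to any other close to
    \<open>t1\<close>.\<close>
  have loc: "\<exists>\<eta>>0. \<forall>t2\<in>{0..1}. \<forall>t\<in>{0..1}. dist t2 t1 < \<eta> --> dist t t1 < \<eta> --> Q t2 --> Q t"
   if t1: "t1 \<in> {0..1}" for t1
  proof -
   have gt: "g s0 t1 \<in> topspace T" "f (g s0 t1) = K (s0, t1)" "K (s0, t1) \<in> S"
    using lift_topspace[OF conjunct1[OF g[OF s0]] t1] g[OF s0] t1 K(2) s0 by (auto simp: lift_def)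
   obtain U \<sigma> where U: "openin T U" "g s0 t1 \<in> U" "open (f ` U)" "continuous_map (top_of_set (f ` U)) T \<sigma>"
    "\<forall>w\<in>U. \<sigma> (f w) = w"
    using local_section[OF gt(1)] gt by metis
   have "K (s0, t1) \<in> f ` U" using U(2) gt(2) by (metis imageI)
   moreover have "(s0, t1) \<in> {0..1} \<times> {0..1}" using s0 t1 by auto
   ultimately have "\<forall>\<^sub>F x in at (s0, t1) within {0..1} \<times> {0..1}. K x \<in> f ` U"
    using K(1) U(3) unfolding continuous_on_def by (blast intro: topological_tendstoD)
   then obtain \<delta> where \<delta>: "\<delta> > 0" "!!x. x \<in> {0..1} \<times> {0..1} ==> dist x (s0, t1) < \<delta> ==> K x \<in> f ` U"
    using \<open>K (s0, t1) \<in> f ` U\<close> unfolding eventually_at by metis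
   have box: "K (s, t) \<in> f ` U" if "s \<in> {0..1}" "t \<in> {0..1}" "dist s s0 < \<delta> / 2" "dist t t1 < \<delta> / 2" for s t
   proof (rule \<delta>(2))
    have "dist (s, t) (s0, t1) \<le> dist s s0 + dist t t1"
     unfolding dist_Pair_Pair by (rule sqrt_sum_squares_le_sum) auto
    then show "dist (s, t) (s0, t1) < \<delta>" using that by linarith
   qed (use that in auto)
   have "openin (top_of_set {0..1}) {t \<in> {0..1}. g s0 t \<in> U}"
    using lift_preimage_open[OF conjunct1[OF g[OF s0]] U(1)] .
   then obtain \<eta>1 where \<eta>1: "\<eta>1 > 0" "!!t. t \<in> {0..1} ==> dist t t1 < \<eta>1 ==> g s0 t \<in> U"
    using t1 U(2) unfolding openin_euclidean_subtopology_iff by blast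
   define \<eta> where "\<eta> = min (\<delta> / 2) \<eta>1"
   show ?thesis
   proof (intro exI[of _ \<eta>] conjI ballI impI)
    show "\<eta> > 0" using \<delta>(1) \<eta>1(1) by (simp add: \<eta>_def)
    fix t2 t :: real
    assume t: "t2 \<in> {0..1}" "t \<in> {0..1}" "dist t2 t1 < \<eta>" "dist t t1 < \<eta>" and Q: "Q t2"
    define J where "J = {0..1} \<inter> ball t1 \<eta>"
    have J: "connected J" unfolding J_def by (intro convex_connected convex_Int) auto
    have tJ: "t \<in> J" "t2 \<in> J" using t by (auto simp: J_def dist_commute)
    have gU: "g s t = \<sigma> (K (s, t))" if s: "s \<in> {0..1}" "dist s s0 < \<delta> / 2" "g s t2 \<in> U" for s
    proof (rule lift_unique[OF J])
     have KU: "K (s, u) \<in> f ` U" if "u \<in> J" for u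
      using box[of s u] that s by (auto simp: J_def \<eta>_def dist_commute)
     show "lift J (%t. K (s, t)) (g s)" using g[OF s(1)] by (auto simp: J_def intro: lift_subset)
     have "continuous_on J (%u. K (s, u))"
      by (rule continuous_on_compose2[OF K(1)]) (use s in \<open>auto simp: J_def intro!: continuous_intros\<close>)
     then have "continuous_map (top_of_set J) (top_of_set (f ` U)) (%u. K (s, u))" using KU by auto
     from continuous_map_compose[OF this U(4)]
     moreover have "f (\<sigma> (K (s, u))) = K (s, u)" if "u \<in> J" for u
      using KU[OF that] U(5) by force
     ultimately show "lift J (%t. K (s, t)) (%u. \<sigma> (K (s, u)))"
      by (simp add: lift_def o_def)
     show "K (s, u) \<in> S" if "u \<in> J" for u using K(2) s(1) that by (auto simp: J_def)
     show "g s t2 = \<sigma> (K (s, t2))"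
      using U(5) s(3) g[OF s(1)] t(1) by (auto simp: lift_def)
    qed (use tJ in auto)
    show "Q t"
     unfolding Q_def
    proof (intro allI impI, elim conjE)
     fix N assume N: "openin T N" "g s0 t \<in> N"
     obtain \<delta>1 where \<delta>1: "\<delta>1 > 0" "!!s. s \<in> {0..1} ==> dist s s0 < \<delta>1 ==> g s t2 \<in> U"
      using Q U(1) \<eta>1(2)[OF t(1)] t(3) unfolding Q_def \<eta>_def by (metis min_less_iff_conj)
     define M where "M = {y \<in> f ` U. \<sigma> y \<in> N}"
     have "openin (top_of_set (f ` U)) M"
      using openin_continuous_map_preimage[OF U(4) N(1)] by (simp add: M_def)
     then have M: "open M" using U(3) openin_open_trans by blast
     have Kt: "K (s0, t) \<in> M"
      using gU[OF s0] box[OF s0 t(2)] \<delta>(1) t(4) N(2) \<delta>1 s0 by (auto simp: M_def \<eta>_def)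
     have "continuous_on {0..1} (%s. K (s, t))"
      by (rule continuous_on_compose2[OF K(1)]) (use t in \<open>auto intro!: continuous_intros\<close>)
     then have "\<forall>\<^sub>F s in at s0 within {0..1}. K (s, t) \<in> M"
      using M Kt s0 topological_tendstoD[of "%s. K (s, t)" "K (s0, t)" "at s0 within {0..1}" M]
      unfolding continuous_on_def by blast
     then obtain \<delta>2 where \<delta>2: "\<delta>2 > 0" "!!s. s \<in> {0..1} ==> dist s s0 < \<delta>2 ==> K (s, t) \<in> M"
      using Kt unfolding eventually_at by metis
     show "\<exists>\<delta>>0. \<forall>s\<in>{0..1}. dist s s0 < \<delta> --> g s t \<in> N"
      using gU \<delta>1 \<delta>2 \<delta>(1)
      by (intro exI[of _ "Min {\<delta>1, \<delta>2, \<delta> / 2}"]) (auto simp: M_def)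
    qed
   qed
  qed
  define P where "P = {t \<in> {0..1}. Q t}"
  have "Q 0" using g s0 unfolding Q_def by (metis zero_less_one)
  have "\<exists>e>0. \<forall>t\<in>{0..1}. dist t t1 < e --> (Q t \<longleftrightarrow> Q t1)" if t1: "t1 \<in> {0..1}" for t1
  proof -
   obtain \<eta> where "\<eta> > 0" "\<forall>t2\<in>{0..1}. \<forall>t\<in>{0..1}. dist t2 t1 < \<eta> --> dist t t1 < \<eta> --> Q t2 --> Q t"
    using loc[OF t1] by blast
   then show ?thesis using t1 by (metis dist_self)
  qed
  then have "openin (top_of_set {0..1}) P" "openin (top_of_set {0..1}) ({0..1} - P)"
   unfolding openin_euclidean_subtopology_iff P_def by (auto, metis+)
  then have "P = {} \<or> P = {0..1}"
   using connected_clopen[of "{0..1::real}"] by (auto simp: closedin_def P_def)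
  moreover have "0 \<in> P" using \<open>Q 0\<close> by (simp add: P_def)
  ultimately have "1 \<in> P" by force
  then have "Q 1" by (simp add: P_def)
  then show ?thesis using N unfolding Q_def by blast
 qed
 have top1: "g s 1 \<in> topspace T" if "s \<in> {0..1}" for s
  using lift_topspace[OF conjunct1[OF g[OF that]], of 1] by simp
 \<comment> \<open>The end points form a lift of a constant path, and so does the constant
   \<open>g 0 1\<close>; lifts are unique.\<close>
 have "lift {0..1} (%_. l) (%s. g s 1)"
  unfolding lift_def continuous_map_def
 proof (intro conjI ballI allI impI)
  show "(%s. g s 1) \<in> topspace (top_of_set {0..1}) \<rightarrow> topspace T"
   using top1 by auto
  show "openin (top_of_set {0..1}) {s \<in> topspace (top_of_set {0..1}). g s 1 \<in> N}" if "openin T N" for N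
   unfolding openin_euclidean_subtopology_iff using cont1 that by auto
  show "f (g s 1) = l" if "s \<in> {0..1}" for s using g[OF that] ends[OF that] by (auto simp: lift_def)
 qed
 moreover have "lift {0..1} (%_. l) (%s. g 0 1)"
  using g[of 0] top1[of 0] ends[of 0] by (simp add: lift_def)
 moreover have "l \<in> S" using K(2) ends[of 0] by force
 ultimately show ?thesis
  using lift_unique[of "{0..1}" "%_. l" "%s. g s 1" "%s. g 0 1" 0 s] s by auto
qed

lemma connects_homotopic:
 assumes h: "homotopic_paths S p q" and c: "connects p w z"
 shows "connects q w z"
proof -
 obtain H :: "real \<times> real => 'b" where H0: "continuous_on ({0..1} \<times> {0..1}) H" "H \<in> ({0..1} \<times> {0..1}) \<rightarrow> S"
  "\<forall>t\<in>{0..1}. H (0, t) = p t" "\<forall>t\<in>{0..1}. H (1, t) = q t"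
  "\<forall>s\<in>{0..1}. pathstart (H \<circ> Pair s) = pathstart p & pathfinish (H \<circ> Pair s) = pathfinish p"
  using h unfolding homotopic_paths by blast
 then have H: "continuous_on ({0..1} \<times> {0..1}) H" "H ` ({0..1} \<times> {0..1}) \<subseteq> S"
  "!!t. t \<in> {0..1} ==> H (0, t) = p t" "!!t. t \<in> {0..1} ==> H (1, t) = q t"
  "!!s. s \<in> {0..1} ==> H (s, 0) = p 0" "!!s. s \<in> {0..1} ==> H (s, 1) = p 1"
  by (auto simp: pathstart_def pathfinish_def)
 have w: "w \<in> topspace T" "f w = p 0" using connects_fibre[OF c] by (auto simp: fibre_def)
 have "\<exists>g. lift {0..1} (%t. H (s, t)) g & g 0 = w" if s: "s \<in> {0..1}" for s
 proof (rule lift_exists)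
  show "path (%t. H (s, t))"
   unfolding path_def by (rule continuous_on_compose2[OF H(1)]) (use s in \<open>auto intro!: continuous_intros\<close>)
  show "path_image (%t. H (s, t)) \<subseteq> S" using H(2) s by (auto simp: path_image_def)
 qed (use w H(5)[OF s] in auto)
 then obtain g where g: "!!s. s \<in> {0..1} ==> lift {0..1} (%t. H (s, t)) (g s) & g s 0 = w" by metis
 have "connects p w (g 0 1)"
  unfolding connects_def lift_def by (rule exI[of _ "g 0"]) (use g[of 0] H(3) in \<open>auto simp: lift_def\<close>)
 then have "g 0 1 = z" using connects_unique[OF _ c] homotopic_paths_imp_subset[OF h] by blast
 moreover have "g 1 1 = g 0 1" by (rule homotopy_lift_end[OF H(1,2,6) g]) auto
 moreover have "connects q w (g 1 1)"
  unfolding connects_def lift_def by (rule exI[of _ "g 1"]) (use g[of 1] H(4) in \<open>auto simp: lift_def\<close>)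
 ultimately show ?thesis by simp
qed

end

section \<open>Generic lines\<close>

text \<open>A substitute for Zariski open sets of lines, tailored to pencils: one line of a pencil
  with the property forces it for almost all. The empty set qualifies, so existence is recorded
  separately.\<close>

definition generic :: "(complex^3 => bool) => bool" where
 "generic P \<longleftrightarrow> (\<forall>c v. c ~= 0 --> P (c *s v) = P v) &
  (\<forall>m0 m1 m2 s0. pencil m0 m1 m2 --> P (pencil.pline m0 m1 s0) -->
    finite {s. \<not> P (pencil.pline m0 m1 s)})"

section \<open>Lines through given points and pencils through given lines\<close>

lemma ex_dot_1: "x ~= 0 ==> \<exists>m. dot x m = 1"
proof -
 assume "x ~= 0"
 then obtain i where "x $ i ~= 0" by (auto simp: vec_eq_iff)
 then have "dot x (axis i (inverse (x $ i))) = 1"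
  by (simp add: dot_def axis_def if_distrib[of "%c. _ * c"] cong: if_cong)
 then show ?thesis by blast
qed

lemma ccross_nonzero:
 assumes "v ~= 0" "!!c. w ~= c *s v"
 shows "ccross v w ~= 0"
proof
 assume "ccross v w = 0"
 then have e: "v$2 * w$3 = v$3 * w$2" "v$3 * w$1 = v$1 * w$3" "v$1 * w$2 = v$2 * w$1"
  by (auto simp: vec_eq_iff forall_3)
 obtain i where "v $ i ~= 0" using assms(1) by (auto simp: vec_eq_iff)
 moreover have "v $ i * w $ j = w $ i * v $ j" for i j
  using e exhaust_3[of i] exhaust_3[of j] by (auto simp: mult.commute)
 ultimately have "w = (w $ i / v $ i) *s v" by (simp add: vec_eq_iff field_simps)
 then show False using assms(2) by blast
qed

lemma pencil_ex: "v ~= 0 ==> (!!c. w ~= c *s v) ==> \<exists>m2. pencil v w m2"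
 using ex_dot_1[OF ccross_nonzero] by (auto simp: pencil_def)

lemma (in pencil) on_m0_m1: "dot x m0 = 0 ==> dot x m1 = 0 ==> x = dot x m2 *s b2"
 using expand[of x] by simp

lemma ex_lines_through:
 assumes "(x :: complex^3) ~= 0"
 shows "\<exists>m0 m1 m2. pencil m0 m1 m2 & dot x m0 = 0 & dot x m1 = 0"
proof -
 obtain m0 m1 :: "complex^3" where m: "dot x m0 = 0" "dot x m1 = 0" "ccross m0 m1 ~= 0"
 proof -
  consider "x $ 1 ~= 0" | "x $ 2 ~= 0" | "x $ 3 ~= 0" using assms by (auto simp: vec_eq_iff forall_3)
  then show ?thesis
  proof cases
   case 1
   then show ?thesis
    by (intro that[of "vector [- x$2, x$1, 0]" "vector [- x$3, 0, x$1]"])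
     (auto simp: dot_3 vec_eq_iff forall_3)
  next
   case 2
   then show ?thesis
    by (intro that[of "vector [0, - x$3, x$2]" "vector [x$2, - x$1, 0]"])
     (auto simp: dot_3 vec_eq_iff forall_3)
  next
   case 3
   then show ?thesis
    by (intro that[of "vector [x$3, 0, - x$1]" "vector [0, x$3, - x$2]"])
     (auto simp: dot_3 vec_eq_iff forall_3)
  qed
 qed
 then show ?thesis using ex_dot_1[of "ccross m0 m1"] by (auto simp: pencil_def)
qed

text \<open>Of two distinct lines through \<open>x\<close> at least one differs from
  \<open>v\<close>.\<close>

lemma ex_second_line_through:
 assumes "x ~= 0" "v ~= 0"
 shows "\<exists>w m2. pencil v w m2 & dot x w = 0"
proof -
 obtain m0 m1 m2 where m: "pencil m0 m1 m2" "dot x m0 = 0" "dot x m1 = 0" using ex_lines_through[OF assms(1)] by blast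
 interpret pencil m0 m1 m2 by fact
 have "\<exists>w\<in>{m0, m1}. \<forall>c. w ~= c *s v"
 proof (rule ccontr)
  assume "\<not> ?thesis"
  then obtain a b where "m0 = a *s v" "m1 = b *s v" by auto
  then have "ccross m0 m1 = 0" by (auto simp: vec_eq_iff forall_3)
  then show False using det1 by simp
 qed
 then show ?thesis using pencil_ex[OF assms(2)] m by blast
qed

text \<open>Both properties hold at almost all members of the pencil that joins \<open>v\<close> and
  \<open>w\<close>.\<close>

lemma generic_meet:
 assumes "generic P" "generic Q" "P v" "Q w" "v ~= 0" "w ~= 0"
 shows "\<exists>u. u ~= 0 & P u & Q u"
proof (cases "\<exists>c. w = c *s v")
 case True
 then obtain c where "w = c *s v" "c ~= 0" using assms(6) by auto
 then show ?thesis using assms unfolding generic_def by metis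
next
 case False
 have "w - v ~= c *s v" for c
 proof
  assume "w - v = c *s v"
  then have "w = (c + 1) *s v" by (simp add: vec_eq_iff algebra_simps)
  then show False using False by blast
 qed
 then obtain m2 where m: "pencil v (w - v) m2" using pencil_ex[OF assms(5)] by blast
 interpret pencil v "w - v" m2 by fact
 have "pline 0 = v" "pline 1 = w" by (simp_all add: pline_def)
 then have "finite {s. \<not> P (pline s)}" "finite {s. \<not> Q (pline s)}"
  using assms(1-4) m unfolding generic_def by metis+
 then have "finite ({s. \<not> P (pline s)} \<union> {s. \<not> Q (pline s)})" by simp
 then obtain s where "s \<notin> {s. \<not> P (pline s)} \<union> {s. \<not> Q (pline s)}"
  using ex_new_if_finite infinite_UNIV_char_0 by blast
 then show ?thesis using pline_nonzero by blast
qed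

lemma generic_meet_ex:
 "generic P ==> generic Q ==> \<exists>v. v ~= 0 & P v ==> \<exists>v. v ~= 0 & Q v ==> \<exists>u. u ~= 0 & P u & Q u"
 using generic_meet by blast

lemma generic_conj: "generic P ==> generic Q ==> generic (%v. P v & Q v)"
 unfolding generic_def
proof (elim conjE, intro conjI allI impI)
 fix m0 m1 m2 s0
 assume *: "\<forall>m0 m1 m2 s0. pencil m0 m1 m2 --> P (pencil.pline m0 m1 s0) --> finite {s. \<not> P (pencil.pline m0 m1 s)}"
  "\<forall>m0 m1 m2 s0. pencil m0 m1 m2 --> Q (pencil.pline m0 m1 s0) --> finite {s. \<not> Q (pencil.pline m0 m1 s)}"
  "pencil m0 m1 m2" "P (pencil.pline m0 m1 s0) & Q (pencil.pline m0 m1 s0)"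
 have "{s. \<not> (P (pencil.pline m0 m1 s) & Q (pencil.pline m0 m1 s))} =
   {s. \<not> P (pencil.pline m0 m1 s)} \<union> {s. \<not> Q (pencil.pline m0 m1 s)}" by auto
 moreover have "finite {s. \<not> P (pencil.pline m0 m1 s)}" "finite {s. \<not> Q (pencil.pline m0 m1 s)}"
  using * by blast+
 ultimately show "finite {s. \<not> (P (pencil.pline m0 m1 s) & Q (pencil.pline m0 m1 s))}" by simp
qed blast

lemma generic_True: "generic (%_. True)"
 by (simp add: generic_def)

lemma generic_Ball:
 assumes "finite I" "!!i. i \<in> I ==> generic (P i)" "!!i. i \<in> I ==> \<exists>v. v ~= 0 & P i v"
 shows "generic (%v. \<forall>i\<in>I. P i v) & (\<exists>v. v ~= 0 & (\<forall>i\<in>I. P i v))"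
 using assms
proof (induction I rule: finite_induct)
 case empty
 have "(axis 1 1 :: complex^3) ~= 0" by (auto simp: vec_eq_iff axis_def)
 then show ?case using generic_True by auto
next
 case (insert i I)
 then have "generic (%v. \<forall>i\<in>I. P i v)" "generic (P i)" "\<exists>v. v ~= 0 & (\<forall>i\<in>I. P i v)" "\<exists>v. v ~= 0 & P i v" by auto
 then show ?case using generic_conj[of "P i" "%v. \<forall>i\<in>I. P i v"] generic_meet[of "P i" "%v. \<forall>i\<in>I. P i v"] by auto
qed

lemma finite_linear_zeros: "a ~= 0 \<or> b ~= 0 ==> finite {s :: complex. a + s * b = 0}"
 using poly_roots_finite[of "[:a, b:]"] by simp

lemma generic_avoid: "generic (%v. dot x v ~= 0)"
 unfolding generic_def
proof (intro conjI allI impI)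
 fix m0 m1 m2 s0 assume "pencil m0 m1 m2" "dot x (pencil.pline m0 m1 s0) ~= 0"
 then show "finite {s. \<not> dot x (pencil.pline m0 m1 s) ~= 0}"
 proof -
  have "dot x m0 ~= 0 \<or> dot x m1 ~= 0"
   using \<open>dot x _ ~= 0\<close> \<open>pencil m0 m1 m2\<close> by (auto simp: pencil.pline_def)
  then show ?thesis
   using finite_linear_zeros[of "dot x m0" "dot x m1"] \<open>pencil m0 m1 m2\<close> by (simp add: pencil.pline_def)
 qed
qed auto

context pencil begin

lemma dehom_bihomogeneous: "\<exists>H. \<forall>s y. poly2 H s y = beval p (ppoint s y) (pline s)"
proof (induction p rule: cpoly_induct)
 case (const c) show ?case by (rule exI[of _ "[:[:c:]:]"]) simp
next
 case (var i) show ?case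
 proof (cases i)
  case (Inl j)
  then show ?thesis by (intro exI[of _ "[:[:b1 $ j, - b0 $ j:], [:b2 $ j:]:]"]) (simp add: ppoint_def)
 next
  case (Inr j)
  then show ?thesis by (intro exI[of _ "[:[:m0 $ j, m1 $ j:]:]"]) (simp add: pline_def)
 qed
next
 case (add p q)
 then show ?case by (metis beval_simps(1) poly2_simps(1))
next
 case (mult p q)
 then show ?case by (metis beval_simps(2) poly2_simps(4))
qed

lemma beval_center: "\<exists>q. \<forall>s. poly q s = beval p b2 (pline s)"
proof (induction p rule: cpoly_induct)
 case (const c) show ?case by (rule exI[of _ "[:c:]"]) simp
next
 case (var i) show ?case
 proof (cases i)
  case (Inl j)
  then show ?thesis by (intro exI[of _ "[:b2 $ j:]"]) simp
 next
  case (Inr j)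
  then show ?thesis by (intro exI[of _ "[:m0 $ j, m1 $ j:]"]) (simp add: pline_def)
 qed
next
 case (add p q)
 then show ?case by (metis beval_simps(1) poly_add)
next
 case (mult p q)
 then show ?case by (metis beval_simps(2) poly_mult)
qed

end

section \<open>One irreducible curve cut by the lines of a pencil\<close>

locale irreducible_form = pencil +
 fixes F :: "3 cpoly" and d :: nat
 assumes fhom: "homogeneous F d" and firr: "irred F" and fd2: "d \<ge> 2"
begin

abbreviation "G \<equiv> dehom F"

lemma irrG: "irred G"
 by (rule irreducible_dehom[OF fhom firr fd2])

text \<open>A centre on the curve uses up one intersection with every line and lowers the degree in
  \<open>y\<close>.\<close>

lemma degree_G_le: "degree G \<le> d - (if peval F b2 = 0 then 1 else 0)"
proof -
 have "coeff G d = 0" if "peval F b2 = 0"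
  using degree_at_s_dehom(2)[OF fhom] that poly_all_0_iff_0[of "coeff G d"] by simp
 then have "degree G ~= d" if "peval F b2 = 0"
  using that fd2 by (metis degree_0 leading_coeff_0_iff not_numeral_le_zero)
 then show ?thesis using degree_dehom_le[OF fhom] by auto
qed

text \<open>The number drops at most where the leading coefficient vanishes or \<open>G\<close> has
  a common zero with its derivative by \<open>y\<close>; irreducibility makes the second set
  finite.\<close>

lemma finite_bad_card:
 assumes "degree G > 0"
 shows "finite {s. card {y. poly2 G s y = 0} ~= degree G}"
proof (rule finite_subset)
 show "{s. card {y. poly2 G s y = 0} ~= degree G} \<subseteq>
  {s. poly (lead_coeff G) s = 0} \<union> {s. \<exists>y. poly2 G s y = 0 & poly2 (pderiv G) s y = 0}"
 proof (rule subsetI, rule ccontr)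
  fix s assume s: "s \<in> {s. card {y. poly2 G s y = 0} ~= degree G}"
   "s \<notin> {s. poly (lead_coeff G) s = 0} \<union> {s. \<exists>y. poly2 G s y = 0 & poly2 (pderiv G) s y = 0}"
  then have "coeff (at_s G s) (degree G) ~= 0" by simp
  then have nz: "at_s G s ~= 0" and "degree G \<le> degree (at_s G s)"
   using le_degree[of "at_s G s" "degree G"] by (metis coeff_0, blast)
  then have "degree (at_s G s) = degree G" using degree_at_s_le[of G s] by simp
  then have "card {y. poly (at_s G s) y = 0} = degree G"
   using s(2) card_roots_eq_degree[OF nz] by (simp flip: at_s_pderiv)
  then show False using s(1) by simp
 qed
 have "lead_coeff G ~= 0" using assms by auto
 then show "finite ({s. poly (lead_coeff G) s = 0} \<union> {s. \<exists>y. poly2 G s y = 0 & poly2 (pderiv G) s y = 0})"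
  using finite_common_roots[OF irrG not_dvd_pderiv[OF assms]] poly_roots_finite[of "lead_coeff G"] by auto
qed

text \<open>The number of distinct roots is at most the degree of \<open>G\<close>, which is bounded
  by \<open>degree_G_le\<close>; a line with \<open>d\<close> distinct points leaves no
  slack.\<close>

lemma card_line_imp:
 assumes "card (line_points F (pline s)) = d"
 shows "at_s G s ~= 0" "card {y. poly2 G s y = 0} = d - (if peval F b2 = 0 then 1 else 0)"
  "degree G = d - (if peval F b2 = 0 then 1 else 0)" "degree G > 0"
proof -
 have fin: "finite (line_points F (pline s))" using assms fd2 by (intro card_ge_0_finite) simp
 have "finite ((%y. proj_pt (ppoint s y)) ` {y. poly2 G s y = 0})"
  using line_points_pline[OF fhom, of s] by (intro finite_subset[OF _ fin]) auto
 moreover have "inj_on (%y. proj_pt (ppoint s y)) {y. poly2 G s y = 0}"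
  using ppoint_inj by (auto intro: inj_onI)
 ultimately have finr: "finite {y. poly2 G s y = 0}" by (rule finite_imageD)
 then show nz: "at_s G s ~= 0"
  using infinite_UNIV_char_0[where 'a = complex] by (metis (mono_tags, lifting) UNIV_eq_I mem_Collect_eq poly_0 poly_at_s)
 show c: "card {y. poly2 G s y = 0} = d - (if peval F b2 = 0 then 1 else 0)"
  using card_line_points_pline[OF fhom finr] assms by (auto split: if_splits)
 have "card {y. poly2 G s y = 0} \<le> degree G"
  using card_poly_roots_bound[OF nz] degree_at_s_le[of G s] by simp
 then show "degree G = d - (if peval F b2 = 0 then 1 else 0)" using c degree_G_le by simp
 then show "degree G > 0" using fd2 by auto
qed

lemma finite_bad_card_line:
 assumes "degree G = d - (if peval F b2 = 0 then 1 else 0)"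
 shows "finite {s. card (line_points F (pline s)) ~= d}"
proof (rule finite_subset)
 have "degree G > 0" using assms fd2 by auto
 then show "finite {s. card {y. poly2 G s y = 0} ~= degree G}" by (rule finite_bad_card)
 show "{s. card (line_points F (pline s)) ~= d} \<subseteq> {s. card {y. poly2 G s y = 0} ~= degree G}"
 proof (rule subsetI, rule ccontr)
  fix s assume s: "s \<in> {s. card (line_points F (pline s)) ~= d}" "s \<notin> {s. card {y. poly2 G s y = 0} ~= degree G}"
  then have c: "card {y. poly2 G s y = 0} = degree G" by simp
  then have "finite {y. poly2 G s y = 0}" using \<open>degree G > 0\<close> by (intro card_ge_0_finite) simp
  from card_line_points_pline[OF fhom this] s(1) c assms fd2 show False by (auto split: if_splits)
 qed
qed

end

lemma irreducible_form_I:
 "pencil m0 m1 m2 ==> homogeneous F d ==> irred F ==> d \<ge> 2 ==>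
  irreducible_form m0 m1 m2 F d"
 by (simp add: irreducible_form_def irreducible_form_axioms_def)

lemma ex_pencil_center_off:
 assumes "homogeneous F d" "F ~= 0" "d > 0"
 shows "\<exists>m0 m1 m2. pencil m0 m1 m2 & peval F (pencil.b2 m0 m1) ~= 0"
proof -
 obtain x where x: "peval F x ~= 0" using peval_inject[of F 0] assms(2) by auto
 then have "x ~= 0" using peval_0[OF assms(1,3)] by auto
 then obtain m0 m1 m2 where m: "pencil m0 m1 m2" "dot x m0 = 0" "dot x m1 = 0" using ex_lines_through by blast
 interpret pencil m0 m1 m2 by fact
 have "peval F x = dot x m2 ^ d * peval F b2"
  using on_m0_m1[OF m(2,3)] peval_scale[OF assms(1)] by metis
 then show ?thesis using x m(1) by auto
qed

text \<open>If the line \<open>s = 0\<close> lay on the curve, \<open>s\<close> would divide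
  \<open>G\<close> and, after homogenization, the form of this line would divide
  \<open>F\<close>.\<close>

lemma irreducible_not_contains_line:
 assumes F: "homogeneous F d" "irred F" "d \<ge> 2" and v: "v ~= 0"
 shows "\<exists>x. dot x v = 0 & peval F x ~= 0"
proof (rule ccontr)
 assume no: "\<not> ?thesis"
 obtain w m2 where "pencil v w m2" using ex_second_line_through[OF v v] by blast
 then interpret irreducible_form v w m2 F d using F by (rule irreducible_form_I)
 have "poly2 G 0 y = 0" for y using no dot_ppoint_pline[of 0 y] by (auto simp: pline_def)
 then have "at_s G 0 = 0" by (metis poly_all_0_iff_0 poly_at_s)
 then have "poly (coeff G j) 0 = 0" for j by (metis coeff_0 coeff_at_s)
 then have "[:0, 1:] dvd coeff G j" for j using poly_eq_0_iff_dvd[of "coeff G j" 0] by simp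
 then have "[:[:0, 1:]:] dvd G" by (simp add: const_poly_dvd_iff)
 then obtain H where H: "G = [:[:0, 1:]:] * H" by blast
 then have "H ~= 0" using irrG by (auto simp: Factorial_Ring.irreducible_def)
 then obtain N Q h where Q: "homogenizes H N Q h" using ex_homogenizes by blast
 have "homogenizes [:[:0, 1:]:] 1 (lin_form (- v)) [:0, 1:]"
  unfolding homogenizes_def using homogeneous_lin_form by auto
 from homogenizes_factorization[OF F(1) H this Q]
 obtain e where e: "F = lin_form (- v) * (Q * lin_form w ^ e)" "1 + N + e = d" by (auto simp: mult.assoc)
 then have "lin_form (- v) dvd 1 \<or> Q * lin_form w ^ e dvd 1"
  using F(2) by (auto simp: Factorial_Ring.irreducible_def)
 moreover have "homogeneous (Q * lin_form w ^ e) (N + e * 1)"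
  using Q by (intro homogeneous_mult homogeneous_power homogeneous_lin_form) (simp add: homogenizes_def)
 ultimately show False
  using homogeneous_unit[OF homogeneous_lin_form] homogeneous_unit[of "Q * lin_form w ^ e" "N + e * 1"] e(2) F(3)
  by auto
qed

section \<open>Curves with several components\<close>

locale plane_curve =
 fixes k :: nat and Comp :: "nat => 3 cpoly" and ds :: "nat => nat"
 assumes hom: "!!i. i \<in> {1..k} ==> homogeneous (Comp i) (ds i)"
  and irr: "!!i. i \<in> {1..k} ==> irred (Comp i)"
  and ds2: "!!i. i \<in> {1..k} ==> ds i \<ge> 2"
  and nonassoc: "!!i j. i \<in> {1..k} ==> j \<in> {1..k} ==> i ~= j ==> \<not> Comp i dvd Comp j"
begin

lemma nz: "i \<in> {1..k} ==> Comp i ~= 0"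
 using irr by (auto simp: Factorial_Ring.irreducible_def)

lemma generic_card:
 assumes i: "i \<in> {1..k}"
 shows "generic (%v. card (line_points (Comp i) v) = ds i)"
  "\<exists>v. v ~= 0 & card (line_points (Comp i) v) = ds i"
proof -
 show "generic (%v. card (line_points (Comp i) v) = ds i)"
  unfolding generic_def
 proof (intro conjI allI impI)
  fix m0 m1 m2 s0 assume m: "pencil m0 m1 m2" "card (line_points (Comp i) (pencil.pline m0 m1 s0)) = ds i"
  interpret irreducible_form m0 m1 m2 "Comp i" "ds i"
   by (rule irreducible_form_I[OF m(1) hom[OF i] irr[OF i] ds2[OF i]])
  show "finite {s. card (line_points (Comp i) (pencil.pline m0 m1 s)) ~= ds i}"
   using finite_bad_card_line[OF card_line_imp(3)[OF m(2)]] .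
 qed (simp add: line_points_scale)
 obtain m0 m1 m2 where m: "pencil m0 m1 m2" "peval (Comp i) (pencil.b2 m0 m1) ~= 0"
  using ex_pencil_center_off[OF hom[OF i] nz[OF i]] ds2[OF i] by auto
 interpret irreducible_form m0 m1 m2 "Comp i" "ds i"
  by (rule irreducible_form_I[OF m(1) hom[OF i] irr[OF i] ds2[OF i]])
 have "finite {s. card (line_points (Comp i) (pline s)) ~= ds i}"
  using degree_dehom_eq[OF hom[OF i] m(2)] m(2) by (intro finite_bad_card_line) simp
 then obtain s where "card (line_points (Comp i) (pline s)) = ds i"
  using ex_new_if_finite[OF infinite_UNIV_char_0] by blast
 then show "\<exists>v. v ~= 0 & card (line_points (Comp i) v) = ds i" using pline_nonzero by blast
qed

text \<open>A centre on both curves would be common to all lines, which the last hypothesis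
  excludes; other common points are common roots of two polynomials without common factor.\<close>

lemma (in pencil) finite_common_points:
 assumes "homogeneous F d" "irred F" "d \<ge> 2" "homogeneous F' d'" "F' ~= 0"
  and "\<not> F dvd F'" "peval F b2 ~= 0 \<or> peval F' b2 ~= 0"
 shows "finite {s. line_points F (pline s) \<inter> line_points F' (pline s) ~= {}}"
proof (rule finite_subset)
 have "\<not> dehom F dvd dehom F'" using dehom_dvd_imp[OF assms(1-5)] assms(6) by blast
 then show "finite {s. \<exists>y. poly2 (dehom F) s y = 0 & poly2 (dehom F') s y = 0}"
  by (rule finite_common_roots[OF irreducible_dehom[OF assms(1-3)]])
 show "{s. line_points F (pline s) \<inter> line_points F' (pline s) ~= {}} \<subseteq>
  {s. \<exists>y. poly2 (dehom F) s y = 0 & poly2 (dehom F') s y = 0}"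
  unfolding line_points_pline[OF assms(1)] line_points_pline[OF assms(4)]
  using assms(7) ppoint_inj ppoint_ne_b2 by (fastforce split: if_splits)
qed

lemma generic_disjoint:
 assumes i: "i \<in> {1..k}" and j: "j \<in> {1..k}" and "i ~= j"
 shows "generic (%v. line_points (Comp i) v \<inter> line_points (Comp j) v = {})"
  "\<exists>v. v ~= 0 & line_points (Comp i) v \<inter> line_points (Comp j) v = {}"
proof -
 show "generic (%v. line_points (Comp i) v \<inter> line_points (Comp j) v = {})"
  unfolding generic_def
 proof (intro conjI allI impI)
  fix m0 m1 m2 s0 assume m: "pencil m0 m1 m2"
   "line_points (Comp i) (pencil.pline m0 m1 s0) \<inter> line_points (Comp j) (pencil.pline m0 m1 s0) = {}"
  interpret pencil m0 m1 m2 by fact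
  have "peval (Comp i) b2 ~= 0 \<or> peval (Comp j) b2 ~= 0"
   using m(2) unfolding line_points_pline[OF hom[OF i]] line_points_pline[OF hom[OF j]] by auto
  from finite_common_points[OF hom[OF i] irr[OF i] ds2[OF i] hom[OF j] nz[OF j] nonassoc[OF assms] this]
  show "finite {s. line_points (Comp i) (pencil.pline m0 m1 s) \<inter> line_points (Comp j) (pencil.pline m0 m1 s) ~= {}}" .
 qed (simp add: line_points_scale)
 obtain m0 m1 m2 where m: "pencil m0 m1 m2" "peval (Comp i) (pencil.b2 m0 m1) ~= 0"
  using ex_pencil_center_off[OF hom[OF i] nz[OF i]] ds2[OF i] by auto
 interpret pencil m0 m1 m2 by fact
 have "finite {s. line_points (Comp i) (pline s) \<inter> line_points (Comp j) (pline s) ~= {}}"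
  using m(2) by (intro finite_common_points[OF hom[OF i] irr[OF i] ds2[OF i] hom[OF j] nz[OF j] nonassoc[OF assms]]) simp
 then obtain s where "line_points (Comp i) (pline s) \<inter> line_points (Comp j) (pline s) = {}"
  using ex_new_if_finite[OF infinite_UNIV_char_0] by blast
 then show "\<exists>v. v ~= 0 & line_points (Comp i) v \<inter> line_points (Comp j) v = {}" using pline_nonzero by blast
qed

definition transversal :: "complex^3 => bool" where
 "transversal v \<longleftrightarrow> (\<forall>i\<in>{1..k}. card (line_points (Comp i) v) = ds i) &
   (\<forall>(i,j)\<in>{(i,j)\<in>{1..k}\<times>{1..k}. i ~= j}. line_points (Comp i) v \<inter> line_points (Comp j) v = {})"

lemma generic_transversal: "generic transversal" "\<exists>v. v ~= 0 & transversal v"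
proof -
 have 1: "generic (%v. \<forall>i\<in>{1..k}. card (line_points (Comp i) v) = ds i) &
  (\<exists>v. v ~= 0 & (\<forall>i\<in>{1..k}. card (line_points (Comp i) v) = ds i))"
  by (rule generic_Ball) (use generic_card in auto)
 have fin: "finite {(i,j)\<in>{1..k}\<times>{1..k}. i ~= j}" by (rule finite_subset[of _ "{1..k} \<times> {1..k}"]) auto
 have 2: "generic (%v. \<forall>(i,j)\<in>{(i,j)\<in>{1..k}\<times>{1..k}. i ~= j}. line_points (Comp i) v \<inter> line_points (Comp j) v = {}) &
  (\<exists>v. v ~= 0 & (\<forall>(i,j)\<in>{(i,j)\<in>{1..k}\<times>{1..k}. i ~= j}. line_points (Comp i) v \<inter> line_points (Comp j) v = {}))"
  unfolding case_prod_unfold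
  by (rule generic_Ball[OF fin[unfolded case_prod_unfold]]) (use generic_disjoint in auto)
 show "generic transversal" using generic_conj[OF conjunct1[OF 1] conjunct1[OF 2]] by (simp add: transversal_def[abs_def])
 show "\<exists>v. v ~= 0 & transversal v"
  using generic_meet_ex[OF conjunct1[OF 1] conjunct1[OF 2] conjunct2[OF 1] conjunct2[OF 2]]
  unfolding transversal_def .
qed

end

text \<open>The polynomial \<open>g i\<close> cuts out a curve on the incidence surface of the \<open>i\<close>-th component,
 which good lines have to avoid.\<close>

locale plane_curve_cut = plane_curve +
 fixes g :: "nat => (3 + 3) cpoly"
 assumes bihom: "!!i. i \<in> {1..k} ==> \<exists>a b. bihomogeneous (g i) a b"
  and witness: "!!i. i \<in> {1..k} ==> \<exists>x v. x ~= 0 & v ~= 0 & dot x v = 0 & peval (Comp i) x = 0 & beval (g i) x v ~= 0"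
begin

text \<open>The count of points is included because it fixes the degree of the dehomogenized form,
  from which finiteness of the exceptions in a pencil follows.\<close>

definition avoids :: "nat => complex^3 => bool" where
 "avoids i v \<longleftrightarrow> card (line_points (Comp i) v) = ds i &
  (\<forall>x. x ~= 0 --> peval (Comp i) x = 0 --> dot x v = 0 --> beval (g i) x v ~= 0)"

text \<open>A zero of \<open>g i\<close> on the component over a line of the pencil is a common root
  of \<open>G\<close> and the restriction \<open>H\<close>, or else the centre. A single point where
  \<open>g i\<close> is nonzero shows that \<open>G\<close> does not divide
  \<open>H\<close>.\<close>

lemma generic_avoids:
 assumes i: "i \<in> {1..k}"
 shows "generic (avoids i)" "\<exists>v. v ~= 0 & avoids i v"
proof -
 obtain a b where ab: "bihomogeneous (g i) a b" using bihom[OF i] by blast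
 have fin: "finite {s. \<not> avoids i (pencil.pline m0 m1 s)}"
  if form: "irreducible_form m0 m1 m2 (Comp i) (ds i)"
   and deg: "degree (pencil.dehom m0 m1 m2 (Comp i)) = ds i - (if peval (Comp i) (pencil.b2 m0 m1) = 0 then 1 else 0)"
   and y: "peval (Comp i) (pencil.ppoint m0 m1 m2 s0 y) = 0"
    "beval (g i) (pencil.ppoint m0 m1 m2 s0 y) (pencil.pline m0 m1 s0) ~= 0"
   and center: "peval (Comp i) (pencil.b2 m0 m1) = 0 ==> beval (g i) (pencil.b2 m0 m1) (pencil.pline m0 m1 s0) ~= 0"
  for m0 m1 m2 s0 y
 proof -
  interpret irreducible_form m0 m1 m2 "Comp i" "ds i" by fact
  obtain H where H: "!!s y. poly2 H s y = beval (g i) (ppoint s y) (pline s)" using dehom_bihomogeneous[of "g i"] by blast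
  obtain q where q: "!!s. poly q s = beval (g i) b2 (pline s)" using beval_center[of "g i"] by blast
  have "\<not> G dvd H"
  proof
   assume "G dvd H"
   then obtain J where "H = G * J" by blast
   then have "poly2 H s0 y = poly2 G s0 y * poly2 J s0 y" by simp
   then show False using y by (simp add: H)
  qed
  then have 1: "finite {s. \<exists>y. poly2 G s y = 0 & poly2 H s y = 0}" by (rule finite_common_roots[OF irrG])
  have 2: "finite {s. card (line_points (Comp i) (pline s)) ~= ds i}" by (rule finite_bad_card_line[OF deg])
  have 3: "finite {s. peval (Comp i) b2 = 0 & poly q s = 0}"
  proof (cases "peval (Comp i) b2 = 0")
   case True
   then have "q ~= 0" using center q[of s0] by auto
   then show ?thesis by (intro finite_subset[OF _ poly_roots_finite[of q]]) auto
  qed auto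
  have "{s. \<not> avoids i (pline s)} \<subseteq> {s. \<exists>y. poly2 G s y = 0 & poly2 H s y = 0} \<union>
    {s. card (line_points (Comp i) (pline s)) ~= ds i} \<union> {s. peval (Comp i) b2 = 0 & poly q s = 0}"
  proof (rule subsetI, rule ccontr)
   fix s assume s: "s \<in> {s. \<not> avoids i (pline s)}" "s \<notin> {s. \<exists>y. poly2 G s y = 0 & poly2 H s y = 0} \<union>
    {s. card (line_points (Comp i) (pline s)) ~= ds i} \<union> {s. peval (Comp i) b2 = 0 & poly q s = 0}"
   then obtain x where x: "x ~= 0" "peval (Comp i) x = 0" "dot x (pline s) = 0" "beval (g i) x (pline s) = 0"
    by (auto simp: avoids_def)
   have bs: "beval (g i) (c *s z) (pline s) = c ^ a * beval (g i) z (pline s)" for c z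
    using beval_scale[OF ab, of c z 1 "pline s"] by simp
   obtain c where "c ~= 0" "x = c *s b2 \<or> (\<exists>y. x = c *s ppoint s y)" using on_pline_cases[OF x(1,3)] by blast
   then have "beval (g i) b2 (pline s) = 0 & peval (Comp i) b2 = 0 \<or>
     (\<exists>y. beval (g i) (ppoint s y) (pline s) = 0 & peval (Comp i) (ppoint s y) = 0)"
    using x(2,4) bs peval_scale[OF hom[OF i]] by auto
   then show False using s(2) q H by auto
  qed
  then show ?thesis using 1 2 3 finite_subset by blast
 qed
 show "generic (avoids i)"
  unfolding generic_def
 proof (intro conjI allI impI)
  fix c :: complex and v assume "c ~= 0"
  then show "avoids i (c *s v) = avoids i v"
   using beval_scale[OF ab, of 1 _ c v] by (simp add: avoids_def line_points_scale)
 next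
  fix m0 m1 m2 s0 assume m: "pencil m0 m1 m2" "avoids i (pencil.pline m0 m1 s0)"
  have form: "irreducible_form m0 m1 m2 (Comp i) (ds i)"
   by (rule irreducible_form_I[OF m(1) hom[OF i] irr[OF i] ds2[OF i]])
  interpret irreducible_form m0 m1 m2 "Comp i" "ds i" by fact
  have c: "card (line_points (Comp i) (pline s0)) = ds i" using m(2) by (simp add: avoids_def)
  have "card {y. poly2 G s0 y = 0} ~= 0" using card_line_imp(2)[OF c] fd2 by auto
  then obtain y where "poly2 G s0 y = 0" by (metis (mono_tags, lifting) Collect_empty_eq card.empty)
  then show "finite {s. \<not> avoids i (pencil.pline m0 m1 s)}"
   using fin[OF form card_line_imp(3)[OF c], of s0 y] m(2) ppoint_nonzero b2_nonzero by (auto simp: avoids_def)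
 qed
 \<comment> \<open>For existence, the witness line \<open>v\<close> is put into a pencil whose
   centre lies on \<open>v\<close> but not on the component, so that the witness point is not the
   centre.\<close>
 obtain x v where xv: "x ~= 0" "v ~= 0" "dot x v = 0" "peval (Comp i) x = 0" "beval (g i) x v ~= 0"
  using witness[OF i] by blast
 obtain z where z: "dot z v = 0" "peval (Comp i) z ~= 0"
  using irreducible_not_contains_line[OF hom[OF i] irr[OF i] ds2[OF i] xv(2)] by blast
 have "z ~= 0" using z(2) peval_0[OF hom[OF i]] ds2[OF i] by auto
 then obtain w m2 where m: "pencil v w m2" "dot z w = 0" using ex_second_line_through xv(2) by blast
 have form: "irreducible_form v w m2 (Comp i) (ds i)"
  by (rule irreducible_form_I[OF m(1) hom[OF i] irr[OF i] ds2[OF i]])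
 interpret irreducible_form v w m2 "Comp i" "ds i" by fact
 have b2: "peval (Comp i) b2 ~= 0"
  using on_m0_m1[OF z(1) m(2)] z(2) peval_scale[OF hom[OF i], of "dot z m2" b2] by auto
 have pl: "pline 0 = v" by (simp add: pline_def)
 obtain c where "c ~= 0" "x = c *s b2 \<or> (\<exists>y. x = c *s ppoint 0 y)"
  using on_pline_cases[OF xv(1), of 0] xv(3) by (auto simp: pl)
 then have "\<exists>y. peval (Comp i) (ppoint 0 y) = 0 & beval (g i) (ppoint 0 y) v ~= 0"
  using xv(4,5) b2 beval_scale[OF ab, of c _ 1 v] peval_scale[OF hom[OF i]] by auto
 then obtain y where "peval (Comp i) (ppoint 0 y) = 0" "beval (g i) (ppoint 0 y) v ~= 0" by blast
 then have "finite {s. \<not> avoids i (pline s)}"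
  using fin[OF form, of 0 y] degree_dehom_eq[OF hom[OF i] b2] b2 pl by simp
 then obtain s where "avoids i (pline s)"
  using ex_new_if_finite[OF infinite_UNIV_char_0] by blast
 then show "\<exists>v. v ~= 0 & avoids i v" using pline_nonzero by blast
qed

definition good :: "complex^3 => bool" where
 "good v \<longleftrightarrow> transversal v & (\<forall>i\<in>{1..k}. avoids i v)"

lemma generic_good: "generic good" "\<exists>v. v ~= 0 & good v"
proof -
 have 1: "generic (%v. \<forall>i\<in>{1..k}. avoids i v) & (\<exists>v. v ~= 0 & (\<forall>i\<in>{1..k}. avoids i v))"
  by (rule generic_Ball) (use generic_avoids in auto)
 show "generic good" using generic_conj[OF generic_transversal(1) conjunct1[OF 1]] by (simp add: good_def[abs_def])
 show "\<exists>v. v ~= 0 & good v"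
  using generic_meet_ex[OF generic_transversal(1) conjunct1[OF 1] generic_transversal(2) conjunct2[OF 1]]
  unfolding good_def .
qed

lemma good_scale: "c ~= 0 ==> good (c *s v) = good v"
 using generic_good(1) by (simp add: generic_def)

lemma finite_bad:
 "pencil m0 m1 m2 ==> good (pencil.pline m0 m1 s0) ==> finite {s. \<not> good (pencil.pline m0 m1 s)}"
 using generic_good(1)[unfolded generic_def, THEN conjunct2, rule_format, of m0 m1 m2 s0] .

lemma ex_good_avoiding:
 assumes "finite E" "0 \<notin> E"
 shows "\<exists>v. v ~= 0 & good v & (\<forall>x\<in>E. dot x v ~= 0)"
proof -
 have 1: "generic (%v. \<forall>x\<in>E. dot x v ~= 0) & (\<exists>v. v ~= 0 & (\<forall>x\<in>E. dot x v ~= 0))"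
 proof (rule generic_Ball[OF assms(1) generic_avoid])
  fix x assume "x \<in> E"
  then have "x ~= 0" using assms(2) by auto
  then obtain m where "dot x m = 1" using ex_dot_1 by blast
  then show "\<exists>v. v ~= 0 & dot x v ~= 0" by (intro exI[of _ m]) auto
 qed
 show ?thesis
  by (rule generic_meet_ex[OF generic_good(1) conjunct1[OF 1] generic_good(2) conjunct2[OF 1]])
qed

end

section \<open>Moving lines\<close>

text \<open>\<open>D\<close> is the differential at \<open>x\<close>, described through lines with
  arbitrary base point because derivatives along several parametrizations through \<open>x\<close>
  are compared later.\<close>

lemma ex_directional_derivative:
 "\<exists>D. (\<forall>a b t. a + t *s b = x --> ((%t. peval F (a + t *s b)) has_field_derivative D b) (at t)) &
  (\<forall>h k. D (h + k) = D h + D k) & (\<forall>c h. D (c *s h) = c * D h)"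
proof (induction F rule: cpoly_induct)
 case (const c) show ?case by (rule exI[of _ "%_. 0"]) auto
next
 case (var i) show ?case
  by (rule exI[of _ "%h. h $ i"]) (auto intro!: derivative_eq_intros)
next
 case (add p q)
 then obtain D1 D2 where D1: "!!a b t. a + t *s b = x ==> ((%t. peval p (a + t *s b)) has_field_derivative D1 b) (at t)"
   "!!h k. D1 (h + k) = D1 h + D1 k" "!!c h. D1 (c *s h) = c * D1 h"
  and D2: "!!a b t. a + t *s b = x ==> ((%t. peval q (a + t *s b)) has_field_derivative D2 b) (at t)"
   "!!h k. D2 (h + k) = D2 h + D2 k" "!!c h. D2 (c *s h) = c * D2 h"
  by metis
 show ?case
  unfolding poly_eval_add using DERIV_add[OF D1(1) D2(1)] D1 D2
  by (intro exI[of _ "%h. D1 h + D2 h"]) (auto simp: algebra_simps)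
next
 case (mult p q)
 then obtain D1 D2 where D1: "!!a b t. a + t *s b = x ==> ((%t. peval p (a + t *s b)) has_field_derivative D1 b) (at t)"
   "!!h k. D1 (h + k) = D1 h + D1 k" "!!c h. D1 (c *s h) = c * D1 h"
  and D2: "!!a b t. a + t *s b = x ==> ((%t. peval q (a + t *s b)) has_field_derivative D2 b) (at t)"
   "!!h k. D2 (h + k) = D2 h + D2 k" "!!c h. D2 (c *s h) = c * D2 h"
  by metis
 show ?case
  unfolding poly_eval_mult
 proof (intro exI[of _ "%h. D1 h * peval q x + D2 h * peval p x"] conjI allI impI)
  fix a b t assume "a + t *s b = x"
  then show "((%t. peval p (a + t *s b) * peval q (a + t *s b)) has_field_derivative
    D1 b * peval q x + D2 b * peval p x) (at t)"
   using DERIV_mult[OF D1(1)[OF \<open>a + t *s b = x\<close>] D2(1)[OF \<open>a + t *s b = x\<close>]] \<open>a + t *s b = x\<close> by simp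
 qed (auto simp: D1 D2 algebra_simps)
qed

context plane_curve begin

definition "d = (\<Sum>i\<in>{1..k}. ds i)"
definition "C = (\<Prod>i\<in>{1..k}. Comp i)"
definition "Rest i = (\<Prod>j\<in>{1..k} - {i}. Comp j)"

lemma homogeneous_C: "homogeneous C d"
 unfolding C_def d_def homogeneous_weighted
 by (rule weighted_prod) (use hom in \<open>auto simp: homogeneous_weighted\<close>)

lemma homogeneous_Rest: "homogeneous (Rest i) (\<Sum>j\<in>{1..k} - {i}. ds j)"
 unfolding Rest_def homogeneous_weighted
 by (rule weighted_prod) (use hom in \<open>auto simp: homogeneous_weighted\<close>)

lemma C_Rest: "i \<in> {1..k} ==> C = Comp i * Rest i"
 unfolding C_def Rest_def by (rule prod.remove) auto

lemma line_points_C: "line_points C v = (\<Union>i\<in>{1..k}. line_points (Comp i) v)"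
 by (auto simp: line_points_def curve_points_def C_def prod_zero_iff)

lemma transversal_card: "transversal v ==> card (line_points C v) = d"
 unfolding line_points_C d_def
 by (subst card_UN_disjoint) (use ds2 in \<open>auto simp: transversal_def intro!: card_ge_0_finite, force\<close>)

lemma transversal_not_both:
 assumes "transversal v" "i \<in> {1..k}" "peval (Comp i) x = 0" "dot x v = 0" "x ~= 0" "v ~= 0"
 shows "peval (Rest i) x ~= 0"
proof
 assume "peval (Rest i) x = 0"
 then have "\<exists>j\<in>{1..k} - {i}. peval (Comp j) x = 0" by (simp add: Rest_def prod_zero_iff)
 then obtain j where j: "j \<in> {1..k}" "j ~= i" "peval (Comp j) x = 0" by blast
 then have "proj_pt x \<in> line_points (Comp i) v \<inter> line_points (Comp j) v"
  using assms line_points_eq[OF hom assms(6)] by auto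
 then show False using assms(1,2) j by (auto simp: transversal_def)
qed

lemma (in pencil) at_s_nonzero:
 assumes "homogeneous F n" "peval F b2 ~= 0"
 shows "at_s (dehom F) s ~= 0" "degree (at_s (dehom F) s) = n"
proof -
 have c: "coeff (at_s (dehom F) s) n ~= 0" using degree_at_s_dehom(2)[OF assms(1), of s] assms(2) by simp
 then show "at_s (dehom F) s ~= 0" by (metis coeff_0)
 show "degree (at_s (dehom F) s) = n" using degree_at_s_dehom(1)[OF assms(1), of s] le_degree[OF c] by simp
qed

text \<open>The last clause says that the differential of \<open>C\<close> at \<open>x\<close> is a
  nonzero multiple of \<open>n\<close>: the curve is smooth at \<open>x\<close> and \<open>n\<close>
  is its tangent. The count of points expresses simple contact and transversality elsewhere.\<close>

lemma ex_simple_tangent_line: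
 assumes i: "i \<in> {1..k}"
 shows "\<exists>n x \<kappa>. n ~= 0 & x ~= 0 & dot x n = 0 & peval (Comp i) x = 0 & card (line_points C n) = d - 1 & \<kappa> ~= 0 &
  (\<forall>a b t. a + t *s b = x --> ((%t. peval C (a + t *s b)) has_field_derivative \<kappa> * dot b n) (at t))"
proof -
 have "ds i \<le> d" unfolding d_def using i by (intro member_le_sum) auto
 then have dpos: "d > 0" using ds2[OF i] by simp
 obtain v where v: "v ~= 0" "transversal v" using generic_transversal(2) by blast
 \<comment> \<open>The centre of the pencil to be used: a point of \<open>v\<close> besides the
   finitely many on \<open>C\<close>.\<close>
 obtain z where z: "z ~= 0" "peval C z ~= 0" "dot z v = 0"
 proof -
  have "card (line_points C v) = d" by (rule transversal_card[OF v(2)])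
  then have fin: "finite (line_points C v)" using dpos by (intro card_ge_0_finite) simp
  obtain w m2 where "pencil v w m2" using ex_second_line_through[OF v(1) v(1)] by blast
  then interpret pencil v w m2 .
  have "infinite (range (%y. proj_pt (ppoint 0 y)))"
   using ppoint_inj infinite_UNIV_char_0[where 'a = complex] by (metis finite_imageD injI)
  then have "\<not> range (%y. proj_pt (ppoint 0 y)) \<subseteq> line_points C v" using fin finite_subset by metis
  then obtain y where "proj_pt (ppoint 0 y) \<notin> line_points C v" by auto
  then show ?thesis
   using that[of "ppoint 0 y"] ppoint_nonzero line_points_eq[OF homogeneous_C v(1)] dot_ppoint_pline[of 0 y]
   by (auto simp: pline_def)
 qed
 obtain w m2 where m: "pencil v w m2" "dot z w = 0" using ex_second_line_through[OF z(1) v(1)] by blast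
 then interpret pencil v w m2 by simp
 have Cb2: "peval C b2 ~= 0"
  using on_m0_m1[OF z(3) m(2)] z(2) peval_scale[OF homogeneous_C, of "dot z m2" b2] by auto
 then have Cib2: "peval (Comp i) b2 ~= 0" using C_Rest[OF i] by auto
 define G where "G = dehom C"
 define S0 where "S0 = {s. \<not> transversal (pline s)}"
 have "pline 0 = v" by (simp add: pline_def)
 then have "finite S0"
  using generic_transversal(1)[unfolded generic_def, THEN conjunct2, rule_format, OF m(1), of 0] v(2) by (simp add: S0_def)
 have nzG: "at_s G s ~= 0" for s unfolding G_def by (rule at_s_nonzero[OF homogeneous_C Cb2])
 have degG: "degree G = d" unfolding G_def by (rule degree_dehom_eq[OF homogeneous_C Cb2])
 have card_roots: "card {y. poly2 G s y = 0} = degree G" if "s \<notin> S0" for s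
 proof -
  have "finite {y. poly2 G s y = 0}" using poly_roots_finite[OF nzG[of s]] by simp
  from card_line_points_pline[OF homogeneous_C this[unfolded G_def]] Cb2
  show ?thesis using transversal_card[of "pline s"] that degG by (simp add: S0_def G_def)
 qed
 \<comment> \<open>The line \<open>y = \<alpha> * s + \<beta>\<close> of the chart consists of the
   points \<open>a \<beta> + s *s b \<alpha>\<close>, and \<open>b \<alpha>\<close> is its point at
   infinity.\<close>
 define a where "a \<beta> = b1 + \<beta> *s b2" for \<beta>
 define b where "b \<alpha> = \<alpha> *s b2 - b0" for \<alpha>
 have ab: "ppoint s (\<alpha> * s + \<beta>) = a \<beta> + s *s b \<alpha>" for s \<alpha> \<beta>
  by (simp add: ppoint_def a_def b_def vec_eq_iff algebra_simps)
 have T: "poly (poly G [:\<beta>, \<alpha>:]) s = peval C (a \<beta> + s *s b \<alpha>)" for \<alpha> \<beta> s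
  by (simp add: poly2_on_line G_def ab)
 obtain lc where lc: "!!\<alpha>. poly lc \<alpha> = peval C (- b0 + \<alpha> *s b2)" using poly_along_line by metis
 have "lc ~= 0" using degree_along_line(2)[OF homogeneous_C lc] Cb2 by auto
 have lcb: "poly lc \<alpha> = peval C (b \<alpha>)" for \<alpha>
  unfolding lc by (rule arg_cong[of _ _ "peval C"]) (simp add: b_def vec_eq_iff)
 obtain s1 \<alpha> \<beta> where t: "poly2 (dehom (Comp i)) s1 (\<alpha> * s1 + \<beta>) = 0" "poly2 (pderiv G) s1 (\<alpha> * s1 + \<beta>) ~= 0"
  "poly (pderiv (poly G [:\<beta>, \<alpha>:])) s1 = 0" "poly lc \<alpha> ~= 0" "card {x. poly (poly G [:\<beta>, \<alpha>:]) x = 0} = d - 1"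
 proof -
  have "G = dehom (Comp i) * dehom (Rest i)" unfolding G_def by (rule poly2_inject) (simp add: C_Rest[OF i])
  moreover have "degree (dehom (Comp i)) \<ge> 2" using degree_dehom_eq[OF hom[OF i] Cib2] ds2[OF i] by simp
  moreover have "degree (poly G [:\<beta>, \<alpha>:]) \<le> d" "coeff (poly G [:\<beta>, \<alpha>:]) d = poly lc \<alpha>" for \<alpha> \<beta>
   using degree_along_line[OF homogeneous_C T] lcb by auto
  ultimately show ?thesis
   using ex_simple_tangent[OF _ irreducible_dehom[OF hom[OF i] irr[OF i] ds2[OF i]] _ \<open>finite S0\<close> card_roots nzG \<open>lc ~= 0\<close>] that
   by blast
 qed
 define x where "x = a \<beta> + s1 *s b \<alpha>"
 \<comment> \<open>The coordinates of this line in the dual plane, scaled to have value 1 at the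
   centre \<open>b2\<close>.\<close>
 define n where "n = m2 - \<beta> *s w + \<alpha> *s v"
 have n_a: "dot (a \<beta>) n = 0" and n_b: "dot (b \<alpha>) n = 0" and n_b2: "dot b2 n = 1"
  by (simp_all add: a_def b_def n_def)
 have "n ~= 0" using n_b2 by auto
 have xp: "x = ppoint s1 (\<alpha> * s1 + \<beta>)" by (simp add: x_def ab)
 have span: "y = dot y w *s a \<beta> + (- dot y v) *s b \<alpha>" if "dot y n = 0" for y
 proof -
  have "dot y m2 = \<beta> * dot y w - \<alpha> * dot y v" using that by (simp add: n_def algebra_simps add_eq_0_iff2)
  then show ?thesis by (subst expand[of y]) (simp only: a_def b_def, simp add: vec_eq_iff algebra_simps)
 qed
 have "line_points C n = (%s. proj_pt (a \<beta> + s *s b \<alpha>)) ` {s. poly (poly G [:\<beta>, \<alpha>:]) s = 0}"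
  unfolding line_points_eq[OF homogeneous_C \<open>n ~= 0\<close>]
 proof (intro equalityI subsetI)
  fix P assume "P \<in> proj_pt ` {x. x ~= 0 & peval C x = 0 & dot x n = 0}"
  then obtain y where y: "y ~= 0" "peval C y = 0" "dot y n = 0" "P = proj_pt y" by blast
  have yw: "dot y w ~= 0"
  proof
   assume "dot y w = 0"
   then have e: "y = (- dot y v) *s b \<alpha>" using span[OF y(3)] by simp
   have "- dot y v ~= 0" using e y(1) by auto
   moreover define c where "c = - dot y v"
   ultimately have "peval C (c *s b \<alpha>) ~= 0" using peval_scale[OF homogeneous_C, of c "b \<alpha>"] t(4) lcb by simp
   then show False using e y(2) by (simp add: c_def)
  qed
  define c s where "c = dot y w" and "s = - dot y v / dot y w"
  have e: "c ~= 0" "y = c *s (a \<beta> + s *s b \<alpha>)"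
  proof -
   show "c ~= 0" using yw by (simp add: c_def)
   show "y = c *s (a \<beta> + s *s b \<alpha>)"
    by (subst span[OF y(3)]) (use yw in \<open>simp add: c_def s_def vec_eq_iff algebra_simps\<close>)
  qed
  then have "peval C (a \<beta> + s *s b \<alpha>) = 0" "P = proj_pt (a \<beta> + s *s b \<alpha>)"
   using y(2,4) peval_scale[OF homogeneous_C, of c "a \<beta> + s *s b \<alpha>"] proj_pt_scale[OF e(1), of "a \<beta> + s *s b \<alpha>"]
   by (simp_all del: vector_add_ldistrib vec.scale_right_distrib)
  then show "P \<in> (%s. proj_pt (a \<beta> + s *s b \<alpha>)) ` {s. poly (poly G [:\<beta>, \<alpha>:]) s = 0}" using T by auto
 next
  fix P assume "P \<in> (%s. proj_pt (a \<beta> + s *s b \<alpha>)) ` {s. poly (poly G [:\<beta>, \<alpha>:]) s = 0}"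
  then obtain s where "P = proj_pt (a \<beta> + s *s b \<alpha>)" "peval C (a \<beta> + s *s b \<alpha>) = 0" using T by auto
  then show "P \<in> proj_pt ` {x. x ~= 0 & peval C x = 0 & dot x n = 0}"
   using n_a n_b ppoint_nonzero[of s "\<alpha> * s + \<beta>"] by (auto simp: ab)
 qed
 moreover have "inj_on (%s. proj_pt (a \<beta> + s *s b \<alpha>)) A" for A
 proof (rule inj_onI)
  fix s s' assume "proj_pt (a \<beta> + s *s b \<alpha>) = proj_pt (a \<beta> + s' *s b \<alpha>)"
  then obtain c where c: "ppoint s' (\<alpha> * s' + \<beta>) = c *s ppoint s (\<alpha> * s + \<beta>)"
   using proj_pt_eq_iff ppoint_nonzero unfolding ab[symmetric] by metis
  have "dot (ppoint s' (\<alpha> * s' + \<beta>)) w = c * dot (ppoint s (\<alpha> * s + \<beta>)) w"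
   "dot (ppoint s' (\<alpha> * s' + \<beta>)) v = c * dot (ppoint s (\<alpha> * s + \<beta>)) v" unfolding c by simp_all
  then show "s = s'" by (simp add: ppoint_def)
 qed
 ultimately have card: "card (line_points C n) = d - 1" using t(5) by (simp add: card_image)
 obtain D where D: "!!a b t. a + t *s b = x ==> ((%t. peval C (a + t *s b)) has_field_derivative D b) (at t)"
  "!!h k. D (h + k) = D h + D k" "!!c h. D (c *s h) = c * D h"
  using ex_directional_derivative[of x C] by metis
 have Cix: "peval (Comp i) x = 0" using t(1) by (simp add: xp)
 then have Cx: "peval C x = 0" by (simp add: C_Rest[OF i])
 have "D b2 = poly2 (pderiv G) s1 (\<alpha> * s1 + \<beta>)"
 proof (rule DERIV_unique)
  show "((%y. poly2 G s1 y) has_field_derivative poly2 (pderiv G) s1 (\<alpha> * s1 + \<beta>)) (at (\<alpha> * s1 + \<beta>))"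
   by (rule poly2_DERIV_y)
  have "(b1 - s1 *s b0) + (\<alpha> * s1 + \<beta>) *s b2 = x" by (simp add: xp ppoint_def)
  from D(1)[OF this] show "((%y. poly2 G s1 y) has_field_derivative D b2) (at (\<alpha> * s1 + \<beta>))"
   by (simp add: G_def ppoint_def)
 qed
 then have Db2: "D b2 ~= 0" using t(2) by simp
 have Db: "D (b \<alpha>) = 0"
 proof (rule DERIV_unique)
  show "((%s. peval C (a \<beta> + s *s b \<alpha>)) has_field_derivative D (b \<alpha>)) (at s1)" by (rule D(1)) (simp add: x_def)
  show "((%s. peval C (a \<beta> + s *s b \<alpha>)) has_field_derivative 0) (at s1)"
   using poly_DERIV[of "poly G [:\<beta>, \<alpha>:]" s1] t(3) by (simp add: T[abs_def])
 qed
 \<comment> \<open>The form stays 0 along the ray through \<open>x\<close>, which is Euler's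
   relation at a point of the curve. With \<open>Db\<close>, the differential vanishes on all
   vectors of the tangent line.\<close>
 have Dx: "D x = 0"
 proof (rule DERIV_unique)
  show "((%t. peval C (0 + t *s x)) has_field_derivative D x) (at 1)" by (rule D(1)) simp
  show "((%t. peval C (0 + t *s x)) has_field_derivative 0) (at 1)"
   using Cx peval_scale[OF homogeneous_C] by simp
 qed
 have Da: "D (a \<beta>) = 0"
  using D(2)[of "a \<beta>" "s1 *s b \<alpha>"] Dx Db by (simp add: x_def D(3))
 have Dn: "D h = D b2 * dot h n" for h
 proof -
  have "dot (h - dot h n *s b2) n = 0" by (simp add: n_b2)
  from span[OF this] have "D (h - dot h n *s b2) = 0"
   using D(2,3) Da Db by (metis add.right_neutral mult_zero_right)
  then show ?thesis using D(2)[of "h - dot h n *s b2" "dot h n *s b2"] by (simp add: D(3) mult.commute)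
 qed
 show ?thesis
  using \<open>n ~= 0\<close> ppoint_nonzero[of s1 "\<alpha> * s1 + \<beta>"] n_a n_b Cix card Db2 D(1)
  by (intro exI[of _ n] exI[of _ x] exI[of _ "D b2"]) (auto simp: xp[symmetric] x_def simp flip: Dn)
qed

end

section \<open>Loops of good lines and the points of the curve that follow them\<close>

context plane_curve_cut begin

text \<open>Line and point are kept in homogeneous coordinates. The lines form a loop of vectors,
  while the point may end elsewhere than it starts.\<close>

definition moves :: "nat => complex^3 => proj_plane => proj_plane => (real => complex^3) => bool" where
 "moves i v P Q \<gamma> \<longleftrightarrow> path \<gamma> & \<gamma> 0 = v & \<gamma> 1 = v & (\<forall>t\<in>{0..1}. \<gamma> t ~= 0 & good (\<gamma> t)) &
  (\<exists>c. path c & (\<forall>t\<in>{0..1}. c t ~= 0 & dot (c t) (\<gamma> t) = 0 & peval (Comp i) (c t) = 0) &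
   proj_pt (c 0) = P & proj_pt (c 1) = Q)"

lemma continuous_on_vec_scale: "continuous_on S f ==> continuous_on S (%t. f t *s (v :: complex^3))"
 unfolding vector_scalar_mult_def by (intro continuous_intros)

text \<open>The covering of the pencil by the roots of the irreducible \<open>G\<close> is path
  connected, and a path in it projects to the loop of lines. The loop stays in the pencil, so its
  centre lies on all these lines.\<close>

lemma pencil_moves:
 assumes m: "pencil v m1 m2" and v: "good v" and i: "i \<in> {1..k}"
  and x: "x ~= 0" "peval (Comp i) x = 0" "dot x v = 0" "dot x m1 ~= 0"
  and z: "z ~= 0" "peval (Comp i) z = 0" "dot z v = 0" "dot z m1 ~= 0"
 shows "\<exists>s. moves i v (proj_pt x) (proj_pt z) (%t. pencil.pline v m1 (s t))"
proof -
 interpret irreducible_form v m1 m2 "Comp i" "ds i"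
  by (rule irreducible_form_I[OF m hom[OF i] irr[OF i] ds2[OF i]])
 have pl: "pline 0 = v" by (simp add: pline_def)
 define S0 where "S0 = {s. \<not> good (pline s)}"
 have "finite S0" unfolding S0_def by (rule finite_bad[OF m, of 0]) (simp add: pl v)
 have c: "card (line_points (Comp i) (pline s)) = ds i" if "s \<notin> S0" for s
  using that i by (auto simp: S0_def good_def transversal_def)
 interpret cov: irreducible_covering G S0
 proof
  show "degree G > 0" using card_line_imp(4)[OF c[of 0]] v by (simp add: S0_def pl)
  show "card {y. poly2 G s y = 0} = degree G" if "s \<notin> S0" for s
   using card_line_imp(2,3)[OF c[OF that]] by simp
 qed (use irrG \<open>finite S0\<close> in auto)
 have rep: "\<exists>c y. c ~= 0 & u = c *s ppoint 0 y & (0, y) \<in> cov.W & proj_pt u = proj_pt (ppoint 0 y)"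
  if u: "u ~= 0" "peval (Comp i) u = 0" "dot u v = 0" "dot u m1 ~= 0" for u
 proof -
  obtain c y where c: "c ~= 0" "u = c *s ppoint 0 y" using on_pline_cases[of u 0] u pl by auto
  then have "peval (Comp i) (ppoint 0 y) = 0"
   using u(2) peval_scale[OF hom[OF i], of c "ppoint 0 y"] by simp
  then have "(0, y) \<in> cov.W" using v unfolding cov.W_def by (simp add: S0_def pl)
  then show ?thesis using c by auto
 qed
 obtain y1 where y1: "(0, y1) \<in> cov.W" "proj_pt x = proj_pt (ppoint 0 y1)" using rep[OF x] by blast
 obtain y2 where y2: "(0, y2) \<in> cov.W" "proj_pt z = proj_pt (ppoint 0 y2)" using rep[OF z] by blast
 obtain p where p: "path p" "path_image p \<subseteq> cov.W" "pathstart p = (0, y1)" "pathfinish p = (0, y2)"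
  using cov.path_component_roots[OF y1(1) y2(1)] unfolding path_component_def by blast
 have pW: "p t \<in> cov.W" if "t \<in> {0..1}" for t using p(2) that by (auto simp: path_image_def)
 have cont: "continuous_on {0..1} (%t. fst (p t))" "continuous_on {0..1} (%t. snd (p t))"
  using p(1) unfolding path_def by (auto intro: continuous_on_fst continuous_on_snd)
 have "moves i v (proj_pt x) (proj_pt z) (%t. pline (fst (p t)))"
  unfolding moves_def
 proof (intro conjI exI[of _ "%t. ppoint (fst (p t)) (snd (p t))"] ballI)
  show "path (%t. pline (fst (p t)))"
   unfolding path_def pline_def by (intro continuous_intros continuous_on_vec_scale cont)
  show "path (%t. ppoint (fst (p t)) (snd (p t)))"
   unfolding path_def ppoint_def by (intro continuous_intros continuous_on_vec_scale cont)
  show "peval (Comp i) (ppoint (fst (p t)) (snd (p t))) = 0" if "t \<in> {0..1}" for t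
   using pW[OF that] by (auto simp: cov.W_def split: prod.splits)
  show "good (pline (fst (p t)))" if "t \<in> {0..1}" for t
   using pW[OF that] unfolding cov.W_def by (auto simp: S0_def)
 qed (use p y1 y2 pl pline_nonzero ppoint_nonzero in \<open>auto simp: pathstart_def pathfinish_def\<close>)
 then show ?thesis by (rule exI[of _ "%t. fst (p t)"])
qed

text \<open>In the pencil centred at \<open>R\<close> the point \<open>R\<close> can stay where it
  is, while the other intersections form a connected covering.\<close>

lemma moves_two_transitive:
 assumes v: "good v" "v ~= 0" and i: "i \<in> {1..k}"
  and P: "P \<in> line_points (Comp i) v" "Q \<in> line_points (Comp i) v" "R \<in> line_points (Comp i) v" "P ~= R" "Q ~= R"
 shows "\<exists>\<gamma>. moves i v P Q \<gamma> & moves i v R R \<gamma>"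
proof -
 obtain x y z where x: "x ~= 0" "peval (Comp i) x = 0" "dot x v = 0" "P = proj_pt x"
  and z: "z ~= 0" "peval (Comp i) z = 0" "dot z v = 0" "Q = proj_pt z"
  and y: "y ~= 0" "peval (Comp i) y = 0" "dot y v = 0" "R = proj_pt y"
  using P unfolding line_points_eq[OF hom[OF i] v(2)] by blast
 obtain m1 m2 where m: "pencil v m1 m2" "dot y m1 = 0" using ex_second_line_through[OF y(1) v(2)] by blast
 interpret pencil v m1 m2 by fact
 have ne: "dot u m1 ~= 0" if "u ~= 0" "dot u v = 0" "proj_pt u ~= R" for u
 proof
  assume "dot u m1 = 0"
  define a b where "a = dot u m2" and "b = dot y m2"
  have "u = a *s b2" "y = b *s b2"
   using on_m0_m1[OF that(2) \<open>dot u m1 = 0\<close>] on_m0_m1[OF y(3) m(2)] by (simp_all add: a_def b_def)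
  moreover from this have "a ~= 0" "b ~= 0" using that(1) y(1) by auto
  ultimately show False using that(3) y(4) by simp
 qed
 obtain s where s: "moves i v P Q (%t. pline (s t))"
  using pencil_moves[OF m(1) v(1) i x(1-3) ne z(1-3) ne] x z P(4,5) by blast
 have "moves i v R R (%t. pline (s t))"
  unfolding moves_def
 proof (intro conjI exI[of _ "%_. y"])
  show "\<forall>t\<in>{0..1}. y ~= 0 & dot y (pline (s t)) = 0 & peval (Comp i) y = 0"
   using y m(2) by (simp add: pline_def)
  show "path (%_. y)" by (simp add: path_def)
 qed (use s y(4) in \<open>auto simp: moves_def\<close>)
 with s show ?thesis by blast
qed

text \<open>On good lines the component has no point in common with the rest of the curve, so the
  interval would be covered by two disjoint closed sets.\<close>

lemma component_along_path:
 assumes \<gamma>: "!!t. t \<in> {0..1} ==> \<gamma> t ~= 0 & good (\<gamma> t)" and c: "path c"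
  "!!t. t \<in> {0..1} ==> c t ~= 0 & dot (c t) (\<gamma> t) = 0 & peval C (c t) = 0"
  and i: "i \<in> {1..k}" "peval (Comp i) (c 0) = 0" and t: "t \<in> {0..1::real}"
 shows "peval (Comp i) (c t) = 0"
proof -
 have cl: "closedin (top_of_set {0..1}) {t \<in> {0..1}. peval F (c t) = 0}" for F
 proof -
  have "continuous_on {0..1} (%t. peval F (c t))"
   using c(1) unfolding path_def continuous_on_def by (auto intro!: tendsto_poly_eval tendsto_vec_nth)
  then show ?thesis using continuous_closedin_preimage_constant[of "{0..1}" "%t. peval F (c t)" 0] by simp
 qed
 let ?A = "{t \<in> {0..1}. peval (Comp i) (c t) = 0}" and ?B = "{t \<in> {0..1}. peval (Rest i) (c t) = 0}"
 have "?A \<inter> ?B = {}"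
  using transversal_not_both[OF _ i(1)] \<gamma> c(2) by (fastforce simp: good_def)
 moreover have zero: "peval (Comp i) (c t) = 0 \<or> peval (Rest i) (c t) = 0" if "t \<in> {0..1}" for t
  using c(2)[OF that] C_Rest[OF i(1)] by auto
 then have "?A \<union> ?B = {0..1}" by blast
 moreover have "?A ~= {}" using i(2) by force
 ultimately have "?B = {}"
  using cl[of "Comp i"] cl[of "Rest i"] connected_closedin_eq[of "{0..1::real}"]
  by (metis (no_types, lifting) connected_Icc)
 then show ?thesis using c(2)[OF t] C_Rest[OF i(1)] t by auto
qed

lemma continuous_peval_ppoint:
 "continuous_on UNIV (%z. peval F (pencil.ppoint m0 m1 m2 (fst z) (snd z)))" if "pencil m0 m1 m2"
proof -
 interpret pencil m0 m1 m2 by fact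
 have "continuous_on UNIV (%z :: complex \<times> complex. ppoint (fst z) (snd z))"
  unfolding ppoint_def by (intro continuous_intros continuous_on_vec_scale)
 then show ?thesis unfolding continuous_on_def by (auto intro!: tendsto_poly_eval tendsto_vec_nth)
qed

text \<open>The loop is a small circle around a simple tangent \<open>n\<close> in a pencil
  containing \<open>n\<close>. All components are followed together, because the loop has to fix
  every intersection except two.\<close>

lemma moves_transposition:
 assumes i: "i \<in> {1..k}"
 shows "\<exists>v \<gamma> P Q. v ~= 0 & good v & P ~= Q & P \<in> line_points (Comp i) v & Q \<in> line_points (Comp i) v &
  (\<forall>j\<in>{1..k}. \<forall>R\<in>line_points (Comp j) v. moves j v R (swap P Q R) \<gamma>)"
proof -
 obtain n x \<kappa> where n: "n ~= 0" and x: "x ~= 0" "dot x n = 0" "peval (Comp i) x = 0"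
  and card: "card (line_points C n) = d - 1" and \<kappa>: "\<kappa> ~= 0"
  and D: "!!a b t. a + t *s b = x ==> ((%t. peval C (a + t *s b)) has_field_derivative \<kappa> * dot b n) (at t)"
  using ex_simple_tangent_line[OF i] by metis
 have "ds i \<le> d" unfolding d_def using i by (intro member_le_sum) auto
 then have "d \<ge> 2" using ds2[OF i] by simp
 then have fin: "finite (line_points C n)" using card by (intro card_ge_0_finite) simp
 have "finite (hcoord ` line_points C n)" "0 \<notin> hcoord ` line_points C n"
  using fin hcoord(1) by (simp, force)
 \<comment> \<open>A good line meeting \<open>n\<close> off the curve: the pencil of
   \<open>n\<close> and \<open>l\<close> then has finitely many bad lines, and its centre is not on
   \<open>C\<close>.\<close>
 then obtain l where l: "l ~= 0" "good l" "!!P. P \<in> line_points C n ==> dot (hcoord P) l ~= 0"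
  using ex_good_avoiding[of "hcoord ` line_points C n"] by blast
 have l': "dot y l ~= 0" if y: "y ~= 0" "dot y n = 0" "peval C y = 0" for y
 proof -
  have "proj_pt y \<in> line_points C n" using y n by (auto simp: line_points_eq[OF homogeneous_C])
  then have "dot (hcoord (proj_pt y)) l ~= 0" by (rule l(3))
  moreover obtain c where c: "y = c *s hcoord (proj_pt y)" "c ~= 0"
   using hcoord proj_pt_eq_iff y(1) by metis
  have "dot y l = c * dot (hcoord (proj_pt y)) l" by (subst c(1)) simp
  ultimately show ?thesis using c(2) by simp
 qed
 have Cx: "peval C x = 0" using x(3) by (simp add: C_Rest[OF i])
 have "l - n ~= c *s n" for c
 proof
  assume e: "l - n = c *s n"
  have "l = c *s n + n" unfolding e[symmetric] by simp
  then show False using l'[OF x(1,2) Cx] x(2) by simp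
 qed
 then obtain m2 where m: "pencil n (l - n) m2" using pencil_ex n by blast
 then interpret pencil n "l - n" m2 .
 have pl0: "pline 0 = n" and pl1: "pline 1 = l" by (simp_all add: pline_def)
 have Cb2: "peval C b2 ~= 0"
  using l'[of b2] b2_nonzero dot_b2_pline[of 0] dot_b2_pline[of 1] by (auto simp: pl0 pl1)
 obtain c y0 where c: "c ~= 0" "x = c *s ppoint 0 y0"
  using on_pline_cases[of x 0] x(1,2) Cx Cb2 peval_scale[OF homogeneous_C] pl0 by auto
 define G where "G = dehom C"
 have nzG: "at_s G s ~= 0" "degree (at_s G s) = d" for s
  unfolding G_def by (rule at_s_nonzero[OF homogeneous_C Cb2])+
 have degG: "degree G = d" unfolding G_def by (rule degree_dehom_eq[OF homogeneous_C Cb2])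
 have "finite {y. poly2 G 0 y = 0}" using poly_roots_finite[OF nzG(1)[of 0]] by simp
 from card_line_points_pline[OF homogeneous_C this[unfolded G_def]] Cb2
 have cardG: "card {y. poly2 G 0 y = 0} = degree G - 1" by (simp add: pl0 card degG) (simp add: G_def)
 have scale: "peval C (c *s z) = c ^ d * peval C z" for z by (rule peval_scale[OF homogeneous_C])
 \<comment> \<open>Moving \<open>y\<close> stays on \<open>n\<close>, where the differential of
   \<open>C\<close> vanishes; moving \<open>s\<close>, as done next, leaves \<open>n\<close> and
   gives a nonzero derivative.\<close>
 have "c ^ d * poly2 (pderiv G) 0 y0 = \<kappa> * dot (c *s b2) n"
 proof (rule DERIV_unique)
  have "c *s b1 + y0 *s (c *s b2) = x" using c(2) by (simp add: ppoint_def vec_eq_iff algebra_simps)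
  from D[OF this] show "((%y. peval C (c *s b1 + y *s (c *s b2))) has_field_derivative \<kappa> * dot (c *s b2) n) (at y0)" .
  have "(%y. peval C (c *s b1 + y *s (c *s b2))) = (%y. c ^ d * poly2 G 0 y)"
  proof
   fix y
   have "c *s b1 + y *s (c *s b2) = c *s ppoint 0 y" by (simp add: ppoint_def vec_eq_iff algebra_simps)
   then show "peval C (c *s b1 + y *s (c *s b2)) = c ^ d * poly2 G 0 y" unfolding G_def poly2_dehom by (metis scale)
  qed
  then show "((%y. peval C (c *s b1 + y *s (c *s b2))) has_field_derivative c ^ d * poly2 (pderiv G) 0 y0) (at y0)"
   using DERIV_cmult[OF poly2_DERIV_y] by simp
 qed
 then have dy: "poly2 (pderiv G) 0 y0 = 0" using c(1) by simp
 have "c ^ d * poly2 (sderiv G) 0 y0 = \<kappa> * dot ((- c) *s b0) n"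
 proof (rule DERIV_unique)
  have "c *s (b1 + y0 *s b2) + 0 *s ((- c) *s b0) = x" using c(2) by (simp add: ppoint_def)
  from D[OF this] show "((%s. peval C (c *s (b1 + y0 *s b2) + s *s ((- c) *s b0))) has_field_derivative
   \<kappa> * dot ((- c) *s b0) n) (at 0)" .
  have "(%s. peval C (c *s (b1 + y0 *s b2) + s *s ((- c) *s b0))) = (%s. c ^ d * poly2 G s y0)"
  proof
   fix s
   have "c *s (b1 + y0 *s b2) + s *s ((- c) *s b0) = c *s ppoint s y0" by (simp add: ppoint_def vec_eq_iff algebra_simps)
   then show "peval C (c *s (b1 + y0 *s b2) + s *s ((- c) *s b0)) = c ^ d * poly2 G s y0" unfolding G_def poly2_dehom by (metis scale)
  qed
  then show "((%s. peval C (c *s (b1 + y0 *s b2) + s *s ((- c) *s b0))) has_field_derivative c ^ d * poly2 (sderiv G) 0 y0) (at 0)"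
   using DERIV_cmult[OF poly2_DERIV_s] by simp
 qed
 then have ds: "poly2 (sderiv G) 0 y0 ~= 0" using c(1) \<kappa> by auto
 have y0: "peval (Comp i) (ppoint 0 y0) = 0" "poly2 G 0 y0 = 0"
  using x(3) Cx c peval_scale[OF hom[OF i]] scale by (simp_all add: G_def)
 \<comment> \<open>At a common zero of both factors the derivative of the product by
   \<open>s\<close> would vanish, contrary to \<open>ds\<close>.\<close>
 have "peval (Rest i) (ppoint 0 y0) ~= 0"
 proof
  assume R0: "peval (Rest i) (ppoint 0 y0) = 0"
  have "((%s. poly2 (dehom (Comp i)) s y0 * poly2 (dehom (Rest i)) s y0) has_field_derivative
   poly2 (sderiv (dehom (Comp i))) 0 y0 * poly2 (dehom (Rest i)) 0 y0 +
   poly2 (sderiv (dehom (Rest i))) 0 y0 * poly2 (dehom (Comp i)) 0 y0) (at 0)"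
   by (rule DERIV_mult[OF poly2_DERIV_s poly2_DERIV_s])
  moreover have "(%s. poly2 (dehom (Comp i)) s y0 * poly2 (dehom (Rest i)) s y0) = (%s. poly2 G s y0)"
   by (simp add: G_def C_Rest[OF i])
  ultimately have "((%s. poly2 G s y0) has_field_derivative 0) (at 0)" using R0 y0 by simp
  then show False using poly2_DERIV_s[of G y0 0] ds DERIV_unique by blast
 qed
 moreover have "open {z. peval (Rest i) (ppoint (fst z) (snd z)) ~= 0}"
  using continuous_peval_ppoint[OF m, of "Rest i"] by (intro open_Collect_neq continuous_on_const)
 ultimately have "\<exists>\<delta>>0. \<forall>z. dist z (0, y0) < \<delta> --> z \<in> {z. peval (Rest i) (ppoint (fst z) (snd z)) ~= 0}"
  unfolding open_dist by simp
 then obtain \<delta> where \<delta>: "\<delta> > 0" "!!z. dist z (0, y0) < \<delta> ==> peval (Rest i) (ppoint (fst z) (snd z)) ~= 0"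
  by auto
 define Q where "Q \<epsilon> \<longleftrightarrow> (\<exists>u v. u ~= v & dist u y0 < \<delta> / 2 & dist v y0 < \<delta> / 2 &
   poly2 G (of_real \<epsilon>) u = 0 & poly2 G (of_real \<epsilon>) v = 0 &
   (\<forall>w. poly2 G (of_real \<epsilon>) w = 0 --> (\<exists>p. path p & p 0 = w & p 1 = swap u v w &
    (\<forall>t\<in>{0..1}. poly2 G (of_real \<epsilon> * exp (2 * pi * \<i> * of_real t)) (p t) = 0))))" for \<epsilon> :: real
 have "degree (at_s G 0) = degree G" "\<delta> / 2 > 0" using \<delta>(1) by (simp_all add: nzG degG)
 from simple_tangent_monodromy[OF nzG(1) this(1) cardG y0(2) dy ds this(2), folded Q_def] nzG(1)
 obtain \<epsilon>0 where \<epsilon>0: "\<epsilon>0 > 0" "!!\<epsilon>. 0 < \<epsilon> ==> \<epsilon> < \<epsilon>0 ==> Q \<epsilon>" by auto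
 define bad where "bad = {s. \<not> good (pline s)}"
 have "finite bad" unfolding bad_def by (rule finite_bad[OF m, of 1]) (simp add: pl1 l)
 \<comment> \<open>The radius is chosen different from the absolute values of the bad parameters, so
   that the whole circle consists of good lines.\<close>
 then have "infinite ({0<..<min \<epsilon>0 (\<delta> / 2)} - cmod ` bad)" using \<epsilon>0(1) \<delta>(1) by (intro Diff_infinite_finite) auto
 then have "{0<..<min \<epsilon>0 (\<delta> / 2)} - cmod ` bad ~= {}" using finite.emptyI by metis
 then obtain \<epsilon> where "\<epsilon> \<in> {0<..<min \<epsilon>0 (\<delta> / 2)} - cmod ` bad" by blast
 then have \<epsilon>: "0 < \<epsilon>" "\<epsilon> < \<epsilon>0" "\<epsilon> < \<delta> / 2" "\<epsilon> \<notin> cmod ` bad" by auto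
 obtain u w where uw: "u ~= w" "dist u y0 < \<delta> / 2" "dist w y0 < \<delta> / 2" "poly2 G \<epsilon> u = 0" "poly2 G \<epsilon> w = 0"
  "!!z. poly2 G \<epsilon> z = 0 ==> (\<exists>p. path p & p 0 = z & p 1 = swap u w z &
    (\<forall>t\<in>{0..1}. poly2 G (\<epsilon> * exp (2 * pi * \<i> * of_real t)) (p t) = 0))"
  using \<epsilon>0(2)[OF \<epsilon>(1,2)] unfolding Q_def by blast
 define v where "v = pline \<epsilon>"
 have "v ~= 0" by (simp add: v_def pline_nonzero)
 define S where "S t = \<epsilon> * exp (2 * pi * \<i> * of_real t)" for t
 define \<gamma> where "\<gamma> t = pline (S t)" for t
 have "cmod (S t) = \<epsilon>" for t using \<epsilon>(1) by (simp add: S_def norm_mult)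
 then have goodS: "good (pline (S t))" for t using \<epsilon>(4) by (force simp: bad_def)
 have S01: "S 0 = \<epsilon>" "S 1 = \<epsilon>" by (simp_all add: S_def)
 have contS: "continuous_on {0..1} S" unfolding S_def by (intro continuous_intros)
 have mem: "proj_pt (ppoint \<epsilon> z) \<in> line_points (Comp i) v" if "poly2 G \<epsilon> z = 0" "dist z y0 < \<delta> / 2" for z
 proof -
  have "dist (complex_of_real \<epsilon>, z) (0, y0) \<le> dist (of_real \<epsilon>) (0 :: complex) + dist z y0"
   unfolding dist_prod_def fst_conv snd_conv by (rule sqrt_sum_squares_le_sum) simp_all
  then have "dist (complex_of_real \<epsilon>, z) (0, y0) < \<delta>" using that(2) \<epsilon>(1,3) by simp
  then have "peval (Rest i) (ppoint \<epsilon> z) ~= 0" using \<delta>(2)[of "(of_real \<epsilon>, z)"] by simp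
  then have "peval (Comp i) (ppoint \<epsilon> z) = 0" using that(1) by (simp add: G_def C_Rest[OF i])
  then show ?thesis unfolding v_def line_points_pline[OF hom[OF i]] by auto
 qed
 define P R0 where "P = proj_pt (ppoint \<epsilon> u)" and "R0 = proj_pt (ppoint \<epsilon> w)"
 have mv: "moves j v R (swap P R0 R) \<gamma>" if j: "j \<in> {1..k}" and R: "R \<in> line_points (Comp j) v" for j R
 proof -
  have "R \<in> line_points C v" using j R by (auto simp: line_points_C)
  then obtain z where z: "poly2 G \<epsilon> z = 0" "R = proj_pt (ppoint \<epsilon> z)"
   using Cb2 unfolding v_def line_points_pline[OF homogeneous_C] by (auto simp: G_def)
  obtain p where p: "path p" "p 0 = z" "p 1 = swap u w z" "!!t. t \<in> {0..1} ==> poly2 G (S t) (p t) = 0"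
   using uw(6)[OF z(1)] unfolding S_def by blast
  have pc: "path (%t. ppoint (S t) (p t))"
   using contS p(1) unfolding path_def ppoint_def by (intro continuous_intros continuous_on_vec_scale) auto
  have "peval (Comp j) (ppoint \<epsilon> z) = 0"
  proof -
   obtain y where y: "y ~= 0" "peval (Comp j) y = 0" "R = proj_pt y"
    using R line_points_eq[OF hom[OF j] \<open>v ~= 0\<close>] by auto
   then obtain a where "ppoint \<epsilon> z = a *s y" using z(2) proj_pt_eq_iff ppoint_nonzero by metis
   then show ?thesis using y(2) peval_scale[OF hom[OF j]] by simp
  qed
  then have "peval (Comp j) (ppoint (S t) (p t)) = 0" if "t \<in> {0..1}" for t
   by (intro component_along_path[OF _ pc _ j _ that, of \<gamma>])
    (use p goodS S01 pline_nonzero ppoint_nonzero in \<open>auto simp: \<gamma>_def G_def\<close>)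
  moreover have "proj_pt (ppoint \<epsilon> (swap u w z)) = swap P R0 R"
   by (auto simp: P_def R0_def z(2) Transposition.transpose_def ppoint_inj)
  moreover have "path \<gamma>" unfolding \<gamma>_def path_def pline_def
   by (intro continuous_intros continuous_on_vec_scale contS)
  ultimately show ?thesis
   unfolding moves_def using p goodS S01 pline_nonzero ppoint_nonzero pc z(2)
   by (intro conjI exI[of _ "%t. ppoint (S t) (p t)"]) (auto simp: \<gamma>_def v_def)
 qed
 have "P ~= R0" using uw(1) by (simp add: P_def R0_def ppoint_inj)
 moreover have "good v" using goodS[of 0] by (simp add: S01 v_def)
 ultimately show ?thesis
  using \<open>v ~= 0\<close> mv mem[OF uw(4,2)] mem[OF uw(5,3)] unfolding P_def R0_def by blast
qed

end

section \<open>Affine charts of the incidence surface\<close>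

lemma ex_rename: "\<exists>q. \<forall>x. poly_eval q x = poly_eval p (%i. x (e i))"
proof (induction p rule: cpoly_induct)
 case (const c) show ?case by (rule exI[of _ "cconst c"]) simp
next
 case (var i) show ?case by (rule exI[of _ "cvar (e i)"]) simp
next
 case (add p q) then show ?case by (metis poly_eval_add)
next
 case (mult p q) then show ?case by (metis poly_eval_mult)
qed

lemma openin_generated_basis:
 assumes "openin (topology_generated_by \<B>) U" "x \<in> U"
  and Int: "!!V W. V \<in> \<B> ==> W \<in> \<B> ==> V \<inter> W \<in> \<B>"
 shows "\<exists>V\<in>\<B>. x \<in> V & V \<subseteq> U"
proof -
 have "generate_topology_on \<B> U" using assms(1) by (simp add: openin_topology_generated_by_iff)
 then show ?thesis using assms(2)
 proof (induction rule: generate_topology_on.induct)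
  case (Int V W)
  then obtain V' W' where "V' \<in> \<B>" "W' \<in> \<B>" "x \<in> V' \<inter> W'" "V' \<subseteq> V" "W' \<subseteq> W" by blast
  then show ?case using assms(3)[of V' W'] by (intro bexI[of _ "V' \<inter> W'"]) auto
 next
  case (UN K)
  then obtain U where U: "U \<in> K" "x \<in> U" by blast
  then show ?case using UN.IH[OF U] by blast
 qed blast+
qed

lemma topspace_generated_by: "topspace (topology_generated_by \<B>) = \<Union>\<B>"
 by (rule topology_generated_by_topspace)

lemma zariski_affine: "zariski (affine_space_of A) = topology_generated_by {{x \<in> A. poly_eval p x ~= 0} | p. True}"
 by (simp add: affine_space_of_def Let_def)

lemma regular_affine: "f \<in> regular (affine_space_of A) U \<longleftrightarrow>
 (\<forall>x\<in>U. \<exists>W p q. openin (zariski (affine_space_of A)) W & x \<in> W & W \<subseteq> U &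
   (\<forall>y\<in>W. poly_eval q y ~= 0 & f y = poly_eval p y / poly_eval q y))"
 by (simp add: affine_space_of_def Let_def)

lemma openin_affine: "openin (zariski (affine_space_of A)) {x \<in> A. poly_eval p x ~= 0}"
 unfolding zariski_affine by (rule topology_generated_by_Basis) blast

lemma topspace_affine [simp]: "topspace (zariski (affine_space_of A)) = A"
proof -
 have "A = {x \<in> A. poly_eval 1 x ~= 0}" by simp
 then show ?thesis unfolding zariski_affine topspace_generated_by by blast
qed

lemma affine_basis:
 assumes "openin (zariski (affine_space_of A)) U" "x \<in> U"
 shows "\<exists>p. poly_eval p x ~= 0 & {y \<in> A. poly_eval p y ~= 0} \<subseteq> U"
proof -
 have *: "V \<inter> W \<in> {{x \<in> A. poly_eval p x ~= 0} | p. True}"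
  if VW: "V \<in> {{x \<in> A. poly_eval p x ~= 0} | p. True}" "W \<in> {{x \<in> A. poly_eval p x ~= 0} | p. True}" for V W
 proof -
  obtain p q where "V = {x \<in> A. poly_eval p x ~= 0}" "W = {x \<in> A. poly_eval q x ~= 0}" using VW by blast
  then have "V \<inter> W = {x \<in> A. poly_eval (p * q) x ~= 0}" by auto
  then show ?thesis by blast
 qed
 show ?thesis
  using openin_generated_basis[OF assms[unfolded zariski_affine] *] by fast
qed

lemma zariski_biproj: "zariski (biprojective_space_of A) =
  topology_generated_by {{x \<in> A. bihom_eval p x ~= 0} | p. \<exists>a b. bihomogeneous p a b}"
 by (simp add: biprojective_space_of_def Let_def)

lemma regular_biproj: "f \<in> regular (biprojective_space_of A) U \<longleftrightarrow>
 (\<forall>x\<in>U. \<exists>W p q a b. openin (zariski (biprojective_space_of A)) W & x \<in> W & W \<subseteq> U &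
   bihomogeneous p a b & bihomogeneous q a b &
   (\<forall>y\<in>W. bihom_eval q y ~= 0 & f y = bihom_eval p y / bihom_eval q y))"
 by (simp add: biprojective_space_of_def Let_def)

lemma bihom_eval_simps [simp]:
 "bihom_eval (p + q) z = bihom_eval p z + bihom_eval q z" "bihom_eval (p * q) z = bihom_eval p z * bihom_eval q z"
 "bihom_eval (p ^ n) z = bihom_eval p z ^ n" "bihom_eval (cconst c) z = c" "bihom_eval 0 z = 0" "bihom_eval 1 z = 1"
 "bihom_eval (cvar (Inl i)) z = hcoord (fst z) $ i" "bihom_eval (cvar (Inr i)) z = hcoord (snd z) $ i"
 by (simp_all add: bihom_eval_def)

lemma openin_biproj: "bihomogeneous p a b ==> openin (zariski (biprojective_space_of A)) {x \<in> A. bihom_eval p x ~= 0}"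
 unfolding zariski_biproj by (rule topology_generated_by_Basis) blast

lemma topspace_biproj [simp]: "topspace (zariski (biprojective_space_of A)) = A"
proof -
 have "A = {x \<in> A. bihom_eval 1 x ~= 0}" by simp
 then show ?thesis unfolding zariski_biproj topspace_generated_by using bihomogeneous_1 by blast
qed

lemma biproj_basis:
 assumes "openin (zariski (biprojective_space_of A)) U" "x \<in> U"
 shows "\<exists>p a b. bihomogeneous p a b & bihom_eval p x ~= 0 & {y \<in> A. bihom_eval p y ~= 0} \<subseteq> U"
proof -
 let ?B = "{{x \<in> A. bihom_eval p x ~= 0} | p. \<exists>a b. bihomogeneous p a b}"
 have *: "V \<inter> W \<in> ?B" if VW: "V \<in> ?B" "W \<in> ?B" for V W
 proof -
  obtain p q a b a' b' where "V = {x \<in> A. bihom_eval p x ~= 0}" "W = {x \<in> A. bihom_eval q x ~= 0}"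
   and pq: "bihomogeneous p a b" "bihomogeneous q a' b'" using VW by blast
  then have "V \<inter> W = {x \<in> A. bihom_eval (p * q) x ~= 0}" by auto
  then show ?thesis using bihomogeneous_mult[OF pq] by blast
 qed
 show ?thesis
  using openin_generated_basis[OF assms[unfolded zariski_biproj] *] by fast
qed

text \<open>Points of affine space are sequences, so the six coordinates of a pair of points have to
  be numbered.\<close>

definition num :: "3 + 3 => nat" where
 "num = (SOME e. bij_betw e UNIV {..<6})"

lemma bij_num: "bij_betw num UNIV {..<6}"
proof -
 have "\<exists>e :: 3 + 3 => nat. bij_betw e UNIV {..<6}"
  using ex_bij_betw_finite_nat[of "UNIV :: (3 + 3) set"] by (simp add: atLeast0LessThan)
 then show ?thesis unfolding num_def by (rule someI_ex)
qed

lemma num_less [simp]: "num i < 6"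
 using bij_betwE[OF bij_num] by auto

lemma inv_num [simp]: "inv_into UNIV num (num i) = i"
 by (rule inv_f_f[OF bij_betw_imp_inj_on[OF bij_num]])

lemma num_cases: "n < 6 ==> (!!i. n = num i ==> P) ==> P"
 using bij_betw_imp_surj_on[OF bij_num] by (metis imageE lessThan_iff)

definition affine_coords :: "3 => 3 => proj_plane \<times> proj_plane => nat => complex" where
 "affine_coords a b z n = (if n < 6 then
   case_sum (($) (chart_coord a (fst z))) (($) (chart_coord b (snd z))) (inv_into UNIV num n) else 0)"

definition left_vec :: "(nat => complex) => complex^3" where "left_vec w = (\<chi> i. w (num (Inl i)))"
definition right_vec :: "(nat => complex) => complex^3" where "right_vec w = (\<chi> i. w (num (Inr i)))"
definition affine_point :: "(nat => complex) => proj_plane \<times> proj_plane" where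
 "affine_point w = (proj_pt (left_vec w), proj_pt (right_vec w))"

lemma left_right_affine_coords [simp]:
 "left_vec (affine_coords a b z) = chart_coord a (fst z)" "right_vec (affine_coords a b z) = chart_coord b (snd z)"
 by (simp_all add: left_vec_def right_vec_def affine_coords_def vec_eq_iff)

lemma affine_point_affine_coords: "z \<in> chart a \<times> chart b ==> affine_point (affine_coords a b z) = z"
 by (auto simp: affine_point_def proj_pt_chart_coord)

text \<open>Denominators are cleared. Equal degrees in both factors allow two summands to be brought
  to the same bidegree by powers of one monomial.\<close>

lemma ex_bihomogenization:
 "\<exists>N p. bihomogeneous p N N & (\<forall>z\<in>chart a \<times> chart b. bihom_eval p z =
   (hcoord (fst z) $ a * hcoord (snd z) $ b) ^ N * poly_eval q (affine_coords a b z))"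
proof (induction q rule: cpoly_induct)
 case (const c) show ?case
  using bihomogeneous_const by (intro exI[of _ 0] exI[of _ "cconst c"]) simp
next
 case (var n)
 show ?case
 proof (cases "n < 6")
  case False
  then show ?thesis using bihomogeneous_0 by (intro exI[of _ 0] exI[of _ 0]) (simp add: affine_coords_def)
 next
  case True
  then obtain i where i: "n = num i" by (rule num_cases)
  show ?thesis
  proof (cases i)
   case (Inl j)
   show ?thesis
    using bihomogeneous_mult[OF bihomogeneous_Inl[of j] bihomogeneous_Inr[of b]] i Inl
    by (intro exI[of _ 1] exI[of _ "cvar (Inl j) * cvar (Inr b)"])
     (auto simp: affine_coords_def chart_coord_def chart_def)
  next
   case (Inr j)
   show ?thesis
    using bihomogeneous_mult[OF bihomogeneous_Inl[of a] bihomogeneous_Inr[of j]] i Inr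
    by (intro exI[of _ 1] exI[of _ "cvar (Inl a) * cvar (Inr j)"])
     (auto simp: affine_coords_def chart_coord_def chart_def)
  qed
 qed
next
 case (add p q)
 let ?u = "cvar (Inl a) * cvar (Inr b)"
 have u: "bihomogeneous (?u ^ n) n n" for n
  using bihomogeneous_power[OF bihomogeneous_mult[OF bihomogeneous_Inl[of a] bihomogeneous_Inr[of b]], of n] by simp
 obtain N p' M q' where *: "bihomogeneous p' N N" "bihomogeneous q' M M"
  "\<forall>z\<in>chart a \<times> chart b. bihom_eval p' z = (hcoord (fst z) $ a * hcoord (snd z) $ b) ^ N * poly_eval p (affine_coords a b z)"
  "\<forall>z\<in>chart a \<times> chart b. bihom_eval q' z = (hcoord (fst z) $ a * hcoord (snd z) $ b) ^ M * poly_eval q (affine_coords a b z)"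
  using add by blast
 have "bihomogeneous (?u ^ M * p' + ?u ^ N * q') (M + N) (M + N)"
  using bihomogeneous_mult[OF u *(1), of M] bihomogeneous_mult[OF u *(2), of N] bihomogeneous_add by (simp add: add.commute)
 then show ?case
  using *(3,4) by (intro exI[of _ "M + N"] exI[of _ "?u ^ M * p' + ?u ^ N * q'"])
   (auto simp: power_add power_mult_distrib algebra_simps)
next
 case (mult p q)
 obtain N p' M q' where *: "bihomogeneous p' N N" "bihomogeneous q' M M"
  "\<forall>z\<in>chart a \<times> chart b. bihom_eval p' z = (hcoord (fst z) $ a * hcoord (snd z) $ b) ^ N * poly_eval p (affine_coords a b z)"
  "\<forall>z\<in>chart a \<times> chart b. bihom_eval q' z = (hcoord (fst z) $ a * hcoord (snd z) $ b) ^ M * poly_eval q (affine_coords a b z)"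
  using mult by blast
 show ?case
  using *(3,4) bihomogeneous_mult[OF *(1,2)] by (intro exI[of _ "N + M"] exI[of _ "p' * q'"])
   (auto simp: power_add algebra_simps)
qed

section \<open>The incidence surface in a product of two charts\<close>

definition incidence_set :: "3 cpoly => (proj_plane \<times> proj_plane) set" where
 "incidence_set F = {(P, l). P \<in> curve_points F & incident P l}"

definition chart_set :: "3 cpoly => 3 => 3 => (proj_plane \<times> proj_plane) set" where
 "chart_set F a b = incidence_set F \<inter> chart a \<times> chart b"

locale incidence_chart =
 fixes F :: "3 cpoly" and d :: nat and a b :: 3
 assumes hom: "homogeneous F d"
begin

abbreviation "A \<equiv> incidence_set F"
abbreviation "V \<equiv> chart_set F a b"
text \<open>Representatives with \<open>a\<close>-th and \<open>b\<close>-th coordinate 1: a closed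
  subset of affine 6-space that models the chart.\<close>

definition "A' = {w. (\<forall>n\<ge>6. w n = 0) & left_vec w $ a = 1 & right_vec w $ b = 1 &
 peval F (left_vec w) = 0 & dot (left_vec w) (right_vec w) = 0}"

abbreviation "X \<equiv> curve_incidence F"

lemma X_def: "X = biprojective_space_of A" by (simp add: curve_incidence_def incidence_set_def)

lemma affine_coords_in: "z \<in> V ==> affine_coords a b z \<in> A'"
proof -
 assume z: "z \<in> V"
 then have c: "fst z \<in> chart a" "snd z \<in> chart b" by (auto simp: chart_set_def)
 have "peval F (chart_coord a (fst z)) = 0"
  using z curve_points_proj_pt[OF hom chart_coord_nonzero[OF c(1)]] proj_pt_chart_coord[OF c(1)] by (auto simp: chart_set_def incidence_set_def)
 moreover have "dot (chart_coord a (fst z)) (chart_coord b (snd z)) = 0"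
  using z incident_proj_pt[OF chart_coord_nonzero[OF c(1)] chart_coord_nonzero[OF c(2)]]
   proj_pt_chart_coord[OF c(1)] proj_pt_chart_coord[OF c(2)] by (auto simp: chart_set_def incidence_set_def)
 ultimately show ?thesis using chart_coord_nth[OF c(1)] chart_coord_nth[OF c(2)] by (simp add: A'_def) (simp add: affine_coords_def)
qed

lemma vec_nonzero: "w \<in> A' ==> left_vec w ~= 0" "w \<in> A' ==> right_vec w ~= 0"
 by (auto simp: A'_def)

lemma affine_point_in: "w \<in> A' ==> affine_point w \<in> V"
 using vec_nonzero[of w] curve_points_proj_pt[OF hom] incident_proj_pt chart_proj_pt
 by (auto simp: A'_def chart_set_def incidence_set_def affine_point_def)

lemma affine_coords_affine_point: "w \<in> A' ==> affine_coords a b (affine_point w) = w"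
proof
 fix n assume w: "w \<in> A'"
 show "affine_coords a b (affine_point w) n = w n"
 proof (cases "n < 6")
  case True
  then obtain i where i: "n = num i" by (rule num_cases)
  show ?thesis using w vec_nonzero[OF w]
   by (cases i) (auto simp: i affine_coords_def affine_point_def chart_coord_proj_pt A'_def left_vec_def right_vec_def)
 qed (use w in \<open>auto simp: A'_def affine_coords_def\<close>)
qed

lemma affine_algebraic_chart: "affine_algebraic_set 6 A'"
proof -
 obtain q where q: "!!w. poly_eval q w = poly_eval F (%i. w (num (Inl i)))" using ex_rename by metis
 have e: "($) (\<chi> i. f i) = (f :: 3 => complex)" for f by (simp add: fun_eq_iff)
 let ?S = "{cvar (num (Inl a)) + cconst (- 1), cvar (num (Inr b)) + cconst (- 1), q,
  \<Sum>i\<in>UNIV. cvar (num (Inl i)) * cvar (num (Inr i))}"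
 have "A' = {w. (\<forall>n\<ge>6. w n = 0) & (\<forall>p\<in>?S. poly_eval p w = 0)}"
  by (auto simp: A'_def q left_vec_def right_vec_def dot_def eq_neg_iff_add_eq_0 e)
 then show ?thesis unfolding affine_algebraic_set_def by blast
qed

lemma openin_V: "openin (zariski X) V"
proof -
 have "V = {z \<in> A. bihom_eval (cvar (Inl a) * cvar (Inr b)) z ~= 0}" by (auto simp: chart_set_def chart_def)
 then show ?thesis
  unfolding X_def by (simp only:) (rule openin_biproj[OF bihomogeneous_mult[OF bihomogeneous_Inl bihomogeneous_Inr]])
qed

lemma topspace_V [simp]: "topspace (zariski (open_subspace X V)) = V"
 using openin_subset[OF openin_V] by (auto simp: open_subspace_def)

lemma continuous_affine_coords:
 "continuous_map (zariski (open_subspace X V)) (zariski (affine_space_of A')) (affine_coords a b)"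
 unfolding zariski_affine
proof (rule continuous_on_generated_topo)
 fix U assume "U \<in> {{x \<in> A'. poly_eval p x ~= 0} | p. True}"
 then obtain q where U: "U = {x \<in> A'. poly_eval q x ~= 0}" by blast
 obtain N p where p: "bihomogeneous p N N" "!!z. z \<in> chart a \<times> chart b ==> bihom_eval p z =
   (hcoord (fst z) $ a * hcoord (snd z) $ b) ^ N * poly_eval q (affine_coords a b z)"
  using ex_bihomogenization[of a b q] by blast
 have "affine_coords a b -` U \<inter> V = {z \<in> A. bihom_eval p z ~= 0} \<inter> V"
  using affine_coords_in p(2) by (auto simp: U chart_set_def chart_def)
 then show "openin (zariski (open_subspace X V)) (affine_coords a b -` U \<inter> topspace (zariski (open_subspace X V)))"
  unfolding topspace_V using openin_biproj[OF p(1)]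
  by (simp add: open_subspace_def X_def openin_subtopology_Int)
next
 show "affine_coords a b ` topspace (zariski (open_subspace X V)) \<subseteq> \<Union> {{x \<in> A'. poly_eval p x ~= 0} | p. True}"
  using affine_coords_in topspace_affine[of A', unfolded zariski_affine topspace_generated_by] by auto
qed

lemma morphism_affine_coords: "morphism (open_subspace X V) (affine_space_of A') (affine_coords a b)"
 unfolding morphism_def
proof (intro conjI allI impI continuous_affine_coords)
 fix U g assume "openin (zariski (affine_space_of A')) U & g \<in> regular (affine_space_of A') U"
 then have U: "openin (zariski (affine_space_of A')) U" and g: "g \<in> regular (affine_space_of A') U" by auto
 show "g \<circ> affine_coords a b \<in> regular (open_subspace X V) (preimage_in (open_subspace X V) (affine_coords a b) U)"
  unfolding open_subspace_def fun_space.simps unfolding X_def regular_biproj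
 proof
  let ?pre = "preimage_in \<lparr>zariski = subtopology (zariski (biprojective_space_of A)) V, regular = regular (biprojective_space_of A)\<rparr> (affine_coords a b)"
  have pre: "?pre U = {z \<in> V. affine_coords a b z \<in> U}" for U
   unfolding X_def[symmetric] open_subspace_def[symmetric] preimage_in_def by simp
  fix z assume "z \<in> ?pre U"
  then have z: "z \<in> V" "affine_coords a b z \<in> U" by (auto simp: pre)
  obtain W p q where W: "openin (zariski (affine_space_of A')) W" "affine_coords a b z \<in> W" "W \<subseteq> U"
   "!!y. y \<in> W ==> poly_eval q y ~= 0 & g y = poly_eval p y / poly_eval q y"
   using g[unfolded regular_affine, rule_format, OF z(2)] by blast
  obtain N p' where p: "bihomogeneous p' N N" "!!z. z \<in> chart a \<times> chart b ==> bihom_eval p' z =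
    (hcoord (fst z) $ a * hcoord (snd z) $ b) ^ N * poly_eval p (affine_coords a b z)"
   using ex_bihomogenization[of a b p] by blast
  obtain M q' where q: "bihomogeneous q' M M" "!!z. z \<in> chart a \<times> chart b ==> bihom_eval q' z =
    (hcoord (fst z) $ a * hcoord (snd z) $ b) ^ M * poly_eval q (affine_coords a b z)"
   using ex_bihomogenization[of a b q] by blast
  let ?u = "cvar (Inl a) * cvar (Inr b)"
  have u: "bihomogeneous (?u ^ n) n n" for n
   using bihomogeneous_power[OF bihomogeneous_mult[OF bihomogeneous_Inl[of a] bihomogeneous_Inr[of b]], of n] by simp
  \<comment> \<open>The powers of \<open>?u\<close> give numerator and denominator the same
    bidegree.\<close>
  have bp: "bihomogeneous (?u ^ M * p') (M + N) (M + N)" by (rule bihomogeneous_mult[OF u p(1)])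
  have bq: "bihomogeneous (?u ^ N * q') (M + N) (M + N)"
   using bihomogeneous_mult[OF u q(1), of N] by (simp add: add.commute)
  let ?W = "{z \<in> V. affine_coords a b z \<in> W}"
  have "openin (zariski (open_subspace X V)) ?W"
   using openin_continuous_map_preimage[OF continuous_affine_coords W(1)] by simp
  then have "openin (zariski X) ?W"
   using openin_V by (simp add: open_subspace_def openin_open_subtopology)
  moreover have "bihom_eval (?u ^ N * q') y ~= 0 &
   (g \<circ> affine_coords a b) y = bihom_eval (?u ^ M * p') y / bihom_eval (?u ^ N * q') y" if "y \<in> ?W" for y
   using that p(2)[of y] q(2)[of y] W(4)[of "affine_coords a b y"]
   by (auto simp: chart_set_def chart_def power_mult_distrib)
  ultimately show "\<exists>W p q m n. openin (zariski (biprojective_space_of A)) W & z \<in> W & W \<subseteq> ?pre U &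
    bihomogeneous p m n & bihomogeneous q m n & (\<forall>y\<in>W. bihom_eval q y ~= 0 &
     (g \<circ> affine_coords a b) y = bihom_eval p y / bihom_eval q y)"
   using z W(2,3) bp bq unfolding X_def pre
   by (intro exI[of _ ?W] exI[of _ "?u ^ M * p'"] exI[of _ "?u ^ N * q'"] exI[of _ "M + N"]) auto
 qed
qed

lemma ex_dehomogenization:
 "\<exists>q. \<forall>w. poly_eval q w = beval p (left_vec w) (right_vec w)"
proof -
 have "(%i. w (num i)) = case_sum (($) (left_vec w)) (($) (right_vec w))" for w
  by (auto simp: fun_eq_iff left_vec_def right_vec_def split: sum.splits)
 then show ?thesis using ex_rename[of p num] by (simp add: beval_def)
qed

lemma continuous_affine_point:
 "continuous_map (zariski (affine_space_of A')) (zariski X) affine_point"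
 unfolding X_def zariski_biproj
proof (rule continuous_on_generated_topo)
 fix U assume "U \<in> {{x \<in> A. bihom_eval p x ~= 0} | p. \<exists>a b. bihomogeneous p a b}"
 then obtain p m n where U: "U = {x \<in> A. bihom_eval p x ~= 0}" "bihomogeneous p m n" by blast
 obtain q where q: "!!w. poly_eval q w = beval p (left_vec w) (right_vec w)" using ex_dehomogenization by metis
 have "bihom_eval p (affine_point w) = 0 \<longleftrightarrow> poly_eval q w = 0" if "w \<in> A'" for w
  using bihom_eval_proj_pt[OF vec_nonzero[OF that]] U(2) unfolding affine_point_def q by (metis mult_eq_0_iff power_eq_0_iff)
 then have "affine_point -` U \<inter> A' = {w \<in> A'. poly_eval q w ~= 0}"
  using affine_point_in by (auto simp: U chart_set_def)
 then show "openin (zariski (affine_space_of A')) (affine_point -` U \<inter> topspace (zariski (affine_space_of A')))"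
  using openin_affine by simp
next
 show "affine_point ` topspace (zariski (affine_space_of A')) \<subseteq> \<Union> {{x \<in> A. bihom_eval p x ~= 0} | p. \<exists>a b. bihomogeneous p a b}"
  using affine_point_in topspace_biproj[of A, unfolded zariski_biproj topspace_generated_by] by (auto simp: chart_set_def)
qed

lemma morphism_affine_point: "morphism (affine_space_of A') (open_subspace X V) affine_point"
 unfolding morphism_def
proof (intro conjI allI impI)
 show cont: "continuous_map (zariski (affine_space_of A')) (zariski (open_subspace X V)) affine_point"
  using continuous_affine_point affine_point_in by (auto simp: open_subspace_def continuous_map_in_subtopology)
 fix U g assume Ug: "openin (zariski (open_subspace X V)) U & g \<in> regular (open_subspace X V) U"
 then have g: "g \<in> regular (biprojective_space_of A) U" by (auto simp: open_subspace_def X_def)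
 show "g \<circ> affine_point \<in> regular (affine_space_of A') (preimage_in (affine_space_of A') affine_point U)"
  unfolding regular_affine
 proof
  fix w assume "w \<in> preimage_in (affine_space_of A') affine_point U"
  then have w: "w \<in> A'" "affine_point w \<in> U" by (auto simp: preimage_in_def)
  obtain W p q m n where W: "openin (zariski X) W" "affine_point w \<in> W" "W \<subseteq> U"
   and pq: "bihomogeneous p m n" "bihomogeneous q m n"
   "!!y. y \<in> W ==> bihom_eval q y ~= 0 & g y = bihom_eval p y / bihom_eval q y"
   using g[unfolded regular_biproj, rule_format, OF w(2)] unfolding X_def by blast
  obtain p' where p': "!!w. poly_eval p' w = beval p (left_vec w) (right_vec w)" using ex_dehomogenization by metis
  obtain q' where q': "!!w. poly_eval q' w = beval q (left_vec w) (right_vec w)" using ex_dehomogenization by metis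
  let ?W = "{y \<in> A'. affine_point y \<in> W}"
  have "openin (zariski (affine_space_of A')) ?W"
   using openin_continuous_map_preimage[OF continuous_affine_point W(1)] by simp
  moreover have "poly_eval q' y ~= 0 & (g \<circ> affine_point) y = poly_eval p' y / poly_eval q' y" if "y \<in> ?W" for y
  proof -
   have y: "y \<in> A'" "affine_point y \<in> W" using that by auto
   obtain s t where "s ~= 0" "t ~= 0" "bihom_eval p (affine_point y) = s ^ m * t ^ n * poly_eval p' y"
    "bihom_eval q (affine_point y) = s ^ m * t ^ n * poly_eval q' y"
    using bihom_eval_proj_pt[OF vec_nonzero[OF y(1)]] pq(1,2) unfolding affine_point_def p' q' by metis
   then show ?thesis using pq(3)[OF y(2)] by auto
  qed
  ultimately show "\<exists>W p q. openin (zariski (affine_space_of A')) W & w \<in> W &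
    W \<subseteq> preimage_in (affine_space_of A') affine_point U &
    (\<forall>y\<in>W. poly_eval q y ~= 0 & (g \<circ> affine_point) y = poly_eval p y / poly_eval q y)"
   using w W by (intro exI[of _ ?W] exI[of _ p'] exI[of _ q']) (auto simp: preimage_in_def)
 qed
qed

lemma regular_chart_coord:
 "(%z. chart_coord a (fst z) $ i) \<in> regular X V" "(%z. chart_coord b (snd z) $ i) \<in> regular X V"
proof -
 have V: "openin (zariski (biprojective_space_of A)) V" using openin_V by (simp add: X_def)
 show "(%z. chart_coord a (fst z) $ i) \<in> regular X V"
  unfolding X_def regular_biproj
  by (rule ballI, rule exI[of _ V], rule exI[of _ "cvar (Inl i)"], rule exI[of _ "cvar (Inl a)"], rule exI[of _ 1], rule exI[of _ 0])
   (use V in \<open>auto simp: bihomogeneous_Inl[unfolded One_nat_def] chart_set_def chart_def chart_coord_def field_simps\<close>)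
 show "(%z. chart_coord b (snd z) $ i) \<in> regular X V"
  unfolding X_def regular_biproj
  by (rule ballI, rule exI[of _ V], rule exI[of _ "cvar (Inr i)"], rule exI[of _ "cvar (Inr b)"], rule exI[of _ 0], rule exI[of _ 1])
   (use V in \<open>auto simp: bihomogeneous_Inr[unfolded One_nat_def] chart_set_def chart_def chart_coord_def field_simps\<close>)
qed

lemma affine_variety_chart: "affine_variety (open_subspace X V)"
proof -
 have "isomorphism (open_subspace X V) (affine_space_of A') (affine_coords a b)"
  unfolding isomorphism_def topspace_V topspace_affine
  using morphism_affine_coords morphism_affine_point affine_point_affine_coords affine_coords_affine_point
  by (intro conjI exI[of _ affine_point]) (auto simp: chart_set_def)
 then show ?thesis unfolding affine_variety_def using affine_algebraic_chart by blast
qed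

end

section \<open>The complex topology\<close>

context
 fixes Z :: "'z fun_space"
 assumes sp: "space_with_functions Z"
begin

lemma regular_const: "openin (zariski Z) U ==> (%_. c) \<in> regular Z U"
 using sp unfolding space_with_functions_def by blast

lemma regular_mult: "openin (zariski Z) U ==> g \<in> regular Z U ==> h \<in> regular Z U ==> (%x. g x * h x) \<in> regular Z U"
 using sp unfolding space_with_functions_def by blast

lemma regular_restrict:
 assumes "openin (zariski Z) U" "openin (zariski Z) U'" "U' \<subseteq> U" "g \<in> regular Z U"
 shows "g \<in> regular Z U'"
proof -
 have *: "(!!U. U \<in> \<U> ==> openin (zariski Z) U) ==> (g \<in> regular Z (\<Union>\<U>) \<longleftrightarrow> (\<forall>U\<in>\<U>. g \<in> regular Z U))" for \<U>
  by (rule conjunct2[OF sp[unfolded space_with_functions_def], rule_format])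
 have "\<Union>{U, U'} = U" using assms by auto
 moreover have "openin (zariski Z) S" if "S \<in> {U, U'}" for S using that assms by auto
 ultimately show ?thesis using *[of "{U, U'}"] assms(4) by simp
qed

lemma openin_complex: "openin (zariski Z) U ==> g \<in> regular Z U ==> open V ==> openin (complex_topology Z) {x \<in> U. g x \<in> V}"
 unfolding complex_topology_def by (rule topology_generated_by_Basis) blast

lemma openin_complex_zariski: "openin (zariski Z) U ==> openin (complex_topology Z) U"
 using openin_complex[OF _ regular_const[of U 0], of UNIV] by simp

lemma topspace_complex: "topspace (complex_topology Z) = topspace (zariski Z)"
proof
 show "topspace (complex_topology Z) \<subseteq> topspace (zariski Z)"
  unfolding complex_topology_def topspace_generated_by using openin_subset by fastforce
 show "topspace (zariski Z) \<subseteq> topspace (complex_topology Z)"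
  by (rule openin_subset[OF openin_complex_zariski]) simp
qed

lemma limitin_complex:
 assumes "z \<in> topspace (zariski Z)"
  and "!!U g. openin (zariski Z) U ==> z \<in> U ==> g \<in> regular Z U ==>
   (\<forall>\<^sub>F n in F. h n \<in> U) & ((%n. g (h n)) \<longlongrightarrow> g z) F"
 shows "limitin (complex_topology Z) h z F"
 unfolding limitin_def
proof (intro conjI allI impI)
 show "z \<in> topspace (complex_topology Z)" using assms(1) by (simp add: topspace_complex)
 fix B assume "openin (complex_topology Z) B & z \<in> B"
 then have "generate_topology_on {{x \<in> U. g x \<in> V} | U g V. openin (zariski Z) U & g \<in> regular Z U & open V} B" "z \<in> B"
  by (simp_all add: complex_topology_def openin_topology_generated_by_iff)
 then show "\<forall>\<^sub>F n in F. h n \<in> B"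
 proof (induction rule: generate_topology_on.induct)
  case (Int a b)
  then show ?case by (auto intro: eventually_conj)
 next
  case (UN K)
  then obtain U where U: "U \<in> K" "z \<in> U" by blast
  show ?case by (rule eventually_mono[OF UN.IH[OF U]]) (use U in blast)
 next
  case (Basis s)
  then obtain U g V where s: "s = {x \<in> U. g x \<in> V}" "openin (zariski Z) U" "g \<in> regular Z U" "open V" by blast
  then have "z \<in> U" "g z \<in> V" using Basis by auto
  then have "\<forall>\<^sub>F n in F. h n \<in> U" "\<forall>\<^sub>F n in F. g (h n) \<in> V"
   using assms(2)[OF s(2) _ s(3)] topological_tendstoD[OF _ s(4)] by blast+
  then show ?case unfolding s(1) by eventually_elim simp
 qed auto
qed

lemma openin_complex_vec:
 fixes h :: "'z => complex^'n"
 assumes U: "openin (zariski Z) U" and h: "!!i. (%z. h z $ i) \<in> regular Z U" and "open B"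
 shows "openin (complex_topology Z) {z \<in> U. h z \<in> B}"
proof (subst openin_subopen, intro ballI)
 fix z assume z: "z \<in> {z \<in> U. h z \<in> B}"
 then have "h z \<in> B" by simp
 from assms(3)[unfolded open_vec_def, rule_format, OF this]
 obtain A where "\<forall>i. open (A i) & h z $ i \<in> A i" "\<forall>y. (\<forall>i. y $ i \<in> A i) --> y \<in> B" by blast
 then have A: "!!i. open (A i)" "!!i. h z $ i \<in> A i" "!!y. (!!i. y $ i \<in> A i) ==> y \<in> B" by auto
 let ?N = "\<Inter>i\<in>UNIV. {y \<in> U. h y $ i \<in> A i}"
 have "openin (complex_topology Z) ?N"
  by (rule openin_INT2) (auto intro!: openin_complex U h A)
 moreover have "z \<in> ?N" "?N \<subseteq> {z \<in> U. h z \<in> B}" using A z by auto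
 ultimately show "\<exists>N. openin (complex_topology Z) N & z \<in> N & N \<subseteq> {z \<in> U. h z \<in> B}" by blast
qed

end

lemma continuous_map_limitin:
 assumes "!!t. t \<in> J ==> limitin T h (h t) (at t within J)"
 shows "continuous_map (top_of_set J) T h"
 unfolding continuous_map_def
proof (intro conjI allI impI)
 show "h \<in> topspace (top_of_set J) \<rightarrow> topspace T" using assms by (auto simp: limitin_def)
 fix U assume U: "openin T U"
 show "openin (top_of_set J) {x \<in> topspace (top_of_set J). h x \<in> U}"
 proof (subst openin_subopen, intro ballI)
  fix t assume "t \<in> {x \<in> topspace (top_of_set J). h x \<in> U}"
  then have t: "t \<in> J" "h t \<in> U" by auto
  then obtain S where "open S" "t \<in> S" "\<forall>x\<in>S. x ~= t --> x \<in> J --> h x \<in> U"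
   using assms[OF t(1)] U unfolding limitin_def eventually_at_topological by blast
  then show "\<exists>N. openin (top_of_set J) N & t \<in> N & N \<subseteq> {x \<in> topspace (top_of_set J). h x \<in> U}"
   using t by (intro exI[of _ "J \<inter> S"]) (auto simp: openin_open)
 qed
qed

text \<open>Zariski open sets are unions of nonvanishing loci of polynomials, and nonvanishing
  persists under small changes of the coordinates.\<close>

lemma biproj_open_tendsto:
 assumes W: "openin (zariski (biprojective_space_of A)) W" and x: "(x \<longlongrightarrow> x0) \<F>" "x0 ~= 0"
  and v: "(v \<longlongrightarrow> v0) \<F>" "v0 ~= 0" and mem: "(proj_pt x0, proj_pt v0) \<in> W"
  and ev: "\<forall>\<^sub>F n in \<F>. (proj_pt (x n), proj_pt (v n)) \<in> A"
 shows "\<forall>\<^sub>F n in \<F>. (proj_pt (x n), proj_pt (v n)) \<in> W"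
proof -
 obtain s a b where s: "bihomogeneous s a b" "bihom_eval s (proj_pt x0, proj_pt v0) ~= 0"
  "{y \<in> A. bihom_eval s y ~= 0} \<subseteq> W"
  using biproj_basis[OF W mem] by blast
 have iff: "bihom_eval s (proj_pt y, proj_pt w) ~= 0 \<longleftrightarrow> beval s y w ~= 0" if "y ~= 0" "w ~= 0" for y w
  using bihom_eval_proj_pt[OF that] s(1) by (metis mult_eq_0_iff power_eq_0_iff)
 have "\<forall>\<^sub>F n in \<F>. beval s (x n) (v n) ~= 0"
  using tendsto_imp_eventually_ne[OF tendsto_beval[OF x(1) v(1)]] s(2) iff[OF x(2) v(2)] by blast
 moreover have "\<forall>\<^sub>F n in \<F>. x n ~= 0" "\<forall>\<^sub>F n in \<F>. v n ~= 0" using tendsto_imp_eventually_ne x v by blast+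
 ultimately show ?thesis using ev
 proof eventually_elim
  case (elim n)
  then show ?case using iff[of "x n" "v n"] s(3) by blast
 qed
qed

lemma regular_local_quotient:
 assumes "g \<in> regular (biprojective_space_of A) W" "z \<in> W"
 shows "\<exists>W' p q. openin (zariski (biprojective_space_of A)) W' & z \<in> W' &
  (\<forall>y w. y ~= 0 --> w ~= 0 --> (proj_pt y, proj_pt w) \<in> W' -->
   beval q y w ~= 0 & g (proj_pt y, proj_pt w) = beval p y w / beval q y w)"
proof -
 obtain W' p q a b where W': "openin (zariski (biprojective_space_of A)) W'" "z \<in> W'"
  "bihomogeneous p a b" "bihomogeneous q a b"
  and pq: "!!y. y \<in> W' ==> bihom_eval q y ~= 0 & g y = bihom_eval p y / bihom_eval q y"
  using assms(1)[unfolded regular_biproj, rule_format, OF assms(2)] by blast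
 have "beval q y w ~= 0 & g (proj_pt y, proj_pt w) = beval p y w / beval q y w"
  if yw: "y ~= 0" "w ~= 0" "(proj_pt y, proj_pt w) \<in> W'" for y w
 proof -
  obtain s t where "s ~= 0" "t ~= 0" "bihom_eval p (proj_pt y, proj_pt w) = s ^ a * t ^ b * beval p y w"
   "bihom_eval q (proj_pt y, proj_pt w) = s ^ a * t ^ b * beval q y w"
   using bihom_eval_proj_pt[OF yw(1,2)] W'(3,4) by metis
  then show ?thesis using pq[OF yw(3)] by auto
 qed
 then show ?thesis using W'(1,2) by (intro exI[of _ W'] exI[of _ p] exI[of _ q]) auto
qed

lemma regular_tendsto:
 fixes A :: "(proj_plane \<times> proj_plane) set"
 defines "X \<equiv> biprojective_space_of A"
 assumes W: "openin (zariski X) W" "g \<in> regular X W" and x: "(x \<longlongrightarrow> x0) \<F>" "x0 ~= 0" and v: "(v \<longlongrightarrow> v0) \<F>" "v0 ~= 0"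
  and mem: "(proj_pt x0, proj_pt v0) \<in> W" and ev: "\<forall>\<^sub>F n in \<F>. (proj_pt (x n), proj_pt (v n)) \<in> A"
 shows "(\<forall>\<^sub>F n in \<F>. (proj_pt (x n), proj_pt (v n)) \<in> W) &
  ((%n. g (proj_pt (x n), proj_pt (v n))) \<longlongrightarrow> g (proj_pt x0, proj_pt v0)) \<F>"
proof -
 note in_open = biproj_open_tendsto[OF _ x v _ ev]
 obtain W' p q where W': "openin (zariski X) W'" "(proj_pt x0, proj_pt v0) \<in> W'"
  and eq: "!!y w. y ~= 0 ==> w ~= 0 ==> (proj_pt y, proj_pt w) \<in> W' ==>
   beval q y w ~= 0 & g (proj_pt y, proj_pt w) = beval p y w / beval q y w"
  using regular_local_quotient[OF W(2)[unfolded X_def] mem] unfolding X_def by blast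
 have "((%n. beval p (x n) (v n) / beval q (x n) (v n)) \<longlongrightarrow> beval p x0 v0 / beval q x0 v0) \<F>"
  using eq[OF x(2) v(2) W'(2)] by (intro tendsto_divide tendsto_beval x v) auto
 moreover have "\<forall>\<^sub>F n in \<F>. x n ~= 0" "\<forall>\<^sub>F n in \<F>. v n ~= 0" using tendsto_imp_eventually_ne x v by blast+
 then have "\<forall>\<^sub>F n in \<F>. beval p (x n) (v n) / beval q (x n) (v n) = g (proj_pt (x n), proj_pt (v n))"
  using in_open[OF W'(1)[unfolded X_def] W'(2)] by eventually_elim (use eq in simp)
 ultimately have "((%n. g (proj_pt (x n), proj_pt (v n))) \<longlongrightarrow> g (proj_pt x0, proj_pt v0)) \<F>"
  using eq[OF x(2) v(2) W'(2)] by (simp add: tendsto_cong)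
 then show ?thesis using in_open[OF W(1)[unfolded X_def] mem] by blast
qed

lemma pointwise_bounded_subsequence:
 fixes w :: "nat => nat => complex"
 assumes "!!i. bounded (range (%n. w n i))"
 shows "\<exists>r. strict_mono r & (\<forall>i<m. convergent (%n. w (r n) i))"
proof (induction m)
 case 0 show ?case by (rule exI[of _ id]) (simp add: strict_mono_def)
next
 case (Suc m)
 then obtain r where r: "strict_mono r" "\<forall>i<m. convergent (%n. w (r n) i)" by blast
 have "bounded (range (%n. w (r n) m))" by (rule bounded_subset[OF assms[of m]]) auto
 then obtain l s where s: "strict_mono s" "((%n. w (r n) m) \<circ> s) \<longlonglongrightarrow> l"
  using bounded_imp_convergent_subsequence by blast
 have "convergent (%n. w (r (s n)) i)" if "i < Suc m" for i
 proof (cases "i = m")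
  case True
  then show ?thesis using s(2) by (auto simp: convergent_def comp_def)
 next
  case False
  then have "convergent (%n. w (r n) i)" using r that by auto
  then show ?thesis using convergent_subseq_convergent[OF _ s(1), of "%n. w (r n) i"] by (simp add: comp_def)
 qed
 then show ?case using strict_mono_o[OF r(1) s(1)] by (intro exI[of _ "r \<circ> s"]) (auto simp: comp_def)
qed

section \<open>The normalized incidence surface\<close>

locale normalized_incidence =
 fixes F :: "3 cpoly" and d :: nat and Z :: "'z fun_space" and \<nu> :: "'z => proj_plane \<times> proj_plane"
 assumes homF: "homogeneous F d" and normalization: "normalization Z (curve_incidence F) \<nu>"
begin

abbreviation "X \<equiv> curve_incidence F"
abbreviation "T \<equiv> complex_topology Z"

lemma X_def: "X = biprojective_space_of (incidence_set F)" by (simp add: curve_incidence_def incidence_set_def)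

lemma sp: "space_with_functions Z"
 using normalization by (simp add: normalization_def normal_variety_def prevariety_def)

lemma morph: "morphism Z X \<nu>"
 using normalization by (simp add: normalization_def finite_morphism_def)

lemma nu_in: "z \<in> topspace (zariski Z) ==> \<nu> z \<in> incidence_set F"
 using morph continuous_map_image_subset_topspace[of "zariski Z" "zariski X" \<nu>] by (auto simp: morphism_def X_def)

lemma openin_preimage: "openin (zariski X) V ==> openin (zariski Z) (preimage_in Z \<nu> V)"
 using morph openin_continuous_map_preimage[of "zariski Z" "zariski X" \<nu> V] by (simp add: morphism_def preimage_in_def)

lemma regular_preimage: "openin (zariski X) V ==> g \<in> regular X V ==> (%z. g (\<nu> z)) \<in> regular Z (preimage_in Z \<nu> V)"
 using morph by (simp add: morphism_def comp_def)

definition "ZC a b = preimage_in Z \<nu> (chart_set F a b)"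

lemma chart: "incidence_chart F d" by unfold_locales (rule homF)

lemma openin_chart_set: "openin (zariski X) (chart_set F a b)"
 by (rule incidence_chart.openin_V[OF chart])

lemma openin_ZC: "openin (zariski Z) (ZC a b)"
 unfolding ZC_def by (rule openin_preimage[OF openin_chart_set])

lemma in_ZC: "z \<in> ZC a b \<longleftrightarrow> z \<in> topspace (zariski Z) & fst (\<nu> z) \<in> chart a & snd (\<nu> z) \<in> chart b"
 using nu_in[of z] by (auto simp: ZC_def preimage_in_def chart_set_def mem_Times_iff)

lemma regular_coord:
 "(%z. chart_coord a (fst (\<nu> z)) $ i) \<in> regular Z (ZC a b)" "(%z. chart_coord b (snd (\<nu> z)) $ i) \<in> regular Z (ZC a b)"
 unfolding ZC_def
 using regular_preimage[OF openin_chart_set incidence_chart.regular_chart_coord(1)[OF chart]]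
  regular_preimage[OF openin_chart_set incidence_chart.regular_chart_coord(2)[OF chart]] by simp_all

text \<open>Stated for any map \<open>p\<close> with regular chart coordinates, to serve both
  projections of \<open>\<nu>\<close>.\<close>

lemma openin_chart_vimage:
 assumes W: "open W" and p: "!!z. z \<in> topspace (zariski Z) ==> \<exists>i a b. z \<in> ZC a b &
  (\<forall>j. (%y. chart_coord i (p y) $ j) \<in> regular Z (ZC a b)) & (\<forall>y\<in>ZC a b. p y \<in> chart i)"
 shows "openin T {z \<in> topspace (zariski Z). p z \<in> W}"
proof (subst openin_subopen, intro ballI)
 fix z assume z: "z \<in> {z \<in> topspace (zariski Z). p z \<in> W}"
 then obtain i a b where ab: "z \<in> ZC a b" "\<forall>j. (%y. chart_coord i (p y) $ j) \<in> regular Z (ZC a b)"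
  "\<forall>y\<in>ZC a b. p y \<in> chart i" using p by blast
 let ?N = "{z \<in> ZC a b. chart_coord i (p z) \<in> {v. v ~= 0 & proj_pt v \<in> W}}"
 have "openin T ?N"
  by (rule openin_complex_vec[OF sp openin_ZC]) (use ab(2) W in \<open>auto simp: open_proj_plane_iff\<close>)
 moreover have "z \<in> ?N" "?N \<subseteq> {z \<in> topspace (zariski Z). p z \<in> W}"
  using ab z by (auto simp: in_ZC proj_pt_chart_coord chart_coord_nonzero)
 ultimately show "\<exists>N. openin T N & z \<in> N & N \<subseteq> {z \<in> topspace (zariski Z). p z \<in> W}" by blast
qed

lemma ex_ZC: "z \<in> topspace (zariski Z) ==> \<exists>a b. z \<in> ZC a b"
 using ex_chart[of "fst (\<nu> z)"] ex_chart[of "snd (\<nu> z)"] in_ZC by blast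

lemma openin_nu:
 assumes "open W"
 shows "openin T {z \<in> topspace (zariski Z). fst (\<nu> z) \<in> W}" "openin T {z \<in> topspace (zariski Z). snd (\<nu> z) \<in> W}"
 using ex_ZC regular_coord in_ZC by (intro openin_chart_vimage[OF assms]; meson)+

lemma finite_chart:
 "affine_variety (open_subspace Z (ZC a b))"
 "\<exists>B. finite B & B \<subseteq> regular Z (ZC a b) & (\<forall>g\<in>regular Z (ZC a b). \<exists>c. (\<forall>b'\<in>B. c b' \<in> regular X (chart_set F a b)) &
   (\<forall>y\<in>ZC a b. g y = (\<Sum>b'\<in>B. c b' (\<nu> y) * b' y)))"
 using normalization openin_chart_set[of a b] incidence_chart.affine_variety_chart[OF chart, of a b]
 unfolding normalization_def finite_morphism_def ZC_def by blast+

text \<open>A regular function is integral over the chart below: multiplication by it is given by a matrix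
 in the finitely many module generators.\<close>

lemma regular_bound:
 assumes h: "h \<in> regular Z (ZC a b)"
 shows "\<exists>(J :: (('z => complex) \<times> ('z => complex)) set) c. finite J & (\<forall>j\<in>J. c j \<in> regular X (chart_set F a b)) &
  (\<forall>z\<in>ZC a b. norm (h z) \<le> (\<Sum>j\<in>J. norm (c j (\<nu> z))))"
proof -
 obtain B where B: "finite B" "B \<subseteq> regular Z (ZC a b)"
  "!!g. g \<in> regular Z (ZC a b) ==> \<exists>c. (\<forall>b'\<in>B. c b' \<in> regular X (chart_set F a b)) &
   (\<forall>y\<in>ZC a b. g y = (\<Sum>b'\<in>B. c b' (\<nu> y) * b' y))"
  using finite_chart(2)[of a b] by blast
 \<comment> \<open>The function 1 is a combination of the generators, so these have no common
   zero.\<close>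
 obtain e where e: "!!y. y \<in> ZC a b ==> 1 = (\<Sum>b'\<in>B. e b' (\<nu> y) * b' y)"
  using B(3)[OF regular_const[OF sp openin_ZC, of 1]] by blast
 have "(%y. h y * \<beta> y) \<in> regular Z (ZC a b)" if "\<beta> \<in> B" for \<beta>
  using regular_mult[OF sp openin_ZC h] B(2) that by blast
 then have "\<forall>\<beta>\<in>B. \<exists>c. (\<forall>b'\<in>B. c b' \<in> regular X (chart_set F a b)) &
   (\<forall>y\<in>ZC a b. h y * \<beta> y = (\<Sum>b'\<in>B. c b' (\<nu> y) * b' y))" using B(3) by blast
 then have "\<exists>c. \<forall>\<beta>\<in>B. (\<forall>b'\<in>B. c \<beta> b' \<in> regular X (chart_set F a b)) &
   (\<forall>y\<in>ZC a b. h y * \<beta> y = (\<Sum>b'\<in>B. c \<beta> b' (\<nu> y) * b' y))" by (rule bchoice)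
 then obtain c where c: "!!\<beta> b'. \<beta> \<in> B ==> b' \<in> B ==> c \<beta> b' \<in> regular X (chart_set F a b)"
  "!!\<beta> y. \<beta> \<in> B ==> y \<in> ZC a b ==> h y * \<beta> y = (\<Sum>b'\<in>B. c \<beta> b' (\<nu> y) * b' y)" by blast
 have "norm (h z) \<le> (\<Sum>(\<beta>, b')\<in>B \<times> B. norm (c \<beta> b' (\<nu> z)))" if z: "z \<in> ZC a b" for z
 proof -
  have "B ~= {}" using e[OF z] by auto
  \<comment> \<open>At the given point the row of the largest generator is used: dividing by it
    bounds \<open>h\<close> by the matrix entries, which are regular functions on the chart
    below.\<close>
  then obtain \<beta> where \<beta>: "\<beta> \<in> B" "!!b'. b' \<in> B ==> norm (b' z) \<le> norm (\<beta> z)"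
   using obtains_MAX[OF B(1), of "%b'. norm (b' z)"] B(1) Max_ge[of "(%b'. norm (b' z)) ` B"]
   by (metis finite_imageI imageI)
  have pos: "norm (\<beta> z) > 0"
  proof (rule ccontr)
   assume "\<not> ?thesis"
   then have "\<forall>b'\<in>B. b' z = 0" using \<beta>(2) by fastforce
   then have "(\<Sum>b'\<in>B. e b' (\<nu> z) * b' z) = 0" by (intro sum.neutral) auto
   then show False using e[OF z] by simp
  qed
  have "norm (h z) * norm (\<beta> z) \<le> (\<Sum>b'\<in>B. norm (c \<beta> b' (\<nu> z) * b' z))"
   using c(2)[OF \<beta>(1) z] norm_sum[of "%b'. c \<beta> b' (\<nu> z) * b' z" B] by (simp flip: norm_mult)
  also have "\<dots> \<le> (\<Sum>b'\<in>B. norm (c \<beta> b' (\<nu> z)) * norm (\<beta> z))"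
   by (rule sum_mono) (simp add: norm_mult mult_left_mono \<beta>(2))
  finally have "norm (h z) \<le> (\<Sum>b'\<in>B. norm (c \<beta> b' (\<nu> z)))"
   using pos by (simp flip: sum_distrib_right)
  also have "\<dots> = (\<Sum>(\<beta>, b')\<in>{\<beta>} \<times> B. norm (c \<beta> b' (\<nu> z)))" by (simp add: sum.cartesian_product[symmetric])
  also have "\<dots> \<le> (\<Sum>(\<beta>, b')\<in>B \<times> B. norm (c \<beta> b' (\<nu> z)))"
   using \<beta>(1) B(1) by (intro sum_mono2) auto
  finally show ?thesis .
 qed
 then show ?thesis
  using c(1) B(1) by (intro exI[of _ "B \<times> B"] exI[of _ "%(\<beta>, b'). c \<beta> b'"]) (auto simp: case_prod_unfold)
qed

text \<open>What later arguments take from an affine chart of \<open>Z\<close>: a closed set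
  \<open>A\<close>, regular coordinates \<open>\<phi>\<close>, and an inverse \<open>\<xi>\<close>
  that is continuous along sequences in the complex topology.\<close>

definition affine_model :: "3 => 3 => nat => (nat => complex) set => ('z => nat => complex) => ((nat => complex) => 'z) => bool" where
 "affine_model a b n A \<phi> \<xi> \<longleftrightarrow> affine_algebraic_set n A & (\<forall>z\<in>ZC a b. \<phi> z \<in> A & \<xi> (\<phi> z) = z) &
   (\<forall>w\<in>A. \<xi> w \<in> ZC a b) & (\<forall>i. (%z. \<phi> z i) \<in> regular Z (ZC a b)) &
   (\<forall>ws w. (\<forall>n. ws n \<in> A) & w \<in> A & (\<forall>i. (%n. ws n i) \<longlonglongrightarrow> w i) --> limitin T (%n. \<xi> (ws n)) (\<xi> w) sequentially)"

lemma ex_affine_model: "\<exists>n A \<phi> \<xi>. affine_model a b n A \<phi> \<xi>"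
proof -
 obtain n :: nat and A \<phi> \<xi> where A: "affine_algebraic_set n A" and
  \<phi>: "morphism (open_subspace Z (ZC a b)) (affine_space_of A) \<phi>" and
  \<xi>: "morphism (affine_space_of A) (open_subspace Z (ZC a b)) \<xi>"
  and inv: "\<forall>x\<in>topspace (zariski (open_subspace Z (ZC a b))). \<xi> (\<phi> x) = x" "\<forall>y\<in>topspace (zariski (affine_space_of A)). \<phi> (\<xi> y) = y"
  using finite_chart(1)[of a b] unfolding affine_variety_def isomorphism_def by blast
 have top: "topspace (zariski (open_subspace Z (ZC a b))) = ZC a b"
  using openin_subset[OF openin_ZC] by (auto simp: open_subspace_def)
 have cont\<phi>: "continuous_map (zariski (open_subspace Z (ZC a b))) (zariski (affine_space_of A)) \<phi>"
  and cont\<xi>: "continuous_map (zariski (affine_space_of A)) (zariski (open_subspace Z (ZC a b))) \<xi>"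
  using \<phi> \<xi> by (auto simp: morphism_def)
 have \<phi>A: "\<phi> z \<in> A" if "z \<in> ZC a b" for z
  using continuous_map_image_subset_topspace[OF cont\<phi>] that top by auto
 have \<xi>Z: "\<xi> w \<in> ZC a b" if "w \<in> A" for w
  using continuous_map_image_subset_topspace[OF cont\<xi>] that top by auto
 have reg: "(%z. \<phi> z i) \<in> regular Z (ZC a b)" for i
 proof -
  have "(%w. w i) \<in> regular (affine_space_of A) A"
   unfolding regular_affine
   using openin_affine[of A 1] by (intro ballI exI[of _ A] exI[of _ "cvar i"] exI[of _ 1]) auto
  moreover have "openin (zariski (affine_space_of A)) A" using openin_affine[of A 1] by simp
  ultimately have "(%w. w i) \<circ> \<phi> \<in> regular (open_subspace Z (ZC a b)) (preimage_in (open_subspace Z (ZC a b)) \<phi> A)"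
   using \<phi> unfolding morphism_def by blast
  moreover have "preimage_in (open_subspace Z (ZC a b)) \<phi> A = ZC a b" using \<phi>A by (auto simp: preimage_in_def top)
  ultimately show ?thesis by (simp add: open_subspace_def comp_def)
 qed
 have lim: "limitin T (%n. \<xi> (ws n)) (\<xi> w) sequentially"
  if ws: "!!n. ws n \<in> A" "w \<in> A" "!!i. (%n. ws n i) \<longlonglongrightarrow> w i" for ws w
 proof (rule limitin_complex[OF sp])
  show "\<xi> w \<in> topspace (zariski Z)" using \<xi>Z[OF ws(2)] by (simp add: in_ZC)
  fix U g assume U: "openin (zariski Z) U" "\<xi> w \<in> U" "g \<in> regular Z U"
  let ?U = "U \<inter> ZC a b" and ?P = "preimage_in (affine_space_of A) \<xi>"
  have oU: "openin (zariski (open_subspace Z (ZC a b))) ?U"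
   using U(1) by (simp add: open_subspace_def openin_subtopology_Int)
  have "g \<in> regular Z ?U" by (rule regular_restrict[OF sp U(1) _ _ U(3)]) (auto intro: openin_Int U(1) openin_ZC)
  then have "g \<in> regular (open_subspace Z (ZC a b)) ?U" by (simp add: open_subspace_def)
  then have "g \<circ> \<xi> \<in> regular (affine_space_of A) (?P ?U)" using \<xi> oU unfolding morphism_def by blast
  moreover have "w \<in> ?P ?U" using \<xi>Z ws(2) U(2) by (simp add: preimage_in_def)
  ultimately obtain W p q where W: "openin (zariski (affine_space_of A)) W" "w \<in> W" "W \<subseteq> ?P ?U"
   "!!y. y \<in> W ==> poly_eval q y ~= 0 & (g \<circ> \<xi>) y = poly_eval p y / poly_eval q y"
   unfolding regular_affine by meson
  obtain s where s: "poly_eval s w ~= 0" "{y \<in> A. poly_eval s y ~= 0} \<subseteq> W" using affine_basis[OF W(1,2)] by blast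
  have ev: "\<forall>\<^sub>F n in sequentially. ws n \<in> W"
   using tendsto_imp_eventually_ne[OF tendsto_poly_eval[OF ws(3)] s(1)] by eventually_elim (use s(2) ws(1) in blast)
  have "((%n. poly_eval p (ws n) / poly_eval q (ws n)) \<longlonglongrightarrow> poly_eval p w / poly_eval q w)"
   using W(4)[OF W(2)] by (intro tendsto_divide tendsto_poly_eval ws) auto
  moreover have "\<forall>\<^sub>F n in sequentially. poly_eval p (ws n) / poly_eval q (ws n) = g (\<xi> (ws n))"
   using ev by eventually_elim (use W(4) in auto)
  ultimately have "(%n. g (\<xi> (ws n))) \<longlonglongrightarrow> g (\<xi> w)" using W(4)[OF W(2)] by (simp add: tendsto_cong)
  moreover have "\<forall>\<^sub>F n in sequentially. \<xi> (ws n) \<in> U" using ev by eventually_elim (use W(3) in \<open>auto simp: preimage_in_def\<close>)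
  ultimately show "(\<forall>\<^sub>F n in sequentially. \<xi> (ws n) \<in> U) & (%n. g (\<xi> (ws n))) \<longlonglongrightarrow> g (\<xi> w)" by blast
 qed
 show ?thesis
  unfolding affine_model_def
  by (rule exI[of _ n], rule exI[of _ A], rule exI[of _ \<phi>], rule exI[of _ \<xi>]) (use A \<phi>A \<xi>Z reg lim inv top in auto)
qed

text \<open>Points with different images are separated in the plane. Points with the same image lie
  in a common affine chart, as preimages of affine charts under \<open>\<nu>\<close> are affine, and
  some coordinate separates them.\<close>

lemma separated:
 assumes "z \<in> topspace T" "z' \<in> topspace T" "z ~= z'"
 shows "\<exists>U V. openin T U & openin T V & z \<in> U & z' \<in> V & U \<inter> V = {}"
proof -
 have zz: "z \<in> topspace (zariski Z)" "z' \<in> topspace (zariski Z)" using assms topspace_complex[OF sp] by auto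
 consider "fst (\<nu> z) ~= fst (\<nu> z')" | "snd (\<nu> z) ~= snd (\<nu> z')" | "\<nu> z = \<nu> z'" using prod_eqI by blast
 then show ?thesis
 proof cases
  case 1
  then obtain U V where "open U" "open V" "fst (\<nu> z) \<in> U" "fst (\<nu> z') \<in> V" "U \<inter> V = {}" using hausdorff[OF 1] by blast
  then show ?thesis using zz openin_nu(1)[of U] openin_nu(1)[of V]
   by (intro exI[of _ "{z \<in> topspace (zariski Z). fst (\<nu> z) \<in> U}"] exI[of _ "{z \<in> topspace (zariski Z). fst (\<nu> z) \<in> V}"]) auto
 next
  case 2
  then obtain U V where "open U" "open V" "snd (\<nu> z) \<in> U" "snd (\<nu> z') \<in> V" "U \<inter> V = {}" using hausdorff[OF 2] by blast
  then show ?thesis using zz openin_nu(2)[of U] openin_nu(2)[of V]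
   by (intro exI[of _ "{z \<in> topspace (zariski Z). snd (\<nu> z) \<in> U}"] exI[of _ "{z \<in> topspace (zariski Z). snd (\<nu> z) \<in> V}"]) auto
 next
  case 3
  obtain a b where ab: "z \<in> ZC a b" "z' \<in> ZC a b" using ex_chart 3 zz by (metis in_ZC)
  obtain n A \<phi> \<xi> where "affine_model a b n A \<phi> \<xi>" using ex_affine_model by blast
  then have "\<forall>z\<in>ZC a b. \<xi> (\<phi> z) = z" and reg: "!!i. (%z. \<phi> z i) \<in> regular Z (ZC a b)"
   unfolding affine_model_def by blast+
  then have "\<phi> z ~= \<phi> z'" using ab assms(3) by metis
  then obtain i where i: "\<phi> z i ~= \<phi> z' i" by blast
  obtain U V where UV: "open U" "open V" "\<phi> z i \<in> U" "\<phi> z' i \<in> V" "U \<inter> V = {}" using hausdorff[OF i] by blast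
  then show ?thesis using ab openin_complex[OF sp openin_ZC reg UV(1)] openin_complex[OF sp openin_ZC reg UV(2)]
   by (intro exI[of _ "{x \<in> ZC a b. \<phi> x i \<in> U}"] exI[of _ "{x \<in> ZC a b. \<phi> x i \<in> V}"]) auto
 qed
qed

lemma tendsto_snd_nu:
 assumes "limitin T zs z \<F>"
 shows "((%n. snd (\<nu> (zs n))) \<longlongrightarrow> snd (\<nu> z)) \<F>"
proof (rule topological_tendstoI)
 fix S assume S: "open S" "snd (\<nu> z) \<in> S"
 have z: "z \<in> topspace (zariski Z)" using assms topspace_complex[OF sp] by (simp add: limitin_def)
 show "\<forall>\<^sub>F n in \<F>. snd (\<nu> (zs n)) \<in> S"
  using assms[unfolded limitin_def, THEN conjunct2, rule_format, of "{z \<in> topspace (zariski Z). snd (\<nu> z) \<in> S}"] openin_nu(2)[OF S(1)] z S(2)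
  by (auto elim: eventually_mono)
qed

text \<open>A subsequence of image points converges inside one chart. By
  \<open>regular_bound\<close> the affine coordinates upstairs are bounded along it, and a limit of
  them satisfies the equations of the affine model.\<close>

lemma proper:
 assumes zs: "!!n::nat. zs n \<in> topspace T" and l: "(%n. snd (\<nu> (zs n))) \<longlonglongrightarrow> l"
 shows "\<exists>r z. strict_mono r & z \<in> topspace T & snd (\<nu> z) = l & limitin T (zs \<circ> r) z sequentially"
proof -
 have zz: "zs n \<in> topspace (zariski Z)" for n using zs topspace_complex[OF sp] by simp
 obtain r1 P where r1: "strict_mono r1" "((%n. fst (\<nu> (zs n))) \<circ> r1) \<longlonglongrightarrow> P"
  using proj_plane_convergent_subsequence by blast
 have P: "(%n. fst (\<nu> (zs (r1 n)))) \<longlonglongrightarrow> P" and l1: "(%n. snd (\<nu> (zs (r1 n)))) \<longlonglongrightarrow> l"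
  using r1(2) LIMSEQ_subseq_LIMSEQ[OF l r1(1)] by (simp_all add: comp_def)
 obtain a b where ab: "P \<in> chart a" "l \<in> chart b" using ex_chart by blast
 have "\<forall>\<^sub>F n in sequentially. zs (r1 n) \<in> ZC a b"
  using topological_tendstoD[OF P open_chart ab(1)] topological_tendstoD[OF l1 open_chart ab(2)]
  by eventually_elim (simp add: in_ZC zz)
 then obtain K where K: "!!n. K \<le> n ==> zs (r1 n) \<in> ZC a b" unfolding eventually_sequentially by blast
 define r2 where "r2 n = r1 (n + K)" for n
 have r2: "strict_mono r2" using r1(1) by (auto simp: r2_def strict_mono_def)
 define ys where "ys n = zs (r2 n)" for n
 have ys: "ys n \<in> ZC a b" for n using K by (simp add: ys_def r2_def)
 define x where "x n = chart_coord a (fst (\<nu> (ys n)))" for n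
 define v where "v n = chart_coord b (snd (\<nu> (ys n)))" for n
 define x0 v0 where "x0 = chart_coord a P" and "v0 = chart_coord b l"
 have x: "x \<longlonglongrightarrow> x0" unfolding x_def x0_def ys_def r2_def
  using LIMSEQ_ignore_initial_segment[OF tendsto_chart_coord[OF P ab(1)], of K] by simp
 have v: "v \<longlonglongrightarrow> v0" unfolding v_def v0_def ys_def r2_def
  using LIMSEQ_ignore_initial_segment[OF tendsto_chart_coord[OF l1 ab(2)], of K] by simp
 have x0: "x0 ~= 0" "proj_pt x0 = P" and v0: "v0 ~= 0" "proj_pt v0 = l"
  using ab by (simp_all add: x0_def v0_def chart_coord_nonzero proj_pt_chart_coord)
 have pts: "(proj_pt (x n), proj_pt (v n)) = \<nu> (ys n)" "x n ~= 0" "v n ~= 0" for n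
  using ys[of n] by (auto simp: x_def v_def in_ZC proj_pt_chart_coord chart_coord_nonzero)
 have mem: "(proj_pt (x n), proj_pt (v n)) \<in> incidence_set F" for n
  unfolding pts(1) using ys[of n] by (intro nu_in) (simp add: in_ZC)
 have "peval F (x n) = 0" "dot (x n) (v n) = 0" for n
  using mem[of n] pts(2,3)[of n] curve_points_proj_pt[OF homF] incident_proj_pt by (auto simp: incidence_set_def)
 moreover have "(%n. peval F (x n)) \<longlonglongrightarrow> peval F x0" by (intro tendsto_poly_eval tendsto_vec_nth x)
 moreover have "(%n. dot (x n) (v n)) \<longlonglongrightarrow> dot x0 v0" unfolding dot_def by (intro tendsto_intros x v)
 ultimately have "peval F x0 = 0" "dot x0 v0 = 0" by (simp_all add: LIMSEQ_const_iff)
 then have "(P, l) \<in> incidence_set F"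
  using curve_points_proj_pt[OF homF x0(1)] incident_proj_pt[OF x0(1) v0(1)] x0(2) v0(2) by (simp add: incidence_set_def)
 then have Pl: "(proj_pt x0, proj_pt v0) \<in> chart_set F a b" using ab x0 v0 by (simp add: chart_set_def)
 have bdd: "bounded (range (%n. h (ys n)))" if h: "h \<in> regular Z (ZC a b)" for h
 proof -
  obtain J :: "(('z => complex) \<times> ('z => complex)) set" and c where J: "finite J" "!!j. j \<in> J ==> c j \<in> regular X (chart_set F a b)"
   "!!z. z \<in> ZC a b ==> norm (h z) \<le> (\<Sum>j\<in>J. norm (c j (\<nu> z)))"
   using regular_bound[OF h] by blast
  have "\<exists>C. \<forall>n. norm (c j (\<nu> (ys n))) \<le> C" if "j \<in> J" for j
  proof -
   have "(%n. c j (proj_pt (x n), proj_pt (v n))) \<longlonglongrightarrow> c j (proj_pt x0, proj_pt v0)"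
    using regular_tendsto[of "incidence_set F" "chart_set F a b" "c j" x x0 sequentially v v0]
     openin_chart_set[of a b] J(2)[OF that] x v x0(1) v0(1) Pl mem by (simp add: X_def)
   then have "Bseq (%n. c j (\<nu> (ys n)))" unfolding pts(1) using convergent_imp_Bseq convergent_def by blast
   then show ?thesis by (auto simp: Bseq_def)
  qed
  then obtain C where C: "!!j n. j \<in> J ==> norm (c j (\<nu> (ys n))) \<le> C j" by metis
  have "norm (h (ys n)) \<le> (\<Sum>j\<in>J. C j)" for n
   using J(3)[OF ys[of n]] sum_mono[of J "%j. norm (c j (\<nu> (ys n)))" C] C by fastforce
  then show ?thesis unfolding bounded_iff by auto
 qed
 obtain n A \<phi> \<xi> where "affine_model a b n A \<phi> \<xi>" using ex_affine_model by blast
 then have A: "affine_algebraic_set n A" and \<phi>: "!!z. z \<in> ZC a b ==> \<phi> z \<in> A & \<xi> (\<phi> z) = z"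
  and \<xi>: "!!w. w \<in> A ==> \<xi> w \<in> ZC a b" and reg: "!!i. (%z. \<phi> z i) \<in> regular Z (ZC a b)"
  and lim: "!!ws w. (!!n. ws n \<in> A) ==> w \<in> A ==> (!!i. (%n. ws n i) \<longlonglongrightarrow> w i) ==> limitin T (%n. \<xi> (ws n)) (\<xi> w) sequentially"
  unfolding affine_model_def by blast+
 obtain S where S: "A = {x. (\<forall>i\<ge>n. x i = 0) & (\<forall>p\<in>S. poly_eval p x = 0)}" using A unfolding affine_algebraic_set_def by blast
 obtain r3 where r3: "strict_mono r3" "!!i. i < n ==> convergent (%m. \<phi> (ys (r3 m)) i)"
  using pointwise_bounded_subsequence[of "%m. \<phi> (ys m)" n] bdd[OF reg] by blast
 have in_A: "\<phi> (ys m) \<in> A" for m using \<phi>[OF ys] by blast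
 have "convergent (%m. \<phi> (ys (r3 m)) i)" for i
 proof (cases "i < n")
  case False
  then have "\<phi> (ys (r3 m)) i = 0" for m using in_A S by auto
  then show ?thesis by (simp add: convergent_const)
 qed (rule r3(2))
 then obtain w where w: "!!i. (%m. \<phi> (ys (r3 m)) i) \<longlonglongrightarrow> w i" unfolding convergent_def by metis
 have "w i = 0" if "i \<ge> n" for i
 proof -
  have "\<phi> (ys (r3 m)) i = 0" for m using in_A S that by auto
  then show ?thesis using w[of i] by (simp add: LIMSEQ_const_iff)
 qed
 moreover have "poly_eval p w = 0" if "p \<in> S" for p
 proof -
  have "poly_eval p (\<phi> (ys (r3 m))) = 0" for m using in_A S that by auto
  then show ?thesis using tendsto_poly_eval[of "%m i. \<phi> (ys (r3 m)) i" w sequentially p] w by (simp add: LIMSEQ_const_iff)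
 qed
 ultimately have "w \<in> A" using S by blast
 have "limitin T (%m. \<xi> (\<phi> (ys (r3 m)))) (\<xi> w) sequentially" by (rule lim[OF in_A \<open>w \<in> A\<close> w])
 then have L: "limitin T (zs \<circ> (r2 \<circ> r3)) (\<xi> w) sequentially" using \<phi>[OF ys] by (simp add: comp_def ys_def)
 have "(%m. snd (\<nu> ((zs \<circ> (r2 \<circ> r3)) m))) \<longlonglongrightarrow> snd (\<nu> (\<xi> w))" by (rule tendsto_snd_nu[OF L])
 moreover have "(%m. snd (\<nu> ((zs \<circ> (r2 \<circ> r3)) m))) \<longlonglongrightarrow> l"
  using LIMSEQ_subseq_LIMSEQ[OF l strict_mono_o[OF r2 r3(1)]] by (simp add: comp_def)
 ultimately have "snd (\<nu> (\<xi> w)) = l" using LIMSEQ_unique by blast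
 moreover have "\<xi> w \<in> topspace T" using \<xi>[OF \<open>w \<in> A\<close>] topspace_complex[OF sp] by (simp add: in_ZC)
 ultimately show ?thesis using L strict_mono_o[OF r2 r3(1)] by blast
qed

end

section \<open>Components of the normalized incidence surface\<close>

lemma germ_cong:
 assumes "openin (zariski Z) U" "z \<in> U" "!!y. y \<in> U ==> f y = g y"
 shows "germ Z z f = germ Z z g"
proof -
 have *: "germ Z z f \<subseteq> germ Z z g" if "!!y. y \<in> U ==> f y = g y" for f g
 proof
  fix h assume "h \<in> germ Z z f"
  then obtain V where "regular_at Z z h" "openin (zariski Z) V" "z \<in> V" "\<forall>y\<in>V. h y = f y" unfolding germ_def by blast
  then show "h \<in> germ Z z g"
   unfolding germ_def using that assms(1,2) openin_Int[of "zariski Z" U V]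
   by (intro CollectI conjI exI[of _ "U \<inter> V"]) auto
 qed
 from *[of f g] *[of g f] assms(3) show ?thesis by auto
qed

lemma germ_self: "regular_at Z z f ==> f \<in> germ Z z f"
 unfolding germ_def regular_at_def by blast

text \<open>The domain property of germs restated for functions: here the product of the two germs
  is the zero germ.\<close>

lemma local_ring_no_zero_divisors:
 assumes dom: "domain (local_ring Z z)" and f: "regular_at Z z f" and g: "regular_at Z z g"
  and U: "openin (zariski Z) U" "z \<in> U" "!!y. y \<in> U ==> f y * g y = 0"
 shows "\<exists>U. openin (zariski Z) U & z \<in> U & ((\<forall>y\<in>U. f y = 0) \<or> (\<forall>y\<in>U. g y = 0))"
proof -
 interpret domain "local_ring Z z" by fact
 have zero: "germ Z z (%y. f' y * g' y) = germ Z z (%_. 0)" if fg: "f' \<in> germ Z z f" "g' \<in> germ Z z g" for f' g'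
 proof -
  obtain V where V: "openin (zariski Z) V" "z \<in> V" "\<forall>y\<in>V. f' y = f y" using fg(1) unfolding germ_def by blast
  obtain W where W: "openin (zariski Z) W" "z \<in> W" "\<forall>y\<in>W. g' y = g y" using fg(2) unfolding germ_def by blast
  show ?thesis
  proof (rule germ_cong)
   show "openin (zariski Z) (U \<inter> V \<inter> W)" using U V W by (intro openin_Int)
   show "f' y * g' y = 0" if "y \<in> U \<inter> V \<inter> W" for y using that U(3)[of y] V(3) W(3) by simp
  qed (use U V W in auto)
 qed
 have "(\<Union>f'\<in>germ Z z f. \<Union>g'\<in>germ Z z g. germ Z z (%y. f' y * g' y)) = germ Z z (%_. 0)"
  using zero germ_self[OF f] germ_self[OF g] by blast
 then have "germ Z z f \<otimes>\<^bsub>local_ring Z z\<^esub> germ Z z g = \<zero>\<^bsub>local_ring Z z\<^esub>" by (simp add: local_ring_def)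
 moreover have "germ Z z f \<in> carrier (local_ring Z z)" "germ Z z g \<in> carrier (local_ring Z z)"
  using f g by (auto simp: local_ring_def)
 ultimately have "germ Z z f = \<zero>\<^bsub>local_ring Z z\<^esub> \<or> germ Z z g = \<zero>\<^bsub>local_ring Z z\<^esub>" by (rule integral)
 then have "f \<in> germ Z z (%_. 0) \<or> g \<in> germ Z z (%_. 0)"
  using germ_self[OF f] germ_self[OF g] by (auto simp: local_ring_def)
 then show ?thesis unfolding germ_def by blast
qed

lemma regular_add:
 "space_with_functions Z ==> openin (zariski Z) U ==> g \<in> regular Z U ==> h \<in> regular Z U ==> (%x. g x + h x) \<in> regular Z U"
 unfolding space_with_functions_def by blast

lemma regular_poly_eval:
 assumes "space_with_functions Z" "openin (zariski Z) U" "!!i. (%y. h y i) \<in> regular Z U"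
 shows "(%y. poly_eval p (h y)) \<in> regular Z U"
 by (induction p rule: cpoly_induct) (simp_all add: regular_const regular_add regular_mult assms)

locale dualizing = plane_curve k Comp ds + normalized_incidence F n Z \<nu>
 for k Comp ds F n and Z :: "'z fun_space" and \<nu> +
 assumes F_C: "F = C"
begin

lemma incidence_set_component:
 assumes "z \<in> incidence_set F"
 shows "\<exists>i\<in>{1..k}. fst z \<in> curve_points (Comp i)"
 using assms by (auto simp: incidence_set_def F_C C_def curve_points_def prod_zero_iff)

text \<open>Every point of the normal surface has an irreducible neighbourhood, which lies over one component.\<close>

definition label :: "'z => nat => bool" where
 "label z i \<longleftrightarrow> i \<in> {1..k} & (\<exists>U. openin (zariski Z) U & z \<in> U & (\<forall>y\<in>U. fst (\<nu> y) \<in> curve_points (Comp i)))"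

text \<open>The product of the equations of all components vanishes near \<open>z\<close>; as the
  local ring is a domain, one factor has zero germ.\<close>

lemma ex_label:
 assumes z: "z \<in> topspace (zariski Z)"
 shows "\<exists>i. label z i"
proof -
 obtain a b where ab: "z \<in> ZC a b" using ex_ZC[OF z] by blast
 define h where "h i y = peval (Comp i) (chart_coord a (fst (\<nu> y)))" for i y
 have reg: "h i \<in> regular Z (ZC a b)" for i
  unfolding h_def[abs_def] by (rule regular_poly_eval[OF sp openin_ZC regular_coord(1)])
 have dom: "domain (local_ring Z z)"
  using normalization z by (simp add: normalization_def normal_variety_def integrally_closed_domain_def)
 have "(%y. \<Prod>i\<in>J. h i y) \<in> regular Z (ZC a b)" for J
  by (induction J rule: infinite_finite_induct) (auto intro: regular_const[OF sp openin_ZC] regular_mult[OF sp openin_ZC reg])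
 then have reg_at: "regular_at Z z (%y. \<Prod>i\<in>J. h i y)" "regular_at Z z (h i)" for J i
  unfolding regular_at_def using openin_ZC ab reg by blast+
 have "\<exists>i\<in>J. \<exists>U. openin (zariski Z) U & z \<in> U & (\<forall>y\<in>U. h i y = 0)"
  if "finite J" "\<exists>U. openin (zariski Z) U & z \<in> U & (\<forall>y\<in>U. (\<Prod>i\<in>J. h i y) = 0)" for J
  using that
 proof (induction J rule: finite_induct)
  case empty then show ?case by auto
 next
  case (insert i J)
  then obtain U where "openin (zariski Z) U" "z \<in> U" "!!y. y \<in> U ==> h i y * (\<Prod>i\<in>J. h i y) = 0" by auto
  from local_ring_no_zero_divisors[OF dom reg_at(2) reg_at(1) this]
  show ?case using insert.IH by blast
 qed
 moreover have on_ZC: "h i y = 0 \<longleftrightarrow> fst (\<nu> y) \<in> curve_points (Comp i)" if "i \<in> {1..k}" "y \<in> ZC a b" for i y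
  using that curve_points_proj_pt[OF hom[OF that(1)] chart_coord_nonzero[of "fst (\<nu> y)" a]] by (simp add: h_def in_ZC proj_pt_chart_coord)
 have "(\<Prod>i\<in>{1..k}. h i y) = 0" if y: "y \<in> ZC a b" for y
 proof -
  have "y \<in> topspace (zariski Z)" using y by (simp add: in_ZC)
  then obtain i where i: "i \<in> {1..k}" "fst (\<nu> y) \<in> curve_points (Comp i)"
   using incidence_set_component[OF nu_in] by blast
  then have "h i y = 0" using on_ZC[OF i(1) y] by simp
  then show ?thesis using i(1) by (auto simp: prod_zero_iff)
 qed
 then have "\<exists>U. openin (zariski Z) U & z \<in> U & (\<forall>y\<in>U. (\<Prod>i\<in>{1..k}. h i y) = 0)" using openin_ZC ab by blast
 ultimately obtain i U where i: "i \<in> {1..k}" and U: "openin (zariski Z) U" "z \<in> U" "\<forall>y\<in>U. h i y = 0" by blast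
 have "openin (zariski Z) (U \<inter> ZC a b)" using U openin_ZC by (intro openin_Int)
 then show ?thesis
  unfolding label_def using i U ab on_ZC[OF i] by (intro exI[of _ i] conjI exI[of _ "U \<inter> ZC a b"]) auto
qed

lemma label_in: "label z i ==> i \<in> {1..k}"
 by (simp add: label_def)

lemma label_on_component: "label z i ==> fst (\<nu> z) \<in> curve_points (Comp i)"
 by (auto simp: label_def)

lemma openin_label: "openin T {z. label z i}"
proof (subst openin_subopen, intro ballI)
 fix z assume "z \<in> {z. label z i}"
 then obtain U where U: "openin (zariski Z) U" "z \<in> U" "\<forall>y\<in>U. fst (\<nu> y) \<in> curve_points (Comp i)" "i \<in> {1..k}" by (auto simp: label_def)
 then show "\<exists>N. openin T N & z \<in> N & N \<subseteq> {z. label z i}"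
  using openin_complex_zariski[OF sp U(1)] by (intro exI[of _ U]) (auto simp: label_def)
qed

text \<open>Each component contributes a point on no other component. A neighbourhood lying over
  this component alone meets the dense set \<open>U\<close>, and a basic open set inside
  \<open>U\<close> around a point found there supplies the polynomial.\<close>

lemma ex_cut:
 assumes U: "openin (zariski X) U" "zariski X closure_of U = topspace (zariski X)"
 shows "\<exists>g. plane_curve_cut k Comp ds g &
  (\<forall>i\<in>{1..k}. {y \<in> incidence_set F. bihom_eval (g i) y ~= 0} \<subseteq> U)"
proof -
 have "\<exists>p. (\<exists>a b. bihomogeneous p a b) & (\<exists>y. fst y \<in> curve_points (Comp i) & incident (fst y) (snd y) & bihom_eval p y ~= 0) &
   {y \<in> incidence_set F. bihom_eval p y ~= 0} \<subseteq> U" if i: "i \<in> {1..k}" for i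
 proof -
  obtain v where v: "v ~= 0" "transversal v" using generic_transversal(2) by blast
  have "card (line_points (Comp i) v) ~= 0" using v(2) i ds2[OF i] by (auto simp: transversal_def)
  then have "line_points (Comp i) v ~= {}" by auto
  then obtain x where x: "x ~= 0" "peval (Comp i) x = 0" "dot x v = 0"
   unfolding line_points_eq[OF hom[OF i] v(1)] by blast
  have R: "peval (Rest i) x ~= 0" by (rule transversal_not_both[OF v(2) i x(2,3,1) v(1)])
  obtain a b where ab: "proj_pt x \<in> chart a" "proj_pt v \<in> chart b" using ex_chart by blast
  obtain q where q: "!!w. poly_eval q w = poly_eval (Rest i) (%j. w (num (Inl j)))" using ex_rename by metis
  obtain N p where p: "bihomogeneous p N N" "!!z. z \<in> chart a \<times> chart b ==> bihom_eval p z =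
    (hcoord (fst z) $ a * hcoord (snd z) $ b) ^ N * poly_eval q (affine_coords a b z)"
   using ex_bihomogenization[of a b q] by blast
  have qz: "poly_eval q (affine_coords a b z) = peval (Rest i) (chart_coord a (fst z))" for z
   unfolding q by (rule arg_cong[of _ _ "poly_eval (Rest i)"]) (simp add: fun_eq_iff affine_coords_def)
  have R_iff: "bihom_eval p z ~= 0 \<longleftrightarrow> fst z \<notin> curve_points (Rest i)" if "z \<in> chart a \<times> chart b" for z
   using that curve_points_proj_pt[OF homogeneous_Rest chart_coord_nonzero] unfolding p(2)[OF that] qz
   by (auto simp: chart_def proj_pt_chart_coord[unfolded chart_def])
  let ?W = "{y \<in> incidence_set F. bihom_eval p y ~= 0} \<inter> chart_set F a b"
  have W: "openin (zariski X) ?W"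
   using openin_biproj[OF p(1)] openin_chart_set by (intro openin_Int) (simp_all add: X_def)
  have "peval F x = 0" using x(2) by (simp add: F_C C_Rest[OF i])
  then have "(proj_pt x, proj_pt v) \<in> incidence_set F"
   using curve_points_proj_pt[OF homF x(1)] incident_proj_pt[OF x(1) v(1)] x(3)
   by (simp add: incidence_set_def)
  moreover have "proj_pt x \<notin> curve_points (Rest i)" using R curve_points_proj_pt[OF homogeneous_Rest x(1)] by simp
  ultimately have mW: "(proj_pt x, proj_pt v) \<in> ?W" using ab R_iff by (simp add: chart_set_def)
  have "(proj_pt x, proj_pt v) \<in> zariski X closure_of U"
   unfolding U(2) using \<open>(proj_pt x, proj_pt v) \<in> incidence_set _\<close> by (simp add: X_def)
  from this[unfolded in_closure_of, THEN conjunct2, rule_format, OF conjI[OF mW W]]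
  obtain y where y: "y \<in> U" "y \<in> ?W" by blast
  then have y': "fst y \<in> curve_points (Comp i)" "incident (fst y) (snd y)"
   using R_iff[of y] by (auto simp: chart_set_def incidence_set_def curve_points_def F_C C_Rest[OF i])
  obtain s m n where "bihomogeneous s m n" "bihom_eval s y ~= 0" "{y \<in> incidence_set F. bihom_eval s y ~= 0} \<subseteq> U"
   using biproj_basis[OF U(1)[unfolded X_def] y(1)] by blast
  then show ?thesis using y' by blast
 qed
 then have "\<forall>i\<in>{1..k}. \<exists>p. (\<exists>a b. bihomogeneous p a b) & (\<exists>y. fst y \<in> curve_points (Comp i) & incident (fst y) (snd y) & bihom_eval p y ~= 0) &
   {y \<in> incidence_set F. bihom_eval p y ~= 0} \<subseteq> U" by blast
 then obtain g where g: "\<forall>i\<in>{1..k}. (\<exists>a b. bihomogeneous (g i) a b) & (\<exists>y. fst y \<in> curve_points (Comp i) & incident (fst y) (snd y) & bihom_eval (g i) y ~= 0) &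
   {y \<in> incidence_set F. bihom_eval (g i) y ~= 0} \<subseteq> U"
  by (rule bchoice[THEN exE])
 have "plane_curve_cut k Comp ds g"
 proof
  fix i assume i: "i \<in> {1..k}"
  show "\<exists>a b. bihomogeneous (g i) a b" using g i by blast
  obtain y where "fst y \<in> curve_points (Comp i)" "incident (fst y) (snd y)" "bihom_eval (g i) y ~= 0" using g i by blast
  then show "\<exists>x v. x ~= 0 & v ~= 0 & dot x v = 0 & peval (Comp i) x = 0 & beval (g i) x v ~= 0"
   by (intro exI[of _ "hcoord (fst y)"] exI[of _ "hcoord (snd y)"])
    (auto simp: hcoord curve_points_def incident_def dot_def bihom_eval_def beval_def)
 qed
 then show ?thesis using g by blast
qed

end

section \<open>Complex differentiability in three variables\<close>

text \<open>The condition on pullbacks in \<open>holomorphic_on_plane\<close>, isolated at one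
  vector.\<close>

definition cdiff :: "(complex^3 => complex) => complex^3 => bool" where
 "cdiff h v \<longleftrightarrow> (\<exists>D. (h has_derivative D) (at v) & (\<forall>c u. D (c *s u) = c * D u))"

lemma cdiff_const: "cdiff (%_. c) v"
 unfolding cdiff_def by (intro exI[of _ "%_. 0"]) auto

lemma cdiff_nth: "cdiff (%v. v $ i) v"
 unfolding cdiff_def
 by (intro exI[of _ "%v. v $ i"]) (simp add: bounded_linear_imp_has_derivative[OF bounded_linear_vec_nth])

lemma cdiff_add:
 assumes "cdiff f v" "cdiff g v" shows "cdiff (%v. f v + g v) v"
proof -
 obtain D E where D: "(f has_derivative D) (at v)" "\<forall>c u. D (c *s u) = c * D u"
  and E: "(g has_derivative E) (at v)" "\<forall>c u. E (c *s u) = c * E u" using assms unfolding cdiff_def by blast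
 show ?thesis unfolding cdiff_def using has_derivative_add[OF D(1) E(1)] D(2) E(2)
  by (intro exI[of _ "%h. D h + E h"]) (simp add: algebra_simps)
qed

lemma cdiff_mult:
 assumes "cdiff f v" "cdiff g v" shows "cdiff (%v. f v * g v) v"
proof -
 obtain D E where D: "(f has_derivative D) (at v)" "\<forall>c u. D (c *s u) = c * D u"
  and E: "(g has_derivative E) (at v)" "\<forall>c u. E (c *s u) = c * E u" using assms unfolding cdiff_def by blast
 show ?thesis unfolding cdiff_def using has_derivative_mult[OF D(1) E(1)] D(2) E(2)
  by (intro exI[of _ "%h. f v * E h + D h * g v"]) (simp add: algebra_simps)
qed

lemma cdiff_divide:
 assumes "cdiff f v" "cdiff g v" "g v ~= 0" shows "cdiff (%v. f v / g v) v"
proof -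
 obtain E where E: "(g has_derivative E) (at v)" "\<forall>c u. E (c *s u) = c * E u" using assms unfolding cdiff_def by blast
 have "cdiff (%v. inverse (g v)) v" unfolding cdiff_def
  using Deriv.has_derivative_inverse[OF assms(3) E(1)] E(2)
  by (intro exI[of _ "%h. - (inverse (g v) * E h * inverse (g v))"]) (simp add: algebra_simps)
 from cdiff_mult[OF assms(1) this] show ?thesis by (simp add: divide_inverse)
qed

lemma cdiff_cong:
 assumes "cdiff f v" "open S" "v \<in> S" "!!u. u \<in> S ==> f u = g u" shows "cdiff g v"
 using assms has_derivative_transform_within_open unfolding cdiff_def by blast

lemma cdiff_poly_eval: "(!!i. cdiff (%v. x v i) v) ==> cdiff (%v. poly_eval p (x v)) v"
 by (induction p rule: cpoly_induct) (auto intro: cdiff_const cdiff_add cdiff_mult)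

lemma cdiff_dot: "cdiff (%v. dot b v) v"
 unfolding dot_def sum_3 by (intro cdiff_add cdiff_mult cdiff_const cdiff_nth)

lemma continuous_vec_scale: "continuous_on UNIV (%u. c *s (u :: complex^3))"
 unfolding vector_scalar_mult_def by (intro continuous_intros)

lemma cdiff_compose_scale:
 assumes "cdiff h (c *s v)" shows "cdiff (%u. h (c *s u)) v"
proof -
 obtain D where D: "(h has_derivative D) (at (c *s v))" "\<forall>c u. D (c *s u) = c * D u" using assms unfolding cdiff_def by blast
 have "linear (%u. c *s (u :: complex^3))" by (rule linearI) (auto simp: vec_eq_iff algebra_simps)
 then have "((%u. c *s (u :: complex^3)) has_derivative (%u. c *s u)) (at v)"
  using bounded_linear_imp_has_derivative linear_conv_bounded_linear by blast
 from has_derivative_compose[OF this D(1)] show ?thesis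
  unfolding cdiff_def using D(2) by (intro exI[of _ "%u. D (c *s u)"]) (simp add: mult.left_commute)
qed

lemma cdiff_isCont: "cdiff h v ==> isCont h v"
 unfolding cdiff_def using has_derivative_continuous by blast

section \<open>Local sections\<close>

lemma line_family:
 fixes \<alpha> \<beta> :: "'a::topological_space => complex^3"
 assumes "!!i. continuous_on S (%v. \<alpha> v $ i)" "!!i. continuous_on S (%v. \<beta> v $ i)"
 shows "\<exists>p. (\<forall>v y. poly (p v) y = peval F (\<alpha> v + y *s \<beta> v)) & (\<forall>j. continuous_on S (%v. coeff (p v) j))"
proof (induction F rule: cpoly_induct)
 case (const c)
 show ?case by (intro exI[of _ "%_. [:c:]"]) auto
next
 case (var i)
 have "continuous_on S (%v. coeff [:\<alpha> v $ i, \<beta> v $ i:] j)" for j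
 proof -
  have "coeff [:\<alpha> v $ i, \<beta> v $ i:] j = (if j = 0 then \<alpha> v $ i else if j = 1 then \<beta> v $ i else 0)" for v
   by (auto simp: coeff_pCons split: nat.split)
  then show ?thesis using assms by (cases "j = 0"; cases "j = 1") simp_all
 qed
 then show ?case by (intro exI[of _ "%v. [:\<alpha> v $ i, \<beta> v $ i:]"]) auto
next
 case (add F G)
 then obtain p q where pq: "\<forall>v y. poly (p v) y = peval F (\<alpha> v + y *s \<beta> v)" "\<forall>j. continuous_on S (%v. coeff (p v) j)"
  "\<forall>v y. poly (q v) y = peval G (\<alpha> v + y *s \<beta> v)" "\<forall>j. continuous_on S (%v. coeff (q v) j)" by blast
 then have "\<forall>j. continuous_on S (%v. coeff (p v + q v) j)" by (auto intro!: continuous_intros)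
 then show ?case using pq(1,3) by (intro exI[of _ "%v. p v + q v"]) (simp only: poly_add poly_eval_add simp_thms)
next
 case (mult F G)
 then obtain p q where pq: "\<forall>v y. poly (p v) y = peval F (\<alpha> v + y *s \<beta> v)" "\<forall>j. continuous_on S (%v. coeff (p v) j)"
  "\<forall>v y. poly (q v) y = peval G (\<alpha> v + y *s \<beta> v)" "\<forall>j. continuous_on S (%v. coeff (q v) j)" by blast
 then have "\<forall>j. continuous_on S (%v. coeff (p v * q v) j)" by (auto simp: coeff_mult intro!: continuous_intros)
 then show ?case using pq(1,3) by (intro exI[of _ "%v. p v * q v"]) (simp only: poly_mult poly_eval_mult simp_thms)
qed

section \<open>Holomorphic motion of the intersection points near a good line\<close>

context plane_curve begin

lemma finite_transversal: "transversal v ==> finite (line_points C v)"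
 unfolding line_points_C transversal_def
 by (rule finite_UN_I) (use ds2 in \<open>auto intro!: card_ge_0_finite, force\<close>)

lemma on_line_points: "v ~= 0 ==> P \<in> line_points C v ==> peval C (hcoord P) = 0 & dot (hcoord P) v = 0"
 using curve_points_proj_pt[OF homogeneous_C hcoord(1)[of P]] incident_proj_pt[OF hcoord(1)[of P]]
 by (simp add: line_points_def hcoord)

end

context plane_curve_cut begin

text \<open>A line that misses all points of \<open>C\<close> on \<open>v\<close> meets
  \<open>v\<close> off the curve.\<close>

lemma ex_pencil_avoiding:
 assumes v: "v ~= 0" "transversal v" and P: "P \<in> line_points C v"
 shows "\<exists>m1 m2. pencil v m1 m2 & peval C (pencil.b2 v m1) ~= 0 & dot (hcoord P) m1 ~= 0"
proof -
 have "finite (hcoord ` line_points C v)" "0 \<notin> hcoord ` line_points C v"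
  using finite_transversal[OF v(2)] hcoord(1) by (simp, force)
 then obtain l where l: "!!P. P \<in> line_points C v ==> dot (hcoord P) l ~= 0"
  using ex_good_avoiding[of "hcoord ` line_points C v"] by blast
 have "l ~= c *s v" for c using l[OF P] on_line_points[OF v(1) P] by auto
 then obtain m2 where m: "pencil v l m2" using pencil_ex v(1) by blast
 then interpret pencil v l m2 .
 have "peval C b2 ~= 0"
 proof
  assume "peval C b2 = 0"
  then have "proj_pt b2 \<in> line_points C v"
   using b2_nonzero v(1) by (auto simp: line_points_eq[OF homogeneous_C v(1)])
  from l[OF this] obtain c where "dot (c *s b2) l ~= 0" using hcoord_proj_pt[OF b2_nonzero] by metis
  then show False by simp
 qed
 then show ?thesis using m l[OF P] by blast
qed

text \<open>For lines near \<open>v0\<close> the intersection near \<open>P0\<close> is a simple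
  root of the equation on the line, so it depends holomorphically on the line. The open set
  \<open>B\<close> singles it out among all intersections.\<close>

lemma ex_local_section:
 assumes v0: "v0 ~= 0" "good v0" and P0: "P0 \<in> line_points C v0"
 shows "\<exists>\<delta> \<sigma> B. \<delta> > 0 & open B & P0 \<in> B & (\<forall>v\<in>ball v0 \<delta>. v ~= 0 & \<sigma> v ~= 0 & dot (\<sigma> v) v = 0 &
  peval C (\<sigma> v) = 0 & (\<forall>i. cdiff (%v. \<sigma> v $ i) v) & proj_pt (\<sigma> v) \<in> B &
  (\<forall>x. x ~= 0 --> peval C x = 0 --> dot x v = 0 --> proj_pt x \<in> B --> proj_pt x = proj_pt (\<sigma> v)))"
proof -
 have tr: "transversal v0" using v0 by (simp add: good_def)
 obtain m1 m2 where m: "pencil v0 m1 m2" and Cb2: "peval C (pencil.b2 v0 m1) ~= 0" and P0m: "dot (hcoord P0) m1 ~= 0"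
  using ex_pencil_avoiding[OF v0(1) tr P0] by blast
 interpret pencil v0 m1 m2 by fact
 have pl: "pline 0 = v0" by (simp add: pline_def)
 define S where "S = {v. dot b0 v ~= 0}"
 have cont_dot: "continuous_on A (%v. dot b v)" for A b unfolding dot_def by (intro continuous_intros)
 have "open S" unfolding S_def by (intro open_Collect_neq cont_dot continuous_on_const)
 have "v0 \<in> S" by (simp add: S_def)
 \<comment> \<open>\<open>\<alpha> v\<close> and \<open>\<beta> v\<close> are \<open>b1\<close> and
   \<open>b2\<close> shifted along \<open>b0\<close> onto the line \<open>v\<close>, so that
   \<open>\<alpha> v + y *s \<beta> v\<close> parametrizes the lines close to
   \<open>v0\<close>.\<close>
 define \<alpha> where "\<alpha> v = b1 + (- 1) *s ((dot b1 v / dot b0 v) *s b0)" for v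
 define \<beta> where "\<beta> v = b2 + (- 1) *s ((dot b2 v / dot b0 v) *s b0)" for v
 have \<alpha>0: "\<alpha> v0 = b1" and \<beta>0: "\<beta> v0 = b2" by (simp_all add: \<alpha>_def \<beta>_def)
 have cdq: "cdiff (%v. x $ i + (- 1) * (dot y v / dot b0 v * z $ i)) v" if "v \<in> S" for v i and x y z :: "complex^3"
  by (intro cdiff_add cdiff_mult cdiff_divide cdiff_const cdiff_dot) (use that in \<open>simp add: S_def\<close>)
 have cd: "cdiff (%v. \<alpha> v $ i) v" "cdiff (%v. \<beta> v $ i) v" if "v \<in> S" for v i
  unfolding \<alpha>_def \<beta>_def vector_add_component vector_smult_component by (rule cdq[OF that])+
 then have cont: "continuous_on S (%v. \<alpha> v $ i)" "continuous_on S (%v. \<beta> v $ i)" for i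
  by (auto intro!: continuous_at_imp_continuous_on cdiff_isCont)
 obtain p where p: "!!v y. poly (p v) y = peval C (\<alpha> v + y *s \<beta> v)" "!!j. continuous_on S (%v. coeff (p v) j)"
  using line_family[OF cont] by blast
 have deg: "degree (p v) \<le> d" for v using degree_along_line(1)[OF homogeneous_C] p(1) by blast
 interpret fam: poly_family S p d by unfold_locales (use \<open>open S\<close> deg p(2) in auto)
 have p0: "p v0 = at_s (dehom C) 0"
  unfolding poly_eq_poly_eq_iff[symmetric] by (simp add: fun_eq_iff p(1) \<alpha>0 \<beta>0 ppoint_def)
 have nz: "at_s (dehom C) 0 ~= 0" "degree (at_s (dehom C) 0) = d" by (rule at_s_nonzero[OF homogeneous_C Cb2])+
 have "finite {y. poly2 (dehom C) 0 y = 0}" using poly_roots_finite[OF nz(1)] by simp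
 from card_line_points_pline[OF homogeneous_C this] Cb2
 have card: "card {y. poly (p v0) y = 0} = d" by (simp add: p0 pl transversal_card[OF tr])
 have P0': "peval C (hcoord P0) = 0" "dot (hcoord P0) v0 = 0" using on_line_points[OF v0(1) P0] by auto
 obtain c0 y0 where x0: "hcoord P0 = c0 *s ppoint 0 y0" and "c0 ~= 0"
  using on_pline_cases[OF hcoord(1)[of P0], of 0] P0m P0'(2) by (auto simp: pl)
 have root: "poly (p v0) y0 = 0"
  using P0'(1) peval_scale[OF homogeneous_C, of c0 "ppoint 0 y0"] \<open>c0 ~= 0\<close> unfolding x0 by (simp add: p0)
 have simple: "poly (pderiv (p v0)) y0 ~= 0"
  using card_roots_le_of_double[of "p v0" y0] root card nz by (auto simp: p0)
 obtain \<delta> r Y where Y: "\<delta> > 0" "ball v0 \<delta> \<subseteq> S" "0 < r" "continuous_on (ball v0 \<delta>) Y"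
  "!!v. v \<in> ball v0 \<delta> ==> Y v \<in> ball y0 r & poly (p v) (Y v) = 0 & poly (pderiv (p v)) (Y v) ~= 0"
  "!!v y. v \<in> ball v0 \<delta> ==> y \<in> ball y0 r ==> poly (p v) y = 0 ==> y = Y v"
  using fam.root_function[OF \<open>v0 \<in> S\<close> root simple zero_less_one] by blast
 define \<sigma> where "\<sigma> v = \<alpha> v + Y v *s \<beta> v" for v
 \<comment> \<open>Points whose coordinate \<open>y\<close> lies in the disc in which the root is
   unique.\<close>
 define B where "B = {P. dot (hcoord P) m1 ~= 0 & dot (hcoord P) m2 / dot (hcoord P) m1 \<in> ball y0 r}"
 have B_iff: "proj_pt x \<in> B \<longleftrightarrow> dot x m1 ~= 0 & dot x m2 / dot x m1 \<in> ball y0 r" if "x ~= 0" for x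
  using hcoord_proj_pt[OF that] by (auto simp: B_def)
 have cont_dot1: "continuous_on A (%x. dot x b)" for A b unfolding dot_def by (intro continuous_intros)
 have "open B"
 proof -
  have o1: "open {x. dot x m1 ~= 0}" by (intro open_Collect_neq cont_dot1 continuous_on_const)
  have "continuous_on {x. dot x m1 ~= 0} (%x. dot x m2 / dot x m1)" by (intro continuous_intros cont_dot1) auto
  from continuous_open_preimage[OF this o1 open_ball[of y0 r]]
  have "open ({x. dot x m1 ~= 0} \<inter> (%x. dot x m2 / dot x m1) -` ball y0 r)" .
  moreover have "{x. x ~= 0 & proj_pt x \<in> B} = {x. dot x m1 ~= 0} \<inter> (%x. dot x m2 / dot x m1) -` ball y0 r"
  proof (intro equalityI subsetI)
   fix x assume "x \<in> {x. dot x m1 ~= 0} \<inter> (%x. dot x m2 / dot x m1) -` ball y0 r"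
   moreover from this have "x ~= 0" by auto
   ultimately show "x \<in> {x. x ~= 0 & proj_pt x \<in> B}" using B_iff by simp
  qed (use B_iff in auto)
  ultimately show ?thesis by (simp add: open_proj_plane_iff)
 qed
 have "P0 \<in> B" using P0m Y(3) by (simp add: B_def x0 ppoint_def)
 have d1: "dot (\<alpha> v) m1 = 1" "dot (\<beta> v) m1 = 0" "dot (\<alpha> v) m2 = 0" "dot (\<beta> v) m2 = 1" for v
  by (simp_all add: \<alpha>_def \<beta>_def)
 have d2: "dot (\<alpha> v) v = 0" "dot (\<beta> v) v = 0" if "v \<in> S" for v using that by (simp_all add: \<alpha>_def \<beta>_def S_def)
 have "v ~= 0 & \<sigma> v ~= 0 & dot (\<sigma> v) v = 0 & peval C (\<sigma> v) = 0 & (\<forall>i. cdiff (%v. \<sigma> v $ i) v) & proj_pt (\<sigma> v) \<in> B &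
  (\<forall>x. x ~= 0 --> peval C x = 0 --> dot x v = 0 --> proj_pt x \<in> B --> proj_pt x = proj_pt (\<sigma> v))"
  if v: "v \<in> ball v0 \<delta>" for v
 proof (intro conjI allI impI)
  have vS: "v \<in> S" using v Y(2) by blast
  then show "v ~= 0" by (auto simp: S_def)
  have s1: "dot (\<sigma> v) m1 = 1" "dot (\<sigma> v) m2 = Y v" by (simp_all add: \<sigma>_def d1)
  then show nz: "\<sigma> v ~= 0" by auto
  show "dot (\<sigma> v) v = 0" by (simp add: \<sigma>_def d2[OF vS])
  show "peval C (\<sigma> v) = 0" using Y(5)[OF v] by (simp add: p(1) \<sigma>_def)
  show "proj_pt (\<sigma> v) \<in> B" using B_iff[OF nz] Y(5)[OF v] s1 by simp
  have "cdiff (%b. poly (p b) (Y v)) v"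
   unfolding p(1) by (intro cdiff_poly_eval) (auto intro!: cdiff_add cdiff_mult cdiff_const cd[OF vS])
  then obtain D where D: "((%b. poly (p b) (Y v)) has_derivative D) (at v)" "!!c u. D (c *s u) = c * D u"
   unfolding cdiff_def by blast
  have "(Y has_derivative (%h. - D h / poly (pderiv (p v)) (Y v))) (at v)"
  proof (rule root_has_derivative[where \<xi> = Y and p = p and N = d and a = v, OF open_ball[of v0 \<delta>] v deg _ _ _ _ D(1)])
   show "isCont Y v" using Y(4) v continuous_on_eq_continuous_at[OF open_ball] by blast
   show "isCont (%b. coeff (p b) j) v" for j
    using p(2)[of j] vS continuous_on_eq_continuous_at[OF \<open>open S\<close>] by blast
  qed (use Y(5) v in auto)
  then have "cdiff Y v" unfolding cdiff_def using D(2) by (intro exI[of _ "%h. - D h / poly (pderiv (p v)) (Y v)"]) simp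
  then show "cdiff (%v. \<sigma> v $ i) v" for i
   unfolding \<sigma>_def vector_add_component vector_smult_component by (intro cdiff_add cdiff_mult cd[OF vS])
  fix x assume x: "x ~= 0" "peval C x = 0" "dot x v = 0" "proj_pt x \<in> B"
  define c y where "c = dot x m1" and "y = dot x m2 / dot x m1"
  have cy: "c ~= 0" "y \<in> ball y0 r" using B_iff[OF x(1)] x(4) by (auto simp: c_def y_def)
  have ex: "x = dot x v0 *s b0 + c *s b1 + (c * y) *s b2" using expand[of x] cy(1) by (simp add: c_def y_def)
  have e1: "dot x v0 * dot b0 v = - c * (dot b1 v + y * dot b2 v)"
   using x(3) by (subst (asm) ex) (simp add: algebra_simps add_eq_0_iff)
  define q1 q2 where "q1 = dot b1 v / dot b0 v" and "q2 = dot b2 v / dot b0 v"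
  have B0: "dot b0 v ~= 0" using vS by (simp add: S_def)
  then have q: "dot b1 v = q1 * dot b0 v" "dot b2 v = q2 * dot b0 v" by (simp_all add: q1_def q2_def)
  have "dot x v0 * dot b0 v = (- c * (q1 + y * q2)) * dot b0 v" unfolding e1 q by (simp add: algebra_simps)
  then have a: "dot x v0 = - c * (q1 + y * q2)" using B0 mult_right_cancel by blast
  have xe: "x = c *s (\<alpha> v + y *s \<beta> v)"
   by (subst ex) (unfold a \<alpha>_def \<beta>_def q1_def[symmetric] q2_def[symmetric], simp add: vec_eq_iff algebra_simps)
  then have "poly (p v) y = 0" using x(2) peval_scale[OF homogeneous_C, of c "\<alpha> v + y *s \<beta> v"] cy(1) by (simp add: p(1))
  then have "y = Y v" using Y(6)[OF v cy(2)] by blast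
  then show "proj_pt x = proj_pt (\<sigma> v)" using proj_pt_scale[OF cy(1), of "\<sigma> v"] xe by (simp only: \<sigma>_def)
 qed
 then show ?thesis using Y(1) \<open>open B\<close> \<open>P0 \<in> B\<close> by blast
qed

end

section \<open>The dualizing covering over good lines\<close>

text \<open>\<open>\<psi>\<close> inverts \<open>\<nu>\<close> over \<open>U\<close>. By
  \<open>cutU\<close>, points of the surface outside \<open>U\<close> are zeros of the polynomials
  that good lines avoid on the components.\<close>

locale dualizing_cut = dualizing k Comp ds F n Z \<nu> + plane_curve_cut k Comp ds g
 for k Comp ds F n and Z :: "'z fun_space" and \<nu> g +
 fixes U :: "(proj_plane \<times> proj_plane) set" and \<psi> :: "proj_plane \<times> proj_plane => 'z"
 assumes openU: "openin (zariski X) U"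
  and psi: "morphism (open_subspace X U) (open_subspace Z (preimage_in Z \<nu> U)) \<psi>"
  and psi_nu: "!!z. z \<in> preimage_in Z \<nu> U ==> \<psi> (\<nu> z) = z"
  and nu_psi: "!!y. y \<in> U ==> \<nu> (\<psi> y) = y"
  and cutU: "!!i. i \<in> {1..k} ==> {y \<in> incidence_set F. bihom_eval (g i) y ~= 0} \<subseteq> U"
begin

abbreviation "f \<equiv> snd \<circ> \<nu>"
abbreviation "Br \<equiv> branch_locus Z f"
abbreviation "ZU \<equiv> preimage_in Z \<nu> U"

lemma U_sub: "U \<subseteq> incidence_set F"
 using openin_subset[OF openU] by (simp add: X_def)

lemma topspace_U: "topspace (zariski (open_subspace X U)) = U"
 using openin_subset[OF openU] by (auto simp: open_subspace_def)

lemma openZU: "openin (zariski Z) ZU" by (rule openin_preimage[OF openU])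

lemma topspace_ZU: "topspace (zariski (open_subspace Z ZU)) = ZU"
 using openin_subset[OF openZU] by (auto simp: open_subspace_def)

lemma psi_in: "y \<in> U ==> \<psi> y \<in> ZU"
 using psi continuous_map_image_subset_topspace[of "zariski (open_subspace X U)" "zariski (open_subspace Z ZU)" \<psi>]
 unfolding morphism_def topspace_U topspace_ZU by blast

lemma psi_topspace: "y \<in> U ==> \<psi> y \<in> topspace (zariski Z)"
 using psi_in by (simp add: preimage_in_def)

lemma psi_pull:
 assumes B: "openin (zariski Z) B" "h \<in> regular Z B"
 shows "openin (zariski X) {y \<in> U. \<psi> y \<in> B} & (%y. h (\<psi> y)) \<in> regular X {y \<in> U. \<psi> y \<in> B}"
proof -
 have pre: "preimage_in (open_subspace X U) \<psi> (B \<inter> ZU) = {y \<in> U. \<psi> y \<in> B}"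
  using psi_in unfolding preimage_in_def[of "open_subspace X U"] topspace_U by blast
 have oB: "openin (zariski (open_subspace Z ZU)) (B \<inter> ZU)"
  using B(1) by (simp add: open_subspace_def openin_subtopology_Int)
 have "h \<in> regular Z (B \<inter> ZU)" by (rule regular_restrict[OF sp B(1) _ _ B(2)]) (auto intro: openin_Int B(1) openZU)
 then have "h \<in> regular (open_subspace Z ZU) (B \<inter> ZU)" by (simp add: open_subspace_def)
 then have "h \<circ> \<psi> \<in> regular (open_subspace X U) {y \<in> U. \<psi> y \<in> B}"
  using psi oB unfolding morphism_def pre[symmetric] by blast
 moreover have "openin (zariski (open_subspace X U)) {y \<in> U. \<psi> y \<in> B}"
  using psi oB openin_continuous_map_preimage[of "zariski (open_subspace X U)" "zariski (open_subspace Z ZU)" \<psi>]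
  unfolding morphism_def pre[symmetric] by (metis preimage_in_def)
 ultimately show ?thesis using openU by (simp add: open_subspace_def comp_def openin_open_subtopology)
qed

lemma psi_tendsto:
 assumes x: "(x \<longlongrightarrow> x0) \<F>" "x0 ~= 0" and v: "(v \<longlongrightarrow> v0) \<F>" "v0 ~= 0"
  and mem: "(proj_pt x0, proj_pt v0) \<in> U" and ev: "\<forall>\<^sub>F n in \<F>. (proj_pt (x n), proj_pt (v n)) \<in> incidence_set F"
 shows "limitin T (%n. \<psi> (proj_pt (x n), proj_pt (v n))) (\<psi> (proj_pt x0, proj_pt v0)) \<F>"
proof (rule limitin_complex[OF sp psi_topspace[OF mem]])
 fix B h assume B: "openin (zariski Z) B" "\<psi> (proj_pt x0, proj_pt v0) \<in> B" "h \<in> regular Z B"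
 from regular_tendsto[OF psi_pull[OF B(1,3), unfolded X_def, THEN conjunct1] psi_pull[OF B(1,3), unfolded X_def, THEN conjunct2] x v _ ev] B(2) mem
 have "(\<forall>\<^sub>F n in \<F>. (proj_pt (x n), proj_pt (v n)) \<in> {y \<in> U. \<psi> y \<in> B}) &
  ((%n. h (\<psi> (proj_pt (x n), proj_pt (v n)))) \<longlongrightarrow> h (\<psi> (proj_pt x0, proj_pt v0))) \<F>" by simp
 then show "(\<forall>\<^sub>F n in \<F>. \<psi> (proj_pt (x n), proj_pt (v n)) \<in> B) &
  ((%n. h (\<psi> (proj_pt (x n), proj_pt (v n)))) \<longlongrightarrow> h (\<psi> (proj_pt x0, proj_pt v0))) \<F>"
  by (auto elim: eventually_mono)
qed

lemma incidence_pt: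
 assumes "x ~= 0" "v ~= 0"
 shows "(proj_pt x, proj_pt v) \<in> incidence_set F \<longleftrightarrow> peval C x = 0 & dot x v = 0"
 using curve_points_proj_pt[OF homF assms(1)] incident_proj_pt[OF assms] by (simp add: incidence_set_def F_C)

lemma good_in_U:
 assumes v: "v ~= 0" "good v" and x: "x ~= 0" "peval C x = 0" "dot x v = 0"
 shows "(proj_pt x, proj_pt v) \<in> U"
proof -
 obtain i where i: "i \<in> {1..k}" "peval (Comp i) x = 0" using x(2) by (auto simp: C_def prod_zero_iff)
 then have "beval (g i) x v ~= 0" using v x by (auto simp: good_def avoids_def)
 moreover obtain a b where "bihomogeneous (g i) a b" using bihom[OF i(1)] by blast
 ultimately have "bihom_eval (g i) (proj_pt x, proj_pt v) ~= 0"
  using bihom_eval_proj_pt[OF x(1) v(1)] by (metis mult_eq_0_iff power_eq_0_iff)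
 then show ?thesis using cutU[OF i(1)] incidence_pt[OF x(1) v(1)] x(2,3) by blast
qed

lemma fibre_good:
 assumes v: "v ~= 0" "good v"
 shows "z \<in> topspace (zariski Z) ==> snd (\<nu> z) = proj_pt v ==>
   fst (\<nu> z) \<in> line_points C v & \<nu> z \<in> U & z = \<psi> (fst (\<nu> z), proj_pt v)"
  and "P \<in> line_points C v ==> (P, proj_pt v) \<in> U"
proof -
 show *: "(P, proj_pt v) \<in> U" if "P \<in> line_points C v" for P
  using good_in_U[OF v hcoord(1)] on_line_points[OF v(1) that] by (metis hcoord(2))
 assume z: "z \<in> topspace (zariski Z)" "snd (\<nu> z) = proj_pt v"
 have P: "fst (\<nu> z) \<in> line_points C v"
  using nu_in[OF z(1)] z(2) by (auto simp: incidence_set_def line_points_def F_C)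
 have "\<nu> z = (fst (\<nu> z), proj_pt v)" using z(2) by (simp add: prod_eq_iff)
 then show "fst (\<nu> z) \<in> line_points C v & \<nu> z \<in> U & z = \<psi> (fst (\<nu> z), proj_pt v)"
  using P *[OF P] psi_nu[of z] z(1) by (simp add: preimage_in_def)
qed

lemma cdiff_regular:
 assumes W: "openin (zariski X) W" "h \<in> regular X W" and N: "open N" "v0 \<in> N"
  and \<sigma>: "!!v. v \<in> N ==> v ~= 0 & \<sigma> v ~= 0 & (\<forall>i. cdiff (%v. \<sigma> v $ i) v) & (proj_pt (\<sigma> v), proj_pt v) \<in> incidence_set F"
  and mem: "(proj_pt (\<sigma> v0), proj_pt v0) \<in> W"
 shows "cdiff (%v. h (proj_pt (\<sigma> v), proj_pt v)) v0"
proof -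
 obtain W' p q where W': "openin (zariski X) W'" "(proj_pt (\<sigma> v0), proj_pt v0) \<in> W'"
  and eq: "!!y w. y ~= 0 ==> w ~= 0 ==> (proj_pt y, proj_pt w) \<in> W' ==>
   beval q y w ~= 0 & h (proj_pt y, proj_pt w) = beval p y w / beval q y w"
  using regular_local_quotient[OF W(2)[unfolded X_def] mem] unfolding X_def by blast
 have ev: "\<forall>\<^sub>F v in nhds v0. v \<in> N" using N eventually_nhds by blast
 have tend: "(\<sigma> \<longlongrightarrow> \<sigma> v0) (nhds v0)"
 proof (rule vec_tendstoI)
  show "((%v. \<sigma> v $ i) \<longlongrightarrow> \<sigma> v0 $ i) (nhds v0)" for i
   using cdiff_isCont \<sigma>[OF N(2)] by (metis tendsto_at_iff_tendsto_nhds isCont_def)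
 qed
 have mem': "\<forall>\<^sub>F v in nhds v0. (proj_pt (\<sigma> v), proj_pt v) \<in> incidence_set F"
  using ev by eventually_elim (use \<sigma> in blast)
 have "\<forall>\<^sub>F v in nhds v0. (proj_pt (\<sigma> v), proj_pt v) \<in> W'"
  using biproj_open_tendsto[OF W'(1)[unfolded X_def] tend _ filterlim_ident _ W'(2) mem'] \<sigma>[OF N(2)] by blast
 then have "\<forall>\<^sub>F v in nhds v0. v \<in> N & (proj_pt (\<sigma> v), proj_pt v) \<in> W'" using ev by eventually_elim blast
 then obtain S where S: "open S" "v0 \<in> S" "!!v. v \<in> S ==> v \<in> N & (proj_pt (\<sigma> v), proj_pt v) \<in> W'"
  unfolding eventually_nhds by blast
 show ?thesis
 proof (rule cdiff_cong[OF _ S(1,2)])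
  have comp: "cdiff (%v. beval p (\<sigma> v) v) v0" for p
   unfolding beval_def
  proof (rule cdiff_poly_eval)
   show "cdiff (%v. case_sum (($) (\<sigma> v)) (($) v) i) v0" for i
    using \<sigma>[OF N(2)] cdiff_nth by (cases i) auto
  qed
  show "cdiff (%v. beval p (\<sigma> v) v / beval q (\<sigma> v) v) v0"
   using eq[of "\<sigma> v0" v0] \<sigma>[OF N(2)] W'(2) by (intro cdiff_divide comp) auto
  show "beval p (\<sigma> v) v / beval q (\<sigma> v) v = h (proj_pt (\<sigma> v), proj_pt v)" if "v \<in> S" for v
   using eq[of "\<sigma> v" v] S(3)[OF that] \<sigma>[of v] by simp
 qed
qed

text \<open>Over a good line \<open>\<psi>\<close> identifies points of \<open>Z\<close> with points
  of the curve, and \<open>\<sigma>\<close> moves such a point holomorphically with the line. The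
  composite \<open>\<tau>\<close> is the local inverse of \<open>f\<close>.\<close>

lemma good_unbranched:
 assumes v0: "v0 ~= 0" "good v0" and z0: "z0 \<in> topspace (zariski Z)" "snd (\<nu> z0) = proj_pt v0"
 shows "locally_biholomorphic_at Z f z0"
proof -
 note fz = fibre_good(1)[OF v0 z0]
 obtain \<delta> \<sigma> B where \<delta>: "\<delta> > 0" "open B" "fst (\<nu> z0) \<in> B" and s: "!!v. v \<in> ball v0 \<delta> ==> v ~= 0 & \<sigma> v ~= 0 & dot (\<sigma> v) v = 0 &
  peval C (\<sigma> v) = 0 & (\<forall>i. cdiff (%v. \<sigma> v $ i) v) & proj_pt (\<sigma> v) \<in> B &
  (\<forall>x. x ~= 0 --> peval C x = 0 --> dot x v = 0 --> proj_pt x \<in> B --> proj_pt x = proj_pt (\<sigma> v))"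
  using ex_local_section[OF v0, of "fst (\<nu> z0)"] fz by blast
 have inc: "(proj_pt (\<sigma> v), proj_pt v) \<in> incidence_set F" if "v \<in> ball v0 \<delta>" for v
  using s[OF that] incidence_pt by blast
 have tend: "(\<sigma> \<longlongrightarrow> \<sigma> v) (nhds v)" if "v \<in> ball v0 \<delta>" for v
 proof (rule vec_tendstoI)
  show "((%v. \<sigma> v $ i) \<longlongrightarrow> \<sigma> v $ i) (nhds v)" for i
   using cdiff_isCont s[OF that] by (metis tendsto_at_iff_tendsto_nhds isCont_def)
 qed
 define N where "N = {v \<in> ball v0 \<delta>. (proj_pt (\<sigma> v), proj_pt v) \<in> U}"
 have "open N"
  unfolding open_subopen[of N]
 proof
  fix v assume v: "v \<in> N"
  then have vb: "v \<in> ball v0 \<delta>" and vU: "(proj_pt (\<sigma> v), proj_pt v) \<in> U" by (auto simp: N_def)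
  have ev: "\<forall>\<^sub>F v in nhds v. v \<in> ball v0 \<delta>" using vb eventually_nhds open_ball by blast
  then have ev': "\<forall>\<^sub>F v in nhds v. (proj_pt (\<sigma> v), proj_pt v) \<in> incidence_set F" by eventually_elim (rule inc)
  have "\<forall>\<^sub>F v in nhds v. (proj_pt (\<sigma> v), proj_pt v) \<in> U"
   using biproj_open_tendsto[OF openU[unfolded X_def] tend[OF vb] _ filterlim_ident _ vU ev'] s[OF vb] by blast
  then have "\<forall>\<^sub>F v in nhds v. v \<in> N" using ev unfolding N_def by eventually_elim blast
  then show "\<exists>S. open S & v \<in> S & S \<subseteq> N" unfolding eventually_nhds by blast
 qed
 have "v0 \<in> N"
  using \<delta>(1) s[of v0] good_in_U[OF v0] by (simp add: N_def)
 define L where "L = proj_pt ` N"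
 have N0: "v ~= 0" if "v \<in> N" for v using s that by (auto simp: N_def)
 have L_iff: "proj_pt w \<in> L \<longleftrightarrow> (\<exists>c. c ~= 0 & c *s w \<in> N)" if "w ~= 0" for w
 proof
  assume "proj_pt w \<in> L"
  then obtain v where "v \<in> N" "proj_pt w = proj_pt v" by (auto simp: L_def)
  then show "\<exists>c. c ~= 0 & c *s w \<in> N" using proj_pt_eq_iff[OF that N0] by auto
 next
  assume "\<exists>c. c ~= 0 & c *s w \<in> N"
  then show "proj_pt w \<in> L" unfolding L_def by (metis image_eqI proj_pt_scale)
 qed
 have "open L"
 proof -
  have "open {w. c *s w \<in> N}" for c
   using open_vimage[OF \<open>open N\<close> continuous_vec_scale[of c]] by (simp add: vimage_def)
  then have "open (\<Union>c\<in>-{0}. {w. c *s w \<in> N})" by blast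
  moreover have "{w. w ~= 0 & proj_pt w \<in> L} = (\<Union>c\<in>-{0}. {w. c *s w \<in> N})"
   using L_iff N0 by fastforce
  ultimately show ?thesis by (simp add: open_proj_plane_iff)
 qed
 \<comment> \<open>Confining the curve point to \<open>B\<close> selects one sheet over
   \<open>L\<close>, which makes \<open>f\<close> injective on \<open>V\<close>.\<close>
 define V where "V = ZU \<inter> {z \<in> topspace (zariski Z). snd (\<nu> z) \<in> L} \<inter> {z \<in> topspace (zariski Z). fst (\<nu> z) \<in> B}"
 have V_open: "openin T V"
  unfolding V_def using openin_complex_zariski[OF sp openZU] openin_nu \<open>open L\<close> \<open>open B\<close> by (intro openin_Int) auto
 define \<tau> where "\<tau> v = \<psi> (proj_pt (\<sigma> v), proj_pt v)" for v
 have \<tau>V: "\<tau> v \<in> V" "f (\<tau> v) = proj_pt v" if "v \<in> N" for v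
 proof -
  have U: "(proj_pt (\<sigma> v), proj_pt v) \<in> U" using that by (simp add: N_def)
  show "\<tau> v \<in> V" "f (\<tau> v) = proj_pt v"
   using U psi_in[OF U] psi_topspace[OF U] nu_psi[OF U] s[of v] that by (auto simp: V_def \<tau>_def L_def N_def)
 qed
 have V_\<tau>: "z = \<tau> v" if z: "z \<in> V" and v: "v \<in> N" "f z = proj_pt v" for z v
 proof -
  have zt: "z \<in> topspace (zariski Z)" "z \<in> ZU" "fst (\<nu> z) \<in> B" using z by (auto simp: V_def)
  have vb: "v \<in> ball v0 \<delta>" using v by (simp add: N_def)
  have "(fst (\<nu> z), proj_pt v) \<in> incidence_set F" using nu_in[OF zt(1)] v(2) by (metis comp_apply prod.collapse)
  then have "proj_pt (hcoord (fst (\<nu> z))) = proj_pt (\<sigma> v)"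
   using s[OF vb] incidence_pt[OF hcoord(1) N0[OF v(1)]] zt(3) hcoord by metis
  then have "\<nu> z = (proj_pt (\<sigma> v), proj_pt v)" using v(2) by (simp add: hcoord prod_eq_iff)
  then show ?thesis using psi_nu[OF zt(2)] by (simp add: \<tau>_def)
 qed
 have fV: "f ` V = L"
 proof
  show "f ` V \<subseteq> L" by (auto simp: V_def)
  show "L \<subseteq> f ` V"
  proof
   fix l assume "l \<in> L"
   then obtain v where "v \<in> N" "l = proj_pt v" by (auto simp: L_def)
   then show "l \<in> f ` V" using \<tau>V by (metis image_eqI)
  qed
 qed
 have inj: "inj_on f V"
 proof (rule inj_onI)
  fix z w assume zw: "z \<in> V" "w \<in> V" "f z = f w"
  then have "f z \<in> L" using fV by blast
  then obtain v where "v \<in> N" "f z = proj_pt v" by (auto simp: L_def)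
  then show "z = w" using V_\<tau> zw by metis
 qed
 define \<rho> where "\<rho> = inv_into V f"
 have \<rho>\<tau>: "\<rho> (proj_pt v) = \<tau> v" if "v \<in> N" for v
  unfolding \<rho>_def using inv_into_f_f[OF inj \<tau>V(1)[OF that]] \<tau>V(2)[OF that] by simp
 have "z0 \<in> V"
 proof -
  have "proj_pt v0 \<in> L" using \<open>v0 \<in> N\<close> by (simp add: L_def)
  then show ?thesis using z0 fz \<delta>(3) by (simp add: V_def preimage_in_def)
 qed
 have cont\<rho>: "continuous_map (top_of_set L) T \<rho>"
 proof (rule continuous_map_limitin)
  fix l assume "l \<in> L"
  then obtain v where v: "v \<in> N" "l = proj_pt v" by (auto simp: L_def)
  obtain i where i: "l \<in> chart i" using ex_chart by blast
  \<comment> \<open>A continuous choice of coordinates near \<open>l\<close> with value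
    \<open>v\<close> at \<open>l\<close>, needed because \<open>\<sigma>\<close> is defined on
    vectors and not on lines.\<close>
  define u where "u l' = v $ i *s chart_coord i l'" for l'
  have vi: "v $ i ~= 0" using i v N0 chart_proj_pt by auto
  then have "u l = v" using v(2) chart_coord_proj_pt[OF N0[OF v(1)] vi] by (simp add: u_def vec_eq_iff)
  have "((%l'. chart_coord i l') \<longlongrightarrow> chart_coord i l) (at l within L)"
   by (rule tendsto_chart_coord[OF _ i]) (rule tendsto_ident_at)
  then have "(u \<longlongrightarrow> u l) (at l within L)"
   unfolding u_def vector_scalar_mult_def by (intro vec_tendstoI) (auto intro!: tendsto_intros)
  then have tu: "(u \<longlongrightarrow> v) (at l within L)" by (simp add: \<open>u l = v\<close>)
  have "\<forall>\<^sub>F l' in at l within L. l' \<in> chart i" by (rule topological_tendstoD[OF tendsto_ident_at open_chart i])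
  then have pu: "\<forall>\<^sub>F l' in at l within L. proj_pt (u l') = l'"
   by eventually_elim (simp add: u_def vi proj_pt_chart_coord)
  have uN: "\<forall>\<^sub>F l' in at l within L. u l' \<in> N" by (rule topological_tendstoD[OF tu \<open>open N\<close> v(1)])
  have vb: "v \<in> ball v0 \<delta>" and vU: "(proj_pt (\<sigma> v), proj_pt v) \<in> U" using v(1) by (auto simp: N_def)
  have "limitin T (%l'. \<psi> (proj_pt (\<sigma> (u l')), proj_pt (u l'))) (\<psi> (proj_pt (\<sigma> v), proj_pt v)) (at l within L)"
  proof (rule psi_tendsto[OF _ _ tu N0[OF v(1)] vU])
   show "((%l'. \<sigma> (u l')) \<longlongrightarrow> \<sigma> v) (at l within L)" by (rule filterlim_compose[OF tend[OF vb] tu])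
   show "\<forall>\<^sub>F l' in at l within L. (proj_pt (\<sigma> (u l')), proj_pt (u l')) \<in> incidence_set F"
    using uN by eventually_elim (use U_sub in \<open>auto simp: N_def\<close>)
  qed (use s[OF vb] in blast)
  then have "limitin T (%l'. \<tau> (u l')) (\<rho> l) (at l within L)" using \<rho>\<tau>[OF v(1)] v(2) by (simp add: \<tau>_def)
  moreover have "\<forall>\<^sub>F l' in at l within L. \<tau> (u l') = \<rho> l'" using uN pu by eventually_elim (metis \<rho>\<tau>)
  ultimately show "limitin T \<rho> (\<rho> l) (at l within L)" using limitin_transform_eventually[of "%l'. \<tau> (u l')" \<rho>] by blast
 qed
 have contf: "continuous_map (subtopology T V) (top_of_set L) f"
  unfolding continuous_map_in_subtopology
 proof (intro conjI continuous_map_from_subtopology)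
  show "continuous_map T euclidean f"
   using openin_nu(2) unfolding continuous_map_def by (simp add: topspace_complex[OF sp])
 qed (use fV in auto)
 have tV: "topspace (subtopology T V) = V" using openin_subset[OF V_open] by auto
 have \<rho>V: "\<rho> l \<in> V" "f (\<rho> l) = l" if "l \<in> L" for l
  unfolding \<rho>_def using that fV by (metis inv_into_into, metis f_inv_into_f)
 have "homeomorphic_maps (subtopology T V) (top_of_set L) f \<rho>"
  unfolding homeomorphic_maps_def continuous_map_in_subtopology[of _ T]
  using contf cont\<rho> tV \<rho>V inv_into_f_f[OF inj] by (auto simp: \<rho>_def)
 then have hom: "homeomorphic_map (subtopology T V) (top_of_set (f ` V)) f"
  unfolding fV by (rule homeomorphic_maps_imp_map)
 have "holomorphic_on_plane (h \<circ> inv_into V f) (f ` (V \<inter> W))" if W: "openin (zariski Z) W" "h \<in> regular Z W" for W h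
  unfolding holomorphic_on_plane_def
 proof (intro allI impI)
  fix w assume w: "w ~= 0 & proj_pt w \<in> f ` (V \<inter> W)"
  then have "proj_pt w \<in> L" using fV by blast
  \<comment> \<open>The vector \<open>w\<close> itself may lie outside \<open>N\<close>; holomorphy
    is transported from its multiple inside \<open>N\<close>.\<close>
  then obtain c where c: "c ~= 0" "c *s w \<in> N" using L_iff w by blast
  obtain z where z: "z \<in> V" "z \<in> W" "f z = proj_pt (c *s w)" using w c(1) by auto
  then have "\<tau> (c *s w) \<in> W" using V_\<tau>[OF z(1) c(2)] by simp
  then have mem: "(proj_pt (\<sigma> (c *s w)), proj_pt (c *s w)) \<in> {y \<in> U. \<psi> y \<in> W}" using c(2) by (simp add: \<tau>_def N_def)
  have s': "v ~= 0 & \<sigma> v ~= 0 & (\<forall>i. cdiff (%v. \<sigma> v $ i) v) & (proj_pt (\<sigma> v), proj_pt v) \<in> incidence_set F" if "v \<in> N" for v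
   using s[of v] U_sub that by (auto simp: N_def)
  have "cdiff (%v. h (\<psi> (proj_pt (\<sigma> v), proj_pt v))) (c *s w)"
   using cdiff_regular[OF psi_pull[OF W, THEN conjunct1] psi_pull[OF W, THEN conjunct2] \<open>open N\<close> c(2) s' mem] by blast
  then have "cdiff (%v. h (\<tau> v)) (c *s w)" unfolding \<tau>_def .
  then have "cdiff (%u. h (\<tau> (c *s u))) w" by (rule cdiff_compose_scale)
  moreover have "open {u. c *s u \<in> N}" using open_vimage[OF \<open>open N\<close> continuous_vec_scale[of c]] by (simp add: vimage_def)
  ultimately have "cdiff (%u. (h \<circ> inv_into V f) (proj_pt u)) w"
  proof (rule cdiff_cong)
   show "w \<in> {u. c *s u \<in> N}" using c by simp
   show "h (\<tau> (c *s u)) = (h \<circ> inv_into V f) (proj_pt u)" if "u \<in> {u. c *s u \<in> N}" for u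
    using \<rho>\<tau>[of "c *s u"] that c(1) by (simp add: \<rho>_def)
  qed
  then show "\<exists>D. ((%u. (h \<circ> inv_into V f) (proj_pt u)) has_derivative D) (at w) & (\<forall>c u. D (c *s u) = c * D u)"
   unfolding cdiff_def .
 qed
 then show ?thesis
  unfolding locally_biholomorphic_at_def using V_open \<open>z0 \<in> V\<close> hom \<open>open L\<close> fV by (intro exI[of _ V]) auto
qed

lemma good_not_branch: "v ~= 0 ==> good v ==> proj_pt v \<notin> Br"
 using good_unbranched by (fastforce simp: branch_locus_def)

sublocale cov: lifting T f "- Br"
proof
 fix z assume z: "z \<in> topspace T" "f z \<in> - Br"
 then have "locally_biholomorphic_at Z f z" using topspace_complex[OF sp] by (auto simp: branch_locus_def)
 then show "\<exists>U. openin T U & z \<in> U & open (f ` U) & homeomorphic_map (subtopology T U) (top_of_set (f ` U)) f"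
  unfolding locally_biholomorphic_at_def by blast
next
 show "\<exists>U V. openin T U & openin T V & z \<in> U & z' \<in> V & U \<inter> V = {}"
  if "z \<in> topspace T" "z' \<in> topspace T" "z ~= z'" for z z' using separated[OF that] .
next
 fix zs :: "nat => 'z" and l assume "!!n. zs n \<in> topspace T" "(%n. f (zs n)) \<longlonglongrightarrow> l"
 then show "\<exists>r z. strict_mono r & z \<in> topspace T & f z = l & limitin T (zs \<circ> r) z sequentially"
  using proper[of zs l] by simp
qed

text \<open>The pairs of moving point and moving line stay in \<open>U\<close>, so
  \<open>\<psi>\<close> carries them to a path in \<open>Z\<close> over the loop of lines.\<close>

lemma moves_connects:
 assumes m: "moves i v P Q \<gamma>" and i: "i \<in> {1..k}"
 shows "cov.connects (%t. proj_pt (\<gamma> t)) (\<psi> (P, proj_pt v)) (\<psi> (Q, proj_pt v))"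
proof -
 obtain c where \<gamma>: "path \<gamma>" "\<gamma> 0 = v" "\<gamma> 1 = v" "!!t. t \<in> {0..1} ==> \<gamma> t ~= 0 & good (\<gamma> t)"
  and c: "path c" "!!t. t \<in> {0..1} ==> c t ~= 0 & dot (c t) (\<gamma> t) = 0 & peval (Comp i) (c t) = 0" "proj_pt (c 0) = P" "proj_pt (c 1) = Q"
  using m unfolding moves_def by blast
 have Cc: "peval C (c t) = 0" if "t \<in> {0..1}" for t using c(2)[OF that] by (simp add: C_Rest[OF i])
 have U: "(proj_pt (c t), proj_pt (\<gamma> t)) \<in> U" if "t \<in> {0..1}" for t
  using good_in_U[of "\<gamma> t" "c t"] \<gamma>(4)[OF that] c(2)[OF that] Cc[OF that] by blast
 let ?h = "%t. \<psi> (proj_pt (c t), proj_pt (\<gamma> t))"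
 have "continuous_map (top_of_set {0..1}) T ?h"
 proof (rule continuous_map_limitin)
  fix t :: real assume t: "t \<in> {0..1}"
  have "\<forall>\<^sub>F s in at t within {0..1}. s \<in> {0..1}" by (simp add: eventually_at_filter)
  then have ev: "\<forall>\<^sub>F s in at t within {0..1}. (proj_pt (c s), proj_pt (\<gamma> s)) \<in> incidence_set F"
   by eventually_elim (use U U_sub in blast)
  show "limitin T ?h (?h t) (at t within {0..1})"
   using c(1) \<gamma>(1) t c(2)[OF t] \<gamma>(4)[OF t] U[OF t] ev
   by (intro psi_tendsto) (auto simp: path_def continuous_on_def)
 qed
 moreover have "f (?h t) = proj_pt (\<gamma> t)" if "t \<in> {0..1}" for t using nu_psi[OF U[OF that]] by simp
 ultimately have "cov.lift {0..1} (%t. proj_pt (\<gamma> t)) ?h" by (simp add: cov.lift_def)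
 then show ?thesis unfolding cov.connects_def using c(3,4) \<gamma>(2,3) by (intro exI[of _ ?h]) auto
qed

lemma moves_path:
 assumes "moves i v P Q \<gamma>"
 shows "path (%t. proj_pt (\<gamma> t))" "path_image (%t. proj_pt (\<gamma> t)) \<subseteq> - Br"
 using assms good_not_branch unfolding moves_def path_def path_image_def
 by (auto intro: continuous_on_proj_pt_compose)

end

section \<open>Permutations of a fibre\<close>

context lifting begin

text \<open>A transposition is its own inverse, so the direction in which lifts are read does not
  matter here.\<close>

definition swaps :: "'b => (real => 'b) => 'z => 'z => bool" where
 "swaps l p z w \<longleftrightarrow> path p & path_image p \<subseteq> S & p 0 = l & p 1 = l &
  (\<forall>u\<in>fibre l. connects p u (swap z w u))"

lemma join_path:
 assumes "path p" "path q" "p 1 = q 0" "path_image p \<subseteq> S" "path_image q \<subseteq> S"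
 shows "path (p +++ q) & path_image (p +++ q) \<subseteq> S & (p +++ q) 0 = p 0 & (p +++ q) 1 = q 1"
proof (intro conjI)
 show "path (p +++ q)" using assms by (simp add: pathfinish_def pathstart_def)
 show "path_image (p +++ q) \<subseteq> S" using assms path_image_join_subset[of p q] by blast
qed (simp_all add: joinpaths_def)

text \<open>Conjugation: back along \<open>q\<close>, around \<open>\<tau>\<close>, and out along
  \<open>q\<close> again.\<close>

lemma swaps_conjugate:
 assumes \<tau>: "swaps l \<tau> P Q" and q: "path q" "path_image q \<subseteq> S" "q 0 = l"
  and PR: "connects q P R" "connects q Q R'"
 shows "\<exists>p. swaps (q 1) p R R'"
proof -
 have t: "path \<tau>" "path_image \<tau> \<subseteq> S" "\<tau> 0 = l" "\<tau> 1 = l" "!!u. u \<in> fibre l ==> connects \<tau> u (swap P Q u)"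
  using \<tau> by (auto simp: swaps_def)
 have r: "path (reversepath q)" "path_image (reversepath q) \<subseteq> S" "reversepath q 0 = q 1" "reversepath q 1 = l"
  using q path_reversepath path_image_reversepath by (blast, metis, auto simp: reversepath_def)
 have j1: "path (\<tau> +++ q) & path_image (\<tau> +++ q) \<subseteq> S & (\<tau> +++ q) 0 = l & (\<tau> +++ q) 1 = q 1"
  using join_path[of \<tau> q] t q by auto
 let ?p = "reversepath q +++ (\<tau> +++ q)"
 have j2: "path ?p & path_image ?p \<subseteq> S & ?p 0 = q 1 & ?p 1 = q 1"
  using join_path[of "reversepath q" "\<tau> +++ q"] j1 r by auto
 have "connects ?p u (swap R R' u)" if u: "u \<in> fibre (q 1)" for u
 proof -
  obtain w where w: "connects q w u" using connects_ex_start[OF q(1,2) u] by blast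
  have "w \<in> fibre l" using connects_fibre[OF w] q(3) by simp
  then have 1: "connects \<tau> w (swap P Q w)" by (rule t(5))
  have "connects q (swap P Q w) (swap R R' u)"
  proof (cases "w = P \<or> w = Q")
   case True
   then show ?thesis using connects_unique[OF q(2) w] PR by (auto simp: Transposition.transpose_def)
  next
   case False
   then have "u ~= R" "u ~= R'" using connects_unique_start[OF q(2) w] PR by auto
   then show ?thesis using False w by simp
  qed
  then have "connects (\<tau> +++ q) w (swap R R' u)"
   using connects_join[OF 1] t q by simp
  then show ?thesis using connects_join[OF connects_reversepath[OF w]] r j1 by simp
 qed
 then show ?thesis using j2 unfolding swaps_def by blast
qed

text \<open>Labels are locally constant along a lift: each label class is open, and over
  \<open>S\<close> the classes are disjoint.\<close>

lemma connects_along: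
 assumes c: "connects p w z" and p: "path_image p \<subseteq> S"
  and open_lab: "!!i. openin T {z. lab z i}" and ex: "!!z. z \<in> topspace T ==> \<exists>i. lab z i"
  and unique: "!!z i j. z \<in> topspace T ==> f z \<in> S ==> lab z i ==> lab z j ==> i = j" and w: "lab w i"
 shows "lab z i"
proof -
 obtain g where g: "lift {0..1} p g" "g 0 = w" "g 1 = z" using c unfolding connects_def by blast
 define A where "A j = {t \<in> {0..1}. g t \<in> {z. lab z j}}" for j
 have op: "openin (top_of_set {0..1}) (A j)" for j unfolding A_def by (rule lift_preimage_open[OF g(1) open_lab])
 have gS: "g t \<in> topspace T" "f (g t) \<in> S" if "t \<in> {0..1}" for t
  using lift_topspace[OF g(1) that] g(1) p that by (auto simp: lift_def path_image_def)
 have "{0..1} - A i = (\<Union>j\<in>- {i}. A j)"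
  using ex[OF gS(1)] unique[OF gS] by (auto simp: A_def) blast
 then have "openin (top_of_set {0..1}) ({0..1} - A i)" using op by auto
 then have "closedin (top_of_set {0..1}) (A i)" by (auto simp: closedin_def A_def)
 then have "A i = {} \<or> A i = {0..1}" using op[of i] connected_Icc[of 0 1] unfolding connected_clopen by blast
 moreover have "0 \<in> A i" using g(2) w by (simp add: A_def)
 ultimately have e: "A i = {0..1}" by blast
 have "1 \<in> A i" unfolding e by simp
 then show ?thesis using g(3) by (simp add: A_def)
qed

lemma connects_bij:
 assumes p: "path p" "path_image p \<subseteq> S"
 shows "\<exists>h. bij_betw h (fibre (p 0)) (fibre (p 1)) & (\<forall>z\<in>fibre (p 0). connects p z (h z))"
proof -
 have "\<forall>z\<in>fibre (p 0). \<exists>w. connects p z w" using connects_ex[OF p] by blast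
 then obtain h where h: "\<forall>z\<in>fibre (p 0). connects p z (h z)" by (rule bchoice[THEN exE])
 have "inj_on h (fibre (p 0))"
 proof (rule inj_onI)
  fix z w assume zw: "z \<in> fibre (p 0)" "w \<in> fibre (p 0)" "h z = h w"
  have "connects p z (h w)" using h zw(1) unfolding zw(3)[symmetric] by blast
  moreover have "connects p w (h w)" using h zw(2) by blast
  ultimately show "z = w" by (rule connects_unique_start[OF p(2)])
 qed
 moreover have "h ` fibre (p 0) = fibre (p 1)"
 proof (intro equalityI subsetI)
  fix w assume "w \<in> h ` fibre (p 0)"
  then show "w \<in> fibre (p 1)" using h connects_fibre by blast
 next
  fix w assume "w \<in> fibre (p 1)"
  then obtain z where z: "connects p z w" using connects_ex_start[OF p] by blast
  then have "z \<in> fibre (p 0)" using connects_fibre by blast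
  moreover have "connects p z (h z)" using h \<open>z \<in> fibre (p 0)\<close> by blast
  then have "w = h z" using connects_unique[OF p(2) z] by blast
  ultimately show "w \<in> h ` fibre (p 0)" by blast
 qed
 ultimately show ?thesis using h by (auto simp: bij_betw_def)
qed

text \<open>Composition with the transposition of \<open>z\<close> and \<open>\<sigma> z\<close>
  fixes \<open>z\<close> and moves no new point, so induction on the number of moved points applies.
  Lifts run from \<open>\<sigma> z\<close> to \<open>z\<close>, as in the convention of
  \<open>monodromy\<close>.\<close>

lemma permutation_by_loop:
 assumes l: "l \<in> S" and fin: "finite (fibre l)"
  and swap: "!!z w. z \<in> fibre l ==> w \<in> fibre l ==> z ~= w ==> lab z = lab w ==> \<exists>p. swaps l p z w"
  and \<sigma>: "bij_betw \<sigma> (fibre l) (fibre l)" "!!z. z \<in> fibre l ==> lab (\<sigma> z) = lab z"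
 shows "\<exists>p. path p & path_image p \<subseteq> S & p 0 = l & p 1 = l & (\<forall>z\<in>fibre l. connects p (\<sigma> z) z)"
 using \<sigma>
proof (induction "card {z \<in> fibre l. \<sigma> z ~= z}" arbitrary: \<sigma> rule: less_induct)
 case less
 note \<sigma> = less.prems
 have in_F: "\<sigma> z \<in> fibre l" if "z \<in> fibre l" for z using bij_betwE[OF \<sigma>(1)] that by blast
 show ?case
 proof (cases "\<forall>z\<in>fibre l. \<sigma> z = z")
  case True
  then show ?thesis using connects_const l
   by (intro exI[of _ "%_. l"]) (auto simp: path_def path_image_def)
 next
  case False
  then obtain z where z: "z \<in> fibre l" "\<sigma> z ~= z" by blast
  let ?\<tau> = "swap z (\<sigma> z)"
  define \<sigma>' where "\<sigma>' = ?\<tau> \<circ> \<sigma>"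
  have "bij_betw ?\<tau> (fibre l) (fibre l)" using z(1) in_F[OF z(1)] by simp
  then have bij: "bij_betw \<sigma>' (fibre l) (fibre l)" unfolding \<sigma>'_def by (rule bij_betw_trans[OF \<sigma>(1)])
  have lab': "lab (\<sigma>' u) = lab u" if "u \<in> fibre l" for u
   using \<sigma>(2)[OF that] \<sigma>(2)[OF z(1)] by (auto simp: \<sigma>'_def Transposition.transpose_def)
  have sub: "{u \<in> fibre l. \<sigma>' u ~= u} \<subset> {u \<in> fibre l. \<sigma> u ~= u}"
  proof
   show "{u \<in> fibre l. \<sigma>' u ~= u} \<subseteq> {u \<in> fibre l. \<sigma> u ~= u}"
   proof (intro subsetI CollectI conjI)
    fix u assume u: "u \<in> {u \<in> fibre l. \<sigma>' u ~= u}"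
    then show "u \<in> fibre l" by simp
    show "\<sigma> u ~= u"
    proof
     assume e: "\<sigma> u = u"
     then have "u ~= z" using z(2) by auto
     moreover have "u ~= \<sigma> z" using bij_betw_imp_inj_on[OF \<sigma>(1)] u z(1) e \<open>u ~= z\<close> by (auto dest: inj_onD)
     ultimately show False using u e by (simp add: \<sigma>'_def)
    qed
   qed
   have "\<sigma>' z = z" by (simp add: \<sigma>'_def)
   then show "{u \<in> fibre l. \<sigma>' u ~= u} ~= {u \<in> fibre l. \<sigma> u ~= u}" using z by blast
  qed
  have "card {u \<in> fibre l. \<sigma>' u ~= u} < card {u \<in> fibre l. \<sigma> u ~= u}"
   by (rule psubset_card_mono[OF _ sub]) (simp add: fin)
  from less.hyps[OF this bij lab'] obtain q where q: "path q" "path_image q \<subseteq> S" "q 0 = l" "q 1 = l"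
   "!!u. u \<in> fibre l ==> connects q (\<sigma>' u) u" by blast
  obtain p where p: "swaps l p z (\<sigma> z)" using swap[OF z(1) in_F[OF z(1)]] z(2) \<sigma>(2)[OF z(1)] by metis
  have "connects (p +++ q) (\<sigma> u) u" if u: "u \<in> fibre l" for u
  proof -
   have "connects p (\<sigma> u) (\<sigma>' u)" using p in_F[OF u] by (simp add: swaps_def \<sigma>'_def)
   then show ?thesis using connects_join[OF _ q(5)[OF u]] p q by (simp add: swaps_def)
  qed
  moreover have "path (p +++ q) & path_image (p +++ q) \<subseteq> S & (p +++ q) 0 = l & (p +++ q) 1 = l"
   using join_path[of p q] p q by (simp add: swaps_def)
  ultimately show ?thesis by blast
 qed
qed

end

section \<open>From arbitrary lines outside the branch locus to good lines\<close>

context plane_curve_cut begin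

lemma pencil_through:
 assumes "v1 ~= 0" "v2 ~= 0" "!!c. c ~= 0 ==> v2 ~= c *s v1"
 shows "\<exists>m2. pencil v1 (v2 - v1) m2"
proof -
 have "v2 - v1 ~= c *s v1" for c
 proof
  assume e: "v2 - v1 = c *s v1"
  define a where "a = c + 1"
  have a: "v2 = a *s v1" using e by (simp add: a_def vec_eq_iff algebra_simps)
  then have "a ~= 0" using assms(2) by auto
  then show False using assms(3) a by blast
 qed
 then show ?thesis using pencil_ex assms(1) by blast
qed

text \<open>The pencil joining \<open>l\<close> to a good line has finitely many bad members, while
  infinitely many of its members lie in \<open>B\<close>.\<close>

lemma good_dense:
 assumes "open B" "l \<in> B"
 shows "\<exists>v. v ~= 0 & good v & proj_pt v \<in> B"
proof -
 define v1 where "v1 = hcoord l"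
 have v1: "v1 ~= 0" "proj_pt v1 \<in> B" using assms(2) by (simp_all add: v1_def hcoord)
 obtain v2 where v2: "v2 ~= 0" "good v2" using generic_good(2) by blast
 show ?thesis
 proof (cases "\<exists>c. c ~= 0 & v2 = c *s v1")
  case True
  then show ?thesis using v1 v2 good_scale by blast
 next
  case False
  then obtain m2 where m: "pencil v1 (v2 - v1) m2" using pencil_through v1(1) v2(1) by blast
  then interpret pencil v1 "v2 - v1" m2 .
  have "pline 1 = v2" by (simp add: pline_def)
  then have fin: "finite {s. \<not> good (pline s)}" using finite_bad[OF m, of 1] v2 by simp
  have "continuous_on UNIV pline" unfolding pline_def by (intro continuous_intros continuous_on_vec_scale)
  moreover have "open {v. v ~= 0 & proj_pt v \<in> B}" using assms(1) by (simp add: open_proj_plane_iff)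
  ultimately have "open (pline -` {v. v ~= 0 & proj_pt v \<in> B})" by (rule open_vimage[rotated])
  moreover have "0 \<in> pline -` {v. v ~= 0 & proj_pt v \<in> B}" using v1 by (simp add: pline_def)
  ultimately have "infinite (pline -` {v. v ~= 0 & proj_pt v \<in> B})"
   using finite_imp_not_open by blast
  then have "\<not> pline -` {v. v ~= 0 & proj_pt v \<in> B} \<subseteq> {s. \<not> good (pline s)}" using fin finite_subset by blast
  then show ?thesis by blast
 qed
qed

end

context dualizing_cut begin

text \<open>Two labels at \<open>z\<close> hold on an open set whose image is open and hence
  contains a good line; but on a good line two components have no common point.\<close>

lemma label_unique:
 assumes z: "z \<in> topspace T" "f z \<in> - Br" and ij: "label z i" "label z j"
 shows "i = j"
proof (rule ccontr)
 assume "i ~= j"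
 obtain V where V: "openin T V" "z \<in> V" "open (f ` V)" "homeomorphic_map (subtopology T V) (top_of_set (f ` V)) f"
  using cov.local_homeo[OF z] by blast
 let ?W = "V \<inter> ({z. label z i} \<inter> {z. label z j})"
 have "openin (subtopology T V) ?W"
  by (rule openin_subtopology_Int2) (intro openin_Int openin_label)
 then have "openin (top_of_set (f ` V)) (f ` ?W)"
  using homeomorphic_imp_open_map[OF V(4)] unfolding open_map_def by blast
 then have "open (f ` ?W)" using V(3) openin_open_eq by blast
 moreover have "f z \<in> f ` ?W" using V(2) ij by blast
 ultimately obtain v where v: "v ~= 0" "good v" "proj_pt v \<in> f ` ?W" using good_dense by blast
 then obtain w where w: "w \<in> ?W" "proj_pt v = f w" by blast
 have "w \<in> topspace (zariski Z)" using w(1) openin_subset[OF V(1)] topspace_complex[OF sp] by auto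
 then have "incident (fst (\<nu> w)) (proj_pt v)" using nu_in[of w] w(2) by (auto simp: incidence_set_def)
 then have "fst (\<nu> w) \<in> line_points (Comp i) v \<inter> line_points (Comp j) v"
  using w(1) label_on_component by (auto simp: line_points_def)
 moreover have "i \<in> {1..k}" "j \<in> {1..k}" using ij label_in by auto
 ultimately show False using v(2) \<open>i ~= j\<close> unfolding good_def transversal_def by blast
qed

lemma label_connects:
 assumes "cov.connects p w z" "path_image p \<subseteq> - Br" "label w i"
 shows "label z i"
proof (rule cov.connects_along[where lab = label, OF assms(1,2) openin_label _ _ assms(3)])
 show "\<exists>i. label z i" if "z \<in> topspace T" for z using ex_label[of z] that topspace_complex[OF sp] by simp
qed (rule label_unique)

text \<open>In the pencil through \<open>l\<close> and \<open>v\<close> the finitely many parameters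
  of bad lines can be bypassed. The parameter 0 of \<open>l\<close> is kept even if \<open>l\<close>
  is bad, since \<open>l\<close> is outside the branch locus.\<close>

lemma path_to_good:
 assumes l: "l \<notin> Br" and v: "v ~= 0" "good v"
 shows "\<exists>p. path p & path_image p \<subseteq> - Br & p 0 = l & p 1 = proj_pt v"
proof -
 define v1 where "v1 = hcoord l"
 have v1: "v1 ~= 0" "proj_pt v1 = l" by (simp_all add: v1_def hcoord)
 show ?thesis
 proof (cases "\<exists>c. c ~= 0 & v = c *s v1")
  case True
  then show ?thesis using v1 l by (intro exI[of _ "%_. l"]) (auto simp: path_def path_image_def)
 next
  case False
  then obtain m2 where m: "pencil v1 (v - v1) m2" using pencil_through v1(1) v(1) by blast
  then interpret pencil v1 "v - v1" m2 .
  have pl: "pline 1 = v" "pline 0 = v1" by (simp_all add: pline_def)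
  define bad where "bad = {s. \<not> good (pline s)} - {0}"
  have "finite bad" using finite_bad[OF m, of 1] v pl by (simp add: bad_def)
  then have "path_connected (- bad)" by (intro path_connected_complement_countable countable_finite) auto
  moreover have "0 \<in> - bad" "1 \<in> - bad" using pl v by (auto simp: bad_def)
  ultimately obtain q where q: "path q" "path_image q \<subseteq> - bad" "pathstart q = 0" "pathfinish q = 1"
   unfolding path_connected_def by blast
  have "proj_pt (pline s) \<notin> Br" if "s \<in> - bad" for s
   using that good_not_branch[OF pline_nonzero] l v1 pl by (cases "s = 0") (auto simp: bad_def)
  then have "path_image (%t. proj_pt (pline (q t))) \<subseteq> - Br" using q(2) by (auto simp: path_image_def)
  moreover have "path (%t. proj_pt (pline (q t)))"
   using q(1) pline_nonzero unfolding path_def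
   by (intro continuous_on_proj_pt_compose) (auto simp: pline_def intro!: continuous_intros continuous_on_vec_scale)
  ultimately show ?thesis using q(3,4) pl v1
   by (intro exI[of _ "%t. proj_pt (pline (q t))"]) (auto simp: pathstart_def pathfinish_def)
 qed
qed

lemma fibre_psi:
 assumes v: "v ~= 0" "good v"
 shows "P \<in> line_points C v ==> \<psi> (P, proj_pt v) \<in> cov.fibre (proj_pt v) & fst (\<nu> (\<psi> (P, proj_pt v))) = P"
  and "z \<in> cov.fibre (proj_pt v) ==> fst (\<nu> z) \<in> line_points C v & z = \<psi> (fst (\<nu> z), proj_pt v)"
 using fibre_good[OF v] nu_psi psi_topspace by (auto simp: cov.fibre_def topspace_complex[OF sp])

lemma label_good:
 assumes v: "v ~= 0" "good v" and z: "z \<in> cov.fibre (proj_pt v)" and i: "i \<in> {1..k}"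
 shows "label z i \<longleftrightarrow> fst (\<nu> z) \<in> line_points (Comp i) v"
proof -
 have *: "fst (\<nu> z) \<in> line_points (Comp j) v" if "label z j" for j
  using label_on_component[OF that] fibre_psi(2)[OF v z] by (simp add: line_points_def)
 show ?thesis
 proof
  assume P: "fst (\<nu> z) \<in> line_points (Comp i) v"
  obtain j where j: "label z j" using ex_label[of z] z topspace_complex[OF sp] by (auto simp: cov.fibre_def)
  have "i = j"
  proof (rule ccontr)
   assume "i ~= j"
   then show False using P *[OF j] v(2) i label_in[OF j] unfolding good_def transversal_def by blast
  qed
  then show "label z i" using j by simp
 qed (rule *)
qed

text \<open>Two moves, each fixing one point, carry a pair to a pair. In the case
  \<open>Q = R\<close> a single move reaches the exchanged order, and a transposition does not
  distinguish the orders.\<close>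

lemma two_transitive:
 assumes v: "v ~= 0" "good v" and i: "i \<in> {1..k}"
  and P: "P \<in> line_points (Comp i) v" "Q \<in> line_points (Comp i) v" "P ~= Q"
  and R: "R \<in> line_points (Comp i) v" "R' \<in> line_points (Comp i) v" "R ~= R'"
 defines "\<Psi> \<equiv> %P. \<psi> (P, proj_pt v)"
 shows "\<exists>p. path p & path_image p \<subseteq> - Br & p 0 = proj_pt v & p 1 = proj_pt v &
  (cov.connects p (\<Psi> P) (\<Psi> R) & cov.connects p (\<Psi> Q) (\<Psi> R') \<or>
   cov.connects p (\<Psi> P) (\<Psi> R') & cov.connects p (\<Psi> Q) (\<Psi> R))"
proof -
 have mv: "\<exists>p. path p & path_image p \<subseteq> - Br & p 0 = proj_pt v & p 1 = proj_pt v &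
  cov.connects p (\<Psi> A) (\<Psi> B) & cov.connects p (\<Psi> E) (\<Psi> E)"
  if ABE: "A \<in> line_points (Comp i) v" "B \<in> line_points (Comp i) v" "E \<in> line_points (Comp i) v" "A ~= E" "B ~= E" for A B E
 proof -
  obtain \<gamma> where \<gamma>: "moves i v A B \<gamma>" "moves i v E E \<gamma>" using moves_two_transitive[OF v(2,1) i ABE] by blast
  have "\<gamma> 0 = v" "\<gamma> 1 = v" using \<gamma>(1) by (auto simp: moves_def)
  then show ?thesis
   using moves_path[OF \<gamma>(1)] moves_connects[OF \<gamma>(1) i] moves_connects[OF \<gamma>(2) i] unfolding \<Psi>_def
   by (intro exI[of _ "%t. proj_pt (\<gamma> t)"]) auto
 qed
 show ?thesis
 proof (cases "Q = R")
  case True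
  obtain p where "path p & path_image p \<subseteq> - Br & p 0 = proj_pt v & p 1 = proj_pt v &
   cov.connects p (\<Psi> P) (\<Psi> R') & cov.connects p (\<Psi> Q) (\<Psi> Q)" using mv[OF P(1) R(2) P(2,3)] R(3) True by blast
  then show ?thesis using True by blast
 next
  case False
  obtain p where p: "path p" "path_image p \<subseteq> - Br" "p 0 = proj_pt v" "p 1 = proj_pt v"
   "cov.connects p (\<Psi> P) (\<Psi> R)" "cov.connects p (\<Psi> Q) (\<Psi> Q)" using mv[OF P(1) R(1) P(2,3)] False by blast
  obtain q where q: "path q" "path_image q \<subseteq> - Br" "q 0 = proj_pt v" "q 1 = proj_pt v"
   "cov.connects q (\<Psi> Q) (\<Psi> R')" "cov.connects q (\<Psi> R) (\<Psi> R)" using mv[OF P(2) R(2,1)] R(3) False by blast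
  have "cov.connects (p +++ q) (\<Psi> P) (\<Psi> R)" "cov.connects (p +++ q) (\<Psi> Q) (\<Psi> R')"
   using cov.connects_join[OF p(5) q(6)] cov.connects_join[OF p(6) q(5)] p q by simp_all
  then show ?thesis using cov.join_path[of p q] p q by (intro exI[of _ "p +++ q"]) auto
 qed
qed

text \<open>The known transposition over a good line is conjugated by a loop that carries its pair
  to the transported points \<open>z1\<close> and \<open>w1\<close>, and then by the path back to
  \<open>l\<close>.\<close>

lemma ex_swap:
 assumes l: "l \<notin> Br" and z: "z \<in> cov.fibre l" and w: "w \<in> cov.fibre l" and "z ~= w"
  and lab: "label z i" "label w i"
 shows "\<exists>p. cov.swaps l p z w"
proof -
 have i: "i \<in> {1..k}" by (rule label_in[OF lab(1)])
 obtain v \<gamma> P Q where v: "v ~= 0" "good v" and PQ: "P ~= Q" "P \<in> line_points (Comp i) v" "Q \<in> line_points (Comp i) v"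
  and mv: "!!j R. j \<in> {1..k} ==> R \<in> line_points (Comp j) v ==> moves j v R (swap P Q R) \<gamma>"
  using moves_transposition[OF i] by blast
 let ?l = "proj_pt v" and ?\<Psi> = "%P. \<psi> (P, proj_pt v)" and ?\<tau> = "%t. proj_pt (\<gamma> t)"
 have sub: "R \<in> line_points C v" if "R \<in> line_points (Comp j) v" "j \<in> {1..k}" for R j
  using that by (auto simp: line_points_C)
 have inj: "?\<Psi> R = ?\<Psi> R' \<longleftrightarrow> R = R'" if "R \<in> line_points C v" "R' \<in> line_points C v" for R R'
  using fibre_psi(1)[OF v that(1)] fibre_psi(1)[OF v that(2)] by metis
 have mP: "moves i v P (swap P Q P) \<gamma>" by (rule mv[OF i PQ(2)])
 then have g01: "\<gamma> 0 = v" "\<gamma> 1 = v" by (auto simp: moves_def)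
 have \<tau>: "cov.swaps ?l ?\<tau> (?\<Psi> P) (?\<Psi> Q)"
  unfolding cov.swaps_def
 proof (intro conjI ballI)
  fix u assume u: "u \<in> cov.fibre ?l"
  define R where "R = fst (\<nu> u)"
  have R: "R \<in> line_points C v" "u = ?\<Psi> R" using fibre_psi(2)[OF v u] by (auto simp: R_def)
  then obtain j where j: "j \<in> {1..k}" "R \<in> line_points (Comp j) v" by (auto simp: line_points_C)
  have "swap (?\<Psi> P) (?\<Psi> Q) u = ?\<Psi> (swap P Q R)"
   using inj[OF R(1) sub[OF PQ(2) i]] inj[OF R(1) sub[OF PQ(3) i]] by (auto simp: R(2) Transposition.transpose_def)
  then show "cov.connects ?\<tau> u (swap (?\<Psi> P) (?\<Psi> Q) u)"
   using moves_connects[OF mv[OF j] j(1)] R(2) by simp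
 qed (use moves_path[OF mP] g01 in auto)
 obtain q where q: "path q" "path_image q \<subseteq> - Br" "q 0 = l" "q 1 = ?l" using path_to_good[OF l v] by blast
 obtain z1 w1 where c: "cov.connects q z z1" "cov.connects q w w1" using cov.connects_ex[OF q(1,2)] z w q(3) by metis
 have f1: "z1 \<in> cov.fibre ?l" "w1 \<in> cov.fibre ?l" using cov.connects_fibre[OF c(1)] cov.connects_fibre[OF c(2)] q(4) by auto
 have "z1 ~= w1" using cov.connects_unique_start[OF q(2)] c \<open>z ~= w\<close> by blast
 define R R' where "R = fst (\<nu> z1)" and "R' = fst (\<nu> w1)"
 have zw1: "z1 = ?\<Psi> R" "w1 = ?\<Psi> R'" using fibre_psi(2)[OF v f1(1)] fibre_psi(2)[OF v f1(2)] by (auto simp: R_def R'_def)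
 have "label z1 i" "label w1 i" using label_connects[OF c(1) q(2)] label_connects[OF c(2) q(2)] lab by auto
 then have RR: "R \<in> line_points (Comp i) v" "R' \<in> line_points (Comp i) v"
  using label_good[OF v f1(1) i] label_good[OF v f1(2) i] by (auto simp: R_def R'_def)
 have "R ~= R'" using zw1 \<open>z1 ~= w1\<close> by auto
 obtain p where p: "path p" "path_image p \<subseteq> - Br" "p 0 = ?l" "p 1 = ?l"
  and cp: "cov.connects p (?\<Psi> P) z1 & cov.connects p (?\<Psi> Q) w1 \<or> cov.connects p (?\<Psi> P) w1 & cov.connects p (?\<Psi> Q) z1"
  using two_transitive[OF v i PQ(2,3,1) RR \<open>R ~= R'\<close>] unfolding zw1 by blast
 have r: "path (reversepath q)" "path_image (reversepath q) \<subseteq> - Br" "reversepath q 0 = ?l" "reversepath q 1 = l"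
  using q path_reversepath path_image_reversepath by (blast, metis, auto simp: reversepath_def)
 let ?q = "p +++ reversepath q"
 have q': "path ?q & path_image ?q \<subseteq> - Br & ?q 0 = ?l & ?q 1 = l"
  using cov.join_path[of p "reversepath q"] p r by auto
 have join: "cov.connects ?q a b" if "cov.connects p a b'" "cov.connects q b b'" for a b b'
  using cov.connects_join[OF that(1) cov.connects_reversepath[OF that(2)]] p r by simp
 from cp have "\<exists>p. cov.swaps l p z w \<or> cov.swaps l p w z"
 proof (elim disjE conjE)
  assume "cov.connects p (?\<Psi> P) z1" "cov.connects p (?\<Psi> Q) w1"
  then have "cov.connects ?q (?\<Psi> P) z" "cov.connects ?q (?\<Psi> Q) w" using join c by blast+
  from cov.swaps_conjugate[OF \<tau> _ _ _ this] show ?thesis using q' by metis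
 next
  assume "cov.connects p (?\<Psi> P) w1" "cov.connects p (?\<Psi> Q) z1"
  then have "cov.connects ?q (?\<Psi> P) w" "cov.connects ?q (?\<Psi> Q) z" using join c by blast+
  from cov.swaps_conjugate[OF \<tau> _ _ _ this] show ?thesis using q' by metis
 qed
 then show ?thesis by (metis cov.swaps_def transpose_commute)
qed

text \<open>Lifting a path gives a label preserving bijection with the fibre over a good line, where
  the block is the set of intersection points with the component.\<close>

lemma card_block:
 assumes l: "l \<notin> Br" and i: "i \<in> {1..k}"
 shows "card {z \<in> cov.fibre l. label z i} = ds i"
proof -
 obtain v where v: "v ~= 0" "good v" using generic_good(2) by blast
 obtain q where q: "path q" "path_image q \<subseteq> - Br" "q 0 = l" "q 1 = proj_pt v" using path_to_good[OF l v] by blast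
 obtain h where h: "bij_betw h (cov.fibre l) (cov.fibre (proj_pt v))" "!!z. z \<in> cov.fibre l ==> cov.connects q z (h z)"
  using cov.connects_bij[OF q(1,2)] q(3,4) by auto
 have r: "path_image (reversepath q) \<subseteq> - Br" using q by simp
 have lab: "label (h z) i \<longleftrightarrow> label z i" if "z \<in> cov.fibre l" for z
  using label_connects[OF h(2)[OF that] q(2)] label_connects[OF cov.connects_reversepath[OF h(2)[OF that]] r] by blast
 have im: "h ` {z \<in> cov.fibre l. label z i} = {z \<in> cov.fibre (proj_pt v). label z i}"
  using lab bij_betw_imp_surj_on[OF h(1)] by force
 have "inj_on h {z \<in> cov.fibre l. label z i}" by (rule inj_on_subset[OF bij_betw_imp_inj_on[OF h(1)]]) auto
 from card_image[OF this] have 1: "card {z \<in> cov.fibre l. label z i} = card {z \<in> cov.fibre (proj_pt v). label z i}"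
  unfolding im by simp
 have "bij_betw (%z. fst (\<nu> z)) {z \<in> cov.fibre (proj_pt v). label z i} (line_points (Comp i) v)"
  unfolding bij_betw_def
 proof
  show "inj_on (%z. fst (\<nu> z)) {z \<in> cov.fibre (proj_pt v). label z i}"
   using fibre_psi(2)[OF v] by (intro inj_onI) (metis (no_types, lifting) mem_Collect_eq)
  show "(%z. fst (\<nu> z)) ` {z \<in> cov.fibre (proj_pt v). label z i} = line_points (Comp i) v"
  proof (intro equalityI subsetI)
   fix P assume P: "P \<in> line_points (Comp i) v"
   then have "P \<in> line_points C v" using i by (auto simp: line_points_C)
   from fibre_psi(1)[OF v this] label_good[OF v _ i] P
   show "P \<in> (%z. fst (\<nu> z)) ` {z \<in> cov.fibre (proj_pt v). label z i}"
    by (intro image_eqI[of _ _ "\<psi> (P, proj_pt v)"]) auto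
  qed (use label_good[OF v _ i] in auto)
 qed
 then have "card {z \<in> cov.fibre (proj_pt v). label z i} = card (line_points (Comp i) v)" by (rule bij_betw_same_card)
 then show ?thesis using 1 v(2) i by (auto simp: good_def transversal_def)
qed

end

section \<open>The Galois group\<close>

text \<open>A label preserving permutation is a family of permutations of the blocks, and
  enumerations \<open>b i\<close> of the blocks translate these into permutations of
  \<open>{1..ds i}\<close>.\<close>

lemma product_sym_group_iso:
 fixes F :: "'a set" and lab :: "'a => nat"
 assumes fin: "finite F" and lab: "!!z. z \<in> F ==> lab z \<in> I"
  and card: "!!i. i \<in> I ==> card {z \<in> F. lab z = i} = ds i"
 shows "product_group I (%i. sym_group (ds i)) \<cong> BijGroup F\<lparr>carrier := {\<sigma> \<in> Bij F. \<forall>z\<in>F. lab (\<sigma> z) = lab z}\<rparr>"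
  (is "?P \<cong> ?G")
proof -
 have "\<forall>i\<in>I. \<exists>b. bij_betw b {1..ds i} {z \<in> F. lab z = i}"
 proof
  fix i assume i: "i \<in> I"
  have "finite {z \<in> F. lab z = i}" using fin by simp
  from ex_bij_betw_nat_finite_1[OF this] show "\<exists>b. bij_betw b {1..ds i} {z \<in> F. lab z = i}" by (simp add: card[OF i])
 qed
 then obtain b where b: "!!i. i \<in> I ==> bij_betw (b i) {1..ds i} {z \<in> F. lab z = i}" by metis
 define c where "c i = inv_into {1..ds i} (b i)" for i
 have bF: "b i j \<in> F" "lab (b i j) = i" "c i (b i j) = j" if "i \<in> I" "j \<in> {1..ds i}" for i j
  using bij_betwE[OF b[OF that(1)]] that(2) bij_betw_inv_into_left[OF b[OF that(1)] that(2)] by (auto simp: c_def)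
 have cF: "c (lab z) z \<in> {1..ds (lab z)}" "b (lab z) (c (lab z) z) = z" if "z \<in> F" for z
  using bij_betwE[OF bij_betw_inv_into[OF b[OF lab[OF that]]]] bij_betw_inv_into_right[OF b[OF lab[OF that]]] that
  by (auto simp: c_def)
 define H where "H x = (\<lambda>z\<in>F. b (lab z) (x (lab z) (c (lab z) z)))" for x
 have car: "x i permutes {1..ds i}" if "x \<in> carrier ?P" "i \<in> I" for x i
  using that by (auto simp: sym_group_carrier)
 have xc: "x (lab z) (c (lab z) z) \<in> {1..ds (lab z)}" if "x \<in> carrier ?P" "z \<in> F" for x z
  using permutes_in_image[OF car[OF that(1) lab[OF that(2)]]] cF(1)[OF that(2)] by blast
 have HF: "H x z \<in> F" "lab (H x z) = lab z" "c (lab z) (H x z) = x (lab z) (c (lab z) z)" if "x \<in> carrier ?P" "z \<in> F" for x z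
  using bF[OF lab[OF that(2)] xc[OF that]] that(2) by (simp_all add: H_def)
 have H_G: "H x \<in> carrier ?G" if x: "x \<in> carrier ?P" for x
 proof -
  have "inj_on (H x) F"
  proof (rule inj_onI)
   fix z w assume zw: "z \<in> F" "w \<in> F" "H x z = H x w"
   then have l: "lab z = lab w" using HF(2)[OF x] by metis
   then have "x (lab z) (c (lab z) z) = x (lab z) (c (lab z) w)" using HF(3)[OF x zw(1)] HF(3)[OF x zw(2)] zw(3) by simp
   then have "c (lab z) z = c (lab z) w" using permutes_inj[OF car[OF x lab[OF zw(1)]]] by (auto dest: injD)
   then show "z = w" using cF(2)[OF zw(1)] cF(2)[OF zw(2)] l by metis
  qed
  moreover have "H x ` F = F" using endo_inj_surj[OF fin _ calculation] HF(1)[OF x] by blast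
  ultimately have "H x \<in> Bij F" by (simp add: Bij_def bij_betw_def H_def)
  then show ?thesis using HF(2)[OF x] by simp
 qed
 have "H \<in> hom ?P ?G"
 proof (rule homI)
  fix x y assume x: "x \<in> carrier ?P" and y: "y \<in> carrier ?P"
  have "H (x \<otimes>\<^bsub>?P\<^esub> y) = compose F (H x) (H y)"
  proof
   fix z
   show "H (x \<otimes>\<^bsub>?P\<^esub> y) z = compose F (H x) (H y) z"
   proof (cases "z \<in> F")
    case True
    have "H (x \<otimes>\<^bsub>?P\<^esub> y) z = b (lab z) (x (lab z) (y (lab z) (c (lab z) z)))"
     using True lab[OF True] by (simp add: H_def sym_group_mult)
    also have "\<dots> = H x (H y z)"
     using HF[OF y True] by (simp add: H_def[of x])
    finally show ?thesis using True by (simp add: compose_def)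
   qed (simp add: H_def compose_def)
  qed
  then show "H (x \<otimes>\<^bsub>?P\<^esub> y) = H x \<otimes>\<^bsub>?G\<^esub> H y" using H_G[OF x] H_G[OF y] by (simp add: BijGroup_def)
 qed (rule H_G)
 moreover have "inj_on H (carrier ?P)"
 proof (rule inj_onI)
  fix x y assume x: "x \<in> carrier ?P" and y: "y \<in> carrier ?P" and e: "H x = H y"
  show "x = y"
  proof (rule PiE_ext)
   show "x \<in> (\<Pi>\<^sub>E i\<in>I. carrier (sym_group (ds i)))" "y \<in> (\<Pi>\<^sub>E i\<in>I. carrier (sym_group (ds i)))" using x y by simp_all
   fix i assume i: "i \<in> I"
   show "x i = y i"
   proof
    fix j
    show "x i j = y i j"
    proof (cases "j \<in> {1..ds i}")
     case True
     then show ?thesis using HF(3)[OF x bF(1)[OF i True]] HF(3)[OF y bF(1)[OF i True]] bF(2,3)[OF i True] e by simp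
    next
     case False
     then show ?thesis using permutes_not_in[OF car[OF x i]] permutes_not_in[OF car[OF y i]] by simp
    qed
   qed
  qed
 qed
 moreover have "\<exists>x\<in>carrier ?P. H x = \<sigma>" if "\<sigma> \<in> carrier ?G" for \<sigma>
 proof -
  have \<sigma>: "\<sigma> \<in> extensional F" "bij_betw \<sigma> F F" "!!z. z \<in> F ==> lab (\<sigma> z) = lab z" using that by (auto simp: Bij_def)
  have \<sigma>F: "\<sigma> z \<in> F" if "z \<in> F" for z using bij_betwE[OF \<sigma>(2)] that by blast
  define x where "x = (\<lambda>i\<in>I. %j. if j \<in> {1..ds i} then c i (\<sigma> (b i j)) else j)"
  have x_in: "x i j \<in> {1..ds i}" "b i (x i j) = \<sigma> (b i j)" if "i \<in> I" "j \<in> {1..ds i}" for i j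
   using cF[OF \<sigma>F[OF bF(1)[OF that]]] \<sigma>(3)[OF bF(1)[OF that]] bF(2)[OF that] that by (simp_all add: x_def)
  have "x i permutes {1..ds i}" if i: "i \<in> I" for i
  proof (rule bij_imp_permutes)
   have "inj_on (x i) {1..ds i}"
   proof (rule inj_onI)
    fix j j' assume j: "j \<in> {1..ds i}" "j' \<in> {1..ds i}" "x i j = x i j'"
    then have "\<sigma> (b i j) = \<sigma> (b i j')" using x_in(2)[OF i] by metis
    then have "b i j = b i j'" using bij_betw_imp_inj_on[OF \<sigma>(2)] bF(1)[OF i] j(1,2) by (meson inj_onD)
    then show "j = j'" using bF(3)[OF i] j(1,2) by metis
   qed
   moreover have "x i ` {1..ds i} \<subseteq> {1..ds i}" using x_in(1)[OF i] by blast
   ultimately show "bij_betw (x i) {1..ds i} {1..ds i}" using endo_inj_surj[of "{1..ds i}" "x i"] by (simp add: bij_betw_def)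
  qed (use i in \<open>auto simp: x_def\<close>)
  then have x: "x \<in> carrier ?P" by (auto simp: sym_group_carrier x_def)
  have "H x = \<sigma>"
  proof
   fix z
   show "H x z = \<sigma> z"
   proof (cases "z \<in> F")
    case True
    then show ?thesis using x_in(2)[OF lab[OF True] cF(1)[OF True]] cF(2)[OF True] by (simp add: H_def)
   qed (use \<sigma>(1) in \<open>auto simp: H_def extensional_def\<close>)
  qed
  then show ?thesis using x by blast
 qed
 then have "H ` carrier ?P = carrier ?G" using H_G by blast
 ultimately have "H \<in> iso ?P ?G" by (simp add: iso_def bij_betw_def)
 then show ?thesis by (auto simp: is_iso_def)
qed

section \<open>The image of the monodromy\<close>

context dualizing_cut begin

definition "lab z = (THE i. label z i)"

lemma lab_eq:
 assumes "l \<notin> Br" "z \<in> cov.fibre l"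
 shows "label z i \<longleftrightarrow> lab z = i"
proof -
 have z: "z \<in> topspace T" "f z \<in> - Br" using assms by (auto simp: cov.fibre_def)
 obtain j where j: "label z j" using ex_label[of z] z(1) topspace_complex[OF sp] by auto
 then have "lab z = j" unfolding lab_def using label_unique[OF z] by blast
 then show ?thesis using j label_unique[OF z] by blast
qed

lemma finite_fibre:
 assumes "l \<notin> Br"
 shows "finite (cov.fibre l)"
proof -
 have "finite {z \<in> cov.fibre l. label z i}" if "i \<in> {1..k}" for i
  using card_block[OF assms that] ds2[OF that] by (intro card_ge_0_finite) simp
 moreover have "cov.fibre l = (\<Union>i\<in>{1..k}. {z \<in> cov.fibre l. label z i})"
  using ex_label label_in topspace_complex[OF sp] by (fastforce simp: cov.fibre_def)
 ultimately show ?thesis by (metis (no_types, lifting) finite_UN_I finite_atLeastAtMost)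
qed

lemma fibre_preimage: "preimage_in Z f {l} = cov.fibre l"
 by (auto simp: preimage_in_def cov.fibre_def topspace_complex[OF sp])

text \<open>Homotopic loops have lifts with the same end points, so one representative stands for
  its class.\<close>

lemma monodromy_eq:
 assumes p: "path p" "path_image p \<subseteq> - Br" "p 0 = l" "p 1 = l"
 shows "monodromy Z f l (path_class (- Br) p) = (\<lambda>z\<in>cov.fibre l. THE w. cov.connects p w z)"
proof -
 have "(\<exists>q\<in>path_class (- Br) p. \<exists>g. lift_of Z f q g & g 0 = w & g 1 = z) \<longleftrightarrow> cov.connects p w z" for w z
 proof
  assume "\<exists>q\<in>path_class (- Br) p. \<exists>g. lift_of Z f q g & g 0 = w & g 1 = z"
  then obtain q where q: "homotopic_paths (- Br) p q" "cov.connects q w z"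
   unfolding path_class_def cov.connects_def cov.lift_def lift_of_def pathin_def by auto
  then show "cov.connects p w z" using cov.connects_homotopic homotopic_paths_sym by blast
 next
  assume "cov.connects p w z"
  moreover have "p \<in> path_class (- Br) p" using p by (simp add: path_class_def homotopic_paths_refl)
  ultimately show "\<exists>q\<in>path_class (- Br) p. \<exists>g. lift_of Z f q g & g 0 = w & g 1 = z"
   unfolding cov.connects_def cov.lift_def lift_of_def pathin_def by blast
 qed
 then show ?thesis by (simp add: monodromy_def fibre_preimage)
qed

lemma monodromy_connects:
 assumes p: "path p" "path_image p \<subseteq> - Br" "p 0 = l" "p 1 = l" and z: "z \<in> cov.fibre l"
 shows "cov.connects p w z \<longleftrightarrow> monodromy Z f l (path_class (- Br) p) z = w"
proof -
 obtain w' where w': "cov.connects p w' z" using cov.connects_ex_start[OF p(1,2)] z p(4) by blast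
 then have "(THE w. cov.connects p w z) = w'" using cov.connects_unique_start[OF p(2)] by blast
 then show ?thesis using w' cov.connects_unique_start[OF p(2)] z unfolding monodromy_eq[OF p(1-4)] by auto
qed

text \<open>One inclusion is the invariance of labels along lifts; the other holds because
  transpositions inside the blocks generate all label preserving permutations.\<close>

lemma monodromy_image:
 assumes l: "l \<notin> Br"
 shows "monodromy Z f l ` carrier (fundamental_group (- Br) l) =
  {\<sigma> \<in> Bij (cov.fibre l). \<forall>z\<in>cov.fibre l. lab (\<sigma> z) = lab z}"
proof (intro equalityI subsetI)
 fix \<sigma> assume "\<sigma> \<in> monodromy Z f l ` carrier (fundamental_group (- Br) l)"
 then obtain p where p: "path p" "path_image p \<subseteq> - Br" "p 0 = l" "p 1 = l"
  and \<sigma>: "\<sigma> = monodromy Z f l (path_class (- Br) p)"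
  by (auto simp: fundamental_group_def pathstart_def pathfinish_def)
 note c = monodromy_connects[OF p, folded \<sigma>]
 have conn: "cov.connects p (\<sigma> z) z" if "z \<in> cov.fibre l" for z using c[OF that] by blast
 then have in_F: "\<sigma> z \<in> cov.fibre l" if "z \<in> cov.fibre l" for z using cov.connects_fibre p(3) that by metis
 have "inj_on \<sigma> (cov.fibre l)"
 proof (rule inj_onI)
  fix z w assume "z \<in> cov.fibre l" "w \<in> cov.fibre l" "\<sigma> z = \<sigma> w"
  then show "z = w" using cov.connects_unique[OF p(2) conn] conn by metis
 qed
 moreover have "\<sigma> ` cov.fibre l = cov.fibre l"
 proof (intro equalityI subsetI)
  fix w assume "w \<in> cov.fibre l"
  then obtain z where z: "cov.connects p w z" using cov.connects_ex[OF p(1,2)] p(3) by blast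
  then have "z \<in> cov.fibre l" using cov.connects_fibre p(4) by blast
  then show "w \<in> \<sigma> ` cov.fibre l" using c[of z w] z by (intro image_eqI[of _ _ z]) auto
 qed (use in_F in blast)
 moreover have "\<sigma> \<in> extensional (cov.fibre l)" by (simp add: \<sigma> monodromy_eq[OF p])
 moreover have "lab (\<sigma> z) = lab z" if "z \<in> cov.fibre l" for z
  using label_connects[OF conn[OF that] p(2), of "lab (\<sigma> z)"] lab_eq[OF l that] lab_eq[OF l in_F[OF that]] by metis
 ultimately show "\<sigma> \<in> {\<sigma> \<in> Bij (cov.fibre l). \<forall>z\<in>cov.fibre l. lab (\<sigma> z) = lab z}"
  by (simp add: Bij_def bij_betw_def)
next
 fix \<sigma> assume "\<sigma> \<in> {\<sigma> \<in> Bij (cov.fibre l). \<forall>z\<in>cov.fibre l. lab (\<sigma> z) = lab z}"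
 then have \<sigma>: "\<sigma> \<in> extensional (cov.fibre l)" "bij_betw \<sigma> (cov.fibre l) (cov.fibre l)" "!!z. z \<in> cov.fibre l ==> lab (\<sigma> z) = lab z"
  by (auto simp: Bij_def)
 have swap: "\<exists>p. cov.swaps l p z w" if "z \<in> cov.fibre l" "w \<in> cov.fibre l" "z ~= w" "lab z = lab w" for z w
  using ex_swap[OF l that(1-3)] lab_eq[OF l that(1)] lab_eq[OF l that(2)] that(4) by metis
 obtain p where p: "path p" "path_image p \<subseteq> - Br" "p 0 = l" "p 1 = l" "!!z. z \<in> cov.fibre l ==> cov.connects p (\<sigma> z) z"
  using cov.permutation_by_loop[where lab = lab, OF _ finite_fibre[OF l] swap \<sigma>(2,3)] l by blast
 have "monodromy Z f l (path_class (- Br) p) = \<sigma>"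
 proof (rule extensionalityI[OF _ \<sigma>(1)])
  show "monodromy Z f l (path_class (- Br) p) \<in> extensional (cov.fibre l)" by (simp add: monodromy_eq[OF p(1-4)])
  show "monodromy Z f l (path_class (- Br) p) z = \<sigma> z" if "z \<in> cov.fibre l" for z
   using monodromy_connects[OF p(1-4) that] p(5)[OF that] by blast
 qed
 moreover have "path_class (- Br) p \<in> carrier (fundamental_group (- Br) l)"
  using p(1-4) by (auto simp: fundamental_group_def pathstart_def pathfinish_def)
 ultimately show "\<sigma> \<in> monodromy Z f l ` carrier (fundamental_group (- Br) l)" by blast
qed

theorem galois_group_iso:
 assumes l: "l \<notin> Br"
 shows "galois_group Z f l \<cong> product_group {1..k} (%i. sym_group (ds i))"
proof (rule group.iso_sym)
 show "group (product_group {1..k} (%i. sym_group (ds i)))" by (simp add: sym_group_is_group)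
 have "card {z \<in> cov.fibre l. lab z = i} = ds i" if "i \<in> {1..k}" for i
 proof -
  have "{z \<in> cov.fibre l. lab z = i} = {z \<in> cov.fibre l. label z i}" using lab_eq[OF l] by blast
  then show ?thesis using card_block[OF l that] by simp
 qed
 moreover have "lab z \<in> {1..k}" if "z \<in> cov.fibre l" for z using label_in lab_eq[OF l that] by blast
 ultimately show "product_group {1..k} (%i. sym_group (ds i)) \<cong> galois_group Z f l"
  unfolding galois_group_def fibre_preimage monodromy_image[OF l] by (intro product_sym_group_iso finite_fibre[OF l])
qed

end

text \<open>A factor dividing another one would occur squared in the product.\<close>

lemma squarefree_not_dvd:
 assumes "squarefree (\<Prod>i\<in>I. p i :: 'a :: comm_semiring_1)" "finite I" "i \<in> I" "j \<in> I" "i ~= j" "p i dvd p j"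
 shows "p i dvd 1"
proof -
 have "(\<Prod>i\<in>I. p i) = p i * (p j * (\<Prod>i\<in>I - {i} - {j}. p i))"
  using prod.remove[OF assms(2,3), of p] prod.remove[of "I - {i}" j p] assms by simp
 moreover obtain q where "p j = p i * q" using assms(6) by blast
 ultimately have "(\<Prod>i\<in>I. p i) = p i ^ 2 * (q * (\<Prod>i\<in>I - {i} - {j}. p i))" by (simp add: power2_eq_square ac_simps)
 then have "p i ^ 2 dvd (\<Prod>i\<in>I. p i)" by simp
 then show ?thesis using assms(1) unfolding squarefree_def by blast
qed

theorem theorem1:
  fixes C :: "3 cpoly" and Comp :: "nat \<Rightarrow> 3 cpoly"
    and d k :: nat and ds :: "nat \<Rightarrow> nat"
    and Z :: "'z fun_space" and f :: "'z \<Rightarrow> dual_proj_plane"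
    and l0 :: dual_proj_plane
  assumes curve: "reduced_plane_curve C d"
    and components: "C = (\<Prod>i\<in>{1..k}. Comp i)"
      "\<And>i. i \<in> {1..k} \<Longrightarrow> irreducible_plane_curve (Comp i) (ds i)"
    and degrees: "\<And>i. i \<in> {1..k} \<Longrightarrow> ds i \<ge> 2"
    and covering: "dualizing_covering C Z f"
    and base_point: "l0 \<notin> branch_locus Z f"
  shows "galois_group Z f l0 \<cong> product_group {1..k} (\<lambda>i. sym_group (ds i))"
proof -
 have pc: "plane_curve k Comp ds"
 proof
  fix i assume i: "i \<in> {1..k}"
  show "homogeneous (Comp i) (ds i)" "irred (Comp i)" "ds i \<ge> 2"
   using components(2)[OF i] degrees[OF i] by (auto simp: irreducible_plane_curve_def)
  fix j assume j: "j \<in> {1..k}" "i ~= j"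
  show "\<not> Comp i dvd Comp j"
  proof
   assume "Comp i dvd Comp j"
   with curve i j have "Comp i dvd 1"
    unfolding reduced_plane_curve_def components(1) by (intro squarefree_not_dvd[of Comp "{1..k}" i j]) auto
   then show False using \<open>irred (Comp i)\<close> by (simp add: Factorial_Ring.irreducible_def)
  qed
 qed
 obtain \<nu> where \<nu>: "normalization Z (curve_incidence C) \<nu>" and f: "f = snd \<circ> \<nu>"
  using covering unfolding dualizing_covering_def by blast
 have C: "C = plane_curve.C k Comp" by (simp add: plane_curve.C_def[OF pc] components(1))
 then have ni: "normalized_incidence C (plane_curve.d k ds) Z \<nu>"
  using plane_curve.homogeneous_C[OF pc] \<nu> by unfold_locales auto
 interpret dualizing k Comp ds C "plane_curve.d k ds" Z \<nu>
  using pc ni C by (simp add: dualizing_def dualizing_axioms_def)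
 \<comment> \<open>Birationality supplies a dense open set over which \<open>\<nu>\<close> is
   invertible; the polynomials \<open>g\<close> are then chosen so that their nonvanishing on the
   surface implies membership in it.\<close>
 obtain U \<psi> where U: "openin (zariski X) U" "zariski X closure_of U = topspace (zariski X)"
  and \<psi>: "morphism (open_subspace X U) (open_subspace Z (preimage_in Z \<nu> U)) \<psi>"
   "\<forall>x\<in>topspace (zariski (open_subspace Z (preimage_in Z \<nu> U))). \<psi> (\<nu> x) = x"
   "\<forall>y\<in>topspace (zariski (open_subspace X U)). \<nu> (\<psi> y) = y"
  using \<nu> unfolding normalization_def birational_morphism_def isomorphism_def by blast
 have top: "topspace (zariski (open_subspace Z (preimage_in Z \<nu> U))) = preimage_in Z \<nu> U"
  "topspace (zariski (open_subspace X U)) = U"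
  using openin_subset[OF U(1)] openin_subset[OF openin_preimage[OF U(1)]] by (auto simp: open_subspace_def)
 obtain g where g: "plane_curve_cut k Comp ds g" "\<forall>i\<in>{1..k}. {y \<in> incidence_set C. bihom_eval (g i) y ~= 0} \<subseteq> U"
  using ex_cut[OF U] by blast
 interpret plane_curve_cut k Comp ds g by (rule g(1))
 interpret dualizing_cut k Comp ds C "plane_curve.d k ds" Z \<nu> g U \<psi>
  by unfold_locales (use U(1) \<psi> top g(2) in auto)
 show ?thesis using galois_group_iso base_point unfolding f by blast
qed

end
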